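(* Let $d\ge3$ and consider the annealed Ising measure $\mu_n$ on the random $d$-regular graph with parameters $\beta>0$, $h\in\mathbb R$; let $M_n=\omega_1+\dots+\omega_n$, and let $A$, $\beta_c$, $\mathcal U$ be as in the context. All limits are as $n\to\infty$. (i) If $(\beta,h)\in\mathcal U$, with unique maximizer $a_*$ of $A$, then $M_n/n\to2a_*-1$ in law; for every sufficiently small $\delta>0$ there is $c>0$ with $\mu_n(|M_n/n-(2a_*-1)|>\delta)\le e^{-cn}$ for all large $n$; and $$d_{\mathrm W}\Big(\frac{M_n-n(2a_*-1)}{\sqrt n},\,N\Big(0,\frac{4}{|A''(a_* )|}\Big)\Big)=O(n^{-1/2}).$$ (ii) If $\beta>\beta_c$ and $h=0$, with maximizers $a_-<a_+$ of $A$, then for every sufficiently small $\delta>0$ there is $c>0$ with $\mu_n(|M_n/n-(2a_i-1)|>\delta\text{ for both }i\in\{-,+\})\le e^{-cn}$ for all large $n$; $M_n/n\to\frac12\delta_{2a_--1}+\frac12\delta_{2a_+-1}$ in law; and for $i\in\{-,+\}$ and every sufficiently small $\delta>0$ $$d_{\mathrm W}\Big(\mathcal L\Big(\frac{M_n-n(2a_i-1)}{\sqrt n}\,\Big|\,|M_n/n-(2a_i-1)|\le\delta\Big),\,N\Big(0,\frac{4}{|A''(a_i)|}\Big)\Big)=O(n^{-1/2}).$$ (iii) If $\beta=\beta_c$ and $h=0$, then $d_{\mathrm W}(n^{-3/4}M_n,Y)=O(n^{-1/4})$, where $Y$ has density proportional to $\exp\Big(\frac{A^{(4)}(1/2)\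,x^4}{2^4\,4!}\Big)$.
   Context: Let $G_n=(V_n,E_n)$ be the random regular graph of degree $d\ge3$ with $n$ vertices $v_1,\dots,v_n$. The annealed Ising measure on $\{1,-1\}^n$ is $$\mu_n(\omega)\propto\mathbb E\Big[\exp\Big(\beta\sum_{(v_i,v_j)\in E_n}\omega_i\omega_j+h\sum_{i=1}^n\omega_i\Big)\Big],$$ where the expectation is over the space of random regular graphs with respect to the uniform distribution. Define $$g_\beta(a)=\int_0^{a\wedge(1-a)}\log\frac{e^{-2\beta}(1-2s)+\sqrt{1+(e^{-4\beta}-1)(1-2s)^2}}{2(1-s)}\,ds,\qquad A(a)=2ha+d\,g_\beta(a)+I(a),\quad a\in[0,1],$$ with $I(a)=-a\log a-(1-a)\log(1-a)$ ($0\log0=0$). Let $\beta_c=\operatorname{atanh}(1/(d-1))$ and $\mathcal U=\{(\beta,h):\beta>0,h\ne0,\text{ or }0<\beta<\beta_c,h=0\}$. It is known (part of the setting) that: if $(\beta,h)\in\mathcal U$, $A$ has a unique maximizer $a_*\in(0,1)$, and $A''(a_* )<0$; if $\beta>\beta_c$, $h=0$, $A$ has exactly two maximizers $0<a_-<a_+=1-a_-<1$, with $A''(a_\pm)<0$; if $\beta=\beta_c$, $h=0$, $A$ has the unique maximizer $1/2$, with $A''(1/2)=A'''(1/2)=0$, $A^{(4)}(1/2)<0$. $d_{\mathrm W}(X,Y)=\sup_{\|h'\|_\infty\le1}|\mathbb Eh(X)-\mathbb Eh(Y)|$; $N(0,\sigma^2)$ is the centered normal law with variance $\sigma^2$. Constants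 in $O(\cdot)$ do not depend on $n$. *)

theory Defs
  imports "HOL-Probability.Probability" "HOL-Library.Ramsey"
begin

text \<open>
  The vertices are \<open>0, \<dots>, n - 1\<close>; a simple graph on them is identified with its set of edges,
  and an edge with the two-element set of its end points.
\<close>

definition regular_graphs :: "nat \<Rightarrow> nat \<Rightarrow> nat set set set" where
  "regular_graphs d n =
     {E. E \<subseteq> nsets {..<n} 2 \<and> (\<forall>v<n. card {e \<in> E. v \<in> e} = d)}"

text \<open>
  The limit \<open>n \<rightarrow> \<infinity>\<close> through the sizes with \<open>d n\<close> even: for odd \<open>d n\<close> there is no \<open>d\<close>-regular
  graph on \<open>n\<close> vertices, and the expectation in \<open>annealed_weight\<close> below has no meaning.
\<close>

definition graph_sizes :: "nat \<Rightarrow> nat filter" where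
  "graph_sizes d = inf sequentially (principal {n. even (d * n)})"

definition spins :: "nat \<Rightarrow> (nat \<Rightarrow> real) set" where
  "spins n = {..<n} \<rightarrow>\<^sub>E {1, -1}"

definition magnetization :: "nat \<Rightarrow> (nat \<Rightarrow> real) \<Rightarrow> real" where
  "magnetization n \<omega> = (\<Sum>i<n. \<omega> i)"

text \<open>For an edge \<open>e = {i, j}\<close> the product \<open>\<Prod>k\<in>e. \<omega> k\<close> is \<open>\<omega> i * \<omega> j\<close>.\<close>

definition annealed_weight :: "nat \<Rightarrow> nat \<Rightarrow> real \<Rightarrow> real \<Rightarrow> (nat \<Rightarrow> real) \<Rightarrow> real" where
  "annealed_weight d n \<beta> h \<omega> =
     measure_pmf.expectation (pmf_of_set (regular_graphs d n))
       (\<lambda>E. exp (\<beta> * (\<Sum>e\<in>E. \<Prod>k\<in>e. \<omega> k) + h * (\<Sum>i<n. \<omega> i)))"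

definition annealed_ising :: "nat \<Rightarrow> nat \<Rightarrow> real \<Rightarrow> real \<Rightarrow> (nat \<Rightarrow> real) measure" where
  "annealed_ising d n \<beta> h =
     point_measure (spins n)
       (\<lambda>\<omega>. ennreal (annealed_weight d n \<beta> h \<omega> / (\<Sum>\<eta>\<in>spins n. annealed_weight d n \<beta> h \<eta>)))"

definition g_fun :: "real \<Rightarrow> real \<Rightarrow> real" where
  "g_fun \<beta> a = integral {0..min a (1 - a)}
     (\<lambda>s. ln ((exp (-2 * \<beta>) * (1 - 2 * s) + sqrt (1 + (exp (-4 * \<beta>) - 1) * (1 - 2 * s)\<^sup>2))
              / (2 * (1 - s))))"

text \<open>The convention \<open>0 log 0 = 0\<close> holds automatically.\<close>

definition entropy_fun :: "real \<Rightarrow> real" where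
  "entropy_fun a = - a * ln a - (1 - a) * ln (1 - a)"

definition A_fun :: "nat \<Rightarrow> real \<Rightarrow> real \<Rightarrow> real \<Rightarrow> real" where
  "A_fun d \<beta> h a = 2 * h * a + real d * g_fun \<beta> a + entropy_fun a"

definition maximizers :: "nat \<Rightarrow> real \<Rightarrow> real \<Rightarrow> real set" where
  "maximizers d \<beta> h = {a \<in> {0..1}. \<forall>b\<in>{0..1}. A_fun d \<beta> h b \<le> A_fun d \<beta> h a}"

definition beta_c :: "nat \<Rightarrow> real" where
  "beta_c d = artanh (1 / (real d - 1))"

definition uniqueness_region :: "nat \<Rightarrow> (real \<times> real) set" where
  "uniqueness_region d = {(\<beta>, h). (\<beta> > 0 \<and> h \<noteq> 0) \<or> (0 < \<beta> \<and> \<beta> < beta_c d \<and> h = 0)}"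

text \<open>
  The condition that the derivative of the test function is bounded by 1 in the supremum norm is
  read as 1-Lipschitz continuity (absolute continuity with derivative bounded by 1 almost
  everywhere). The supremum is taken in \<open>ennreal\<close>, so it is a genuine supremum even if infinite.
\<close>

definition wasserstein :: "real measure \<Rightarrow> real measure \<Rightarrow> ennreal" where
  "wasserstein P Q =
     (SUP f\<in>{f. 1-lipschitz_on UNIV f}. ennreal \<bar>(\<integral>x. f x \<partial>P) - (\<integral>x. f x \<partial>Q)\<bar>)"

text \<open>\<open>weak_conv_m\<close> along an arbitrary filter, needed since not all \<open>n\<close> are admissible.\<close>

definition conv_in_law :: "'i filter \<Rightarrow> ('i \<Rightarrow> real measure) \<Rightarrow> real measure \<Rightarrow> bool" where
  "conv_in_law F P Q \<longleftrightarrow>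
     (\<forall>x. isCont (cdf Q) x \<longrightarrow> ((\<lambda>i. cdf (P i) x) \<longlongrightarrow> cdf Q x) F)"

definition centered_normal :: "real \<Rightarrow> real measure" where
  "centered_normal v = density lborel (\<lambda>x. ennreal (normal_density 0 (sqrt v) x))"

definition density_proportional_to :: "(real \<Rightarrow> real) \<Rightarrow> real measure" where
  "density_proportional_to f = density lborel (\<lambda>x. ennreal (f x / (\<integral>y. f y \<partial>lborel)))"

definition half_half :: "real \<Rightarrow> real \<Rightarrow> real measure" where
  "half_half x y = distr (measure_pmf (bernoulli_pmf (1/2))) borel (\<lambda>b. if b then x else y)"

end

(*
  Let q = exp (-2 beta). Up to constants the annealed weight of a configuration with set S of plus
  spins is exp (2 h |S|) times the sum of q^cut(S) over all d-regular graphs. For v outside S, the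
  ratio of the sums for S + v and S is the mean of q^(d - 2X), where X is the number of neighbours
  of v in S and graphs are weighted by q^cut(S). Switchings (replace edges aa', bb' by ab, a'b')
  that do not touch v show that, given X, the cut has mean n d r + O(1), with
  q^2 (a - r) (1 - a - r) = r^2 and a = |S| / n; switchings that do touch v show that X is binomial up
  to relative error O(1/n). Hence the weights L(k) of the levels |S| = k satisfy
  ln L(k + 1) - ln L(k) = A'(k/n) + O(1/n). Summing up, ln L(k) - ln L(k') differs from
  n (A(k/n) - A(k'/n)) by O(|k - k'| / n) only, and comparing Riemann sums with integrals gives
  the Wasserstein bounds.
*)
theory Submission
  imports Defs "HOL-Real_Asymp.Real_Asymp"
begin

section \<open>Switchings of regular graphs\<close>

text \<open>The average runs over simple graphs, and switchings stand in for an explicit formula for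
  the weights: each tuple acts as a bijection between the graphs to which it applies and those on
  which it can be undone, and bounded degree blocks only boundedly many partners of a given edge, so
  the relevant counts are products of edge counts up to lower order. The accuracy is dictated by the
  claimed rates: the limit laws live on windows of n^(1/2) levels, or n^(3/4) at the critical point,
  where an error O(1/n) per level adds up to n^(-1/2) or n^(-1/4). For this the mean of the cut is
  needed up to O(1) although its fluctuations may be of order n^(1/2); the quadratic balance
  equation yields such a mean only after the variance has been bounded. The estimates degenerate as
  k/n tends to 0 or 1, where A' is infinite; there a crude monotonicity of the level weights takes
  over. Strict negativity of A'' at the maximizers is derived from its explicit form, and at the
  critical point so is uniqueness of the maximizer.\<close>

definition switch :: "'a \<times> 'a \<times> 'a \<times> 'a \<Rightarrow> 'a set set \<Rightarrow> 'a set set" where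
  "switch = (\<lambda>(a, a', b, b') E. (E - {{a, a'}, {b, b'}}) \<union> {{a, b}, {a', b'}})"

definition switchable :: "'a \<times> 'a \<times> 'a \<times> 'a \<Rightarrow> 'a set set \<Rightarrow> bool" where
  "switchable = (\<lambda>(a, a', b, b') E. distinct [a, a', b, b'] \<and>
     {a, a'} \<in> E \<and> {b, b'} \<in> E \<and> {a, b} \<notin> E \<and> {a', b'} \<notin> E)"

text \<open>The code of the inverse switching: with its middle entries exchanged, the tuple removes
  the edges that \<open>switch\<close> has created and restores the old ones.\<close>

definition swap_middle :: "'a \<times> 'a \<times> 'a \<times> 'a \<Rightarrow> 'a \<times> 'a \<times> 'a \<times> 'a" where
  "swap_middle = (\<lambda>(a, a', b, b'). (a, b, a', b'))"

lemma finite_regular_graphs: "finite (regular_graphs d n)"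
  by (rule finite_subset[of _ "Pow (nsets {..<n} 2)"])
     (auto simp: regular_graphs_def finite_imp_finite_nsets)

lemma regular_graph_edge:
  assumes "E \<in> regular_graphs d n" "{x, y} \<in> E"
  shows "x < n" "y < n" "x \<noteq> y"
  using assms unfolding regular_graphs_def by (auto simp: nsets_def card_insert_if split: if_splits)

lemma regular_graph_finite: "E \<in> regular_graphs d n \<Longrightarrow> finite E"
  unfolding regular_graphs_def
  by (auto intro: finite_subset[of _ "nsets {..<n} 2"] simp: finite_imp_finite_nsets)

lemma regular_graph_degree:
  assumes E: "E \<in> regular_graphs d n" and x: "x < n"
  shows "card {y. {x, y} \<in> E} = d"
proof -
  have "bij_betw (\<lambda>y. {x, y}) {y. {x, y} \<in> E} {e \<in> E. x \<in> e}"
    unfolding bij_betw_def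
  proof
    show "inj_on (\<lambda>y. {x, y}) {y. {x, y} \<in> E}"
      by (auto simp: inj_on_def doubleton_eq_iff)
    show "(\<lambda>y. {x, y}) ` {y. {x, y} \<in> E} = {e \<in> E. x \<in> e}"
    proof (intro equalityI subsetI)
      fix e assume "e \<in> {e \<in> E. x \<in> e}"
      then have "e \<in> E" "x \<in> e" "card e = 2"
        using E by (auto simp: regular_graphs_def nsets_def)
      then obtain y where "e = {x, y}"
        by (metis card_2_iff insertE insert_commute singletonD)
      then show "e \<in> (\<lambda>y. {x, y}) ` {y. {x, y} \<in> E}"
        using \<open>e \<in> E\<close> by auto
    qed auto
  qed
  then have "card {y. {x, y} \<in> E} = card {e \<in> E. x \<in> e}"
    by (rule bij_betw_same_card)
  then show ?thesis using E x by (simp add: regular_graphs_def)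
qed

lemma finite_nbrs: "E \<in> regular_graphs d n \<Longrightarrow> finite {y. {x, y} \<in> E}"
  by (rule finite_subset[of _ "{..<n}"]) (auto dest: regular_graph_edge)

lemma switch_regular:
  assumes E: "E \<in> regular_graphs d n" and t: "switchable t E"
  shows "switch t E \<in> regular_graphs d n"
proof -
  obtain a a' b b' where t_eq: "t = (a, a', b, b')" by (cases t) auto
  have dist: "a \<noteq> a'" "a \<noteq> b" "a \<noteq> b'" "a' \<noteq> b" "a' \<noteq> b'" "b \<noteq> b'"
    and inE: "{a, a'} \<in> E" "{b, b'} \<in> E" and notE: "{a, b} \<notin> E" "{a', b'} \<notin> E"
    using t unfolding t_eq switchable_def by auto
  have lt: "a < n" "a' < n" "b < n" "b' < n"
    using regular_graph_edge[OF E] inE by blast+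
  have "switch t E \<subseteq> nsets {..<n} 2"
    using E lt dist unfolding t_eq switch_def regular_graphs_def nsets_def by auto
  moreover have "card {e \<in> switch t E. z \<in> e} = d" if z: "z < n" for z
  proof -
    have fin: "finite {e \<in> E. z \<in> e}" using regular_graph_finite[OF E] by simp
    have deg: "card {e \<in> E. z \<in> e} = d" using E z by (simp add: regular_graphs_def)
    \<comment> \<open>Each of the four vertices loses exactly one edge and gains exactly one:
      \<open>p\<close> and \<open>r\<close> are the old and the new edge at \<open>z\<close>, while
      \<open>p'\<close> and \<open>r'\<close> avoid \<open>z\<close>.\<close>
    have one: "card {e \<in> switch t E. z \<in> e} = d"
      if sw: "switch t E = (E - {p, p'}) \<union> {r, r'}"
        and mem: "p \<in> E" "r \<notin> E" "z \<in> p" "z \<in> r" "z \<notin> p'" "z \<notin> r'"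
      for p p' r r'
    proof -
      have eq: "{e \<in> switch t E. z \<in> e} = insert r ({e \<in> E. z \<in> e} - {p})"
        unfolding sw using mem by blast
      have "card (insert r ({e \<in> E. z \<in> e} - {p})) = Suc (card ({e \<in> E. z \<in> e} - {p}))"
        using fin mem by (subst card_insert_disjoint) auto
      also have "\<dots> = card {e \<in> E. z \<in> e}"
        using fin mem by (simp add: card_Suc_Diff1 del: card_Diff_insert card_Diff_singleton)
      finally show ?thesis using eq deg by simp
    qed
    have sw: "switch t E = (E - {{a, a'}, {b, b'}}) \<union> {{a, b}, {a', b'}}"
      by (simp add: t_eq switch_def)
    consider "z = a" | "z = a'" | "z = b" | "z = b'" | "z \<notin> {a, a', b, b'}" by blast
    then show ?thesis
    proof cases
      case 1 show ?thesis
        by (rule one[of "{a, a'}" "{b, b'}" "{a, b}" "{a', b'}"])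
           (use 1 dist inE notE in \<open>simp_all add: sw insert_commute\<close>)
    next
      case 2 show ?thesis
        by (rule one[of "{a, a'}" "{b, b'}" "{a', b'}" "{a, b}"])
           (use 2 dist inE notE in \<open>simp_all add: sw insert_commute\<close>)
    next
      case 3 show ?thesis
        by (rule one[of "{b, b'}" "{a, a'}" "{a, b}" "{a', b'}"])
           (use 3 dist inE notE in \<open>simp_all add: sw insert_commute\<close>)
    next
      case 4 show ?thesis
        by (rule one[of "{b, b'}" "{a, a'}" "{a', b'}" "{a, b}"])
           (use 4 dist inE notE in \<open>simp_all add: sw insert_commute\<close>)
    next
      case 5
      then have "{e \<in> switch t E. z \<in> e} = {e \<in> E. z \<in> e}"
        by (auto simp: t_eq switch_def)
      then show ?thesis using deg by simp
    qed
  qed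
  ultimately show ?thesis by (simp add: regular_graphs_def)
qed

lemma swap_middle_swap_middle [simp]: "swap_middle (swap_middle t) = t"
  by (cases t) (simp add: swap_middle_def)

lemma switchable_switch: "switchable t E \<Longrightarrow> switchable (swap_middle t) (switch t E)"
  by (cases t) (auto simp: swap_middle_def switch_def switchable_def doubleton_eq_iff)

lemma switch_switch: "switchable t E \<Longrightarrow> switch (swap_middle t) (switch t E) = E"
  by (cases t) (auto simp: swap_middle_def switch_def switchable_def doubleton_eq_iff)

lemma switch_bij_betw:
  "bij_betw (switch t) {E \<in> regular_graphs d n. switchable t E}
     {E \<in> regular_graphs d n. switchable (swap_middle t) E}"
  by (rule bij_betwI[where g = "switch (swap_middle t)"])
     (use switchable_switch[of "swap_middle t"] switch_switch[of "swap_middle t"] in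
       \<open>auto intro!: switch_regular switchable_switch switch_switch\<close>)

text \<open>Double counting of the pairs of a graph and a switching applicable to it: when the sum
  runs over the result instead of the source, each \<open>E\<close> is hit once for every switching
  whose inverse can be applied to it.\<close>

lemma sum_switch:
  fixes F :: "nat set set \<Rightarrow> real"
  assumes T: "finite T"
  shows "(\<Sum>E\<in>regular_graphs d n. \<Sum>t\<in>{t \<in> T. switchable t E}. F (switch t E)) =
         (\<Sum>E\<in>regular_graphs d n. F E * card {t \<in> T. switchable (swap_middle t) E})"
proof -
  let ?R = "regular_graphs d n"
  have "(\<Sum>E\<in>?R. \<Sum>t\<in>{t \<in> T. switchable t E}. F (switch t E)) =
        (\<Sum>t\<in>T. \<Sum>E\<in>{E \<in> ?R. switchable t E}. F (switch t E))"
    using sum.swap_restrict[OF finite_regular_graphs[of d n] T, of "\<lambda>E t. F (switch t E)" "\<lambda>E t. switchable t E"]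
    by simp
  also have "\<dots> = (\<Sum>t\<in>T. \<Sum>E\<in>{E \<in> ?R. switchable (swap_middle t) E}. F E)"
    by (intro sum.cong refl sum.reindex_bij_betw switch_bij_betw)
  also have "\<dots> = (\<Sum>E\<in>?R. \<Sum>t\<in>{t \<in> T. switchable (swap_middle t) E}. F E)"
    using sum.swap_restrict[OF T finite_regular_graphs[of d n], of "\<lambda>t E. F E" "\<lambda>t E. switchable (swap_middle t) E"]
    by simp
  finally show ?thesis by (simp add: mult.commute)
qed

text \<open>Ordered pairs, so an edge with both ends in \<open>X\<close> and in \<open>Y\<close>
  counts twice. In this way every vertex contributes exactly \<open>d\<close> arcs, and each arc has
  a first and a second end, as the tuples of a switching require.\<close>

definition arcs :: "'a set \<Rightarrow> 'a set \<Rightarrow> 'a set set \<Rightarrow> ('a \<times> 'a) set" where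
  "arcs X Y E = {(x, y) \<in> X \<times> Y. {x, y} \<in> E}"

lemma arcs_swap: "card (arcs X Y E) = card (arcs Y X E)"
  by (rule bij_betw_same_card[of prod.swap])
     (auto simp: bij_betw_def arcs_def inj_on_def insert_commute image_iff)

lemma card_arcs_all:
  assumes E: "E \<in> regular_graphs d n" and X: "X \<subseteq> {..<n}"
  shows "card (arcs X {..<n} E) = d * card X"
proof -
  have finX: "finite X" using X finite_subset by blast
  have "arcs X {..<n} E = Sigma X (\<lambda>x. {y. {x, y} \<in> E})"
    using regular_graph_edge(2)[OF E] by (auto simp: arcs_def)
  then have "card (arcs X {..<n} E) = (\<Sum>x\<in>X. card {y. {x, y} \<in> E})"
    using finX finite_nbrs[OF E] by simp
  also have "\<dots> = (\<Sum>x\<in>X. d)"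
    using X regular_graph_degree[OF E] by (intro sum.cong) auto
  finally show ?thesis by (simp add: mult.commute)
qed

lemma card_arcs_split:
  assumes E: "E \<in> regular_graphs d n" and X: "X \<subseteq> {..<n}" and S: "S \<subseteq> {..<n}"
  shows "card (arcs X S E) + card (arcs X ({..<n} - S) E) = d * card X"
proof -
  have fin: "finite (arcs X Y E)" if "Y \<subseteq> {..<n}" for Y
    by (rule finite_subset[of _ "{..<n} \<times> {..<n}"]) (use X that in \<open>auto simp: arcs_def\<close>)
  have "arcs X {..<n} E = arcs X S E \<union> arcs X ({..<n} - S) E"
    using S by (auto simp: arcs_def)
  moreover have "arcs X S E \<inter> arcs X ({..<n} - S) E = {}" by (auto simp: arcs_def)
  ultimately have "card (arcs X {..<n} E) = card (arcs X S E) + card (arcs X ({..<n} - S) E)"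
    using fin S by (simp add: card_Un_disjoint)
  then show ?thesis using card_arcs_all[OF E X] by simp
qed

lemma card_nbrs_le: "E \<in> regular_graphs d n \<Longrightarrow> card {y. {x, y} \<in> E} \<le> d"
proof (cases "x < n")
  assume E: "E \<in> regular_graphs d n"
  case False
  then have "{y. {x, y} \<in> E} = {}" using regular_graph_edge(1)[OF E] by auto
  then show ?thesis by simp
qed (simp add: regular_graph_degree)

lemma finite_arcs: "E \<in> regular_graphs d n \<Longrightarrow> finite (arcs X Y E)"
  by (rule finite_subset[of _ "{..<n} \<times> {..<n}"]) (auto simp: arcs_def dest: regular_graph_edge)

lemma card_near_pairs:
  assumes E: "E \<in> regular_graphs d n"
  shows "finite {(b, b'). {b, b'} \<in> E \<and> (b = a \<or> b' = a \<or> {a, b} \<in> E)}" (is "finite ?A")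
    and "card {(b, b'). {b, b'} \<in> E \<and> (b = a \<or> b' = a \<or> {a, b} \<in> E)} \<le> d\<^sup>2 + 2 * d"
proof -
  let ?N = "\<lambda>x. {y. {x, y} \<in> E}"
  have fin: "finite (?N x)" and le: "card (?N x) \<le> d" for x
    using finite_nbrs[OF E] card_nbrs_le[OF E] by blast+
  \<comment> \<open>The pairs that start at \<open>a\<close>, those that end at \<open>a\<close>,
    and those that start at a neighbour of \<open>a\<close>; hence
    \<open>d + d + d\<^sup>2\<close>.\<close>
  have sub: "?A \<subseteq> Pair a ` ?N a \<union> ((\<lambda>b. (b, a)) ` ?N a \<union> Sigma (?N a) ?N)"
    by (auto simp: insert_commute image_iff)
  show "finite ?A"
    by (rule finite_subset[OF sub]) (use fin in auto)
  have "card (Sigma (?N a) ?N) = (\<Sum>x\<in>?N a. card (?N x))"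
    using fin by (intro card_SigmaI) auto
  also have "\<dots> \<le> card (?N a) * d"
    using le sum_bounded_above[of "?N a" "\<lambda>x. card (?N x)" d] by simp
  also have "\<dots> \<le> d * d" using le[of a] by simp
  finally have S: "card (Sigma (?N a) ?N) \<le> d\<^sup>2" by (simp add: power2_eq_square)
  have "card ?A \<le> card (Pair a ` ?N a \<union> ((\<lambda>b. (b, a)) ` ?N a \<union> Sigma (?N a) ?N))"
    by (rule card_mono[OF _ sub]) (use fin in auto)
  also have "\<dots> \<le> card (Pair a ` ?N a) + (card ((\<lambda>b. (b, a)) ` ?N a) + card (Sigma (?N a) ?N))"
    by (meson card_Un_le add_left_mono order_trans)
  also have "\<dots> \<le> d + (d + d\<^sup>2)"
    using card_image_le[OF fin[of a], of "Pair a"] card_image_le[OF fin[of a], of "\<lambda>b. (b, a)"] le[of a] S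
    by linarith
  finally show "card ?A \<le> d\<^sup>2 + 2 * d" by simp
qed

text \<open>A pair of arcs fails to be switchable only if the arcs meet or a new edge is already
  present, which leaves at most 2 (d^2 + 2 d) bad partners for each first arc. The loss is therefore
  proportional to \<open>P\<close> alone; for \<open>X = {v}\<close> it is bounded, and the
  switchings at \<open>v\<close> depend on this.\<close>

lemma card_switchable:
  fixes X X' Y Y' :: "nat set"
  assumes E: "E \<in> regular_graphs d n"
  defines "N \<equiv> real (card {t \<in> X \<times> X' \<times> Y \<times> Y'. switchable t E})"
    and "P \<equiv> real (card (arcs X X' E))" and "Q \<equiv> real (card (arcs Y Y' E))"
  shows "N \<le> P * Q" and "P * Q - 2 * (d\<^sup>2 + 2 * d) * P \<le> N"
proof -
  let ?T = "{t \<in> X \<times> X' \<times> Y \<times> Y'. switchable t E}"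
  define near where "near a = {(b, b'). {b, b'} \<in> E \<and> (b = a \<or> b' = a \<or> {a, b} \<in> E)}" for a
  \<comment> \<open>\<open>near a\<close> covers \<open>b = a\<close>, \<open>b' = a\<close> and an
    existing edge between \<open>a\<close> and \<open>b\<close>; the swapped copy of
    \<open>near a'\<close> covers the analogous cases for \<open>a'\<close> and
    \<open>b'\<close>.\<close>
  define bad where "bad = (\<lambda>(a, a'). near a \<union> prod.swap ` near a')"
  let ?f = "\<lambda>(a, a', b, b'). ((a, a'), (b, b'))"
  have inj: "inj_on ?f A" for A :: "(nat \<times> nat \<times> nat \<times> nat) set" by (auto simp: inj_on_def)
  have cT: "card (?f ` ?T) = card ?T" by (rule card_image[OF inj])
  have near: "finite (near a)" "card (near a) \<le> d\<^sup>2 + 2 * d" for a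
    using card_near_pairs[OF E, of a] by (auto simp: near_def)
  have bad: "finite (bad p)" "card (bad p) \<le> 2 * (d\<^sup>2 + 2 * d)" for p
  proof -
    show "finite (bad p)" using near by (auto simp: bad_def split: prod.split)
    have "card (bad p) \<le> card (near (fst p)) + card (prod.swap ` near (snd p))"
      by (auto simp: bad_def card_Un_le split: prod.split)
    moreover have "card (prod.swap ` near (snd p)) \<le> card (near (snd p))"
      using near by (intro card_image_le)
    ultimately show "card (bad p) \<le> 2 * (d\<^sup>2 + 2 * d)"
      using near(2)[of "fst p"] near(2)[of "snd p"]
      unfolding mult_2[of "d\<^sup>2 + 2 * d"] by linarith
  qed
  have "?f ` ?T \<subseteq> arcs X X' E \<times> arcs Y Y' E"
    by (auto simp: switchable_def arcs_def)
  then have "card (?f ` ?T) \<le> card (arcs X X' E \<times> arcs Y Y' E)"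
    using finite_arcs[OF E] by (intro card_mono) auto
  then have "card ?T \<le> card (arcs X X' E) * card (arcs Y Y' E)"
    unfolding cT card_cartesian_product .
  then show "N \<le> P * Q"
    unfolding N_def P_def Q_def of_nat_mult[symmetric] of_nat_le_iff .
  have fT: "finite (?f ` ?T)"
    by (rule finite_subset[OF \<open>?f ` ?T \<subseteq> _\<close>]) (use finite_arcs[OF E] in auto)
  have "arcs X X' E \<times> arcs Y Y' E \<subseteq> ?f ` ?T \<union> Sigma (arcs X X' E) bad"
  proof
    fix z assume "z \<in> arcs X X' E \<times> arcs Y Y' E"
    then obtain a a' b b' where z: "z = ((a, a'), (b, b'))"
      and mem: "a \<in> X" "a' \<in> X'" "b \<in> Y" "b' \<in> Y'" and e: "{a, a'} \<in> E" "{b, b'} \<in> E"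
      by (auto simp: arcs_def)
    have "a \<noteq> a'" "b \<noteq> b'" using regular_graph_edge(3)[OF E] e by blast+
    show "z \<in> ?f ` ?T \<union> Sigma (arcs X X' E) bad"
    proof (cases "switchable (a, a', b, b') E")
      case True
      then have "(a, a', b, b') \<in> ?T" using mem by simp
      then have "?f (a, a', b, b') \<in> ?f ` ?T" by (rule imageI)
      then show ?thesis using z by simp
    next
      case False
      have e': "{b', b} \<in> E" using e(2) by (simp add: insert_commute)
      have "(b, b') \<in> near a \<or> (b', b) \<in> near a'"
        using False e e' \<open>a \<noteq> a'\<close> \<open>b \<noteq> b'\<close> unfolding switchable_def near_def by auto
      then have "(b, b') \<in> bad (a, a')" by (force simp: bad_def image_iff)
      then show ?thesis using z mem e by (auto simp: arcs_def)
    qed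
  qed
  then have "card (arcs X X' E \<times> arcs Y Y' E) \<le> card (?f ` ?T \<union> Sigma (arcs X X' E) bad)"
    using fT finite_arcs[OF E] bad by (intro card_mono) auto
  also have "\<dots> \<le> card (?f ` ?T) + card (Sigma (arcs X X' E) bad)" by (rule card_Un_le)
  finally have "card (arcs X X' E) * card (arcs Y Y' E) \<le> card ?T + card (Sigma (arcs X X' E) bad)"
    unfolding cT card_cartesian_product .
  moreover have "card (Sigma (arcs X X' E) bad) = (\<Sum>p\<in>arcs X X' E. card (bad p))"
    using finite_arcs[OF E] bad by (intro card_SigmaI) auto
  moreover have "(\<Sum>p\<in>arcs X X' E. card (bad p)) \<le> card (arcs X X' E) * (2 * (d\<^sup>2 + 2 * d))"
    using bad sum_bounded_above[of "arcs X X' E" "\<lambda>p. card (bad p)" "2 * (d\<^sup>2 + 2 * d)"] by simp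
  ultimately have "card (arcs X X' E) * card (arcs Y Y' E) \<le>
      card ?T + card (arcs X X' E) * (2 * (d\<^sup>2 + 2 * d))"
    by linarith
  then have "real (card (arcs X X' E) * card (arcs Y Y' E)) \<le>
      real (card ?T + card (arcs X X' E) * (2 * (d\<^sup>2 + 2 * d)))"
    by (simp only: of_nat_le_iff)
  then show "P * Q - 2 * (d\<^sup>2 + 2 * d) * P \<le> N"
    unfolding N_def P_def Q_def by (simp add: algebra_simps)
qed

text \<open>The switchings that lead into \<open>E\<close> are those that lead out of it with the
  two middle sets exchanged, so \<open>card_switchable\<close> estimates both sides of a balance
  equation.\<close>

lemma card_switchable_swap_middle:
  "card {t \<in> X \<times> X' \<times> Y \<times> Y'. switchable (swap_middle t) E} =
   card {t \<in> X \<times> Y \<times> X' \<times> Y'. switchable t E}"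
  by (rule bij_betw_same_card[of swap_middle], rule bij_betwI[where g = swap_middle])
     (auto simp: swap_middle_def)

text \<open>The complement is taken among all natural numbers; in a regular graph only its part
  below \<open>n\<close> is met by edges (\<open>arcs_inside\<close>).\<close>

definition cut_size :: "nat set \<Rightarrow> nat set set \<Rightarrow> nat" where
  "cut_size S E = card (arcs S (- S) E)"

text \<open>The quantity X of the overview, when \<open>v\<close> lies outside
  \<open>S\<close>.\<close>

definition link :: "nat \<Rightarrow> nat set \<Rightarrow> nat set set \<Rightarrow> nat" where
  "link v S E = card {x \<in> S. {v, x} \<in> E}"

lemma arcs_inside: 
  assumes "E \<in> regular_graphs d n"
  shows "arcs X ({..<n} - S) E = arcs X (- S) E" "arcs ({..<n} - S) X E = arcs (- S) X E"
  using assms by (auto simp: arcs_def dest: regular_graph_edge)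

lemma link_eq_arcs: "link v S E = card (arcs {v} S E)"
  unfolding link_def
  by (rule bij_betw_same_card[of "Pair v"]) (auto simp: bij_betw_def inj_on_def arcs_def image_iff)

text \<open>One edge inside \<open>S\<close> and one outside it are turned into two crossing edges.
  Since \<open>v\<close> is none of the four ends, its neighbours stay the same.\<close>

lemma cut_switch_inner:
  assumes E: "E \<in> regular_graphs d n" and t: "switchable (a, a', b, b') E"
    and mem: "a \<in> S" "a' \<in> S" "b \<notin> S" "b' \<notin> S" "b \<noteq> v" "b' \<noteq> v" "v \<notin> S"
  shows "cut_size S (switch (a, a', b, b') E) = cut_size S E + 2"
    and "link v S (switch (a, a', b, b') E) = link v S E"
proof -
  have "arcs S (- S) (switch (a, a', b, b') E) = insert (a, b) (insert (a', b') (arcs S (- S) E))"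
  proof -
    have "{x, y} \<in> switch (a, a', b, b') E \<longleftrightarrow> (x = a \<and> y = b) \<or> (x = a' \<and> y = b') \<or> {x, y} \<in> E"
      if "x \<in> S" "y \<notin> S" for x y
    proof -
      have "{x, y} \<noteq> {a, a'}" "{x, y} \<noteq> {b, b'}"
        "{x, y} = {a, b} \<longleftrightarrow> x = a \<and> y = b" "{x, y} = {a', b'} \<longleftrightarrow> x = a' \<and> y = b'"
        using mem that by (auto simp: doubleton_eq_iff)
      then show ?thesis by (simp add: switch_def)
    qed
    then show ?thesis using mem unfolding arcs_def by blast
  qed
  moreover have "(a, b) \<noteq> (a', b')" "(a, b) \<notin> arcs S (- S) E" "(a', b') \<notin> arcs S (- S) E"
    using t by (auto simp: arcs_def switchable_def)
  ultimately show "cut_size S (switch (a, a', b, b') E) = cut_size S E + 2"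
    unfolding cut_size_def using finite_arcs[OF E, of S "- S"] by simp
  have "{x \<in> S. {v, x} \<in> switch (a, a', b, b') E} = {x \<in> S. {v, x} \<in> E}"
    using mem by (auto simp: switch_def doubleton_eq_iff)
  then show "link v S (switch (a, a', b, b') E) = link v S E" by (simp add: link_def)
qed

text \<open>The crossing edge \<open>xy\<close> is traded for the crossing edge \<open>vx\<close>,
  and the other two edges lie outside \<open>S\<close>: the cut keeps its size while
  \<open>v\<close> gains the neighbour \<open>x\<close> in \<open>S\<close>.\<close>

lemma cut_switch_link:
  assumes E: "E \<in> regular_graphs d n" and t: "switchable (v, u, x, y) E"
    and mem: "v \<notin> S" "u \<notin> S" "x \<in> S" "y \<notin> S"
  shows "cut_size S (switch (v, u, x, y) E) = cut_size S E"
    and "link v S (switch (v, u, x, y) E) = link v S E + 1"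
proof -
  have "arcs S (- S) (switch (v, u, x, y) E) = insert (x, v) (arcs S (- S) E - {(x, y)})"
  proof -
    have "{p, r} \<in> switch (v, u, x, y) E \<longleftrightarrow> (p = x \<and> r = v) \<or> {p, r} \<in> E \<and> \<not> (p = x \<and> r = y)"
      if "p \<in> S" "r \<notin> S" for p r
    proof -
      have "{p, r} \<noteq> {v, u}" "{p, r} \<noteq> {u, y}"
        "{p, r} = {x, y} \<longleftrightarrow> p = x \<and> r = y" "{p, r} = {v, x} \<longleftrightarrow> p = x \<and> r = v"
        using mem that by (auto simp: doubleton_eq_iff)
      then show ?thesis using t by (auto simp: switch_def switchable_def)
    qed
    moreover have "v \<noteq> y" using t by (simp add: switchable_def)
    ultimately show ?thesis using mem unfolding arcs_def by blast
  qed
  moreover have "(x, v) \<notin> arcs S (- S) E" "(x, y) \<in> arcs S (- S) E"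
    using t mem by (auto simp: arcs_def switchable_def insert_commute)
  ultimately show "cut_size S (switch (v, u, x, y) E) = cut_size S E"
    unfolding cut_size_def using finite_arcs[OF E, of S "- S"]
    using card.remove[of "arcs S (- S) E" "(x, y)"]
      card_insert_disjoint[of "arcs S (- S) E - {(x, y)}" "(x, v)"] by auto
  have "{z \<in> S. {v, z} \<in> switch (v, u, x, y) E} = insert x {z \<in> S. {v, z} \<in> E}"
    using t mem by (auto simp: switch_def switchable_def doubleton_eq_iff)
  moreover have "x \<notin> {z \<in> S. {v, z} \<in> E}" using t by (simp add: switchable_def)
  moreover have "finite {z \<in> S. {v, z} \<in> E}"
    using finite_subset[OF _ finite_nbrs[OF E, of v]] by auto
  ultimately show "link v S (switch (v, u, x, y) E) = link v S E + 1"
    by (simp add: link_def)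
qed

section \<open>Edge counts determined by the cut and the link\<close>

context
  fixes d n k :: nat and S B :: "nat set" and v :: nat and E :: "nat set set"
  assumes E: "E \<in> regular_graphs d n" and S: "S \<subseteq> {..<n}" and k: "card S = k"
    and v: "v < n" "v \<notin> S"
  defines "B \<equiv> {..<n} - S - {v}"
begin

lemma link_le: "link v S E \<le> d"
  unfolding link_def
  by (rule order_trans[OF card_mono[OF finite_nbrs[OF E, of v]] card_nbrs_le[OF E, of v]]) auto

lemma arcs_v_B: "card (arcs {v} B E) + link v S E = d"
proof -
  have "arcs {v} B E = arcs {v} ({..<n} - S) E"
    unfolding B_def arcs_def using regular_graph_edge(3)[OF E] by blast
  then show ?thesis
    using card_arcs_split[OF E _ S, of "{v}"] v by (simp add: link_eq_arcs)
qed

lemma arcs_S_B: "card (arcs S B E) + link v S E = cut_size S E"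
proof -
  have "arcs S (- S) E = arcs S B E \<union> arcs S {v} E"
    unfolding B_def arcs_def using regular_graph_edge[OF E] v by auto
  moreover have "arcs S B E \<inter> arcs S {v} E = {}" by (auto simp: arcs_def B_def)
  ultimately show ?thesis unfolding cut_size_def link_eq_arcs arcs_swap[of "{v}"]
    using finite_arcs[OF E] by (simp add: card_Un_disjoint)
qed

lemma arcs_S_S: "card (arcs S S E) + cut_size S E = d * k"
  using card_arcs_split[OF E S S] k by (simp add: cut_size_def arcs_inside[OF E])

text \<open>Degree count over \<open>B\<close>: leaving out \<open>v\<close> costs \<open>d\<close>
  arcs, the arcs from \<open>B\<close> to \<open>S\<close> number the cut minus the link, and those
  from \<open>B\<close> to \<open>v\<close> number \<open>d\<close> minus the link.\<close>

lemma arcs_B_B: "card (arcs B B E) + cut_size S E + 2 * d = d * (n - k) + 2 * link v S E"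
proof -
  have B: "B \<subseteq> {..<n}" by (auto simp: B_def)
  have cB: "card B + 1 = n - k"
  proof -
    have "card ({..<n} - S) = n - k" using S k finite_subset[OF S] by (simp add: card_Diff_subset)
    moreover have "v \<in> {..<n} - S" using v by simp
    ultimately show ?thesis unfolding B_def using card.remove[of "{..<n} - S" v] by simp
  qed
  have "card (arcs B S E) + card (arcs B ({..<n} - S) E) = d * card B"
    using card_arcs_split[OF E B S] .
  moreover have "arcs B ({..<n} - S) E = arcs B B E \<union> arcs B {v} E"
    using v by (auto simp: B_def arcs_def)
  moreover have "arcs B B E \<inter> arcs B {v} E = {}" by (auto simp: arcs_def B_def)
  ultimately have "card (arcs B S E) + (card (arcs B B E) + card (arcs B {v} E)) = d * card B"
    using finite_arcs[OF E] by (simp add: card_Un_disjoint)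
  moreover have "d * (n - k) = d * card B + d" by (simp flip: cB)
  ultimately show ?thesis
    using arcs_S_B arcs_v_B arcs_swap[of B S E] arcs_swap[of B "{v}" E] by linarith
qed

text \<open>When \<open>v\<close> joins \<open>S\<close>, its edges into \<open>S\<close> stop
  crossing and its other edges start to cross. This is the source of the factor q^(d - 2X).\<close>

lemma cut_insert: "cut_size (insert v S) E + 2 * link v S E = cut_size S E + d"
proof -
  have "arcs (insert v S) (- insert v S) E = arcs S B E \<union> arcs {v} B E"
    unfolding B_def arcs_def using regular_graph_edge[OF E] by auto
  moreover have "arcs S B E \<inter> arcs {v} B E = {}" using v by (auto simp: arcs_def)
  ultimately have "cut_size (insert v S) E = card (arcs S B E) + card (arcs {v} B E)"
    unfolding cut_size_def using finite_arcs[OF E] by (simp add: card_Un_disjoint)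
  then show ?thesis using arcs_S_B arcs_v_B by linarith
qed

end

section \<open>Concentration of the cut and near-binomial links\<close>

text \<open>
  The balance equation with \<open>\<phi> m = m - m0\<close> bounds the variance of \<open>m\<close> by \<open>O(x + y)\<close>; inserting this
  into the equation with \<open>\<phi> = 1\<close>, which is quadratic in \<open>m\<close>, gives the mean up to \<open>O(1)\<close>.
\<close>

lemma balanced_mean:
  fixes w m N1 N2 :: "'b \<Rightarrow> real" and q x y C m0 :: real
  assumes w: "\<And>e. e \<in> \<Omega> \<Longrightarrow> 0 \<le> w e" and q: "0 < q" "q < 1" and C: "0 \<le> C"
    and m: "\<And>e. e \<in> \<Omega> \<Longrightarrow> 0 \<le> m e \<and> m e \<le> x \<and> m e \<le> y"
    and N1: "\<And>e. e \<in> \<Omega> \<Longrightarrow> \<bar>N1 e - (x - m e) * (y - m e)\<bar> \<le> C * (x + y)"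
    and N2: "\<And>e. e \<in> \<Omega> \<Longrightarrow> \<bar>N2 e - (m e)\<^sup>2\<bar> \<le> C * (x + y)"
    and bal: "\<And>\<phi> :: real \<Rightarrow> real.
      (\<Sum>e\<in>\<Omega>. w e * (q\<^sup>2 * \<phi> (m e + 2) * N1 e)) = (\<Sum>e\<in>\<Omega>. w e * (\<phi> (m e) * N2 e))"
    and m0: "0 \<le> m0" "q\<^sup>2 * (x - m0) * (y - m0) = m0\<^sup>2" and N: "x + y \<ge> 1" "0 \<le> x" "0 \<le> y"
  defines "K1 \<equiv> 2 / q\<^sup>2 * (2 * C\<^sup>2 / q\<^sup>2 + 2 + 2 * C)"
  shows "\<bar>\<Sum>e\<in>\<Omega>. w e * (m e - m0)\<bar> \<le> (2 * C + K1) / q\<^sup>2 * (\<Sum>e\<in>\<Omega>. w e)"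
proof -
  define N where "N = x + y"
  have N1': "N \<ge> 1" using N by (simp add: N_def)
  have q2: "0 < q\<^sup>2" "q\<^sup>2 < 1" using q by (auto simp: power_less_one_iff)
  have K1: "K1 \<ge> 0" unfolding K1_def using C q2 by auto
  define t where "t e = m e - m0" for e
  \<comment> \<open>\<open>m0\<close> is a root of this quadratic in \<open>m e\<close>, so it
    factors through \<open>t e\<close>. The cofactor has size at least \<open>q\<^sup>2 * N\<close>:
    the balance pushes the cut back towards \<open>m0\<close> with a strength proportional to
    \<open>N\<close>.\<close>
  define F where "F e = q\<^sup>2 * (x - m e) * (y - m e) - (m e)\<^sup>2" for e
  have F: "F e = - t e * (q\<^sup>2 * N + (1 - q\<^sup>2) * (m e + m0))" for e
  proof -
    have "F e = F e - (q\<^sup>2 * (x - m0) * (y - m0) - m0\<^sup>2)" using m0 by simp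
    also have "\<dots> = - t e * (q\<^sup>2 * N + (1 - q\<^sup>2) * (m e + m0))"
      by (simp add: F_def t_def N_def power2_eq_square algebra_simps)
    finally show ?thesis .
  qed
  have err: "\<bar>(q\<^sup>2 * N1 e - N2 e) - F e\<bar> \<le> 2 * C * N" if "e \<in> \<Omega>" for e
  proof -
    have "(q\<^sup>2 * N1 e - N2 e) - F e =
        q\<^sup>2 * (N1 e - (x - m e) * (y - m e)) - (N2 e - (m e)\<^sup>2)"
      by (simp add: F_def algebra_simps)
    also have "\<bar>\<dots>\<bar> \<le> q\<^sup>2 * \<bar>N1 e - (x - m e) * (y - m e)\<bar> + \<bar>N2 e - (m e)\<^sup>2\<bar>"
      by (rule order_trans[OF abs_triangle_ineq4]) (simp add: abs_mult)
    also have "\<dots> \<le> 1 * (C * (x + y)) + C * (x + y)"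
      using N1[OF that] N2[OF that] q2 by (intro add_mono mult_mono) auto
    finally show ?thesis by (simp add: N_def)
  qed
  \<comment> \<open>The test function is s - m0. Its shift by 2 leaves the extra term
    \<open>2 * q\<^sup>2 * N1 e\<close>, of order \<open>N * N\<close>; the rest is
    \<open>t e\<close> times the drift.\<close>
  have pt: "w e * (q\<^sup>2 * (m e + 2 - m0) * N1 e) - w e * ((m e - m0) * N2 e) \<le>
      w e * (- (q\<^sup>2 / 2 * N * (t e)\<^sup>2) + N * N * (2 * C\<^sup>2 / q\<^sup>2 + 2 + 2 * C))" if e: "e \<in> \<Omega>" for e
  proof -
    have "t e * (q\<^sup>2 * N1 e - N2 e) \<le> t e * F e + \<bar>t e\<bar> * (2 * C * N)"
    proof -
      have "t e * (q\<^sup>2 * N1 e - N2 e) - t e * F e = t e * ((q\<^sup>2 * N1 e - N2 e) - F e)"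
        by (simp add: algebra_simps)
      also have "\<dots> \<le> \<bar>t e\<bar> * \<bar>(q\<^sup>2 * N1 e - N2 e) - F e\<bar>" by (metis abs_ge_self abs_mult)
      also have "\<dots> \<le> \<bar>t e\<bar> * (2 * C * N)" using err[OF e] by (intro mult_left_mono) auto
      finally show ?thesis by simp
    qed
    moreover have "t e * F e \<le> - (q\<^sup>2 * N * (t e)\<^sup>2)"
    proof -
      have "t e * F e = - (q\<^sup>2 * N * (t e)\<^sup>2) - (t e)\<^sup>2 * ((1 - q\<^sup>2) * (m e + m0))"
        unfolding F by (simp add: power2_eq_square algebra_simps)
      moreover have "(t e)\<^sup>2 * ((1 - q\<^sup>2) * (m e + m0)) \<ge> 0"
        using m[OF e] m0 q2 by simp
      ultimately show ?thesis by simp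
    qed
    \<comment> \<open>Completing a square absorbs the linear error into half of the quadratic drift
      term.\<close>
    moreover have "\<bar>t e\<bar> * (2 * C * N) \<le> q\<^sup>2 / 2 * N * (t e)\<^sup>2 + N * (2 * C\<^sup>2 / q\<^sup>2)"
    proof -
      have "0 \<le> N / (2 * q\<^sup>2) * (q\<^sup>2 * \<bar>t e\<bar> - 2 * C)\<^sup>2" using N1' q2 by simp
      also have "\<dots> = q\<^sup>2 / 2 * N * (t e)\<^sup>2 + N * (2 * C\<^sup>2 / q\<^sup>2) - \<bar>t e\<bar> * (2 * C * N)"
        using q by (simp add: power2_diff power_mult_distrib field_simps power2_eq_square)
      finally show ?thesis by simp
    qed
    moreover have "2 * q\<^sup>2 * N1 e \<le> N * N * (2 + 2 * C)"
    proof -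
      have "(x - m e) * (y - m e) \<le> N * N"
        using m[OF e] N by (intro mult_mono) (auto simp: N_def)
      moreover have "C * N \<le> C * (N * N)" using C N1' by (simp add: mult_left_mono)
      ultimately have "N1 e \<le> N * N * (1 + C)"
        using N1[OF e] by (simp add: N_def algebra_simps abs_le_iff)
      then have "q\<^sup>2 * N1 e \<le> q\<^sup>2 * (N * N * (1 + C))" using q2 by simp
      also have "\<dots> \<le> 1 * (N * N * (1 + C))"
        using q2 C N1' by (intro mult_right_mono) auto
      finally show ?thesis by (simp add: algebra_simps)
    qed
    moreover have "N * (2 * C\<^sup>2 / q\<^sup>2) \<le> N * N * (2 * C\<^sup>2 / q\<^sup>2)"
      using N1' q2 by (intro mult_right_mono) auto
    moreover have "q\<^sup>2 * (m e + 2 - m0) * N1 e - (m e - m0) * N2 e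
        = t e * (q\<^sup>2 * N1 e - N2 e) + 2 * q\<^sup>2 * N1 e"
      by (simp add: t_def algebra_simps)
    moreover have "N * N * (2 * C\<^sup>2 / q\<^sup>2 + 2 + 2 * C) = N * N * (2 * C\<^sup>2 / q\<^sup>2) + N * N * (2 + 2 * C)"
      by (simp add: algebra_simps)
    ultimately have "q\<^sup>2 * (m e + 2 - m0) * N1 e - (m e - m0) * N2 e \<le>
      - (q\<^sup>2 / 2 * N * (t e)\<^sup>2) + N * N * (2 * C\<^sup>2 / q\<^sup>2 + 2 + 2 * C)"
      by linarith
    then show ?thesis using w[OF e] by (simp add: mult_left_mono flip: right_diff_distrib)
  qed
  have var: "(\<Sum>e\<in>\<Omega>. w e * (t e)\<^sup>2) \<le> K1 * N * (\<Sum>e\<in>\<Omega>. w e)"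
  proof -
    \<comment> \<open>By the balance equation the left-hand sides of \<open>pt\<close> sum to
      zero.\<close>
    have "0 = (\<Sum>e\<in>\<Omega>. w e * (q\<^sup>2 * (m e + 2 - m0) * N1 e) - w e * ((m e - m0) * N2 e))"
      using bal[of "\<lambda>s. s - m0"] by (simp add: sum_subtractf)
    also have "\<dots> \<le> (\<Sum>e\<in>\<Omega>. w e * (- (q\<^sup>2 / 2 * N * (t e)\<^sup>2) + N * N * (2 * C\<^sup>2 / q\<^sup>2 + 2 + 2 * C)))"
      by (rule sum_mono) (rule pt)
    also have "\<dots> = - (q\<^sup>2 / 2 * N) * (\<Sum>e\<in>\<Omega>. w e * (t e)\<^sup>2)
        + N * N * (2 * C\<^sup>2 / q\<^sup>2 + 2 + 2 * C) * (\<Sum>e\<in>\<Omega>. w e)"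
      unfolding sum_distrib_left sum.distrib[symmetric]
      by (intro sum.cong refl) (simp add: algebra_simps)
    finally have "(q\<^sup>2 / 2 * N) * (\<Sum>e\<in>\<Omega>. w e * (t e)\<^sup>2) \<le> (q\<^sup>2 / 2 * N) * (K1 * N * (\<Sum>e\<in>\<Omega>. w e))"
    proof -
      assume "0 \<le> - (q\<^sup>2 / 2 * N) * (\<Sum>e\<in>\<Omega>. w e * (t e)\<^sup>2)
        + N * N * (2 * C\<^sup>2 / q\<^sup>2 + 2 + 2 * C) * (\<Sum>e\<in>\<Omega>. w e)"
      moreover have "2 * C\<^sup>2 / q\<^sup>2 + 2 + 2 * C = q\<^sup>2 / 2 * K1" using q2 by (simp add: K1_def)
      ultimately have "0 \<le> - (q\<^sup>2 / 2 * N) * (\<Sum>e\<in>\<Omega>. w e * (t e)\<^sup>2)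
        + N * N * (q\<^sup>2 / 2 * K1) * (\<Sum>e\<in>\<Omega>. w e)" by (simp only:)
      then show ?thesis by (simp add: algebra_simps)
    qed
    then show ?thesis using q2 N1' by (subst (asm) mult_le_cancel_left_pos) auto
  qed
  \<comment> \<open>Now the test function 1. Since \<open>m e + m0 = t e + 2 * m0\<close>, the sum
    of \<open>F\<close> is linear in the sum of \<open>t\<close> up to the second moment, which
    \<open>var\<close> bounds by O(N); dividing by a coefficient of order \<open>N\<close> leaves
    O(1).\<close>
  have eq: "(q\<^sup>2 * N + 2 * (1 - q\<^sup>2) * m0) * (\<Sum>e\<in>\<Omega>. w e * t e)
      = - (1 - q\<^sup>2) * (\<Sum>e\<in>\<Omega>. w e * (t e)\<^sup>2) + (\<Sum>e\<in>\<Omega>. w e * ((q\<^sup>2 * N1 e - N2 e) - F e))"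
  proof -
    have "(\<Sum>e\<in>\<Omega>. w e * (q\<^sup>2 * N1 e - N2 e)) = 0"
      using bal[of "\<lambda>s. 1"] by (simp add: sum_subtractf algebra_simps)
    then have "(\<Sum>e\<in>\<Omega>. w e * ((q\<^sup>2 * N1 e - N2 e) - F e)) = - (\<Sum>e\<in>\<Omega>. w e * F e)"
      by (simp add: right_diff_distrib sum_subtractf)
    moreover have "(\<Sum>e\<in>\<Omega>. w e * F e) = - (1 - q\<^sup>2) * (\<Sum>e\<in>\<Omega>. w e * (t e)\<^sup>2)
        - (q\<^sup>2 * N + 2 * (1 - q\<^sup>2) * m0) * (\<Sum>e\<in>\<Omega>. w e * t e)"
      unfolding sum_distrib_left sum_subtractf[symmetric]
      by (intro sum.cong refl) (simp add: F t_def power2_eq_square algebra_simps)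
    ultimately show ?thesis by linarith
  qed
  have "(q\<^sup>2 * N + 2 * (1 - q\<^sup>2) * m0) * \<bar>\<Sum>e\<in>\<Omega>. w e * t e\<bar>
      = \<bar>- (1 - q\<^sup>2) * (\<Sum>e\<in>\<Omega>. w e * (t e)\<^sup>2) + (\<Sum>e\<in>\<Omega>. w e * ((q\<^sup>2 * N1 e - N2 e) - F e))\<bar>"
  proof -
    have "\<bar>q\<^sup>2 * N + 2 * (1 - q\<^sup>2) * m0\<bar> = q\<^sup>2 * N + 2 * (1 - q\<^sup>2) * m0"
      using q2 N1' m0 by (intro abs_of_nonneg) auto
    then have "\<bar>(q\<^sup>2 * N + 2 * (1 - q\<^sup>2) * m0) * (\<Sum>e\<in>\<Omega>. w e * t e)\<bar> =
        (q\<^sup>2 * N + 2 * (1 - q\<^sup>2) * m0) * \<bar>\<Sum>e\<in>\<Omega>. w e * t e\<bar>"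
      by (simp only: abs_mult)
    then show ?thesis unfolding eq by (rule sym)
  qed
  also have "\<dots> \<le> (1 - q\<^sup>2) * (\<Sum>e\<in>\<Omega>. w e * (t e)\<^sup>2) + (\<Sum>e\<in>\<Omega>. w e * (2 * C * N))"
  proof (rule order_trans[OF abs_triangle_ineq add_mono])
    show "\<bar>- (1 - q\<^sup>2) * (\<Sum>e\<in>\<Omega>. w e * (t e)\<^sup>2)\<bar> \<le> (1 - q\<^sup>2) * (\<Sum>e\<in>\<Omega>. w e * (t e)\<^sup>2)"
      using q2 w by (simp add: abs_mult sum_nonneg)
    show "\<bar>\<Sum>e\<in>\<Omega>. w e * ((q\<^sup>2 * N1 e - N2 e) - F e)\<bar> \<le> (\<Sum>e\<in>\<Omega>. w e * (2 * C * N))"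
      using err w by (intro order_trans[OF sum_abs] sum_mono) (simp add: abs_mult mult_left_mono)
  qed
  also have "\<dots> \<le> 1 * (K1 * N * (\<Sum>e\<in>\<Omega>. w e)) + (\<Sum>e\<in>\<Omega>. w e * (2 * C * N))"
    using var q2 K1 N1' w by (intro add_mono mult_mono) (auto intro!: sum_nonneg)
  also have "\<dots> = N * (2 * C + K1) * (\<Sum>e\<in>\<Omega>. w e)"
    by (simp add: sum_distrib_left sum_distrib_right algebra_simps)
  finally have "(q\<^sup>2 * N + 2 * (1 - q\<^sup>2) * m0) * \<bar>\<Sum>e\<in>\<Omega>. w e * t e\<bar> \<le> N * (2 * C + K1) * (\<Sum>e\<in>\<Omega>. w e)" .
  moreover have "q\<^sup>2 * N * \<bar>\<Sum>e\<in>\<Omega>. w e * t e\<bar> \<le> (q\<^sup>2 * N + 2 * (1 - q\<^sup>2) * m0) * \<bar>\<Sum>e\<in>\<Omega>. w e * t e\<bar>"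
    using q2 m0 by (intro mult_right_mono) auto
  ultimately have "N * (q\<^sup>2 * \<bar>\<Sum>e\<in>\<Omega>. w e * t e\<bar>) \<le> N * ((2 * C + K1) * (\<Sum>e\<in>\<Omega>. w e))"
    by (simp add: algebra_simps)
  then have "q\<^sup>2 * \<bar>\<Sum>e\<in>\<Omega>. w e * t e\<bar> \<le> (2 * C + K1) * (\<Sum>e\<in>\<Omega>. w e)"
    using N1' by (subst (asm) mult_le_cancel_left_pos) auto
  then show ?thesis using q2 by (simp add: t_def field_simps)
qed

text \<open>
  The generating function \<open>G\<close> of \<open>W\<close> nearly satisfies \<open>(1 - p + p s) G' = d p G\<close>, the equation
  of the binomial generating function, so \<open>G / (1 - p + p s)\<^sup>d\<close> is nearly constant.
\<close>

lemma near_binomial_pgf: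
  fixes W :: "nat \<Rightarrow> real" and p e z :: real
  assumes W: "\<And>j. 0 \<le> W j" and p: "0 \<le> p" "p \<le> 1" and z: "1 \<le> z" and e: "0 \<le> e"
    and bal: "\<And>j. j < d \<Longrightarrow>
      \<bar>(real d - real j) * p * W j - (real j + 1) * (1 - p) * W (Suc j)\<bar> \<le> e * (W j + W (Suc j))"
  defines "Z \<equiv> \<Sum>j\<le>d. W j"
  shows "\<bar>(\<Sum>j\<le>d. W j * z ^ j) - (1 - p + p * z) ^ d * Z\<bar> \<le>
    2 * e * z ^ d * (z - 1) * ((1 - p + p * z) ^ d * Z)"
proof -
  define G where "G s = (\<Sum>j\<le>d. W j * s ^ j)" for s
  define G' where "G' s = (\<Sum>j<d. W (Suc j) * (real j + 1) * s ^ j)" for s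
  define u where "u s = 1 - p + p * s" for s
  have u1: "u s \<ge> 1" if "s \<ge> 1" for s
    using p that mult_left_mono[of 1 s p] by (simp add: u_def)
  have G': "(G has_real_derivative G' s) (at s)" for s
  proof -
    have "(G has_real_derivative (\<Sum>j\<le>d. W j * (real j * s ^ (j - 1)))) (at s)"
      unfolding G_def by (auto intro!: derivative_eq_intros sum.cong)
    also have "(\<Sum>j\<le>d. W j * (real j * s ^ (j - 1))) = G' s"
      unfolding G'_def by (subst lessThan_Suc_atMost[symmetric], subst sum.lessThan_Suc_shift)
        (auto simp: algebra_simps)
    finally show ?thesis .
  qed
  \<comment> \<open>The coefficients of s^j are the balance defects; the terms of degree
    \<open>d\<close> cancel, so that only \<open>j < d\<close> occurs.\<close>
  have ode: "u s * G' s - real d * p * G s =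
      - (\<Sum>j<d. ((real d - real j) * p * W j - (real j + 1) * (1 - p) * W (Suc j)) * s ^ j)" for s
  proof -
    have "(\<Sum>j<d. W (Suc j) * (real j + 1) * s ^ Suc j) = (\<Sum>j<Suc d. W j * real j * s ^ j)"
      by (subst sum.lessThan_Suc_shift) (auto simp: algebra_simps)
    also have "\<dots> = (\<Sum>j<d. W j * real j * s ^ j) + W d * real d * s ^ d" by simp
    finally have 1: "s * G' s = (\<Sum>j<d. W j * real j * s ^ j) + W d * real d * s ^ d"
      by (simp add: G'_def sum_distrib_left algebra_simps)
    have "u s * G' s = (1 - p) * G' s + p * (s * G' s)" by (simp add: u_def algebra_simps)
    moreover have "G s = (\<Sum>j<d. W j * s ^ j) + W d * s ^ d"
      by (simp add: G_def flip: lessThan_Suc_atMost)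
    ultimately have "u s * G' s - real d * p * G s = (1 - p) * G' s
        + p * (\<Sum>j<d. W j * real j * s ^ j) - real d * p * (\<Sum>j<d. W j * s ^ j)"
      unfolding 1 by (simp add: algebra_simps)
    also have "\<dots> = - (\<Sum>j<d. ((real d - real j) * p * W j - (real j + 1) * (1 - p) * W (Suc j)) * s ^ j)"
      unfolding G'_def sum_distrib_left sum.distrib[symmetric] sum_subtractf[symmetric]
        sum_negf[symmetric]
      by (intro sum.cong refl) (simp add: algebra_simps)
    finally show ?thesis .
  qed
  \<comment> \<open>The derivative of \<open>G / u ^ d\<close>, which would vanish identically for
    an exact binomial law.\<close>
  define H' where "H' s = (u s * G' s - real d * p * G s) / u s ^ Suc d" for s
  have H': "((\<lambda>s. G s / u s ^ d) has_real_derivative H' s) (at s)" if "s \<ge> 1" for s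
  proof -
    have us: "u s \<noteq> 0" using u1[OF that] by auto
    have "((\<lambda>s. u s ^ d) has_real_derivative real d * u s ^ (d - 1) * p) (at s)"
      unfolding u_def by (auto intro!: derivative_eq_intros)
    from DERIV_divide[OF G' this] have "((\<lambda>s. G s / u s ^ d) has_real_derivative
        (G' s * u s ^ d - G s * (real d * u s ^ (d - 1) * p)) / (u s ^ d * u s ^ d)) (at s)"
      using us by simp
    also have "(G' s * u s ^ d - G s * (real d * u s ^ (d - 1) * p)) / (u s ^ d * u s ^ d) = H' s"
      using us unfolding H'_def by (cases d) (simp_all add: field_simps)
    finally show ?thesis .
  qed
  have Z: "Z \<ge> 0" unfolding Z_def by (intro sum_nonneg W)
  have bound: "\<bar>H' s\<bar> \<le> 2 * e * Z * z ^ d" if s: "1 \<le> s" "s \<le> z" for s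
  proof -
    have "\<bar>u s * G' s - real d * p * G s\<bar> \<le> (\<Sum>j<d. e * (W j + W (Suc j)) * z ^ d)"
      unfolding ode abs_minus_cancel
    proof (rule order_trans[OF sum_abs sum_mono])
      fix j assume j: "j \<in> {..<d}"
      have "s ^ j \<le> z ^ d"
        using s j by (meson lessThan_iff less_imp_le order_trans power_increasing power_mono
            zero_le_one)
      then show "\<bar>((real d - real j) * p * W j - (real j + 1) * (1 - p) * W (Suc j)) * s ^ j\<bar>
          \<le> e * (W j + W (Suc j)) * z ^ d"
        unfolding abs_mult using bal[of j] j s W e by (intro mult_mono) auto
    qed
    also have "\<dots> = e * z ^ d * ((\<Sum>j<d. W j) + (\<Sum>j<d. W (Suc j)))"
      by (simp add: sum_distrib_left sum.distrib algebra_simps)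
    also have "\<dots> \<le> e * z ^ d * (Z + Z)"
    proof (intro mult_left_mono add_mono)
      show "(\<Sum>j<d. W j) \<le> Z" unfolding Z_def using W by (intro sum_mono2) auto
      have "(\<Sum>j<d. W (Suc j)) = (\<Sum>j\<in>Suc ` {..<d}. W j)" by (simp add: sum.reindex)
      also have "\<dots> \<le> Z" unfolding Z_def using W by (intro sum_mono2) auto
      finally show "(\<Sum>j<d. W (Suc j)) \<le> Z" .
    qed (use e z in auto)
    finally have *: "\<bar>u s * G' s - real d * p * G s\<bar> \<le> 2 * e * Z * z ^ d" by (simp add: algebra_simps)
    have "\<bar>H' s\<bar> = \<bar>u s * G' s - real d * p * G s\<bar> / u s ^ Suc d"
      using u1[OF s(1)] by (simp add: H'_def abs_mult)
    also have "\<dots> \<le> \<bar>u s * G' s - real d * p * G s\<bar> / 1"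
      using u1[OF s(1)] by (intro divide_left_mono one_le_power) auto
    finally show ?thesis using * by simp
  qed
  have "\<bar>G z / u z ^ d - G 1 / u 1 ^ d\<bar> \<le> 2 * e * Z * z ^ d * \<bar>z - 1\<bar>"
  proof -
    have "norm (G z / u z ^ d - G 1 / u 1 ^ d) \<le> 2 * e * Z * z ^ d * norm (z - 1)"
      by (rule field_differentiable_bound[where S = "{1..z}" and f' = H'])
         (use H' bound z in \<open>auto intro: has_field_derivative_at_within\<close>)
    then show ?thesis by simp
  qed
  then have "\<bar>G z / u z ^ d - Z\<bar> \<le> 2 * e * Z * z ^ d * (z - 1)"
    using z by (simp add: u_def G_def Z_def)
  then have "u z ^ d * \<bar>G z / u z ^ d - Z\<bar> \<le> u z ^ d * (2 * e * Z * z ^ d * (z - 1))"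
    using u1[OF z] by (intro mult_left_mono) auto
  moreover have "u z ^ d * \<bar>G z / u z ^ d - Z\<bar> = \<bar>G z - u z ^ d * Z\<bar>"
  proof -
    have "u z ^ d > 0" using u1[OF z] by simp
    then have "u z ^ d * \<bar>G z / u z ^ d - Z\<bar> = \<bar>u z ^ d * (G z / u z ^ d - Z)\<bar>"
      by (simp add: abs_mult)
    also have "u z ^ d * (G z / u z ^ d - Z) = G z - u z ^ d * Z"
      using u1[OF z] by (simp add: field_simps)
    finally show ?thesis .
  qed
  ultimately show ?thesis by (simp add: G_def u_def algebra_simps)
qed

text \<open>The constant of \<open>balanced_mean\<close> for the counting error \<open>C\<close> of
  \<open>card_inner_bounds\<close>: 2 d^2 + 4 d from the blocked pairs in
  \<open>card_switchable\<close> and 2 d from the edges at \<open>v\<close>.\<close>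

definition mean_const :: "nat \<Rightarrow> real \<Rightarrow> real" where
  "mean_const d q = (let C = 2 * (real d)\<^sup>2 + 6 * real d in
     (2 * C + 2 / q\<^sup>2 * (2 * C\<^sup>2 / q\<^sup>2 + 2 + 2 * C)) / q\<^sup>2)"

lemma mean_const_nonneg: "0 \<le> mean_const d q"
  unfolding mean_const_def Let_def by (intro divide_nonneg_nonneg add_nonneg_nonneg mult_nonneg_nonneg) auto

section \<open>Graphs with a prescribed number of neighbours of v in S\<close>

context
  fixes d n k :: nat and S B :: "nat set" and v :: nat and q m0 :: real
  assumes S: "S \<subseteq> {..<n}" and k: "card S = k" and v: "v < n" "v \<notin> S"
    and q: "0 < q" "q < 1" and d: "1 \<le> d"
  defines "B \<equiv> {..<n} - S - {v}"
begin

definition fibre :: "nat \<Rightarrow> nat set set set" where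
  "fibre j = {E \<in> regular_graphs d n. link v S E = j}"

definition fibre_weight :: "nat \<Rightarrow> real" where
  "fibre_weight j = (\<Sum>E\<in>fibre j. q ^ cut_size S E)"

lemma finite_B: "finite S" "finite B"
  using S finite_subset by (auto simp: B_def)

lemma sum_fibre: "(\<Sum>E\<in>regular_graphs d n. if link v S E = j then f E else 0) = (\<Sum>E\<in>fibre j. f E :: real)"
  unfolding fibre_def by (simp add: sum.inter_filter finite_regular_graphs)

text \<open>Switchings that avoid \<open>v\<close> stay in the fibre and raise the cut by 2; this
  produces the factor \<open>q\<^sup>2\<close> and the shifted argument of \<open>\<phi>\<close>.
  The reverse moves take two edges between \<open>S\<close> and \<open>B\<close>.\<close>

lemma balance_inner:
  fixes \<phi> :: "real \<Rightarrow> real"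
  shows "(\<Sum>E\<in>fibre j. q ^ cut_size S E * (q\<^sup>2 * \<phi> (real (cut_size S E) + 2) *
            real (card {t \<in> S \<times> S \<times> B \<times> B. switchable t E}))) =
         (\<Sum>E\<in>fibre j. q ^ cut_size S E * (\<phi> (real (cut_size S E)) *
            real (card {t \<in> S \<times> B \<times> S \<times> B. switchable t E})))"
proof -
  let ?R = "regular_graphs d n" and ?T = "S \<times> S \<times> B \<times> B"
  \<comment> \<open>Cutting off outside the fibre lets \<open>sum_switch\<close>, which sums over
    all regular graphs, apply.\<close>
  define F where "F E = (if link v S E = j then q ^ cut_size S E * \<phi> (real (cut_size S E)) else 0)" for E
  have "(\<Sum>E\<in>?R. \<Sum>t\<in>{t \<in> ?T. switchable t E}. F (switch t E)) =
        (\<Sum>E\<in>?R. if link v S E = j then q ^ cut_size S E * (q\<^sup>2 * \<phi> (real (cut_size S E) + 2) *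
            real (card {t \<in> ?T. switchable t E})) else 0)"
  proof (rule sum.cong[OF refl])
    fix E assume E: "E \<in> ?R"
    have "F (switch t E) = (if link v S E = j then q ^ cut_size S E * (q\<^sup>2 * \<phi> (real (cut_size S E) + 2)) else 0)"
      if "t \<in> {t \<in> ?T. switchable t E}" for t
    proof -
      obtain a a' b b' where t: "t = (a, a', b, b')" by (cases t) auto
      have mem: "switchable (a, a', b, b') E" "a \<in> S" "a' \<in> S" "b \<notin> S" "b' \<notin> S" "b \<noteq> v" "b' \<noteq> v"
        using that unfolding t by (auto simp: B_def)
      show ?thesis
        unfolding t F_def cut_switch_inner[OF E mem v(2)] by (simp add: power2_eq_square add.commute)
    qed
    then show "(\<Sum>t\<in>{t \<in> ?T. switchable t E}. F (switch t E)) =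
        (if link v S E = j then q ^ cut_size S E * (q\<^sup>2 * \<phi> (real (cut_size S E) + 2) *
            real (card {t \<in> ?T. switchable t E})) else 0)"
      by simp
  qed
  also have "(\<Sum>E\<in>?R. \<Sum>t\<in>{t \<in> ?T. switchable t E}. F (switch t E)) =
      (\<Sum>E\<in>?R. F E * card {t \<in> S \<times> B \<times> S \<times> B. switchable t E})"
    unfolding card_switchable_swap_middle[symmetric]
    by (rule sum_switch) (use finite_B in auto)
  also have "\<dots> = (\<Sum>E\<in>?R. if link v S E = j then q ^ cut_size S E * (\<phi> (real (cut_size S E)) *
            real (card {t \<in> S \<times> B \<times> S \<times> B. switchable t E})) else 0)"
    by (intro sum.cong refl) (simp add: F_def)
  finally show ?thesis by (simp only: sum_fibre)
qed

text \<open>Switchings at \<open>v\<close> change the fibre but not the cut, so no power of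
  \<open>q\<close> appears; they relate the weights of neighbouring fibres.\<close>

lemma balance_link:
  "(\<Sum>E\<in>fibre j. q ^ cut_size S E * real (card {t \<in> {v} \<times> B \<times> S \<times> B. switchable t E})) =
   (\<Sum>E\<in>fibre (Suc j). q ^ cut_size S E * real (card {t \<in> {v} \<times> S \<times> B \<times> B. switchable t E}))"
proof -
  let ?R = "regular_graphs d n" and ?T = "{v} \<times> B \<times> S \<times> B"
  define F where "F E = (if link v S E = Suc j then q ^ cut_size S E else 0)" for E
  have "(\<Sum>E\<in>?R. \<Sum>t\<in>{t \<in> ?T. switchable t E}. F (switch t E)) =
        (\<Sum>E\<in>?R. if link v S E = j then q ^ cut_size S E * real (card {t \<in> ?T. switchable t E}) else 0)"
  proof (rule sum.cong[OF refl])
    fix E assume E: "E \<in> ?R"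
    have "F (switch t E) = (if link v S E = j then q ^ cut_size S E else 0)"
      if "t \<in> {t \<in> ?T. switchable t E}" for t
    proof -
      obtain v' u x y where "t = (v', u, x, y)" by (cases t) auto
      then have t: "t = (v, u, x, y)" using that by simp
      have mem: "switchable (v, u, x, y) E" "v \<notin> S" "u \<notin> S" "x \<in> S" "y \<notin> S"
        using that v unfolding t by (auto simp: B_def)
      show ?thesis unfolding t F_def cut_switch_link[OF E mem] by simp
    qed
    then show "(\<Sum>t\<in>{t \<in> ?T. switchable t E}. F (switch t E)) =
        (if link v S E = j then q ^ cut_size S E * real (card {t \<in> ?T. switchable t E}) else 0)"
      by simp
  qed
  also have "(\<Sum>E\<in>?R. \<Sum>t\<in>{t \<in> ?T. switchable t E}. F (switch t E)) =
      (\<Sum>E\<in>?R. F E * card {t \<in> {v} \<times> S \<times> B \<times> B. switchable t E})"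
    unfolding card_switchable_swap_middle[symmetric]
    by (rule sum_switch) (use finite_B in auto)
  also have "\<dots> = (\<Sum>E\<in>?R. if link v S E = Suc j then q ^ cut_size S E *
            real (card {t \<in> {v} \<times> S \<times> B \<times> B. switchable t E}) else 0)"
    by (intro sum.cong refl) (simp add: F_def)
  finally show ?thesis by (simp only: sum_fibre)
qed

lemma k_less: "k < n"
  using psubset_card_mono[of "{..<n}" S] S v k by auto

lemma fibre_arcs:
  assumes "E \<in> fibre j"
  shows "j \<le> d" "real (card (arcs {v} B E)) = real d - real j"
    "real (card (arcs {v} S E)) = real j"
    "real (card (arcs S B E)) = real (cut_size S E) - real j"
    "real (card (arcs S S E)) = real d * real k - real (cut_size S E)"
    "real (card (arcs B B E)) = real d * (real n - real k) - real (cut_size S E) - 2 * (real d - real j)"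
    "real (cut_size S E) \<le> real d * (real n - real k)" "real (cut_size S E) \<le> real d * real k"
    "real j \<le> real (cut_size S E)"
proof -
  have E: "E \<in> regular_graphs d n" and j: "link v S E = j" using assms by (auto simp: fibre_def)
  show "j \<le> d" using link_le[OF E S k v] j by simp
  show "real (card (arcs {v} B E)) = real d - real j"
    using arcs_v_B[OF E S k v] j unfolding B_def by linarith
  show "real (card (arcs {v} S E)) = real j"
    using j by (simp add: link_eq_arcs)
  show 1: "real (card (arcs S B E)) = real (cut_size S E) - real j"
    using arcs_S_B[OF E S k v] j unfolding B_def by linarith
  show "real j \<le> real (cut_size S E)" using 1 by (metis diff_ge_0_iff_ge of_nat_0_le_iff)
  have "real (card (arcs S S E) + cut_size S E) = real (d * k)"
    using arcs_S_S[OF E S k v] by simp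
  then show 2: "real (card (arcs S S E)) = real d * real k - real (cut_size S E)" by simp
  show "real (cut_size S E) \<le> real d * real k" using 2 by (metis diff_ge_0_iff_ge of_nat_0_le_iff)
  have "real (card (arcs B B E) + cut_size S E + 2 * d) = real (d * (n - k) + 2 * j)"
    using arcs_B_B[OF E S k v] j unfolding B_def by simp
  then show "real (card (arcs B B E)) = real d * (real n - real k) - real (cut_size S E) - 2 * (real d - real j)"
    using k_less by (simp add: of_nat_diff)
  have "card (arcs (- S) S E) \<le> d * (n - k)"
    using card_arcs_split[OF E Diff_subset[of "{..<n}" S] S] S k finite_B
    by (simp add: arcs_inside[OF E] card_Diff_subset)
  then have "real (cut_size S E) \<le> real (d * (n - k))"
    unfolding cut_size_def arcs_swap[of S "- S"] of_nat_le_iff .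
  then show "real (cut_size S E) \<le> real d * (real n - real k)"
    using k_less by (simp add: of_nat_diff)
qed

text \<open>The arc counts of \<open>fibre_arcs\<close> are inserted into
  \<open>card_switchable\<close>; besides the blocked pairs, the deviation comes from the edges at
  \<open>v\<close>, at most \<open>d\<close> in number, and is linear in the size of the
  graph.\<close>

lemma card_inner_bounds:
  assumes "E \<in> fibre j"
  defines "C \<equiv> 2 * (real d)\<^sup>2 + 6 * real d" and "m \<equiv> real (cut_size S E)"
    and "x \<equiv> real d * real k" and "y \<equiv> real d * (real n - real k)"
  shows "\<bar>real (card {t \<in> S \<times> S \<times> B \<times> B. switchable t E}) - (x - m) * (y - m)\<bar> \<le> C * (x + y)"
    and "\<bar>real (card {t \<in> S \<times> B \<times> S \<times> B. switchable t E}) - m\<^sup>2\<bar> \<le> C * (x + y)"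
proof -
  have E: "E \<in> regular_graphs d n" using assms by (auto simp: fibre_def)
  note A = fibre_arcs[OF assms(1), folded m_def x_def y_def]
  have j: "real j \<le> real d" "0 \<le> real j" using A(1) by auto
  have m: "0 \<le> m" by (simp add: m_def)
  define c where "c = 2 * ((real d)\<^sup>2 + 2 * real d)"
  have c: "0 \<le> c" by (simp add: c_def)
  have C: "C = c + 2 * real d" by (simp add: C_def c_def)
  have d0: "0 \<le> real d" by simp
  define N1 where "N1 = real (card {t \<in> S \<times> S \<times> B \<times> B. switchable t E})"
  have N1: "N1 \<le> (x - m) * (y - m - 2 * (real d - real j))"
    "(x - m) * (y - m - 2 * (real d - real j)) - c * (x - m) \<le> N1"
    using card_switchable[OF E, of S S B B] unfolding N1_def c_def A(5,6) by simp_all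
  have "\<bar>N1 - (x - m) * (y - m)\<bar> \<le> C * (x - m)"
  proof (rule abs_leI)
    have "(x - m) * (2 * (real d - real j)) \<ge> 0" using j A by (intro mult_nonneg_nonneg) auto
    moreover have "C * (x - m) \<ge> 0" using A c C by (intro mult_nonneg_nonneg) auto
    ultimately show "N1 - (x - m) * (y - m) \<le> C * (x - m)"
      using N1(1) by (simp add: algebra_simps)
    have "(x - m) * (2 * (real d - real j)) \<le> (x - m) * (2 * real d)"
      using j A by (intro mult_left_mono) auto
    then show "- (N1 - (x - m) * (y - m)) \<le> C * (x - m)"
      using N1(2) by (simp add: algebra_simps C)
  qed
  also have "\<dots> \<le> C * (x + y)" using A m c C by (intro mult_left_mono) auto
  finally show "\<bar>real (card {t \<in> S \<times> S \<times> B \<times> B. switchable t E}) - (x - m) * (y - m)\<bar> \<le> C * (x + y)"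
    unfolding N1_def .
  define N2 where "N2 = real (card {t \<in> S \<times> B \<times> S \<times> B. switchable t E})"
  have N2: "N2 \<le> (m - real j) * (m - real j)"
    "(m - real j) * (m - real j) - c * (m - real j) \<le> N2"
    using card_switchable[OF E, of S B S B] unfolding N2_def c_def A(4) by simp_all
  have "\<bar>N2 - m\<^sup>2\<bar> \<le> C * m"
  proof (rule abs_leI)
    have "(m - real j) * (m - real j) \<le> m * m" using j A by (intro mult_mono) auto
    moreover have "0 \<le> C * m" using m c C by simp
    ultimately show "N2 - m\<^sup>2 \<le> C * m" using N2(1) by (simp add: power2_eq_square)
    have "m * real j \<le> m * real d" "0 \<le> c * real j" using j m c by (auto intro: mult_left_mono)
    moreover have "(m - real j) * (m - real j) - c * (m - real j) =
        m * m - 2 * (m * real j) - c * m + c * real j + real j * real j"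
      by (simp add: algebra_simps)
    moreover have "0 \<le> real j * real j" by simp
    moreover have "C * m = c * m + 2 * (m * real d)" by (simp add: C algebra_simps)
    ultimately show "- (N2 - m\<^sup>2) \<le> C * m"
      using N2(2) unfolding power2_eq_square by linarith
  qed
  also have "\<dots> \<le> C * (x + y)" using A m c C by (intro mult_left_mono) auto
  finally show "\<bar>real (card {t \<in> S \<times> B \<times> S \<times> B. switchable t E}) - m\<^sup>2\<bar> \<le> C * (x + y)"
    unfolding N2_def .
qed

text \<open>The first arc starts at \<open>v\<close>, so there are at most \<open>d\<close> choices
  for it and the loss in \<open>card_switchable\<close> stays bounded.\<close>

lemma card_link_bounds:
  assumes "E \<in> fibre j"
  defines "C \<equiv> real d * (2 * (real d)\<^sup>2 + 6 * real d)" and "m \<equiv> real (cut_size S E)"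
    and "y \<equiv> real d * (real n - real k)"
  shows "\<bar>real (card {t \<in> {v} \<times> B \<times> S \<times> B. switchable t E}) - (real d - real j) * m\<bar> \<le> C"
    and "\<bar>real (card {t \<in> {v} \<times> S \<times> B \<times> B. switchable t E}) - real j * (y - m)\<bar> \<le> C"
proof -
  have E: "E \<in> regular_graphs d n" using assms by (auto simp: fibre_def)
  note A = fibre_arcs[OF assms(1), folded m_def y_def]
  have j: "real j \<le> real d" "0 \<le> real j" using A(1) by auto
  define c where "c = 2 * ((real d)\<^sup>2 + 2 * real d)"
  have c: "0 \<le> c" by (simp add: c_def)
  have C: "C = real d * (c + 2 * real d)" by (simp add: C_def c_def)
  define N3 where "N3 = real (card {t \<in> {v} \<times> B \<times> S \<times> B. switchable t E})"
  have N3: "N3 \<le> (real d - real j) * (m - real j)"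
    "(real d - real j) * (m - real j) - c * (real d - real j) \<le> N3"
    using card_switchable[OF E, of "{v}" B S B] unfolding N3_def c_def A(2,4) by simp_all
  show "\<bar>N3 - (real d - real j) * m\<bar> \<le> C"
  proof (rule abs_leI)
    have "0 \<le> (real d - real j) * real j" "0 \<le> C" using j c C by auto
    then show "N3 - (real d - real j) * m \<le> C" using N3(1) by (simp add: algebra_simps)
    have "(real d - real j) * (real j + c) \<le> real d * (2 * real d + c)"
      using j c by (intro mult_mono) auto
    then show "- (N3 - (real d - real j) * m) \<le> C" using N3(2) by (simp add: algebra_simps C)
  qed
  define N4 where "N4 = real (card {t \<in> {v} \<times> S \<times> B \<times> B. switchable t E})"
  have N4: "N4 \<le> real j * (y - m - 2 * (real d - real j))"
    "real j * (y - m - 2 * (real d - real j)) - c * real j \<le> N4"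
    using card_switchable[OF E, of "{v}" S B B] unfolding N4_def c_def A(3,6) by simp_all
  show "\<bar>N4 - real j * (y - m)\<bar> \<le> C"
  proof (rule abs_leI)
    have "0 \<le> (real d - real j) * real j" "0 \<le> C" using j c C by auto
    then show "N4 - real j * (y - m) \<le> C" using N4(1) by (simp add: algebra_simps)
    have "real j * (2 * (real d - real j) + c) \<le> real d * (2 * real d + c)"
      using j c by (intro mult_mono) auto
    then show "- (N4 - real j * (y - m)) \<le> C" using N4(2) by (simp add: algebra_simps C)
  qed
qed

context
  assumes m0: "0 \<le> m0" "m0 \<le> real d * (real n - real k)"
    "q\<^sup>2 * (real d * real k - m0) * (real d * (real n - real k) - m0) = m0\<^sup>2"
begin

text \<open>The centre \<open>m0\<close> and the constant are the same for all fibres, which allows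
  neighbouring fibres to be compared through a common mean.\<close>

lemma fibre_mean:
  "\<bar>\<Sum>E\<in>fibre j. q ^ cut_size S E * (real (cut_size S E) - m0)\<bar> \<le> mean_const d q * fibre_weight j"
  unfolding mean_const_def Let_def fibre_weight_def
proof (rule balanced_mean)
  show "(\<Sum>E\<in>fibre j. q ^ cut_size S E * (q\<^sup>2 * \<phi> (real (cut_size S E) + 2) *
            real (card {t \<in> S \<times> S \<times> B \<times> B. switchable t E}))) =
         (\<Sum>E\<in>fibre j. q ^ cut_size S E * (\<phi> (real (cut_size S E)) *
            real (card {t \<in> S \<times> B \<times> S \<times> B. switchable t E})))" for \<phi>
    by (rule balance_inner)
  show "q\<^sup>2 * (real d * real k - m0) * (real d * (real n - real k) - m0) = m0\<^sup>2" by fact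
  show "1 \<le> real d * real k + real d * (real n - real k)"
    using d k_less by (simp add: algebra_simps flip: of_nat_mult)
qed (use q m0 k_less fibre_arcs card_inner_bounds in \<open>auto simp: algebra_simps\<close>)

text \<open>Replacing the cut by its mean in the counts of \<open>card_link_bounds\<close> turns
  \<open>balance_link\<close> into the recursion for the weights of a binomial law with success
  probability \<open>m0 / y\<close>.\<close>

lemma fibre_weight_balance:
  defines "e \<equiv> real d * (2 * (real d)\<^sup>2 + 6 * real d) + real d * mean_const d q"
    and "y \<equiv> real d * (real n - real k)"
  assumes j: "j < d"
  shows "\<bar>(real d - real j) * m0 * fibre_weight j - (real j + 1) * (y - m0) * fibre_weight (Suc j)\<bar>
    \<le> e * (fibre_weight j + fibre_weight (Suc j))"
proof -
  define c where "c = real d * (2 * (real d)\<^sup>2 + 6 * real d)"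
  let ?w = "\<lambda>E. q ^ cut_size S E"
  define N3 where "N3 E = real (card {t \<in> {v} \<times> B \<times> S \<times> B. switchable t E})" for E
  define N4 where "N4 E = real (card {t \<in> {v} \<times> S \<times> B \<times> B. switchable t E})" for E
  have w: "0 \<le> ?w E" for E using q by simp
  have 1: "\<bar>(\<Sum>E\<in>fibre j. ?w E * N3 E) - (real d - real j) * (\<Sum>E\<in>fibre j. ?w E * real (cut_size S E))\<bar>
      \<le> c * fibre_weight j"
  proof -
    have "(\<Sum>E\<in>fibre j. ?w E * N3 E) - (real d - real j) * (\<Sum>E\<in>fibre j. ?w E * real (cut_size S E)) =
        (\<Sum>E\<in>fibre j. ?w E * (N3 E - (real d - real j) * real (cut_size S E)))"
      unfolding sum_distrib_left sum_subtractf[symmetric] by (intro sum.cong refl) (simp add: algebra_simps)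
    also have "\<bar>\<dots>\<bar> \<le> (\<Sum>E\<in>fibre j. ?w E * c)"
      using card_link_bounds(1) w unfolding c_def N3_def
      by (intro order_trans[OF sum_abs] sum_mono) (simp add: abs_mult mult_left_mono)
    finally show ?thesis by (simp add: fibre_weight_def sum_distrib_left mult.commute)
  qed
  have 2: "\<bar>(\<Sum>E\<in>fibre (Suc j). ?w E * N4 E) - (real j + 1) * (\<Sum>E\<in>fibre (Suc j). ?w E * (y - real (cut_size S E)))\<bar>
      \<le> c * fibre_weight (Suc j)"
  proof -
    have "(\<Sum>E\<in>fibre (Suc j). ?w E * N4 E) - (real j + 1) * (\<Sum>E\<in>fibre (Suc j). ?w E * (y - real (cut_size S E))) =
        (\<Sum>E\<in>fibre (Suc j). ?w E * (N4 E - real (Suc j) * (y - real (cut_size S E))))"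
      unfolding sum_distrib_left sum_subtractf[symmetric] by (intro sum.cong refl) (simp add: algebra_simps)
    also have "\<bar>\<dots>\<bar> \<le> (\<Sum>E\<in>fibre (Suc j). ?w E * c)"
      using card_link_bounds(2) w unfolding c_def N4_def y_def
      by (intro order_trans[OF sum_abs] sum_mono) (simp add: abs_mult mult_left_mono del: of_nat_Suc)
    finally show ?thesis by (simp add: fibre_weight_def sum_distrib_left mult.commute)
  qed
  have bal: "(\<Sum>E\<in>fibre j. ?w E * N3 E) = (\<Sum>E\<in>fibre (Suc j). ?w E * N4 E)"
    unfolding N3_def N4_def by (rule balance_link)
  define D where "D i = (\<Sum>E\<in>fibre i. ?w E * (real (cut_size S E) - m0))" for i
  have D: "\<bar>D i\<bar> \<le> mean_const d q * fibre_weight i" for i unfolding D_def by (rule fibre_mean)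
  have 3: "(\<Sum>E\<in>fibre i. ?w E * real (cut_size S E)) = m0 * fibre_weight i + D i" for i
    unfolding D_def fibre_weight_def sum_distrib_left sum.distrib[symmetric]
    by (intro sum.cong refl) (simp add: algebra_simps)
  have 4: "(\<Sum>E\<in>fibre i. ?w E * (y - real (cut_size S E))) = (y - m0) * fibre_weight i - D i" for i
    unfolding D_def fibre_weight_def sum_distrib_left sum_subtractf[symmetric]
    by (intro sum.cong refl) (simp add: algebra_simps)
  have 5: "\<bar>(real d - real j) * D j\<bar> \<le> real d * (mean_const d q * fibre_weight j)"
    unfolding abs_mult using D[of j] j by (intro mult_mono) auto
  have 6: "\<bar>(real j + 1) * D (Suc j)\<bar> \<le> real d * (mean_const d q * fibre_weight (Suc j))"
    unfolding abs_mult using D[of "Suc j"] j by (intro mult_mono) auto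
  show ?thesis using 1 2 5 6 unfolding bal 3 4 e_def c_def[symmetric] by (simp add: algebra_simps)
qed

text \<open>Moving \<open>v\<close> into \<open>S\<close> multiplies the weight by q^(d - 2X). For X
  binomial with parameters \<open>d\<close> and \<open>p\<close> the mean of this factor is q^d (1 -
  p + p / q^2)^d, which is \<open>\<rho>\<close>.\<close>

lemma cut_insert_ratio:
  defines "e \<equiv> real d * (2 * (real d)\<^sup>2 + 6 * real d) + real d * mean_const d q"
    and "p \<equiv> m0 / (real d * (real n - real k))"
  defines "\<rho> \<equiv> (q * (1 - p) + p / q) ^ d"
  shows "\<bar>(\<Sum>E\<in>regular_graphs d n. q ^ cut_size (insert v S) E) - \<rho> * (\<Sum>E\<in>regular_graphs d n. q ^ cut_size S E)\<bar>
    \<le> 2 * (e / (real n - real k)) * (1 / q\<^sup>2) ^ d * (1 / q\<^sup>2 - 1) * (\<rho> * (\<Sum>E\<in>regular_graphs d n. q ^ cut_size S E))"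
proof -
  let ?R = "regular_graphs d n"
  define y where "y = real d * (real n - real k)"
  \<comment> \<open>The generating function is evaluated where z^X = q^(-2X).\<close>
  define z where "z = 1 / q\<^sup>2"
  have y: "y > 0" using d k_less by (simp add: y_def)
  have split: "(\<Sum>E\<in>?R. f E) = (\<Sum>j\<le>d. \<Sum>E\<in>fibre j. f E)" for f :: "nat set set \<Rightarrow> real"
    unfolding fibre_def
    by (rule sum.group[symmetric]) (auto simp: finite_regular_graphs link_le[OF _ S k v])
  have Z: "(\<Sum>E\<in>?R. q ^ cut_size S E) = (\<Sum>j\<le>d. fibre_weight j)"
    by (simp add: split fibre_weight_def)
  have Y: "(\<Sum>E\<in>?R. q ^ cut_size (insert v S) E) = q ^ d * (\<Sum>j\<le>d. fibre_weight j * z ^ j)"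
    unfolding split fibre_weight_def sum_distrib_left sum_distrib_right
  proof (intro sum.cong refl)
    fix j E assume "E \<in> fibre j"
    then have E: "E \<in> ?R" "link v S E = j" by (auto simp: fibre_def)
    have "cut_size (insert v S) E + 2 * j = cut_size S E + d" using cut_insert[OF E(1) S k v] E by simp
    then have "q ^ cut_size (insert v S) E * (q\<^sup>2) ^ j = q ^ cut_size S E * q ^ d"
      by (metis power_add power_mult)
    then have "q ^ cut_size (insert v S) E = q ^ cut_size S E * q ^ d / (q\<^sup>2) ^ j" using q by (simp add: field_simps)
    then show "q ^ cut_size (insert v S) E = q ^ d * (q ^ cut_size S E * z ^ j)"
      by (simp add: z_def power_one_over)
  qed
  have z1: "z \<ge> 1" unfolding z_def using q by (simp add: power_le_one)
  note mc = mean_const_nonneg[of d q]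
  have "\<bar>(\<Sum>j\<le>d. fibre_weight j * z ^ j) - (1 - p + p * z) ^ d * (\<Sum>j\<le>d. fibre_weight j)\<bar> \<le>
    2 * (e / y) * z ^ d * (z - 1) * ((1 - p + p * z) ^ d * (\<Sum>j\<le>d. fibre_weight j))"
  proof (rule near_binomial_pgf)
    show "0 \<le> fibre_weight j" for j unfolding fibre_weight_def using q by (intro sum_nonneg) simp
    show "0 \<le> p" "p \<le> 1" using m0 y by (auto simp: p_def y_def)
    show "0 \<le> e / y" using y mc by (simp add: e_def)
    fix j assume j: "j < d"
    have "(real d - real j) * p * fibre_weight j - (real j + 1) * (1 - p) * fibre_weight (Suc j) =
        ((real d - real j) * m0 * fibre_weight j - (real j + 1) * (y - m0) * fibre_weight (Suc j)) / y"
      using y unfolding p_def y_def[symmetric] by (simp add: field_simps)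
    also have "\<bar>\<dots>\<bar> \<le> e * (fibre_weight j + fibre_weight (Suc j)) / y"
      using fibre_weight_balance[OF j] y unfolding e_def y_def[symmetric]
      by (simp add: divide_right_mono)
    finally show "\<bar>(real d - real j) * p * fibre_weight j - (real j + 1) * (1 - p) * fibre_weight (Suc j)\<bar>
        \<le> e / y * (fibre_weight j + fibre_weight (Suc j))" by simp
  qed (rule z1)
  then have "q ^ d * \<bar>(\<Sum>j\<le>d. fibre_weight j * z ^ j) - (1 - p + p * z) ^ d * (\<Sum>j\<le>d. fibre_weight j)\<bar> \<le>
    q ^ d * (2 * (e / y) * z ^ d * (z - 1) * ((1 - p + p * z) ^ d * (\<Sum>j\<le>d. fibre_weight j)))"
    using q by (intro mult_left_mono) auto
  moreover have \<rho>: "q ^ d * (1 - p + p * z) ^ d = \<rho>"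
    unfolding \<rho>_def z_def power_mult_distrib[symmetric]
    by (rule arg_cong[where f = "\<lambda>x. x ^ d"]) (use q in \<open>simp add: field_simps power2_eq_square\<close>)
  moreover have "q ^ d * \<bar>(\<Sum>j\<le>d. fibre_weight j * z ^ j) - (1 - p + p * z) ^ d * (\<Sum>j\<le>d. fibre_weight j)\<bar> =
      \<bar>q ^ d * (\<Sum>j\<le>d. fibre_weight j * z ^ j) - q ^ d * (1 - p + p * z) ^ d * (\<Sum>j\<le>d. fibre_weight j)\<bar>"
  proof -
    have "q ^ d * \<bar>x - y\<bar> = \<bar>q ^ d * x - q ^ d * y\<bar>" for x y
      using q by (simp add: abs_mult flip: right_diff_distrib)
    then show ?thesis by (simp add: mult.assoc)
  qed
  ultimately have "\<bar>(\<Sum>E\<in>?R. q ^ cut_size (insert v S) E) - \<rho> * (\<Sum>E\<in>?R. q ^ cut_size S E)\<bar>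
    \<le> 2 * (e / y) * z ^ d * (z - 1) * (\<rho> * (\<Sum>E\<in>?R. q ^ cut_size S E))"
    unfolding Z Y \<rho>[symmetric] by (simp add: mult.assoc mult.left_commute)
  also have "\<dots> \<le> 2 * (e / (real n - real k)) * z ^ d * (z - 1) * (\<rho> * (\<Sum>E\<in>?R. q ^ cut_size S E))"
  proof (intro mult_right_mono mult_left_mono divide_left_mono)
    show "real n - real k \<le> y" unfolding y_def using d k_less
      by (simp add: mult_le_cancel_right1)
    have "0 \<le> p" "p \<le> 1" using m0 y by (auto simp: p_def y_def)
    then show "0 \<le> \<rho> * (\<Sum>E\<in>?R. q ^ cut_size S E)"
      unfolding \<rho>_def using q by (intro mult_nonneg_nonneg sum_nonneg zero_le_power) auto
    show "0 \<le> e" using mc by (simp add: e_def)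
  qed (use q y z1 k_less in auto)
  finally show ?thesis by (simp add: z_def)
qed

end

end

text \<open>The constant is uniform in \<open>n\<close>, \<open>k\<close>, \<open>S\<close> and
  \<open>v\<close>. Here \<open>m0\<close> is still any solution of the quadratic equation in the
  right range; \<open>crossing\<close> will provide one.\<close>

lemma cut_ratio:
  assumes q: "0 < q" "q < 1" and d: "1 \<le> (d::nat)"
  obtains K where "K \<ge> 0" "\<And>n k S v m0. \<lbrakk>S \<subseteq> {..<n}; card S = k; v < n; v \<notin> S; 0 \<le> m0;
     m0 \<le> real d * (real n - real k);
     q\<^sup>2 * (real d * real k - m0) * (real d * (real n - real k) - m0) = m0\<^sup>2\<rbrakk> \<Longrightarrow>
     \<bar>(\<Sum>E\<in>regular_graphs d n. q ^ cut_size (insert v S) E) -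
       (q * (1 - m0 / (real d * (real n - real k))) + m0 / (real d * (real n - real k)) / q) ^ d *
         (\<Sum>E\<in>regular_graphs d n. q ^ cut_size S E)\<bar>
     \<le> K / (real n - real k) *
       ((q * (1 - m0 / (real d * (real n - real k))) + m0 / (real d * (real n - real k)) / q) ^ d *
         (\<Sum>E\<in>regular_graphs d n. q ^ cut_size S E))"
proof -
  define e where "e = real d * (2 * (real d)\<^sup>2 + 6 * real d) + real d * mean_const d q"
  have "e \<ge> 0" unfolding e_def using mean_const_nonneg[of d q] by simp
  moreover have "1 / q\<^sup>2 - 1 \<ge> 0" using q by (simp add: power_le_one)
  ultimately have "2 * e * (1 / q\<^sup>2) ^ d * (1 / q\<^sup>2 - 1) \<ge> 0" by simp
  then show ?thesis
    by (rule that) (use cut_insert_ratio[OF _ _ _ _ q d, folded e_def] in \<open>simp add: mult_ac\<close>)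
qed

section \<open>The free energy and its derivatives\<close>

text \<open>Times \<open>q\<close>, the square root of the discriminant of the quadratic that
  defines \<open>crossing\<close>.\<close>

definition disc_root :: "real \<Rightarrow> real \<Rightarrow> real" where
  "disc_root q a = sqrt (1 + (q\<^sup>2 - 1) * (1 - 2 * a)\<^sup>2)"

text \<open>The integrand of \<open>g_fun\<close> for \<open>q = exp (- 2 * \<beta>)\<close>, and by
  \<open>crossing_eq\<close> also the logarithm of the mean of q^(1 - 2Y) for Y Bernoulli with
  parameter \<open>crossing q a / (1 - a)\<close>.\<close>

definition slope :: "real \<Rightarrow> real \<Rightarrow> real" where
  "slope q a = ln ((q * (1 - 2 * a) + disc_root q a) / (2 * (1 - a)))"

text \<open>The root \<open>r\<close> of \<open>q\<^sup>2 (a - r) (1 - a - r) = r\<^sup>2\<close>: the typical cut has \<open>n d r\<close> edges.\<close>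

definition crossing :: "real \<Rightarrow> real \<Rightarrow> real" where
  "crossing q a = q * (disc_root q a - q) / (2 * (1 - q\<^sup>2))"

text \<open>\<open>g_fun\<close> without the reflection at 1/2; the two agree on the open unit
  interval because of \<open>slope_integral_sym\<close>.\<close>

definition slope_integral :: "real \<Rightarrow> real \<Rightarrow> real" where
  "slope_integral q a = integral {0..a} (slope q)"

context
  fixes q :: real
  assumes q: "0 < q" "q < 1"
begin

lemma q2: "0 < q\<^sup>2" "q\<^sup>2 < 1"
  using q by (auto simp: power_less_one_iff)

lemma root_arg: assumes "0 \<le> a" "a \<le> 1"
  shows "q\<^sup>2 \<le> 1 + (q\<^sup>2 - 1) * (1 - 2 * a)\<^sup>2" "1 + (q\<^sup>2 - 1) * (1 - 2 * a)\<^sup>2 \<le> 1"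
proof -
  have "(1 - 2 * a)\<^sup>2 \<le> 1" using assms by (simp add: abs_square_le_1)
  then have "(1 - q\<^sup>2) * (1 - 2 * a)\<^sup>2 \<le> (1 - q\<^sup>2) * 1" using q2 by (intro mult_left_mono) auto
  then show "q\<^sup>2 \<le> 1 + (q\<^sup>2 - 1) * (1 - 2 * a)\<^sup>2" by (simp add: algebra_simps)
  show "1 + (q\<^sup>2 - 1) * (1 - 2 * a)\<^sup>2 \<le> 1" using q2 by (simp add: mult_nonpos_nonneg)
qed

lemma root_bounds: assumes "0 \<le> a" "a \<le> 1"
  shows "q \<le> disc_root q a" "disc_root q a \<le> 1" "0 < disc_root q a"
    "(disc_root q a)\<^sup>2 = 1 + (q\<^sup>2 - 1) * (1 - 2 * a)\<^sup>2"
proof -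
  show 1: "q \<le> disc_root q a" unfolding disc_root_def using root_arg[OF assms] q by (intro real_le_rsqrt)
  show "disc_root q a \<le> 1" unfolding disc_root_def using root_arg[OF assms] by simp
  show "0 < disc_root q a" using 1 q by simp
  show "(disc_root q a)\<^sup>2 = 1 + (q\<^sup>2 - 1) * (1 - 2 * a)\<^sup>2"
    unfolding disc_root_def using root_arg[OF assms] q2 by (intro real_sqrt_pow2) linarith
qed

lemma root_sym: "disc_root q (1 - a) = disc_root q a"
  unfolding disc_root_def by (simp add: power2_eq_square algebra_simps)

text \<open>The second factor is the numerator of \<open>slope\<close> at \<open>1 - a\<close>, so
  this product is what makes \<open>slope\<close> odd about 1/2.\<close>

lemma root_prod: assumes "0 \<le> a" "a \<le> 1"
  shows "(q * (1 - 2 * a) + disc_root q a) * (disc_root q a - q * (1 - 2 * a)) = 4 * a * (1 - a)"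
proof -
  have "(q * (1 - 2 * a) + disc_root q a) * (disc_root q a - q * (1 - 2 * a)) = (disc_root q a)\<^sup>2 - q\<^sup>2 * (1 - 2 * a)\<^sup>2"
    by (simp add: power2_eq_square algebra_simps)
  then show ?thesis unfolding root_bounds(4)[OF assms] by (simp add: power2_eq_square algebra_simps)
qed

lemma numerator_pos: assumes "0 \<le> a" "a < 1"
  shows "0 < q * (1 - 2 * a) + disc_root q a"
proof -
  have "q * (2 * a - 1) < q * 1" using assms q by (intro mult_strict_left_mono) auto
  then show ?thesis using root_bounds(1)[of a] assms by (simp add: algebra_simps)
qed

lemma exp_slope: assumes "0 \<le> a" "a < 1"
  shows "exp (slope q a) = (q * (1 - 2 * a) + disc_root q a) / (2 * (1 - a))"
  unfolding slope_def using numerator_pos[OF assms] assms by (intro exp_ln divide_pos_pos) auto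

lemma slope_sym: assumes "0 < a" "a < 1"
  shows "slope q (1 - a) = - slope q a"
proof -
  let ?u = "q * (1 - 2 * a) + disc_root q a" and ?v = "disc_root q a - q * (1 - 2 * a)"
  have u: "0 < ?u" using numerator_pos[of a] assms by simp
  have "?u * ?v = 4 * a * (1 - a)" using root_prod[of a] assms by simp
  then have "?v / (2 * a) = inverse (?u / (2 * (1 - a)))"
    using u assms by (simp add: field_simps)
  moreover have "slope q (1 - a) = ln (?v / (2 * a))"
    unfolding slope_def root_sym by (simp add: algebra_simps)
  ultimately have "slope q (1 - a) = ln (inverse (?u / (2 * (1 - a))))" by (simp only:)
  also have "\<dots> = - ln (?u / (2 * (1 - a)))"
    by (rule ln_inverse)
  finally show ?thesis by (simp only: slope_def)
qed

lemma slope_ge: assumes "0 \<le> a" "a < 1"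
  shows "ln q \<le> slope q a"
proof -
  have "q * (2 * (1 - a)) \<le> q * (1 - 2 * a) + disc_root q a"
    using root_bounds(1)[of a] assms by (simp add: algebra_simps)
  then have "q \<le> (q * (1 - 2 * a) + disc_root q a) / (2 * (1 - a))" using assms by (simp add: field_simps)
  then show ?thesis unfolding slope_def using q by simp
qed

lemma slope_half: "slope q (1 / 2) = 0"
  using slope_sym[of "1 / 2"] by simp

lemma root_deriv: assumes "0 \<le> a" "a \<le> 1"
  shows "(disc_root q has_real_derivative 2 * (1 - q\<^sup>2) * (1 - 2 * a) / disc_root q a) (at a)"
proof -
  have pos: "0 < 1 + (q\<^sup>2 - 1) * (1 - 2 * a)\<^sup>2" using root_arg[OF assms] q2 by linarith
  have "((\<lambda>a. 1 + (q\<^sup>2 - 1) * (1 - 2 * a)\<^sup>2) has_real_derivative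
      (q\<^sup>2 - 1) * (2 * (1 - 2 * a) * (-2))) (at a)"
    by (auto intro!: derivative_eq_intros)
  from DERIV_chain'[OF this DERIV_real_sqrt[OF pos]]
  have "((\<lambda>a. sqrt (1 + (q\<^sup>2 - 1) * (1 - 2 * a)\<^sup>2)) has_real_derivative
      (q\<^sup>2 - 1) * (2 * (1 - 2 * a) * (-2)) * (inverse (disc_root q a) / 2)) (at a)"
    by (simp add: disc_root_def mult.commute)
  also have "(\<lambda>a. sqrt (1 + (q\<^sup>2 - 1) * (1 - 2 * a)\<^sup>2)) = disc_root q"
    by (auto simp: disc_root_def)
  also have "(q\<^sup>2 - 1) * (2 * (1 - 2 * a) * (-2)) * (inverse (disc_root q a) / 2) =
      2 * (1 - q\<^sup>2) * (1 - 2 * a) / disc_root q a"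
  proof -
    have "(x - 1) * (2 * y * (-2)) * (inverse r / 2) = 2 * (1 - x) * y / r" for x y r :: real
      by (cases "r = 0") (simp_all add: field_simps)
    then show ?thesis by (simp only:)
  qed
  finally show ?thesis .
qed

lemma slope_deriv: assumes "0 < a" "a < 1"
  shows "(slope q has_real_derivative (1 - q / disc_root q a) / (2 * a * (1 - a))) (at a)"
proof -
  define R where "R = disc_root q a"
  define s where "s = 1 - 2 * a"
  define u where "u = q * s + R"
  have R: "0 < R" "R\<^sup>2 = 1 + (q\<^sup>2 - 1) * s\<^sup>2"
    using root_bounds[of a] assms by (auto simp: R_def s_def)
  have u: "0 < u" using numerator_pos[of a] assms by (simp add: u_def s_def R_def)
  have "((\<lambda>a. q * (1 - 2 * a) + disc_root q a) has_real_derivative q * (-2) + 2 * (1 - q\<^sup>2) * s / R) (at a)"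
    using assms unfolding s_def R_def
    by (auto intro!: derivative_eq_intros root_deriv)
  moreover have "((\<lambda>a. 2 * (1 - a)) has_real_derivative (-2)) (at a)"
    by (auto intro!: derivative_eq_intros)
  ultimately have "((\<lambda>a. (q * (1 - 2 * a) + disc_root q a) / (2 * (1 - a))) has_real_derivative
      ((q * (-2) + 2 * (1 - q\<^sup>2) * s / R) * (2 * (1 - a)) - (q * (1 - 2 * a) + disc_root q a) * (-2)) /
      ((2 * (1 - a)) * (2 * (1 - a)))) (at a)"
    using assms by (intro DERIV_divide) auto
  then have "((\<lambda>a. ln ((q * (1 - 2 * a) + disc_root q a) / (2 * (1 - a)))) has_real_derivative
      (1 / ((q * (1 - 2 * a) + disc_root q a) / (2 * (1 - a)))) *
      (((q * (-2) + 2 * (1 - q\<^sup>2) * s / R) * (2 * (1 - a)) - (q * (1 - 2 * a) + disc_root q a) * (-2)) /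
      ((2 * (1 - a)) * (2 * (1 - a))))) (at a)"
    using u assms by (intro DERIV_chain'[OF _ DERIV_ln_divide]) (auto simp: u_def s_def R_def)
  also have "(\<lambda>a. ln ((q * (1 - 2 * a) + disc_root q a) / (2 * (1 - a)))) = slope q"
    by (auto simp: slope_def)
  also have "(1 / ((q * (1 - 2 * a) + disc_root q a) / (2 * (1 - a)))) *
      (((q * (-2) + 2 * (1 - q\<^sup>2) * s / R) * (2 * (1 - a)) - (q * (1 - 2 * a) + disc_root q a) * (-2)) /
      ((2 * (1 - a)) * (2 * (1 - a)))) = (1 - q / R) / (2 * a * (1 - a))"
  proof -
    have a: "2 * (1 - a) = 1 + s" "2 * a * (1 - a) = (1 - s) * (1 + s) / 2"
      "q * (1 - 2 * a) + disc_root q a = u"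
      by (auto simp: s_def u_def R_def algebra_simps)
    have s: "1 + s > 0" "1 - s > 0" using assms by (auto simp: s_def)
    \<comment> \<open>The two sides differ by a multiple of
      \<open>R\<^sup>2 - (1 + (q\<^sup>2 - 1) * s\<^sup>2)\<close>, which vanishes.\<close>
    have key: "(1 - s) * (((1 - q\<^sup>2) * s - q * R) * (1 + s) + u * R) = u * (R - q)"
    proof -
      have "(1 - s) * (((1 - q\<^sup>2) * s - q * R) * (1 + s) + u * R) - u * (R - q) =
        (R\<^sup>2 - (1 + (q\<^sup>2 - 1) * s\<^sup>2)) * (- s)"
        unfolding u_def power2_eq_square by (simp add: algebra_simps)
      then show ?thesis using R by simp
    qed
    have "(1 / (u / (1 + s))) * (((q * (-2) + 2 * (1 - q\<^sup>2) * s / R) * (1 + s) - u * (-2)) /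
      ((1 + s) * (1 + s))) = 2 * (((1 - q\<^sup>2) * s - q * R) * (1 + s) + u * R) / (u * R * (1 + s))"
    proof -
      have 1: "(1 / (u / t)) * ((2 * Y / R * t - u * (-2)) / (t * t)) = 2 * (Y * t + u * R) / (u * R * t)"
        if "t > 0" for t Y using u R(1) that by (simp add: field_simps)
      have 2: "q * (-2) + 2 * (1 - q\<^sup>2) * s / R = 2 * ((1 - q\<^sup>2) * s - q * R) / R"
        using R(1) by (simp add: field_simps)
      show ?thesis unfolding 2 by (rule 1) (rule s)
    qed
    also have "\<dots> = 2 * ((1 - s) * (((1 - q\<^sup>2) * s - q * R) * (1 + s) + u * R)) / (u * R * (1 + s) * (1 - s))"
      using s by simp
    also have "\<dots> = (1 - q / R) / ((1 - s) * (1 + s) / 2)"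
    proof -
      have "2 * (u * (R - q)) / (u * R * t * w) = (1 - q / R) / (w * t / 2)" if "t > 0" "w > 0" for t w
        using u R(1) that by (simp add: field_simps)
      then show ?thesis unfolding key using s by blast
    qed
    finally show ?thesis unfolding a .
  qed
  finally show ?thesis unfolding R_def .
qed

lemma crossing_eq: assumes "0 < a" "a < 1"
  shows "0 \<le> crossing q a" "crossing q a \<le> a" "crossing q a \<le> 1 - a"
    "q\<^sup>2 * (a - crossing q a) * (1 - a - crossing q a) = (crossing q a)\<^sup>2"
    "q * (1 - crossing q a / (1 - a)) + crossing q a / (1 - a) / q = exp (slope q a)"
proof -
  define R where "R = disc_root q a"
  define r where "r = crossing q a"
  have R: "q \<le> R" "R \<le> 1" "R\<^sup>2 = 1 + (q\<^sup>2 - 1) * (1 - 2 * a)\<^sup>2"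
    using root_bounds[of a] assms by (auto simp: R_def)
  have r: "r * (2 * (1 - q\<^sup>2)) = q * (R - q)" using q2 by (simp add: r_def crossing_def R_def)
  show 0: "0 \<le> crossing q a" unfolding crossing_def R_def[symmetric] using R q q2 by simp
  \<comment> \<open>By the quadratic equation \<open>a - r\<close> and \<open>1 - a - r\<close>
    cannot have opposite signs; with \<open>2 * r < 1\<close> their sum is positive, so neither is
    negative.\<close>
  have half: "2 * r < 1"
  proof -
    have "q * (R - q) \<le> q * (1 - q)" using R q by (intro mult_left_mono) auto
    also have "\<dots> < (1 + q) * (1 - q)" using q by (intro mult_strict_right_mono) auto
    finally have "(2 * r) * (1 - q\<^sup>2) < 1 * (1 - q\<^sup>2)" using r by (simp add: power2_eq_square algebra_simps)
    then show ?thesis using q2 by (subst (asm) mult_less_cancel_right_pos) auto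
  qed
  have eq: "q\<^sup>2 * (a - r) * (1 - a - r) = r\<^sup>2"
  proof -
    have "(2 * (1 - q\<^sup>2) * r + q\<^sup>2)\<^sup>2 = q\<^sup>2 * R\<^sup>2"
    proof -
      have "2 * (1 - q\<^sup>2) * r + q\<^sup>2 = q * R" using r by (simp add: power2_eq_square algebra_simps)
      then show ?thesis by (simp add: power_mult_distrib)
    qed
    \<comment> \<open>Completing the square in the quadratic for \<open>r\<close>.\<close>
    moreover have "4 * (1 - q\<^sup>2) * (q\<^sup>2 * (a - r) * (1 - a - r) - r\<^sup>2) =
        q\<^sup>2 * (1 + (q\<^sup>2 - 1) * (1 - 2 * a)\<^sup>2) - (2 * (1 - q\<^sup>2) * r + q\<^sup>2)\<^sup>2"
      unfolding power2_eq_square by (simp add: algebra_simps)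
    ultimately have "4 * (1 - q\<^sup>2) * (q\<^sup>2 * (a - r) * (1 - a - r) - r\<^sup>2) = 0"
      by (simp add: R(3))
    then show ?thesis using q2 by simp
  qed
  show "q\<^sup>2 * (a - crossing q a) * (1 - a - crossing q a) = (crossing q a)\<^sup>2" using eq by (simp add: r_def)
  have "(a - r) * (1 - a - r) \<ge> 0"
  proof (rule ccontr)
    assume "\<not> ?thesis"
    then have "q\<^sup>2 * ((a - r) * (1 - a - r)) < 0" using q2 by (simp add: mult_pos_neg)
    then show False using eq by (simp add: mult.assoc)
  qed
  then have "r \<le> a \<and> r \<le> 1 - a"
    using half unfolding zero_le_mult_iff by auto
  then show "crossing q a \<le> a" "crossing q a \<le> 1 - a" by (auto simp: r_def)
  have "q * (1 - r / (1 - a)) + r / (1 - a) / q = (q * q * (1 - a - r) + r) / ((1 - a) * q)"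
  proof -
    have "q * (1 - r / b) + r / b / q = (q * q * (b - r) + r) / (b * q)" if "b > 0" for b
      using q that by (simp add: field_simps)
    then show ?thesis using assms by simp
  qed
  also have "q * q * (1 - a - r) + r = q * (q * (1 - 2 * a) + R) / 2"
    using r by (simp add: power2_eq_square algebra_simps)
  also have "q * (q * (1 - 2 * a) + R) / 2 / ((1 - a) * q) = (q * (1 - 2 * a) + R) / (2 * (1 - a))"
    using q assms by (simp add: field_simps)
  finally show "q * (1 - crossing q a / (1 - a)) + crossing q a / (1 - a) / q = exp (slope q a)"
    using exp_slope[of a] assms by (simp add: r_def R_def)
qed

lemma continuous_on_slope: "continuous_on {0..<1} (slope q)"
proof -
  have "continuous_on {0..<1} (disc_root q)" unfolding disc_root_def by (intro continuous_intros)
  moreover have "(q * (1 - 2 * a) + disc_root q a) / (2 * (1 - a)) \<noteq> 0" if "a \<in> {0..<1}" for a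
    using numerator_pos[of a] that by auto
  ultimately show ?thesis
    unfolding slope_def using numerator_pos by (intro continuous_intros) auto
qed

lemma slope_integral_deriv: assumes "0 < a" "a < 1"
  shows "(slope_integral q has_real_derivative slope q a) (at a)"
proof -
  obtain b where b: "a < b" "b < 1" using assms dense by blast
  have "continuous_on {0..b} (slope q)"
    by (rule continuous_on_subset[OF continuous_on_slope]) (use b in auto)
  then have "((\<lambda>x. integral {0..x} (slope q)) has_real_derivative slope q a) (at a within {0..b})"
    using assms b by (intro integral_has_real_derivative) auto
  moreover have "at a within {0..b} = at a"
    using assms b by (intro at_within_interior) auto
  ultimately show ?thesis by (simp add: slope_integral_def[abs_def])
qed

text \<open>The derivative of the difference vanishes since \<open>slope\<close> is odd about 1/2,
  and the difference itself vanishes at 1/2.\<close>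

lemma slope_integral_sym: assumes "0 < a" "a < 1"
  shows "slope_integral q (1 - a) = slope_integral q a"
proof -
  have "((\<lambda>x. slope_integral q x - slope_integral q (1 - x)) has_real_derivative 0) (at x)" if "x \<in> {0<..<1}" for x
  proof -
    have "((\<lambda>x. slope_integral q (1 - x)) has_real_derivative slope q (1 - x) * (-1)) (at x)"
      using that by (intro DERIV_chain'[where g = "slope_integral q"] slope_integral_deriv)
        (auto intro!: derivative_eq_intros)
    from DERIV_diff[OF slope_integral_deriv this, of] that
    have "((\<lambda>x. slope_integral q x - slope_integral q (1 - x)) has_real_derivative slope q x - slope q (1 - x) * (-1)) (at x)"
      by auto
    then show ?thesis using slope_sym[of x] that by simp
  qed
  then have "\<exists>c. \<forall>x\<in>{0<..<1}. slope_integral q x - slope_integral q (1 - x) = c"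
    by (intro has_field_derivative_zero_constant[of "{0<..<1}"])
      (auto intro: has_field_derivative_at_within)
  then obtain c where c: "\<And>x. x \<in> {0<..<1} \<Longrightarrow> slope_integral q x - slope_integral q (1 - x) = c" by blast
  have "c = 0" using c[of "1/2"] by simp
  then show ?thesis using c[of a] assms by simp
qed

end

section \<open>The function g, the derivatives of A and their signs\<close>

context
  fixes \<beta> q :: real
  assumes \<beta>: "0 < \<beta>"
  defines "q \<equiv> exp (- 2 * \<beta>)"
begin

lemma q_bounds: "0 < q" "q < 1" using \<beta> by (auto simp: q_def)

lemma g_fun_eq_integral: "g_fun \<beta> a = slope_integral q (min a (1 - a))"
proof -
  have "exp (- 4 * \<beta>) = q\<^sup>2" by (simp add: q_def flip: exp_of_nat_mult)
  then show ?thesis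
    unfolding q_def g_fun_def slope_integral_def slope_def disc_root_def by simp
qed

lemma g_fun_eq: "0 < a \<Longrightarrow> a < 1 \<Longrightarrow> g_fun \<beta> a = slope_integral q a"
  using slope_integral_sym[OF q_bounds, of a] by (auto simp: g_fun_eq_integral min_def)

lemma g_fun_sym: "g_fun \<beta> (1 - a) = g_fun \<beta> a"
  by (simp add: g_fun_eq_integral min.commute)

text \<open>A lower bound linear in \<open>a\<close>, enough for the entropy with its infinite slope
  at 0 to win.\<close>

lemma g_fun_ge: assumes "0 \<le> a" "a \<le> 1 / 2"
  shows "a * ln q \<le> g_fun \<beta> a"
proof -
  have cont: "continuous_on {0..a} (slope q)"
    by (rule continuous_on_subset[OF continuous_on_slope[OF q_bounds]]) (use assms in auto)
  have "integral {0..a} (\<lambda>_. ln q) \<le> integral {0..a} (slope q)"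
    using assms by (intro integral_le integrable_continuous_interval cont slope_ge[OF q_bounds]) auto
  then show ?thesis using assms by (simp add: g_fun_eq_integral slope_integral_def min_def)
qed

lemma g_fun_deriv: assumes "0 < a" "a < 1"
  shows "(g_fun \<beta> has_real_derivative slope q a) (at a)"
proof (rule has_field_derivative_transform_within_open[OF slope_integral_deriv[OF q_bounds assms]])
  show "open {0<..<1::real}" by simp
qed (use assms g_fun_eq in auto)

end

text \<open>The closed form of A' on the open unit interval (\<open>A_fun_deriv\<close>), and the
  limit of the logarithmic ratios of consecutive level weights
  (\<open>level_weight_ratio\<close>).\<close>

definition dA :: "nat \<Rightarrow> real \<Rightarrow> real \<Rightarrow> real \<Rightarrow> real" where
  "dA d \<beta> h a = 2 * h + real d * slope (exp (- 2 * \<beta>)) a + ln ((1 - a) / a)"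

text \<open>The closed form of A''; its sign is that of the numerator, which depends on
  \<open>a\<close> only through \<open>disc_root\<close>.\<close>

definition ddA :: "nat \<Rightarrow> real \<Rightarrow> real \<Rightarrow> real" where
  "ddA d \<beta> a = (real d - 2 - real d * exp (- 2 * \<beta>) / disc_root (exp (- 2 * \<beta>)) a) / (2 * a * (1 - a))"

lemma entropy_sym: "entropy_fun (1 - a) = entropy_fun a"
  by (simp add: entropy_fun_def algebra_simps)

text \<open>So \<open>beta_c\<close> is the value of \<beta> at which A'' vanishes at the midpoint;
  compare \<open>ddA_half\<close>.\<close>

lemma beta_c_eq: assumes "d \<ge> 3"
  shows "exp (- 2 * beta_c d) = (real d - 2) / real d"
proof -
  have d: "real d \<ge> 3" using assms by simp
  have "(1 + 1 / (real d - 1)) / (1 - 1 / (real d - 1)) = real d / (real d - 2)"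
  proof -
    have "1 + 1 / (real d - 1) = real d / (real d - 1)" "1 - 1 / (real d - 1) = (real d - 2) / (real d - 1)"
      using d by (auto simp: field_simps)
    then show ?thesis using d by simp
  qed
  then have "- 2 * beta_c d = - ln (real d / (real d - 2))"
    by (simp add: beta_c_def artanh_def)
  also have "\<dots> = ln ((real d - 2) / real d)" using d by (simp add: ln_div)
  finally show ?thesis using d by simp
qed

lemma A_fun_endpoints: "A_fun d \<beta> h 0 = 0" "A_fun d \<beta> h 1 = 2 * h"
  by (simp_all add: A_fun_def entropy_fun_def g_fun_def)

context
  fixes d :: nat and \<beta> q :: real
  assumes d: "d \<ge> 3" and \<beta>: "0 < \<beta>"
  defines "q \<equiv> exp (- 2 * \<beta>)"
begin

lemmas q_bounds' = q_bounds[OF \<beta>, folded q_def]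

lemma dA_eq: "dA d \<beta> h = (\<lambda>a. 2 * h + real d * slope q a + ln ((1 - a) / a))"
  by (simp add: fun_eq_iff dA_def q_def)

lemma ddA_eq: "ddA d \<beta> = (\<lambda>a. (real d - 2 - real d * q / disc_root q a) / (2 * a * (1 - a)))"
  by (simp add: fun_eq_iff ddA_def q_def)

lemma A_fun_sym: "A_fun d \<beta> 0 (1 - a) = A_fun d \<beta> 0 a"
  unfolding A_fun_def g_fun_sym[OF \<beta>] entropy_sym by simp

lemma A_fun_deriv: assumes "0 < a" "a < 1"
  shows "(A_fun d \<beta> h has_real_derivative dA d \<beta> h a) (at a)"
proof -
  have "(entropy_fun has_real_derivative ln ((1 - a) / a)) (at a)"
  proof -
    have "((\<lambda>a. - a * ln a - (1 - a) * ln (1 - a)) has_real_derivative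
        (- ln a - a * (1 / a)) - (- ln (1 - a) + (1 - a) * (- 1 / (1 - a)))) (at a)"
      using assms by (auto intro!: derivative_eq_intros)
    then show ?thesis using assms by (simp add: entropy_fun_def[abs_def] ln_div)
  qed
  then show ?thesis
    unfolding A_fun_def[abs_def] dA_eq using g_fun_deriv[OF \<beta> assms, folded q_def]
    by (auto intro!: derivative_eq_intros)
qed

lemma dA_deriv: assumes "0 < a" "a < 1"
  shows "(dA d \<beta> h has_real_derivative ddA d \<beta> a) (at a)"
proof -
  have R: "disc_root q a > 0" using root_bounds[OF q_bounds', of a] assms by simp
  have "((\<lambda>a. ln ((1 - a) / a)) has_real_derivative - (1 / (a * (1 - a)))) (at a)"
    using assms by (auto intro!: derivative_eq_intros simp: field_simps)
  from DERIV_add[OF DERIV_const[of "2 * h"] DERIV_add[OF DERIV_cmult[OF slope_deriv[OF q_bounds' assms], of "real d"] this]]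
  have "((\<lambda>a. 2 * h + (real d * slope q a + ln ((1 - a) / a))) has_real_derivative
      real d * ((1 - q / disc_root q a) / (2 * a * (1 - a))) + - (1 / (a * (1 - a)))) (at a)"
    by simp
  moreover have "real d * ((1 - r) / (2 * a * (1 - a))) + - (1 / (a * (1 - a))) =
      (real d - 2 - real d * r) / (2 * a * (1 - a))" for r
  proof -
    have "real d * ((1 - r) / (2 * a * b)) + - (1 / (a * b)) = (real d - 2 - real d * r) / (2 * a * b)"
      if "b \<noteq> 0" for b using assms that by (simp add: field_simps)
    then show ?thesis using assms by simp
  qed
  ultimately show ?thesis unfolding dA_eq ddA_eq by (simp add: add.assoc)
qed

lemma dA_half: "dA d \<beta> h (1 / 2) = 2 * h"
  using slope_half[OF q_bounds'] by (simp add: dA_eq)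

lemma disc_root_half: "disc_root q (1 / 2) = 1" by (simp add: disc_root_def)

lemma ddA_half: "ddA d \<beta> (1 / 2) = 2 * (real d - 2 - real d * q)"
  by (simp add: ddA_eq disc_root_half)

lemma disc_root_differentiable: assumes "0 < a" "a < 1"
  obtains D where "(disc_root q has_real_derivative D) (at a)"
  using root_deriv[OF q_bounds', of a] assms by auto

lemma ddA_differentiable: assumes "0 < a" "a < 1"
  obtains D where "(ddA d \<beta> has_real_derivative D) (at a)"
proof -
  obtain D where D: "(disc_root q has_real_derivative D) (at a)"
    using disc_root_differentiable[OF assms] .
  have R: "disc_root q a \<noteq> 0" using root_bounds(3)[OF q_bounds', of a] assms by simp
  have 1: "((\<lambda>a. real d - 2 - real d * q / disc_root q a) has_real_derivative
      0 - (0 * disc_root q a - real d * q * D) / (disc_root q a * disc_root q a)) (at a)"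
    by (intro DERIV_diff DERIV_const DERIV_divide D R)
  have 2: "((\<lambda>a. 2 * a * (1 - a)) has_real_derivative 2 * (1 - a) - 2 * a) (at a)"
    by (auto intro!: derivative_eq_intros)
  have "2 * a * (1 - a) \<noteq> 0" using assms by simp
  from that[unfolded ddA_eq, OF DERIV_divide[OF 1 2 this]] show ?thesis .
qed

lemma continuous_on_ddA: "continuous_on {0<..<1} (ddA d \<beta>)"
proof (rule DERIV_continuous_on)
  fix a :: real assume "a \<in> {0<..<1}"
  then show "(ddA d \<beta> has_real_derivative (SOME D. (ddA d \<beta> has_real_derivative D) (at a)))
      (at a within {0<..<1})"
    using ddA_differentiable[of a] someI[of "\<lambda>D. (ddA d \<beta> has_real_derivative D) (at a)"]
    by (auto intro: has_field_derivative_at_within)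
qed

lemma cont_A: assumes "S \<subseteq> {0<..<1}"
  shows "continuous_on S (dA d \<beta> h)" "continuous_on S (A_fun d \<beta> h)"
proof -
  show "continuous_on S (dA d \<beta> h)"
    by (intro continuous_at_imp_continuous_on ballI DERIV_isCont[OF dA_deriv]) (use assms in auto)
  show "continuous_on S (A_fun d \<beta> h)"
    by (intro continuous_at_imp_continuous_on ballI DERIV_isCont[OF A_fun_deriv]) (use assms in auto)
qed

lemma dA_increasing:
  assumes "0 < a" "a < b" "b < 1" "\<And>x. a < x \<Longrightarrow> x < b \<Longrightarrow> ddA d \<beta> x > 0"
  shows "dA d \<beta> h a < dA d \<beta> h b"
proof (rule DERIV_pos_imp_increasing_open[OF assms(2) _ cont_A(1)])
  fix x assume "a < x" "x < b"
  then show "\<exists>y. (dA d \<beta> h has_real_derivative y) (at x) \<and> y > 0"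
    using assms by (intro exI[of _ "ddA d \<beta> x"] conjI dA_deriv) auto
qed (use assms in auto)

lemma dA_decreasing:
  assumes "0 < a" "a < b" "b < 1" "\<And>x. a < x \<Longrightarrow> x < b \<Longrightarrow> ddA d \<beta> x < 0"
  shows "dA d \<beta> h a > dA d \<beta> h b"
proof (rule DERIV_neg_imp_decreasing_open[OF assms(2) _ cont_A(1)])
  fix x assume "a < x" "x < b"
  then show "\<exists>y. (dA d \<beta> h has_real_derivative y) (at x) \<and> y < 0"
    using assms by (intro exI[of _ "ddA d \<beta> x"] conjI dA_deriv) auto
qed (use assms in auto)

lemma A_fun_increasing:
  assumes "0 < a" "a < b" "b < 1" "\<And>x. a < x \<Longrightarrow> x < b \<Longrightarrow> dA d \<beta> h x > 0"
  shows "A_fun d \<beta> h a < A_fun d \<beta> h b"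
proof (rule DERIV_pos_imp_increasing_open[OF assms(2) _ cont_A(2)])
  fix x assume "a < x" "x < b"
  then show "\<exists>y. (A_fun d \<beta> h has_real_derivative y) (at x) \<and> y > 0"
    using assms by (intro exI[of _ "dA d \<beta> h x"] conjI A_fun_deriv) auto
qed (use assms in auto)

lemma A_fun_decreasing:
  assumes "0 < a" "a < b" "b < 1" "\<And>x. a < x \<Longrightarrow> x < b \<Longrightarrow> dA d \<beta> h x < 0"
  shows "A_fun d \<beta> h a > A_fun d \<beta> h b"
proof (rule DERIV_neg_imp_decreasing_open[OF assms(2) _ cont_A(2)])
  fix x assume "a < x" "x < b"
  then show "\<exists>y. (A_fun d \<beta> h has_real_derivative y) (at x) \<and> y < 0"
    using assms by (intro exI[of _ "dA d \<beta> h x"] conjI A_fun_deriv) auto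
qed (use assms in auto)

lemma deriv2_A_fun: assumes "0 < a" "a < 1"
  shows "(deriv ^^ 2) (A_fun d \<beta> h) a = ddA d \<beta> a"
proof -
  have "eventually (\<lambda>x. x \<in> {0<..<1}) (nhds a)"
    using assms by (intro eventually_nhds_in_open) auto
  then have "eventually (\<lambda>x. deriv (A_fun d \<beta> h) x = dA d \<beta> h x) (nhds a)"
    by eventually_elim (auto intro!: DERIV_imp_deriv A_fun_deriv)
  then have "deriv (deriv (A_fun d \<beta> h)) a = deriv (dA d \<beta> h) a"
    by (intro deriv_cong_ev refl)
  then show ?thesis using DERIV_imp_deriv[OF dA_deriv[OF assms]] by (simp add: numeral_2_eq_2)
qed

text \<open>For small \<open>a\<close> the entropy is at least \<open>- a * ln a\<close>, while the
  other terms are at least \<open>c * a\<close>; so A exceeds its boundary value 0.\<close>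

lemma A_fun_pos_near_0: "\<exists>a. 0 < a \<and> a < 1 \<and> 2 * h * a + real d * g_fun \<beta> a + entropy_fun a > 0"
proof -
  define c where "c = 2 * h + real d * ln q"
  \<comment> \<open>The choice makes \<open>c - ln a\<close> at least 1.\<close>
  define a where "a = min (1 / 2) (exp (c - 1))"
  have a: "0 < a" "a \<le> 1 / 2" "a \<le> exp (c - 1)" by (auto simp: a_def)
  have "ln a \<le> ln (exp (c - 1))" using a by (subst ln_le_cancel_iff) auto
  then have "0 < a * (c - ln a)" using a by simp
  also have "\<dots> = 2 * h * a + real d * (a * ln q) - a * ln a" by (simp add: c_def algebra_simps)
  also have "\<dots> \<le> 2 * h * a + real d * g_fun \<beta> a - a * ln a"
    using g_fun_ge[OF \<beta>, of a, folded q_def] a by (simp add: mult_left_mono)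
  also have "\<dots> \<le> 2 * h * a + real d * g_fun \<beta> a + entropy_fun a"
    using a by (simp add: entropy_fun_def mult_nonneg_nonpos)
  finally show ?thesis using a by (intro exI[of _ a]) auto
qed

text \<open>The endpoint 0 is excluded by \<open>A_fun_pos_near_0\<close>; reflection turns the
  endpoint 1 into 0 with \<open>h\<close> replaced by its negative.\<close>

lemma maximizer_interior:
  assumes a: "a \<in> maximizers d \<beta> h"
  shows "0 < a" "a < 1"
proof -
  have max: "A_fun d \<beta> h b \<le> A_fun d \<beta> h a" if "0 < b" "b < 1" for b
    using a that by (auto simp: maximizers_def)
  have mem: "0 \<le> a" "a \<le> 1" using a by (auto simp: maximizers_def)
  have "a \<noteq> 0"
  proof
    assume "a = 0"
    obtain b where "0 < b" "b < 1" "A_fun d \<beta> h b > 0"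
      using A_fun_pos_near_0[of h] by (auto simp: A_fun_def)
    then show False using max[of b] A_fun_endpoints[of d \<beta> h] \<open>a = 0\<close> by simp
  qed
  moreover have "a \<noteq> 1"
  proof
    assume "a = 1"
    obtain b where b: "0 < b" "b < 1" "2 * (- h) * b + real d * g_fun \<beta> b + entropy_fun b > 0"
      using A_fun_pos_near_0[of "- h"] by auto
    then have "A_fun d \<beta> h (1 - b) > 2 * h"
      unfolding A_fun_def g_fun_sym[OF \<beta>] entropy_sym by (simp add: algebra_simps)
    then show False using max[of "1 - b"] b A_fun_endpoints[of d \<beta> h] \<open>a = 1\<close> by simp
  qed
  ultimately show "0 < a" "a < 1" using mem by auto
qed

lemma maximizer_critical:
  assumes a: "a \<in> maximizers d \<beta> h"
  shows "dA d \<beta> h a = 0"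
proof (rule DERIV_local_max[OF A_fun_deriv])
  note I = maximizer_interior[OF a]
  show "0 < a" "a < 1" by fact+
  show "0 < min a (1 - a)" using I by simp
  show "\<forall>y. \<bar>a - y\<bar> < min a (1 - a) \<longrightarrow> A_fun d \<beta> h y \<le> A_fun d \<beta> h a"
    using a by (auto simp: maximizers_def abs_if split: if_splits)
qed

lemma A_fun_less_right:
  assumes "0 < a" "a < b" "b < 1" "dA d \<beta> h a = 0" "\<And>x. a < x \<Longrightarrow> x < b \<Longrightarrow> ddA d \<beta> x > 0"
  shows "A_fun d \<beta> h a < A_fun d \<beta> h b"
proof -
  have "dA d \<beta> h a < dA d \<beta> h x" if "a < x" "x < b" for x
    using that assms by (intro dA_increasing) auto
  then show ?thesis using assms by (intro A_fun_increasing) auto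
qed

lemma A_fun_less_left:
  assumes "0 < b" "b < a" "a < 1" "dA d \<beta> h a = 0" "\<And>x. b < x \<Longrightarrow> x < a \<Longrightarrow> ddA d \<beta> x > 0"
  shows "A_fun d \<beta> h a < A_fun d \<beta> h b"
proof -
  have "dA d \<beta> h x < dA d \<beta> h a" if "b < x" "x < a" for x
    using that assms by (intro dA_increasing) auto
  then show ?thesis using assms by (intro A_fun_decreasing) auto
qed

text \<open>Otherwise A' would be positive just to the right of the maximizer.\<close>

lemma maximizer_ddA_nonpos:
  assumes a: "a \<in> maximizers d \<beta> h"
  shows "ddA d \<beta> a \<le> 0"
proof (rule ccontr)
  assume "\<not> ?thesis"
  note I = maximizer_interior[OF a]
  have "isCont (ddA d \<beta>) a"
    using ddA_differentiable[OF I] DERIV_isCont by blast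
  then have "eventually (\<lambda>x. ddA d \<beta> x > 0) (at a)"
    using \<open>\<not> _\<close> unfolding isCont_def by (intro order_tendstoD) auto
  then obtain e where e: "e > 0" "\<And>x. x \<noteq> a \<Longrightarrow> dist x a < e \<Longrightarrow> ddA d \<beta> x > 0"
    unfolding eventually_at by auto
  define b where "b = a + min e (1 - a) / 2"
  have b: "a < b" "b < 1" "b < a + e" using I e by (auto simp: b_def min_def field_simps)
  have "A_fun d \<beta> h a < A_fun d \<beta> h b"
  proof (rule A_fun_less_right[OF I(1) b(1,2) maximizer_critical[OF a]])
    fix x assume "a < x" "x < b"
    then show "ddA d \<beta> x > 0" using b by (intro e) (auto simp: dist_real_def)
  qed
  then show False using a b I by (auto simp: maximizers_def not_le[symmetric])
qed

lemma disc_root_less: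
  assumes "0 < x" "x < 1" "0 < a" "a < 1" "\<bar>1 - 2 * x\<bar> < \<bar>1 - 2 * a\<bar>"
  shows "disc_root q a < disc_root q x"
proof -
  have "(1 - 2 * x)\<^sup>2 < (1 - 2 * a)\<^sup>2"
    using power_strict_mono[OF assms(5), of 2] by simp
  then show ?thesis
    unfolding disc_root_def using q2[OF q_bounds'] by (simp add: mult_strict_left_mono_neg)
qed

lemma ddA_pos_of_closer:
  assumes "0 < x" "x < 1" "0 < a" "a < 1" "\<bar>1 - 2 * x\<bar> < \<bar>1 - 2 * a\<bar>" "ddA d \<beta> a \<ge> 0"
  shows "ddA d \<beta> x > 0"
proof -
  have R: "0 < disc_root q a" "disc_root q a < disc_root q x"
    using root_bounds(3)[OF q_bounds', of a] disc_root_less assms by auto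
  have "real d * q / disc_root q x < real d * q / disc_root q a"
    using R d \<beta> by (intro divide_strict_left_mono mult_pos_pos) (auto simp: q_bounds')
  moreover have "0 \<le> real d - 2 - real d * q / disc_root q a"
  proof -
    have "0 < a * (1 - a)" using assms by simp
    then show ?thesis using assms(6) unfolding ddA_eq by (auto simp: zero_le_divide_iff)
  qed
  ultimately show ?thesis using assms unfolding ddA_eq by (intro divide_pos_pos mult_pos_pos) auto
qed

text \<open>
  The sign of \<open>A''\<close> is that of \<open>R(a) - d q / (d - 2)\<close> with \<open>R\<close> increasing towards the midpoint.
  So if \<open>A''\<close> vanished at a critical point off the midpoint, \<open>A\<close> would increase from it all the
  way to the midpoint.
\<close>

lemma maximizer_ddA_neg:
  assumes a: "a \<in> maximizers d \<beta> h" and half: "a \<noteq> 1 / 2"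
  shows "ddA d \<beta> a < 0"
proof (rule ccontr)
  assume "\<not> ?thesis"
  then have ddA: "ddA d \<beta> a \<ge> 0" by simp
  note I = maximizer_interior[OF a]
  have "A_fun d \<beta> h a < A_fun d \<beta> h (1 / 2)"
  proof (cases "a < 1 / 2")
    case True
    then show ?thesis
      using I ddA maximizer_critical[OF a]
      by (intro A_fun_less_right ddA_pos_of_closer[of _ a]) auto
  next
    case False
    then show ?thesis
      using I ddA half maximizer_critical[OF a]
      by (intro A_fun_less_left ddA_pos_of_closer[of _ a]) auto
  qed
  then show False using a by (auto simp: maximizers_def not_le[symmetric])
qed

lemma beta_less_iff: "\<beta> < beta_c d \<longleftrightarrow> real d - 2 < real d * q"
  "\<beta> > beta_c d \<longleftrightarrow> real d - 2 > real d * q"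
  "\<beta> = beta_c d \<longleftrightarrow> real d - 2 = real d * q"
proof -
  have d0: "real d > 0" using d by simp
  have eq: "real d - 2 = real d * exp (- 2 * beta_c d)" using beta_c_eq[OF d] d0 by simp
  show "\<beta> < beta_c d \<longleftrightarrow> real d - 2 < real d * q" "\<beta> > beta_c d \<longleftrightarrow> real d - 2 > real d * q"
    "\<beta> = beta_c d \<longleftrightarrow> real d - 2 = real d * q"
    unfolding eq q_def using d0 by auto
qed

text \<open>Only the midpoint is left open by \<open>maximizer_ddA_neg\<close>. It can be critical
  only for \<open>h = 0\<close>, and then the uniqueness region puts \<beta> below the
  threshold.\<close>

lemma maximizer_ddA_neg_uniqueness:
  assumes a: "a \<in> maximizers d \<beta> h" and U: "(\<beta>, h) \<in> uniqueness_region d"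
  shows "ddA d \<beta> a < 0"
proof (cases "a = 1 / 2")
  case True
  have "h = 0" using maximizer_critical[OF a] unfolding True dA_half by simp
  then have "real d - 2 < real d * q" using U beta_less_iff by (simp add: uniqueness_region_def)
  then show ?thesis unfolding True ddA_half by simp
qed (rule maximizer_ddA_neg[OF a])

text \<open>Above the threshold A'' is positive at the midpoint, which is therefore no
  maximizer.\<close>

lemma maximizer_ddA_neg_supercritical:
  assumes a: "a \<in> maximizers d \<beta> 0" and sup: "\<beta> > beta_c d"
  shows "ddA d \<beta> a < 0"
proof (cases "a = 1 / 2")
  case True
  then show ?thesis using maximizer_ddA_nonpos[OF a] sup beta_less_iff unfolding True ddA_half by simp
qed (rule maximizer_ddA_neg[OF a])

context
  assumes crit: "\<beta> = beta_c d"
begin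

text \<open>A nonnegative value off the midpoint would force a positive one at the midpoint, where
  A'' vanishes at the threshold.\<close>

lemma critical_ddA_neg: assumes "0 < a" "a < 1" "a \<noteq> 1 / 2"
  shows "ddA d \<beta> a < 0"
proof (rule ccontr)
  assume "\<not> ?thesis"
  then have "ddA d \<beta> (1 / 2) > 0" using assms by (intro ddA_pos_of_closer[of _ a]) auto
  then show False using crit beta_less_iff unfolding ddA_half by simp
qed

text \<open>Part (iii) of the theorem does not presuppose a unique maximizer, so uniqueness is
  derived: A' is strictly decreasing on the left half and vanishes at 1/2; the right half follows by
  symmetry.\<close>

lemma critical_unique_max: assumes "0 < b" "b < 1" "b \<noteq> 1 / 2"
  shows "A_fun d \<beta> 0 b < A_fun d \<beta> 0 (1 / 2)"
proof -
  have less: "A_fun d \<beta> 0 b < A_fun d \<beta> 0 (1 / 2)" if "0 < b" "b < 1 / 2" for b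
  proof -
    have "dA d \<beta> 0 x > dA d \<beta> 0 (1 / 2)" if "b < x" "x < 1 / 2" for x
      using that \<open>0 < b\<close> by (intro dA_decreasing critical_ddA_neg) auto
    then show ?thesis using that dA_half[of 0] by (intro A_fun_increasing) auto
  qed
  show ?thesis
  proof (cases "b < 1 / 2")
    case False
    then show ?thesis using less[of "1 - b"] assms A_fun_sym[of b] by simp
  qed (use less assms in auto)
qed

end

end

section \<open>Taylor expansions of A at its maximizers\<close>

lemma abs_le_power_of_deriv:
  fixes G :: "real \<Rightarrow> real"
  assumes G: "\<And>x. \<bar>x - a\<bar> \<le> \<delta> \<Longrightarrow> (G has_real_derivative G' x) (at x)" and Ga: "G a = 0"
    and G': "\<And>x. \<bar>x - a\<bar> \<le> \<delta> \<Longrightarrow> \<bar>G' x\<bar> \<le> M * \<bar>x - a\<bar> ^ k" and M: "0 \<le> M"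
    and x: "\<bar>x - a\<bar> \<le> \<delta>"
  shows "\<bar>G x\<bar> \<le> M * \<bar>x - a\<bar> ^ Suc k"
proof -
  let ?S = "{a - \<bar>x - a\<bar> .. a + \<bar>x - a\<bar>}"
  have "norm (G x - G a) \<le> (M * \<bar>x - a\<bar> ^ k) * norm (x - a)"
  proof (rule field_differentiable_bound[of ?S G G'])
    fix y assume "y \<in> ?S"
    then have y: "\<bar>y - a\<bar> \<le> \<bar>x - a\<bar>" by auto
    then show "(G has_field_derivative G' y) (at y within ?S)"
      using x by (intro has_field_derivative_at_within[OF G]) linarith
    have "\<bar>G' y\<bar> \<le> M * \<bar>y - a\<bar> ^ k" using y x by (intro G') linarith
    also have "\<dots> \<le> M * \<bar>x - a\<bar> ^ k" using y M by (intro mult_left_mono power_mono) auto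
    finally show "norm (G' y) \<le> M * \<bar>x - a\<bar> ^ k" by simp
  qed auto
  then show ?thesis using Ga by (simp add: mult_ac)
qed

text \<open>Two integrations of an estimate of the second derivative, for which A'' has a convenient
  closed form. \<open>k = 0\<close> serves a nondegenerate maximum and \<open>k = 2\<close> the
  critical one.\<close>

lemma expansion_of_second_derivative:
  fixes f f' f'' :: "real \<Rightarrow> real"
  assumes f: "\<And>x. \<bar>x - a\<bar> \<le> \<delta> \<Longrightarrow> (f has_real_derivative f' x) (at x)"
    and f': "\<And>x. \<bar>x - a\<bar> \<le> \<delta> \<Longrightarrow> (f' has_real_derivative f'' x) (at x)"
    and crit: "f' a = 0" and M: "0 \<le> M"
    and f'': "\<And>x. \<bar>x - a\<bar> \<le> \<delta> \<Longrightarrow>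
      \<bar>f'' x - c * (real (k + 2) * real (k + 1)) * (x - a) ^ k\<bar> \<le> M * \<bar>x - a\<bar> ^ Suc k"
    and x: "\<bar>x - a\<bar> \<le> \<delta>"
  shows "\<bar>f x - f a - c * (x - a) ^ (k + 2)\<bar> \<le> M * \<bar>x - a\<bar> ^ (k + 3)"
proof -
  have pow: "((\<lambda>x. (x - a) ^ Suc n) has_real_derivative real (Suc n) * (y - a) ^ n) (at y)" for n y
    by (rule DERIV_cong[OF DERIV_power_Suc[OF DERIV_diff[OF DERIV_ident DERIV_const]]]) simp
  have 1: "\<bar>f' x - c * real (k + 2) * (x - a) ^ Suc k\<bar> \<le> M * \<bar>x - a\<bar> ^ Suc (Suc k)"
    if "\<bar>x - a\<bar> \<le> \<delta>" for x
  proof (rule abs_le_power_of_deriv[OF _ _ f'' M that])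
    fix y assume y: "\<bar>y - a\<bar> \<le> \<delta>"
    show "((\<lambda>x. f' x - c * real (k + 2) * (x - a) ^ Suc k) has_real_derivative
        f'' y - c * (real (k + 2) * real (k + 1)) * (y - a) ^ k) (at y)"
      by (rule DERIV_cong[OF DERIV_diff[OF f'[OF y] DERIV_cmult[OF pow]]]) simp
  qed (use crit in auto)
  have "\<bar>f x - f a - c * (x - a) ^ Suc (Suc k)\<bar> \<le> M * \<bar>x - a\<bar> ^ Suc (Suc (Suc k))"
  proof (rule abs_le_power_of_deriv[OF _ _ 1 M x])
    fix y assume y: "\<bar>y - a\<bar> \<le> \<delta>"
    show "((\<lambda>x. f x - f a - c * (x - a) ^ Suc (Suc k)) has_real_derivative
        f' y - c * real (k + 2) * (y - a) ^ Suc k) (at y)"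
      by (rule DERIV_cong[OF DERIV_diff[OF DERIV_diff[OF f[OF y] DERIV_const] DERIV_cmult[OF pow]]]) simp
  qed auto
  then show ?thesis by (simp add: numeral_3_eq_3)
qed

text \<open>A Lipschitz bound centred at one point, which is all that the remainder terms of the
  expansions need.\<close>

lemma differentiable_imp_lipschitz_at:
  fixes f :: "real \<Rightarrow> real"
  assumes "(f has_real_derivative D) (at a)"
  obtains M \<delta> where "M \<ge> 0" "\<delta> > 0" "\<And>x. \<bar>x - a\<bar> \<le> \<delta> \<Longrightarrow> \<bar>f x - f a\<bar> \<le> M * \<bar>x - a\<bar>"
proof -
  have "((\<lambda>x. (f x - f a) / (x - a)) \<longlongrightarrow> D) (at a)"
    using assms by (simp add: has_field_derivative_iff)
  then have "eventually (\<lambda>x. dist ((f x - f a) / (x - a)) D < 1) (at a)"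
    by (rule tendstoD) simp
  then obtain e where e: "e > 0" "\<And>x. x \<noteq> a \<Longrightarrow> dist x a < e \<Longrightarrow> dist ((f x - f a) / (x - a)) D < 1"
    unfolding eventually_at by auto
  show thesis
  proof (rule that[of "\<bar>D\<bar> + 1" "e / 2"])
    fix x assume x: "\<bar>x - a\<bar> \<le> e / 2"
    show "\<bar>f x - f a\<bar> \<le> (\<bar>D\<bar> + 1) * \<bar>x - a\<bar>"
    proof (cases "x = a")
      case False
      then have "dist ((f x - f a) / (x - a)) D < 1" using e x by (intro e(2)) (auto simp: dist_real_def)
      then have "\<bar>(f x - f a) / (x - a)\<bar> \<le> \<bar>D\<bar> + 1"
        unfolding dist_real_def by linarith
      then show ?thesis using False by (simp add: abs_divide field_simps)
    qed simp
  qed (use e in auto)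
qed

context
  fixes d :: nat and \<beta> q :: real
  assumes d: "d \<ge> 3" and \<beta>: "0 < \<beta>"
  defines "q \<equiv> exp (- 2 * \<beta>)"
begin

lemma A_fun_expansion_2:
  assumes a: "0 < a" "a < 1" and crit: "dA d \<beta> h a = 0"
  obtains M \<delta> where "M \<ge> 0" "\<delta> > 0"
    "\<And>x. \<bar>x - a\<bar> \<le> \<delta> \<Longrightarrow> \<bar>A_fun d \<beta> h x - A_fun d \<beta> h a - ddA d \<beta> a / 2 * (x - a) ^ 2\<bar> \<le> M * \<bar>x - a\<bar> ^ 3"
proof -
  obtain D where "(ddA d \<beta> has_real_derivative D) (at a)" using ddA_differentiable[OF d \<beta> a] .
  then obtain M \<delta> where M: "M \<ge> 0" "\<delta> > 0"
    "\<And>x. \<bar>x - a\<bar> \<le> \<delta> \<Longrightarrow> \<bar>ddA d \<beta> x - ddA d \<beta> a\<bar> \<le> M * \<bar>x - a\<bar>"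
    using differentiable_imp_lipschitz_at by blast
  define \<delta>' where "\<delta>' = min \<delta> (min (a / 2) ((1 - a) / 2))"
  have \<delta>': "\<delta>' > 0" "\<delta>' \<le> \<delta>" "\<delta>' \<le> a / 2" "\<delta>' \<le> (1 - a) / 2" using M a by (auto simp: \<delta>'_def min_def)
  have I: "0 < x \<and> x < 1" if "\<bar>x - a\<bar> \<le> \<delta>'" for x using that \<delta>' a by (auto simp: abs_le_iff)
  show thesis
  proof (rule that[OF M(1) \<delta>'(1)])
    fix x assume "\<bar>x - a\<bar> \<le> \<delta>'"
    then show "\<bar>A_fun d \<beta> h x - A_fun d \<beta> h a - ddA d \<beta> a / 2 * (x - a) ^ 2\<bar> \<le> M * \<bar>x - a\<bar> ^ 3"
      using expansion_of_second_derivative[of a \<delta>' "A_fun d \<beta> h" "dA d \<beta> h" "ddA d \<beta>" M "ddA d \<beta> a / 2" 0 x]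
        I A_fun_deriv[OF d \<beta>] dA_deriv[OF d \<beta>] crit M \<delta>' by (simp add: power2_eq_square)
  qed
qed

text \<open>At the critical point \<open>A'' = u \<phi>(u)\<close> with \<open>u = (1 - 2 a)\<^sup>2\<close> and \<open>\<phi>\<close> the following function.\<close>

definition critical_factor :: "real \<Rightarrow> real" where
  "critical_factor u = - 2 * (real d - 2) * (1 - q\<^sup>2) /
     ((sqrt (1 - (1 - q\<^sup>2) * u) + (1 - (1 - q\<^sup>2) * u)) * (1 - u))"

text \<open>The quotient rule spelled out, because continuity of this derivative at 0 enters the
  fourth derivative of A.\<close>

definition critical_factor_deriv :: "real \<Rightarrow> real" where
  "critical_factor_deriv u = (let c = 1 - q\<^sup>2; K = - 2 * (real d - 2) * c; r = sqrt (1 - c * u);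
     N = (r + (1 - c * u)) * (1 - u); N' = (- c * (inverse r / 2) - c) * (1 - u) - (r + (1 - c * u))
     in - (K * N') / (N * N))"

lemma qs: "0 < q" "q < 1" "0 < q\<^sup>2" "q\<^sup>2 < 1"
  using q_bounds[OF \<beta>] q2[of q] by (auto simp: q_def)

lemma critical_factor_has_deriv: assumes "\<bar>u\<bar> < 1"
  shows "(critical_factor has_real_derivative critical_factor_deriv u) (at u)"
proof -
  define c where "c = 1 - q\<^sup>2"
  define r where "r = sqrt (1 - c * u)"
  have c: "0 < c" "c < 1" using qs by (auto simp: c_def)
  have "c * u \<le> c * 1" using c assms by (intro mult_left_mono) auto
  then have pos: "0 < 1 - c * u" using c by linarith
  have r: "0 < r" using pos by (simp add: r_def)
  have "((\<lambda>u. 1 - c * u) has_real_derivative - c) (at u)" by (auto intro!: derivative_eq_intros)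
  from DERIV_chain'[OF this DERIV_real_sqrt[OF pos]]
  have 1: "((\<lambda>u. sqrt (1 - c * u)) has_real_derivative - c * (inverse r / 2)) (at u)"
    by (simp add: r_def mult.commute)
  have 2: "((\<lambda>u. sqrt (1 - c * u) + (1 - c * u)) has_real_derivative - c * (inverse r / 2) - c) (at u)"
    using DERIV_add[OF 1 DERIV_diff[OF DERIV_const[of 1] DERIV_cmult[OF DERIV_ident, of c]]] by simp
  have 3: "((\<lambda>u. 1 - u) has_real_derivative - 1) (at u)" by (auto intro!: derivative_eq_intros)
  have 4: "((\<lambda>u. (sqrt (1 - c * u) + (1 - c * u)) * (1 - u)) has_real_derivative
      (- c * (inverse r / 2) - c) * (1 - u) - (r + (1 - c * u))) (at u)"
    using DERIV_mult[OF 2 3] by (simp add: r_def algebra_simps)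
  have "(sqrt (1 - c * u) + (1 - c * u)) * (1 - u) > 0"
    using r pos assms unfolding r_def by (intro mult_pos_pos add_pos_pos) auto
  then have N: "(sqrt (1 - c * u) + (1 - c * u)) * (1 - u) \<noteq> 0" by linarith
  from DERIV_divide[OF DERIV_const[of "- 2 * (real d - 2) * c"] 4 N] show ?thesis
    unfolding critical_factor_def[abs_def] critical_factor_deriv_def Let_def c_def r_def
    by simp
qed

lemma critical_factor_deriv_cont: "isCont critical_factor_deriv 0"
  unfolding critical_factor_deriv_def[abs_def] Let_def
  by (intro continuous_intros) auto

lemma critical_factor_0: "critical_factor 0 = - (real d - 2) * (1 - q\<^sup>2)"
  by (simp add: critical_factor_def)

context
  assumes crit: "\<beta> = beta_c d"
begin

lemma ddA_critical: assumes "0 < a" "a < 1"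
  shows "ddA d \<beta> a = (1 - 2 * a)\<^sup>2 * critical_factor ((1 - 2 * a)\<^sup>2)"
proof -
  define R where "R = disc_root q a"
  define u where "u = (1 - 2 * a)\<^sup>2"
  define c where "c = 1 - q\<^sup>2"
  have R: "0 < R" "R\<^sup>2 = 1 - c * u"
    using root_bounds(3,4)[OF qs(1,2), of a] assms by (auto simp: R_def u_def c_def algebra_simps)
  have Rs: "sqrt (1 - c * u) = R" using R by (intro real_sqrt_unique) auto
  have a: "2 * a * (1 - a) = (1 - u) / 2" by (simp add: u_def power2_eq_square algebra_simps)
  have u: "1 - u > 0" using assms by (simp add: u_def power2_eq_square algebra_simps mult_pos_pos)
  have dq: "real d * q = real d - 2" using beta_less_iff(3)[OF d \<beta>] crit by (simp add: q_def)
  have "ddA d \<beta> a = (real d - 2 - (real d - 2) / R) / ((1 - u) / 2)"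
    by (simp only: ddA_def q_def[symmetric] dq R_def[symmetric] a)
  also have "\<dots> = 2 * (real d - 2) * ((R - 1) / R) / (1 - u)"
    using R(1) u by (simp add: field_simps)
  \<comment> \<open>Multiplying by \<open>R + 1\<close> exposes the factor \<open>u\<close>, since
    \<open>R\<^sup>2 - 1 = - c * u\<close>.\<close>
  also have "(R - 1) / R = - c * u / (R + R\<^sup>2)"
  proof -
    have "(R - 1) * (R + R\<^sup>2) = R * (R\<^sup>2 - 1)" by (simp add: power2_eq_square algebra_simps)
    then have "(R - 1) * (R + R\<^sup>2) = - c * u * R" using R by simp
    moreover have "R + R\<^sup>2 > 0" using R(1) by (simp add: add_pos_pos)
    ultimately show ?thesis using R(1) by (subst frac_eq_eq) auto
  qed
  also have "2 * (real d - 2) * (- c * u / (R + R\<^sup>2)) / (1 - u) = u * critical_factor u"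
  proof -
    have "critical_factor u = - 2 * (real d - 2) * c / ((R + R\<^sup>2) * (1 - u))"
      by (simp only: critical_factor_def c_def[symmetric] Rs R(2))
    moreover have "2 * D * (- c * u / P) / v = u * (- 2 * D * c / (P * v))" for D P v by simp
    ultimately show ?thesis by (simp only:)
  qed
  finally show ?thesis by (simp add: u_def)
qed

lemma deriv4_A_fun: "(deriv ^^ 4) (A_fun d \<beta> h) (1 / 2) = 8 * critical_factor 0"
proof -
  \<comment> \<open>The third derivative is \<open>\<psi> x * (x - 1 / 2)\<close>; by Caratheodory's
    criterion, continuity of \<open>\<psi>\<close> at 1/2 then gives the fourth derivative there as
    \<open>\<psi> (1 / 2)\<close>.\<close>
  define \<psi> where "\<psi> x = 8 * (critical_factor ((1 - 2 * x)\<^sup>2) + (1 - 2 * x)\<^sup>2 * critical_factor_deriv ((1 - 2 * x)\<^sup>2))" for x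
  have ev: "eventually (\<lambda>x. x \<in> {0<..<1}) (nhds x)" if "0 < x" "x < 1" for x :: real
    using that by (intro eventually_nhds_in_open) auto
  have 3: "deriv ((deriv ^^ 2) (A_fun d \<beta> h)) x = \<psi> x * (x - 1 / 2)" if x: "0 < x" "x < 1" for x
  proof -
    have "deriv ((deriv ^^ 2) (A_fun d \<beta> h)) x = deriv (\<lambda>x. (1 - 2 * x)\<^sup>2 * critical_factor ((1 - 2 * x)\<^sup>2)) x"
      by (rule deriv_cong_ev[OF eventually_mono[OF ev[OF x]]])
        (auto simp: deriv2_A_fun[OF d \<beta>] ddA_critical)
    also have "\<dots> = \<psi> x * (x - 1 / 2)"
    proof (rule DERIV_imp_deriv)
      have s: "((\<lambda>x. (1 - 2 * x)\<^sup>2) has_real_derivative - 4 * (1 - 2 * x)) (at x)"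
        by (auto intro!: derivative_eq_intros)
      have "(1 - 2 * x)\<^sup>2 < 1" using x by (simp add: abs_square_less_1)
      then have "(critical_factor has_real_derivative critical_factor_deriv ((1 - 2 * x)\<^sup>2)) (at ((1 - 2 * x)\<^sup>2))"
        by (intro critical_factor_has_deriv) auto
      from DERIV_mult[OF s DERIV_chain'[OF s this]]
      show "((\<lambda>x. (1 - 2 * x)\<^sup>2 * critical_factor ((1 - 2 * x)\<^sup>2)) has_real_derivative \<psi> x * (x - 1 / 2)) (at x)"
        by (rule DERIV_cong) (simp add: \<psi>_def algebra_simps)
    qed
    finally show ?thesis .
  qed
  have "isCont (\<lambda>x. critical_factor ((1 - 2 * x)\<^sup>2)) (1 / 2)"
    by (rule isCont_o2[where g = critical_factor])
      (auto intro!: continuous_intros DERIV_isCont[OF critical_factor_has_deriv])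
  moreover have "isCont (\<lambda>x. critical_factor_deriv ((1 - 2 * x)\<^sup>2)) (1 / 2)"
    by (rule isCont_o2[where g = critical_factor_deriv])
      (auto intro!: continuous_intros critical_factor_deriv_cont)
  ultimately have cont: "isCont \<psi> (1 / 2)"
    unfolding \<psi>_def by (intro continuous_intros)
  have "((\<lambda>x. \<psi> x * (x - 1 / 2)) has_real_derivative \<psi> (1 / 2)) (at (1 / 2))"
    using cont by (auto simp: CARAT_DERIV intro!: exI[of _ \<psi>])
  moreover have "deriv (deriv ((deriv ^^ 2) (A_fun d \<beta> h))) (1 / 2) = deriv (\<lambda>x. \<psi> x * (x - 1 / 2)) (1 / 2)"
    by (rule deriv_cong_ev[OF eventually_mono[OF ev[of "1 / 2"]]]) (auto simp: 3)
  ultimately have "deriv (deriv ((deriv ^^ 2) (A_fun d \<beta> h))) (1 / 2) = \<psi> (1 / 2)"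
    using DERIV_imp_deriv by simp
  then show ?thesis by (simp add: \<psi>_def numeral_eq_Suc)
qed

lemma critical_factor_neg: "critical_factor 0 < 0"
proof -
  have "2 - real d < 0" using d by simp
  then show ?thesis using qs by (simp add: critical_factor_0 mult_neg_pos)
qed

text \<open>With u = 4 (x - 1/2)^2 the leading term of A'' is 4 (x - 1/2)^2 times
  \<open>critical_factor 0\<close>; two integrations divide the coefficient by 12.\<close>

lemma A_fun_expansion_4:
  obtains M \<delta> where "M \<ge> 0" "\<delta> > 0"
    "\<And>x. \<bar>x - 1 / 2\<bar> \<le> \<delta> \<Longrightarrow> \<bar>A_fun d \<beta> 0 x - A_fun d \<beta> 0 (1 / 2) -
       critical_factor 0 / 3 * (x - 1 / 2) ^ 4\<bar> \<le> M * \<bar>x - 1 / 2\<bar> ^ 5"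
proof -
  obtain M \<delta> where M: "M \<ge> 0" "\<delta> > 0"
    "\<And>u. \<bar>u\<bar> \<le> \<delta> \<Longrightarrow> \<bar>critical_factor u - critical_factor 0\<bar> \<le> M * \<bar>u\<bar>"
    using differentiable_imp_lipschitz_at[OF critical_factor_has_deriv[of 0]] by auto
  \<comment> \<open>Ensures \<open>4 * t\<^sup>2 \<le> \<delta>\<close> for
    \<open>t \<le> e\<close>, because \<open>t\<^sup>2 \<le> t\<close>.\<close>
  define e where "e = min (1 / 4) (\<delta> / 4)"
  have e: "0 < e" "e \<le> 1 / 4" "4 * e \<le> \<delta>" using M by (auto simp: e_def)
  have I: "0 < x \<and> x < 1" if "\<bar>x - 1 / 2\<bar> \<le> e" for x using that e by (auto simp: abs_le_iff)
  have bound: "\<bar>ddA d \<beta> x - critical_factor 0 / 3 * (real (2 + 2) * real (2 + 1)) * (x - 1 / 2) ^ 2\<bar>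
      \<le> 16 * M * \<bar>x - 1 / 2\<bar> ^ Suc 2" if x: "\<bar>x - 1 / 2\<bar> \<le> e" for x
  proof -
    define t where "t = \<bar>x - 1 / 2\<bar>"
    have u: "(1 - 2 * x)\<^sup>2 = 4 * t\<^sup>2" by (simp add: t_def power2_eq_square algebra_simps)
    have t: "0 \<le> t" "t \<le> e" "t \<le> 1" using x e by (auto simp: t_def)
    have "t\<^sup>2 \<le> t" using t by (simp add: power2_eq_square mult_left_le)
    then have "\<bar>critical_factor (4 * t\<^sup>2) - critical_factor 0\<bar> \<le> M * \<bar>4 * t\<^sup>2\<bar>"
      using t e by (intro M) auto
    then have "4 * t\<^sup>2 * \<bar>critical_factor (4 * t\<^sup>2) - critical_factor 0\<bar> \<le> 4 * t\<^sup>2 * (M * (4 * t\<^sup>2))"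
      by (intro mult_left_mono) auto
    also have "\<dots> = 16 * M * (t ^ 3 * t)" by (simp add: power2_eq_square power3_eq_cube)
    also have "\<dots> \<le> 16 * M * (t ^ 3 * 1)" using t M by (intro mult_left_mono) auto
    finally have *: "4 * t\<^sup>2 * \<bar>critical_factor (4 * t\<^sup>2) - critical_factor 0\<bar> \<le> 16 * M * t ^ 3" by simp
    have "ddA d \<beta> x - critical_factor 0 / 3 * (real (2 + 2) * real (2 + 1)) * (x - 1 / 2) ^ 2 =
        4 * t\<^sup>2 * (critical_factor (4 * t\<^sup>2) - critical_factor 0)"
    proof -
      have t2: "(x - 1 / 2)\<^sup>2 = t\<^sup>2" by (simp add: t_def)
      have A2x: "ddA d \<beta> x = (1 - 2 * x)\<^sup>2 * critical_factor ((1 - 2 * x)\<^sup>2)"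
        by (rule ddA_critical) (use I[OF x] in auto)
      show ?thesis unfolding A2x u t2 by (simp add: algebra_simps)
    qed
    then have "\<bar>ddA d \<beta> x - critical_factor 0 / 3 * (real (2 + 2) * real (2 + 1)) * (x - 1 / 2) ^ 2\<bar> =
        4 * t\<^sup>2 * \<bar>critical_factor (4 * t\<^sup>2) - critical_factor 0\<bar>"
      by (simp add: abs_mult)
    then show ?thesis using * by (simp add: t_def numeral_3_eq_3)
  qed
  show thesis
  proof (rule that[of "16 * M" e])
    fix x assume x: "\<bar>x - 1 / 2\<bar> \<le> e"
    show "\<bar>A_fun d \<beta> 0 x - A_fun d \<beta> 0 (1 / 2) - critical_factor 0 / 3 * (x - 1 / 2) ^ 4\<bar>
        \<le> 16 * M * \<bar>x - 1 / 2\<bar> ^ 5"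
      using expansion_of_second_derivative[of "1 / 2" e "A_fun d \<beta> 0" "dA d \<beta> 0" "ddA d \<beta>" "16 * M"
          "critical_factor 0 / 3" 2 x] bound x I A_fun_deriv[OF d \<beta>] dA_deriv[OF d \<beta>] dA_half[OF d \<beta>, of 0] M
      by simp
  qed (use M e in auto)
qed

end

text \<open>A Taylor bound uniform on a compact subinterval, where A'' is bounded. With
  \<open>b - a = 1 / n\<close> it turns A' into an increment of n A up to O(1/n).\<close>

lemma A_fun_linear_approx:
  assumes \<epsilon>: "0 < \<epsilon>"
  obtains M where "M \<ge> 0" "\<And>a b. \<epsilon> \<le> a \<Longrightarrow> a \<le> b \<Longrightarrow> b \<le> 1 - \<epsilon> \<Longrightarrow>
    \<bar>A_fun d \<beta> h b - A_fun d \<beta> h a - dA d \<beta> h a * (b - a)\<bar> \<le> M * (b - a)\<^sup>2"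
proof -
  have "compact (ddA d \<beta> ` {\<epsilon>..1 - \<epsilon>})"
    using \<epsilon> by (intro compact_continuous_image continuous_on_subset[OF continuous_on_ddA[OF d \<beta>]]) auto
  from compact_imp_bounded[OF this]
  obtain M where M: "\<forall>x\<in>{\<epsilon>..1 - \<epsilon>}. \<bar>ddA d \<beta> x\<bar> \<le> M"
    unfolding bounded_iff by auto
  show thesis
  proof (rule that[of "max M 0"])
    fix a b assume ab: "\<epsilon> \<le> a" "a \<le> b" "b \<le> 1 - \<epsilon>"
    have 1: "norm (dA d \<beta> h x - dA d \<beta> h a) \<le> max M 0 * norm (x - a)" if "x \<in> {a..b}" for x
    proof (rule field_differentiable_bound[of "{a..b}" _ "ddA d \<beta>"])
      fix y assume "y \<in> {a..b}"
      then have y: "0 < y" "y < 1" "y \<in> {\<epsilon>..1 - \<epsilon>}" using ab \<epsilon> by auto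
      show "(dA d \<beta> h has_field_derivative ddA d \<beta> y) (at y within {a..b})"
        by (rule has_field_derivative_at_within[OF dA_deriv[OF d \<beta> y(1,2)]])
      show "norm (ddA d \<beta> y) \<le> max M 0" using bspec[OF M y(3)] by auto
    qed (use that in auto)
    have "norm ((\<lambda>x. A_fun d \<beta> h x - dA d \<beta> h a * x) b - (\<lambda>x. A_fun d \<beta> h x - dA d \<beta> h a * x) a)
        \<le> (max M 0 * (b - a)) * norm (b - a)"
    proof (rule field_differentiable_bound[of "{a..b}" _ "\<lambda>x. dA d \<beta> h x - dA d \<beta> h a"])
      fix x assume x: "x \<in> {a..b}"
      show "((\<lambda>x. A_fun d \<beta> h x - dA d \<beta> h a * x) has_field_derivative dA d \<beta> h x - dA d \<beta> h a)
          (at x within {a..b})"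
      proof -
        have "0 < x" "x < 1" using x ab \<epsilon> by auto
        from DERIV_diff[OF A_fun_deriv[OF d \<beta> this] DERIV_cmult_Id]
        show ?thesis by (rule has_field_derivative_at_within)
      qed
      have "norm (dA d \<beta> h x - dA d \<beta> h a) \<le> max M 0 * norm (x - a)" by (rule 1[OF x])
      also have "\<dots> \<le> max M 0 * (b - a)" using x by (intro mult_left_mono) auto
      finally show "norm (dA d \<beta> h x - dA d \<beta> h a) \<le> max M 0 * (b - a)" .
    qed (use ab in auto)
    then show "\<bar>A_fun d \<beta> h b - A_fun d \<beta> h a - dA d \<beta> h a * (b - a)\<bar> \<le> max M 0 * (b - a)\<^sup>2"
      using ab by (simp add: algebra_simps power2_eq_square)
  qed simp
qed

end

section \<open>Weights of the magnetization levels\<close>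

definition cut_sum :: "nat \<Rightarrow> nat \<Rightarrow> real \<Rightarrow> nat set \<Rightarrow> real" where
  "cut_sum d n q S = (\<Sum>E\<in>regular_graphs d n. q ^ cut_size S E)"

text \<open>The total weight of the configurations with \<open>k\<close> plus spins, up to a factor
  common to all levels (\<open>annealed_weight_eq\<close>).\<close>

definition level_weight :: "nat \<Rightarrow> nat \<Rightarrow> real \<Rightarrow> real \<Rightarrow> nat \<Rightarrow> real" where
  "level_weight d n \<beta> h k =
     exp (2 * h * real k) * (\<Sum>S | S \<subseteq> {..<n} \<and> card S = k. cut_sum d n (exp (- 2 * \<beta>)) S)"

lemma finite_level: "finite {S :: nat set. S \<subseteq> {..<n} \<and> card S = k}"
  by (rule finite_subset[of _ "Pow {..<n}"]) auto

lemma cut_sum_pos: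
  assumes "regular_graphs d n \<noteq> {}" "0 < q"
  shows "0 < cut_sum d n q S"
  unfolding cut_sum_def using assms by (intro sum_pos finite_regular_graphs) auto

lemma level_weight_nonneg: "0 \<le> level_weight d n \<beta> h k"
  unfolding level_weight_def cut_sum_def by (intro mult_nonneg_nonneg sum_nonneg) auto

lemma level_weight_pos:
  assumes "regular_graphs d n \<noteq> {}" "k \<le> n"
  shows "0 < level_weight d n \<beta> h k"
proof -
  have "{..<k} \<in> {S. S \<subseteq> {..<n} \<and> card S = k}" using assms by auto
  then have "{S. S \<subseteq> {..<n} \<and> card S = k} \<noteq> {}" by blast
  then show ?thesis
    unfolding level_weight_def using assms
    by (intro mult_pos_pos sum_pos finite_level cut_sum_pos) auto
qed

text \<open>Counts the pairs of a set and one of its elements, by the larger set or by the set with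
  that element removed.\<close>

lemma sum_level_insert:
  fixes f :: "nat set \<Rightarrow> real"
  shows "real (Suc k) * (\<Sum>T | T \<subseteq> {..<n} \<and> card T = Suc k. f T) =
    (\<Sum>S | S \<subseteq> {..<n} \<and> card S = k. \<Sum>v\<in>{..<n} - S. f (insert v S))"
proof -
  have fin: "T \<subseteq> {..<n} \<Longrightarrow> finite T" for T :: "nat set" using finite_subset by blast
  have "real (Suc k) * (\<Sum>T | T \<subseteq> {..<n} \<and> card T = Suc k. f T) =
      (\<Sum>T | T \<subseteq> {..<n} \<and> card T = Suc k. \<Sum>v\<in>T. f T)"
    by (simp add: sum_distrib_left)
  also have "\<dots> = (\<Sum>(T, v)\<in>Sigma {T. T \<subseteq> {..<n} \<and> card T = Suc k} (\<lambda>T. T). f T)"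
    by (rule sum.Sigma) (use finite_level fin in auto)
  also have "\<dots> = (\<Sum>(S, v)\<in>Sigma {S. S \<subseteq> {..<n} \<and> card S = k} (\<lambda>S. {..<n} - S). f (insert v S))"
    by (rule sum.reindex_bij_witness[of _ "\<lambda>(S, v). (insert v S, v)" "\<lambda>(T, v). (T - {v}, v)"])
      (use fin in \<open>auto simp: insert_absorb\<close>)
  also have "\<dots> = (\<Sum>S | S \<subseteq> {..<n} \<and> card S = k. \<Sum>v\<in>{..<n} - S. f (insert v S))"
    by (rule sum.Sigma[symmetric]) (use finite_level in auto)
  finally show ?thesis .
qed

lemma level_weight_Suc:
  "real (Suc k) * level_weight d n \<beta> h (Suc k) = exp (2 * h) * exp (2 * h * real k) *
     (\<Sum>S | S \<subseteq> {..<n} \<and> card S = k. \<Sum>v\<in>{..<n} - S. cut_sum d n (exp (- 2 * \<beta>)) (insert v S))"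
  unfolding level_weight_def sum_level_insert[symmetric]
  by (simp add: mult_ac distrib_left flip: exp_add)

lemma card_compl: "S \<subseteq> {..<n} \<Longrightarrow> card S = k \<Longrightarrow> real (card ({..<n} - S)) = real n - real k"
  using card_mono[of "{..<n}" S] finite_subset[of S "{..<n}"]
  by (simp add: card_Diff_subset of_nat_diff)

text \<open>Bounds for adding a single vertex pass to the levels with the combinatorial factor
  \<open>(n - k) / (k + 1)\<close>, the source of the entropy in A.\<close>

lemma level_weight_ratio_bounds:
  assumes lo: "\<And>S v. S \<subseteq> {..<n} \<Longrightarrow> card S = k \<Longrightarrow> v < n \<Longrightarrow> v \<notin> S \<Longrightarrow>
      c * cut_sum d n (exp (- 2 * \<beta>)) S \<le> cut_sum d n (exp (- 2 * \<beta>)) (insert v S)"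
    and up: "\<And>S v. S \<subseteq> {..<n} \<Longrightarrow> card S = k \<Longrightarrow> v < n \<Longrightarrow> v \<notin> S \<Longrightarrow>
      cut_sum d n (exp (- 2 * \<beta>)) (insert v S) \<le> c' * cut_sum d n (exp (- 2 * \<beta>)) S"
  shows "exp (2 * h) * (real n - real k) * c * level_weight d n \<beta> h k \<le> real (Suc k) * level_weight d n \<beta> h (Suc k)"
    and "real (Suc k) * level_weight d n \<beta> h (Suc k) \<le> exp (2 * h) * (real n - real k) * c' * level_weight d n \<beta> h k"
proof -
  let ?L = "{S. S \<subseteq> {..<n} \<and> card S = k}" and ?Z = "cut_sum d n (exp (- 2 * \<beta>))"
  have eq: "(\<Sum>S\<in>?L. \<Sum>v\<in>{..<n} - S. a * ?Z S) = (real n - real k) * a * (\<Sum>S\<in>?L. ?Z S)" for a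
    unfolding sum_distrib_left by (intro sum.cong refl) (auto simp: card_compl)
  have "(real n - real k) * c * (\<Sum>S\<in>?L. ?Z S) \<le> (\<Sum>S\<in>?L. \<Sum>v\<in>{..<n} - S. ?Z (insert v S))"
    unfolding eq[symmetric] using lo by (intro sum_mono) auto
  from mult_left_mono[OF this, of "exp (2 * h) * exp (2 * h * real k)"]
  show "exp (2 * h) * (real n - real k) * c * level_weight d n \<beta> h k \<le> real (Suc k) * level_weight d n \<beta> h (Suc k)"
    unfolding level_weight_Suc by (simp add: level_weight_def mult_ac)
  have "(\<Sum>S\<in>?L. \<Sum>v\<in>{..<n} - S. ?Z (insert v S)) \<le> (real n - real k) * c' * (\<Sum>S\<in>?L. ?Z S)"
    unfolding eq[symmetric] using up by (intro sum_mono) auto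
  from mult_left_mono[OF this, of "exp (2 * h) * exp (2 * h * real k)"]
  show "real (Suc k) * level_weight d n \<beta> h (Suc k) \<le> exp (2 * h) * (real n - real k) * c' * level_weight d n \<beta> h k"
    unfolding level_weight_Suc by (simp add: level_weight_def mult_ac)
qed

text \<open>Adding a vertex changes the cut by at most \<open>d\<close>. The bound is crude but
  uniform up to the ends of the range of levels.\<close>

lemma cut_sum_insert_crude:
  assumes q: "0 < q" "q < 1" and S: "S \<subseteq> {..<n}" "v < n" "v \<notin> S"
  shows "q ^ d * cut_sum d n q S \<le> cut_sum d n q (insert v S)"
    and "cut_sum d n q (insert v S) \<le> (1 / q) ^ d * cut_sum d n q S"
proof -
  have *: "cut_size (insert v S) E \<le> cut_size S E + d" "cut_size S E \<le> cut_size (insert v S) E + d"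
    if "E \<in> regular_graphs d n" for E
    using cut_insert[OF that S(1) refl S(2,3)] link_le[OF that S(1) refl S(2,3)] by linarith+
  show "q ^ d * cut_sum d n q S \<le> cut_sum d n q (insert v S)"
    unfolding cut_sum_def sum_distrib_left
  proof (rule sum_mono)
    fix E assume "E \<in> regular_graphs d n"
    then have "q ^ (cut_size S E + d) \<le> q ^ cut_size (insert v S) E"
      using q * by (intro power_decreasing) auto
    then show "q ^ d * q ^ cut_size S E \<le> q ^ cut_size (insert v S) E"
      by (simp add: power_add mult.commute)
  qed
  show "cut_sum d n q (insert v S) \<le> (1 / q) ^ d * cut_sum d n q S"
    unfolding cut_sum_def sum_distrib_left
  proof (rule sum_mono)
    fix E assume "E \<in> regular_graphs d n"
    then have "q ^ (cut_size (insert v S) E + d) \<le> q ^ cut_size S E"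
      using q * by (intro power_decreasing) auto
    then show "q ^ cut_size (insert v S) E \<le> (1 / q) ^ d * q ^ cut_size S E"
      using q by (simp add: power_add power_one_over field_simps)
  qed
qed

text \<open>Invariance under flipping all spins at zero field: a set and its complement have the
  same cut.\<close>

lemma level_weight_compl:
  assumes "k \<le> n"
  shows "level_weight d n \<beta> 0 (n - k) = level_weight d n \<beta> 0 k"
proof -
  have cut: "cut_size ({..<n} - S) E = cut_size S E" if "S \<subseteq> {..<n}" "E \<in> regular_graphs d n" for S E
  proof -
    have "arcs ({..<n} - S) (- ({..<n} - S)) E = arcs (- S) S E"
      using that(1) by (auto simp: arcs_def dest: regular_graph_edge[OF that(2)])
    then show ?thesis unfolding cut_size_def by (simp add: arcs_swap[of S "- S"])
  qed
  have fin: "finite S" if "S \<subseteq> {..<n}" for S :: "nat set" using that finite_subset by blast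
  have card: "card S \<le> n" if "S \<subseteq> {..<n}" for S :: "nat set"
    using card_mono[OF _ that] by simp
  have "(\<Sum>S | S \<subseteq> {..<n} \<and> card S = n - k. cut_sum d n (exp (- 2 * \<beta>)) S) =
      (\<Sum>S | S \<subseteq> {..<n} \<and> card S = k. cut_sum d n (exp (- 2 * \<beta>)) S)"
    by (rule sum.reindex_bij_witness[of _ "\<lambda>S. {..<n} - S" "\<lambda>S. {..<n} - S"])
      (use assms fin card in \<open>auto simp: double_diff card_Diff_subset cut_sum_def cut intro!: sum.cong\<close>)
  then show ?thesis by (simp add: level_weight_def)
qed

lemma abs_ln_le:
  fixes x t :: real
  assumes "\<bar>x - 1\<bar> \<le> t" "t \<le> 1 / 2"
  shows "\<bar>ln x\<bar> \<le> 2 * t"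
proof -
  have x: "x \<ge> 1 / 2" using assms by linarith
  have "ln x \<le> x - 1" using x by (intro ln_le_minus_one) auto
  moreover have "ln (1 / x) \<le> 1 / x - 1" using x by (intro ln_le_minus_one) auto
  moreover have "1 / x - 1 \<le> 2 * t"
  proof -
    have "1 - x \<le> t * (2 * x)" using assms x mult_left_mono[of 1 "2 * x" t] by linarith
    then show ?thesis using x by (simp add: field_simps)
  qed
  moreover have "ln (1 / x) = - ln x" using x by (simp add: ln_div)
  ultimately show ?thesis using assms by linarith
qed

context
  fixes d :: nat and \<beta> h :: real
  assumes d: "d \<ge> 3" and \<beta>: "0 < \<beta>"
begin

text \<open>The predicted ratio is the product of \<open>exp (2 * h)\<close>, the combinatorial
  \<open>(n - k) / (k + 1)\<close> and \<open>\<rho>\<close>, whose logarithms give the three terms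
  of \<open>dA\<close>. Keeping \<open>k / n\<close> away from 0 and 1 makes all errors
  O(1/n).\<close>

lemma level_weight_ratio:
  assumes \<epsilon>: "0 < \<epsilon>"
  obtains C N where "C \<ge> 0" "\<And>n k. n \<ge> N \<Longrightarrow> regular_graphs d n \<noteq> {} \<Longrightarrow>
    \<epsilon> * real n \<le> real k \<Longrightarrow> real k \<le> (1 - \<epsilon>) * real n \<Longrightarrow>
    \<bar>ln (level_weight d n \<beta> h (Suc k)) - ln (level_weight d n \<beta> h k) - dA d \<beta> h (real k / real n)\<bar>
      \<le> C / real n"
proof -
  define q where "q = exp (- 2 * \<beta>)"
  have q: "0 < q" "q < 1" using q_bounds[OF \<beta>] by (auto simp: q_def)
  have d1: "1 \<le> d" using d by simp
  obtain K where K: "K \<ge> 0" and ratio: "\<And>n k S v m0. \<lbrakk>S \<subseteq> {..<n}; card S = k; v < n; v \<notin> S; 0 \<le> m0;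
     m0 \<le> real d * (real n - real k);
     q\<^sup>2 * (real d * real k - m0) * (real d * (real n - real k) - m0) = m0\<^sup>2\<rbrakk> \<Longrightarrow>
     \<bar>cut_sum d n q (insert v S) -
       (q * (1 - m0 / (real d * (real n - real k))) + m0 / (real d * (real n - real k)) / q) ^ d *
         cut_sum d n q S\<bar>
     \<le> K / (real n - real k) *
       ((q * (1 - m0 / (real d * (real n - real k))) + m0 / (real d * (real n - real k)) / q) ^ d *
         cut_sum d n q S)"
    using cut_ratio[OF q d1] unfolding cut_sum_def by blast
  \<comment> \<open>Large enough for both relative errors, \<open>\<theta>\<close> and
    \<open>1 / (\<epsilon> * n)\<close>, to be at most 1/2, as \<open>abs_ln_le\<close>
    requires.\<close>
  define N where "N = nat \<lceil>2 * K / \<epsilon>\<rceil> + nat \<lceil>2 / \<epsilon>\<rceil> + 1"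
  show thesis
  proof (rule that[of "2 * K / \<epsilon> + 2 / \<epsilon>" N])
    show "0 \<le> 2 * K / \<epsilon> + 2 / \<epsilon>" using K \<epsilon> by simp
    fix n k assume n: "n \<ge> N" and R: "regular_graphs d n \<noteq> {}"
      and k: "\<epsilon> * real n \<le> real k" "real k \<le> (1 - \<epsilon>) * real n"
    have n0: "real n > 0" and nK: "2 * K / \<epsilon> \<le> real n" "2 / \<epsilon> \<le> real n"
      using n unfolding N_def by linarith+
    define a where "a = real k / real n"
    have en: "0 < \<epsilon> * real n" using \<epsilon> n0 by simp
    have "(1 - \<epsilon>) * real n = real n - \<epsilon> * real n" by (simp add: algebra_simps)
    then have a: "0 < a" "a < 1" using en k n0 by (auto simp: a_def)
    have k0: "real k > 0" "real k < real n" using a n0 by (auto simp: a_def field_simps)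
    have nk: "real n - real k \<ge> \<epsilon> * real n" using k by (simp add: algebra_simps)
    define \<rho> where "\<rho> = exp (real d * slope q a)"
    have \<rho>: "\<rho> > 0" by (simp add: \<rho>_def)
    define m0 where "m0 = real d * real n * crossing q a"
    note X = crossing_eq[OF q a]
    have m0: "0 \<le> m0" "m0 \<le> real d * (real n - real k)"
      "q\<^sup>2 * (real d * real k - m0) * (real d * (real n - real k) - m0) = m0\<^sup>2"
      "m0 / (real d * (real n - real k)) = crossing q a / (1 - a)"
    proof -
      have ka: "real k = real n * a" using n0 by (simp add: a_def)
      show "0 \<le> m0" using X(1) by (simp add: m0_def)
      have "real d * real n * crossing q a \<le> real d * real n * (1 - a)"
        using X(3) by (intro mult_left_mono) auto
      then show "m0 \<le> real d * (real n - real k)" by (simp add: m0_def ka algebra_simps)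
      have "q\<^sup>2 * (real d * real k - m0) * (real d * (real n - real k) - m0) =
          (real d * real n)\<^sup>2 * (q\<^sup>2 * (a - crossing q a) * (1 - a - crossing q a))"
        unfolding m0_def ka by (simp add: power2_eq_square algebra_simps)
      then show "q\<^sup>2 * (real d * real k - m0) * (real d * (real n - real k) - m0) = m0\<^sup>2"
        unfolding X(4) by (simp add: m0_def power_mult_distrib)
      have "real d * (real n - real k) = real d * real n * (1 - a)" by (simp add: ka algebra_simps)
      then show "m0 / (real d * (real n - real k)) = crossing q a / (1 - a)"
        using n0 d by (simp add: m0_def)
    qed
    have \<rho>_eq: "(q * (1 - m0 / (real d * (real n - real k))) + m0 / (real d * (real n - real k)) / q) ^ d = \<rho>"
      unfolding m0(4) X(5) by (simp add: \<rho>_def exp_of_nat_mult)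
    define \<theta> where "\<theta> = K / (\<epsilon> * real n)"
    have \<theta>: "0 \<le> \<theta>" "\<theta> \<le> 1 / 2" using K \<epsilon> n0 nK by (auto simp: \<theta>_def field_simps)
    have Z: "\<bar>cut_sum d n q (insert v S) - \<rho> * cut_sum d n q S\<bar> \<le> \<theta> * (\<rho> * cut_sum d n q S)"
      if "S \<subseteq> {..<n}" "card S = k" "v < n" "v \<notin> S" for S v
    proof -
      have "\<bar>cut_sum d n q (insert v S) - \<rho> * cut_sum d n q S\<bar> \<le> K / (real n - real k) * (\<rho> * cut_sum d n q S)"
        using ratio[OF that m0(1-3)] unfolding \<rho>_eq .
      also have "\<dots> \<le> \<theta> * (\<rho> * cut_sum d n q S)"
        unfolding \<theta>_def using K nk \<epsilon> n0 k0 \<rho> cut_sum_pos[OF R q(1), of S]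
        by (intro mult_right_mono divide_left_mono mult_pos_pos) auto
      finally show ?thesis .
    qed
    define L where "L = level_weight d n \<beta> h k"
    define L' where "L' = level_weight d n \<beta> h (Suc k)"
    have L: "0 < L" "0 < L'" using k0 by (auto simp: L_def L'_def intro!: level_weight_pos[OF R])
    define \<mu> where "\<mu> = exp (2 * h) * (real n - real k) * \<rho> / real (Suc k)"
    have \<mu>: "\<mu> > 0" using k0 \<rho> by (simp add: \<mu>_def)
    have b: "exp (2 * h) * (real n - real k) * ((1 - \<theta>) * \<rho>) * L \<le> real (Suc k) * L'"
      "real (Suc k) * L' \<le> exp (2 * h) * (real n - real k) * ((1 + \<theta>) * \<rho>) * L"
      unfolding L_def L'_def
      by (rule level_weight_ratio_bounds[of n k "(1 - \<theta>) * \<rho>" d \<beta> "(1 + \<theta>) * \<rho>", folded q_def];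
          use Z in \<open>force simp: abs_le_iff algebra_simps\<close>)+
    have "\<bar>L' / (\<mu> * L) - 1\<bar> \<le> \<theta>"
    proof -
      have "(1 - \<theta>) * (\<mu> * L) \<le> L'" "L' \<le> (1 + \<theta>) * (\<mu> * L)"
        using b unfolding \<mu>_def by (simp_all add: field_simps del: of_nat_Suc)
      then have "1 - \<theta> \<le> L' / (\<mu> * L)" "L' / (\<mu> * L) \<le> 1 + \<theta>"
        using \<mu> L by (auto simp: pos_le_divide_eq pos_divide_le_eq)
      then show ?thesis by linarith
    qed
    then have 1: "\<bar>ln (L' / (\<mu> * L))\<bar> \<le> 2 * \<theta>" using \<theta> by (intro abs_ln_le) auto
    \<comment> \<open>\<open>dA\<close> contains \<open>(1 - a) / a\<close>, that is
      \<open>(n - k) / k\<close>, in place of \<open>(n - k) / (k + 1)\<close>; the correction is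
      O(1/n).\<close>
    have "\<bar>real k / real (Suc k) - 1\<bar> \<le> 1 / (\<epsilon> * real n)"
    proof -
      have "real k / real (Suc k) - 1 = - (1 / real (Suc k))" by (simp add: field_simps)
      moreover have "1 / real (Suc k) \<le> 1 / (\<epsilon> * real n)"
        using k \<epsilon> n0 by (intro divide_left_mono mult_pos_pos) auto
      ultimately show ?thesis by simp
    qed
    then have 2: "\<bar>ln (real k / real (Suc k))\<bar> \<le> 2 * (1 / (\<epsilon> * real n))"
      using \<epsilon> nK n0 by (intro abs_ln_le) (auto simp: field_simps)
    have dA: "dA d \<beta> h a = 2 * h + ln \<rho> + ln ((1 - a) / a)"
      by (simp add: dA_def \<rho>_def q_def)
    have "\<mu> = exp (2 * h) * \<rho> * ((1 - a) / a) * (real k / real (Suc k))"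
    proof -
      have "(1 - a) / a = (real n - real k) / real k" using n0 k0 by (simp add: a_def field_simps)
      then show ?thesis using k0 unfolding \<mu>_def by simp
    qed
    moreover have "(1 - a) / a > 0" "real k / real (Suc k) > 0" using a k0 by auto
    ultimately have "ln \<mu> = dA d \<beta> h a + ln (real k / real (Suc k))"
    proof -
      assume \<mu>: "\<mu> = exp (2 * h) * \<rho> * ((1 - a) / a) * (real k / real (Suc k))"
        and pos: "(1 - a) / a > 0" "real k / real (Suc k) > 0"
      have "ln (exp (2 * h) * \<rho> * y * z) = 2 * h + ln \<rho> + ln y + ln z" if "y > 0" "z > 0" for y z
        using that \<rho> by (simp add: ln_mult_pos)
      from this[OF pos] show ?thesis unfolding dA \<mu> .
    qed
    moreover have "ln (L' / (\<mu> * L)) = ln L' - ln L - ln \<mu>"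
      using L \<mu> by (simp add: ln_div ln_mult_pos)
    ultimately have "\<bar>ln L' - ln L - dA d \<beta> h a\<bar> \<le> 2 * \<theta> + 2 * (1 / (\<epsilon> * real n))"
      using 1 2 by linarith
    also have "\<dots> = (2 * K / \<epsilon> + 2 / \<epsilon>) / real n"
      using \<epsilon> n0 by (simp add: \<theta>_def field_simps)
    finally show "\<bar>ln (level_weight d n \<beta> h (Suc k)) - ln (level_weight d n \<beta> h k) - dA d \<beta> h (real k / real n)\<bar>
      \<le> (2 * K / \<epsilon> + 2 / \<epsilon>) / real n"
      by (simp add: L_def L'_def a_def)
  qed
qed

lemma level_weight_asymp:
  assumes \<epsilon>: "0 < \<epsilon>"
  obtains C N where "C \<ge> 0" "\<And>n k k'. n \<ge> N \<Longrightarrow> regular_graphs d n \<noteq> {} \<Longrightarrow>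
    \<epsilon> * real n \<le> real k \<Longrightarrow> k \<le> k' \<Longrightarrow> real k' \<le> (1 - \<epsilon>) * real n \<Longrightarrow>
    \<bar>ln (level_weight d n \<beta> h k') - ln (level_weight d n \<beta> h k) -
       real n * (A_fun d \<beta> h (real k' / real n) - A_fun d \<beta> h (real k / real n))\<bar>
      \<le> C * (real k' - real k) / real n"
proof -
  obtain C N where C: "C \<ge> 0" and ratio: "\<And>n k. n \<ge> N \<Longrightarrow> regular_graphs d n \<noteq> {} \<Longrightarrow>
    \<epsilon> * real n \<le> real k \<Longrightarrow> real k \<le> (1 - \<epsilon>) * real n \<Longrightarrow>
    \<bar>ln (level_weight d n \<beta> h (Suc k)) - ln (level_weight d n \<beta> h k) - dA d \<beta> h (real k / real n)\<bar>
      \<le> C / real n"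
    using level_weight_ratio[OF \<epsilon>] by blast
  obtain M where M: "M \<ge> 0" and lin: "\<And>a b. \<epsilon> \<le> a \<Longrightarrow> a \<le> b \<Longrightarrow> b \<le> 1 - \<epsilon> \<Longrightarrow>
    \<bar>A_fun d \<beta> h b - A_fun d \<beta> h a - dA d \<beta> h a * (b - a)\<bar> \<le> M * (b - a)\<^sup>2"
    using A_fun_linear_approx[OF d \<beta> \<epsilon>, of h] by blast
  show thesis
  proof (rule that[of "C + M" "max N 1"])
    show "0 \<le> C + M" using C M by simp
    fix n k k' assume n: "n \<ge> max N 1" and R: "regular_graphs d n \<noteq> {}"
      and k: "\<epsilon> * real n \<le> real k" and le: "k \<le> k'" and k': "real k' \<le> (1 - \<epsilon>) * real n"
    have n0: "real n > 0" using n by simp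
    \<comment> \<open>The discrepancy between the logarithmic weight and n A; it moves by O(1/n)
      from one level to the next.\<close>
    define D where "D j = ln (level_weight d n \<beta> h j) - real n * A_fun d \<beta> h (real j / real n)" for j
    have step: "\<bar>D (Suc j) - D j\<bar> \<le> (C + M) / real n" if j: "k \<le> j" "j < k'" for j
    proof -
      have b: "\<epsilon> * real n \<le> real j" "real (Suc j) \<le> (1 - \<epsilon>) * real n" using j k k' by linarith+
      have "\<epsilon> \<le> real j / real n" "real (Suc j) / real n \<le> 1 - \<epsilon>"
        using b n0 by (auto simp: pos_le_divide_eq pos_divide_le_eq)
      moreover have "real j / real n \<le> real (Suc j) / real n" using n0 by (simp add: divide_right_mono)
      moreover have "real (Suc j) / real n - real j / real n = 1 / real n" by (simp add: add_divide_distrib)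
      ultimately have "\<bar>A_fun d \<beta> h (real (Suc j) / real n) - A_fun d \<beta> h (real j / real n)
          - dA d \<beta> h (real j / real n) * (1 / real n)\<bar> \<le> M * (1 / real n)\<^sup>2"
        using lin[of "real j / real n" "real (Suc j) / real n"] by simp
      then have "real n * \<bar>A_fun d \<beta> h (real (Suc j) / real n) - A_fun d \<beta> h (real j / real n)
          - dA d \<beta> h (real j / real n) * (1 / real n)\<bar> \<le> real n * (M * (1 / real n)\<^sup>2)"
        using n0 by (intro mult_left_mono) auto
      also have "real n * (M * (1 / real n)\<^sup>2) = M / real n" using n0 by (simp add: power2_eq_square)
      also have "real n * \<bar>A_fun d \<beta> h (real (Suc j) / real n) - A_fun d \<beta> h (real j / real n)
          - dA d \<beta> h (real j / real n) * (1 / real n)\<bar> =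
        \<bar>real n * (A_fun d \<beta> h (real (Suc j) / real n) - A_fun d \<beta> h (real j / real n)
          - dA d \<beta> h (real j / real n) * (1 / real n))\<bar>"
        by (simp add: abs_mult)
      also have "real n * (A_fun d \<beta> h (real (Suc j) / real n) - A_fun d \<beta> h (real j / real n)
          - dA d \<beta> h (real j / real n) * (1 / real n)) =
          real n * A_fun d \<beta> h (real (Suc j) / real n) - real n * A_fun d \<beta> h (real j / real n)
          - dA d \<beta> h (real j / real n)"
        using n0 by (simp add: right_diff_distrib)
      finally have 1: "\<bar>real n * A_fun d \<beta> h (real (Suc j) / real n) - real n * A_fun d \<beta> h (real j / real n)
          - dA d \<beta> h (real j / real n)\<bar> \<le> M / real n" .
      have "\<bar>ln (level_weight d n \<beta> h (Suc j)) - ln (level_weight d n \<beta> h j) - dA d \<beta> h (real j / real n)\<bar>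
        \<le> C / real n"
        using n b by (intro ratio R) auto
      with 1 show ?thesis unfolding D_def add_divide_distrib by linarith
    qed
    have "\<bar>D k' - D k\<bar> \<le> (C + M) / real n * (real k' - real k)"
      using le step
    proof (induction k' rule: dec_induct)
      case (step j)
      have "\<bar>D (Suc j) - D k\<bar> \<le> \<bar>D (Suc j) - D j\<bar> + \<bar>D j - D k\<bar>" by linarith
      also have "\<dots> \<le> (C + M) / real n + (C + M) / real n * (real j - real k)"
        using step by (intro add_mono) auto
      also have "\<dots> = (C + M) / real n * (real (Suc j) - real k)"
      proof -
        have "c + c * (real j - real k) = c * (real (Suc j) - real k)" for c
          by (simp add: algebra_simps)
        then show ?thesis .
      qed
      finally show ?case .
    qed simp
    then show "\<bar>ln (level_weight d n \<beta> h k') - ln (level_weight d n \<beta> h k) -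
       real n * (A_fun d \<beta> h (real k' / real n) - A_fun d \<beta> h (real k / real n))\<bar>
      \<le> (C + M) * (real k' - real k) / real n"
      by (simp add: D_def algebra_simps)
  qed
qed

text \<open>Near both ends A' is unbounded and the asymptotics are not uniform. There
  \<open>(n - k) / (k + 1)\<close> is so large, or so small, that it outweighs all bounded factors,
  and the weights grow towards the interior.\<close>

lemma level_weight_edges:
  obtains \<epsilon>0 where "0 < \<epsilon>0" "\<epsilon>0 < 1 / 2"
    "\<And>n k. regular_graphs d n \<noteq> {} \<Longrightarrow> real (Suc k) \<le> \<epsilon>0 * real n \<Longrightarrow>
       level_weight d n \<beta> h k \<le> level_weight d n \<beta> h (Suc k)"
    "\<And>n k. regular_graphs d n \<noteq> {} \<Longrightarrow> k < n \<Longrightarrow> real k \<ge> (1 - \<epsilon>0) * real n \<Longrightarrow>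
       level_weight d n \<beta> h (Suc k) \<le> level_weight d n \<beta> h k"
proof -
  define q where "q = exp (- 2 * \<beta>)"
  have q: "0 < q" "q < 1" using q_bounds[OF \<beta>] by (auto simp: q_def)
  \<comment> \<open>A common lower bound for the bounded factors at the left end and for the
    reciprocals of those at the right end.\<close>
  define c where "c = exp (- 2 * \<bar>h\<bar>) * q ^ d"
  have c: "0 < c" "c \<le> 1" using q by (auto simp: c_def intro!: mult_le_one power_le_one)
  \<comment> \<open>With this fraction \<open>k + 1 \<le> c * (n - k)\<close> at the left end and
    \<open>n - k \<le> c * (k + 1)\<close> at the right end.\<close>
  define \<epsilon>0 where "\<epsilon>0 = c / 4"
  have \<epsilon>0: "0 < \<epsilon>0" "\<epsilon>0 < 1 / 2" "\<epsilon>0 \<le> c / 4" using c by (auto simp: \<epsilon>0_def)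
  have "exp (- 2 * \<bar>h\<bar>) \<le> exp (2 * h)" "exp (2 * h) * exp (- 2 * \<bar>h\<bar>) \<le> 1" by (auto simp flip: exp_add)
  then have c1: "c \<le> exp (2 * h) * q ^ d" "c * (exp (2 * h) * (1 / q) ^ d) \<le> 1"
    using q by (auto simp: c_def power_one_over mult_ac)
  have k_le: "real k \<le> real n" if "real k \<le> \<epsilon>0 * real n" for k n :: nat
    using that \<epsilon>0 mult_right_mono[of \<epsilon>0 1 "real n"] by simp
  have crude: "exp (2 * h) * (real n - real k) * q ^ d * level_weight d n \<beta> h k
        \<le> real (Suc k) * level_weight d n \<beta> h (Suc k)"
      "real (Suc k) * level_weight d n \<beta> h (Suc k)
        \<le> exp (2 * h) * (real n - real k) * (1 / q) ^ d * level_weight d n \<beta> h k" for n k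
    using level_weight_ratio_bounds[of n k "q ^ d" d \<beta> "(1 / q) ^ d" h, folded q_def]
      cut_sum_insert_crude[OF q] by auto
  show thesis
  proof (rule that[OF \<epsilon>0(1,2)])
    fix n k assume R: "regular_graphs d n \<noteq> {}" and k: "real (Suc k) \<le> \<epsilon>0 * real n"
    have L: "0 \<le> level_weight d n \<beta> h k" by (rule level_weight_nonneg)
    have kn: "real k \<le> real n / 2"
      using k \<epsilon>0 mult_right_mono[of \<epsilon>0 "1 / 2" "real n"] by simp
    have "real (Suc k) \<le> c / 4 * real n" using k \<epsilon>0_def by simp
    also have "\<dots> \<le> c * (real n - real k)"
      using kn c mult_left_mono[of "real n / 4" "real n - real k" c] by simp
    also have "\<dots> \<le> (exp (2 * h) * q ^ d) * (real n - real k)"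
      using c1 kn by (intro mult_right_mono) auto
    finally have "real (Suc k) * level_weight d n \<beta> h k \<le>
        (exp (2 * h) * q ^ d) * (real n - real k) * level_weight d n \<beta> h k"
      using L by (rule mult_right_mono)
    also have "\<dots> \<le> real (Suc k) * level_weight d n \<beta> h (Suc k)"
      using crude(1)[of n k] by (simp add: mult_ac)
    finally show "level_weight d n \<beta> h k \<le> level_weight d n \<beta> h (Suc k)"
      by (subst (asm) mult_le_cancel_left_pos) auto
  next
    fix n k assume R: "regular_graphs d n \<noteq> {}" and kn: "k < n" and k: "real k \<ge> (1 - \<epsilon>0) * real n"
    have L: "0 \<le> level_weight d n \<beta> h k" by (rule level_weight_nonneg)
    have 1: "real n - real k \<le> c * real (Suc k)"
    proof -
      have "real n - real k \<le> \<epsilon>0 * real n" using k by (simp add: algebra_simps)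
      also have "\<dots> = c * (real n / 4)" by (simp add: \<epsilon>0_def)
      also have "\<dots> \<le> c * real (Suc k)"
      proof (rule mult_left_mono)
        have "real n / 2 \<le> (1 - \<epsilon>0) * real n" using \<epsilon>0 mult_right_mono[of "1 / 2" "1 - \<epsilon>0" "real n"] by simp
        then show "real n / 4 \<le> real (Suc k)" using k by simp
      qed (use c in auto)
      finally show ?thesis .
    qed
    have "exp (2 * h) * (real n - real k) * (1 / q) ^ d \<le> exp (2 * h) * (c * real (Suc k)) * (1 / q) ^ d"
      using q 1 by (intro mult_right_mono mult_left_mono) auto
    also have "\<dots> = (c * (exp (2 * h) * (1 / q) ^ d)) * real (Suc k)" by (simp add: mult_ac)
    also have "\<dots> \<le> 1 * real (Suc k)" using c1 by (intro mult_right_mono) auto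
    finally have "exp (2 * h) * (real n - real k) * (1 / q) ^ d \<le> real (Suc k)" by simp
    from order_trans[OF crude(2)[of k n] mult_right_mono[OF this L]]
    have "real (Suc k) * level_weight d n \<beta> h (Suc k) \<le> real (Suc k) * level_weight d n \<beta> h k" .
    then show "level_weight d n \<beta> h (Suc k) \<le> level_weight d n \<beta> h k"
      by (subst (asm) mult_le_cancel_left_pos) auto
  qed
qed

end

section \<open>Existence of regular graphs\<close>

lemma add_mod_cases:
  fixes v s n :: nat
  assumes "v < n" "s < n"
  shows "(v + s) mod n = (if v + s < n then v + s else v + s - n)"
proof (cases "v + s < n")
  case False
  then have "(v + s) mod n = (v + s - n) mod n" by (simp add: le_mod_geq)
  then show ?thesis using False assms by simp
qed simp

text \<open>The circulant graph with connection set \<open>D\<close>; since \<open>D\<close> is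
  closed under negation modulo \<open>n\<close>, the edges at \<open>x\<close> are exactly those to
  \<open>x + s\<close> with \<open>s\<close> in \<open>D\<close>.\<close>

lemma circulant_regular:
  assumes D: "D \<subseteq> {0<..<n}" and sym: "\<And>s. s \<in> D \<Longrightarrow> n - s \<in> D" and card: "card D = d"
  shows "{e. \<exists>v<n. \<exists>s\<in>D. e = {v, (v + s) mod n}} \<in> regular_graphs d n"
proof -
  let ?E = "{e. \<exists>v<n. \<exists>s\<in>D. e = {v, (v + s) mod n}}"
  have s: "0 < s" "s < n" if "s \<in> D" for s using that D by auto
  have "?E \<subseteq> nsets {..<n} 2"
  proof
    fix e assume "e \<in> ?E"
    then obtain v t where e: "v < n" "t \<in> D" "e = {v, (v + t) mod n}" by blast
    then have "(v + t) mod n < n" "(v + t) mod n \<noteq> v" using s[of t] by (auto simp: add_mod_cases)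
    then show "e \<in> nsets {..<n} 2" using e by (auto simp: nsets_def)
  qed
  moreover have "card {e \<in> ?E. x \<in> e} = d" if x: "x < n" for x
  proof -
    have "{e \<in> ?E. x \<in> e} = (\<lambda>s. {x, (x + s) mod n}) ` D"
    proof (intro equalityI subsetI)
      fix e assume "e \<in> {e \<in> ?E. x \<in> e}"
      then obtain v t where e: "v < n" "t \<in> D" "e = {v, (v + t) mod n}" "x \<in> e" by blast
      show "e \<in> (\<lambda>s. {x, (x + s) mod n}) ` D"
      proof (cases "x = v")
        case True
        then show ?thesis using e by auto
      next
        case False
        then have "x = (v + t) mod n" using e by auto
        moreover have "v = ((v + t) mod n + (n - t)) mod n"
          using e s[of t] by (auto simp: add_mod_cases)
        ultimately have "e = {x, (x + (n - t)) mod n}" using e by auto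
        then show ?thesis using sym[OF e(2)] by blast
      qed
    qed (use x in auto)
    moreover have "inj_on (\<lambda>s. {x, (x + s) mod n}) D"
    proof (rule inj_onI)
      fix a b assume ab: "a \<in> D" "b \<in> D" "{x, (x + a) mod n} = {x, (x + b) mod n}"
      then have "(x + a) mod n = (x + b) mod n" by (auto simp: doubleton_eq_iff)
      then show "a = b" using s[OF ab(1)] s[OF ab(2)] x by (auto simp: add_mod_cases split: if_splits)
    qed
    ultimately show ?thesis using card by (simp add: card_image)
  qed
  ultimately show ?thesis unfolding regular_graphs_def by simp
qed

text \<open>This gives the expectation over graphs a meaning. \<open>D0\<close> is a symmetric set
  of size 2 (d div 2); for odd \<open>d\<close> the number \<open>n\<close> is even, and
  \<open>n / 2\<close>, its own negative modulo \<open>n\<close>, is added.\<close>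

lemma regular_graphs_nonempty:
  assumes n: "d < n" and even: "even (d * n)"
  shows "regular_graphs d n \<noteq> {}"
proof -
  define r where "r = d div 2"
  define D0 where "D0 = {1..r} \<union> {n - r..<n}"
  have r: "2 * r \<le> d" by (simp add: r_def)
  have D0: "D0 \<subseteq> {0<..<n}" "\<And>s. s \<in> D0 \<Longrightarrow> n - s \<in> D0" using r n by (auto simp: D0_def)
  have cD0: "card D0 = 2 * r"
    unfolding D0_def using r n by (subst card_Un_disjoint) auto
  show ?thesis
  proof (cases "even d")
    case True
    then have "card D0 = d" using cD0 by (simp add: r_def)
    then show ?thesis using circulant_regular[OF D0] by blast
  next
    case False
    then have d: "d = 2 * r + 1" and "even n" using even by (auto simp: r_def)
    then obtain m where m: "n = 2 * m" by blast
    have "m \<notin> D0" using m n d by (auto simp: D0_def)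
    moreover have "finite D0" by (simp add: D0_def)
    ultimately have "card (insert m D0) = d" using cD0 d by simp
    moreover have "insert m D0 \<subseteq> {0<..<n}" "\<And>s. s \<in> insert m D0 \<Longrightarrow> n - s \<in> insert m D0"
      using D0 m n by auto
    ultimately show ?thesis using circulant_regular[of "insert m D0" n d] by blast
  qed
qed

section \<open>From spin configurations to levels\<close>

definition plus_set :: "nat \<Rightarrow> (nat \<Rightarrow> real) \<Rightarrow> nat set" where
  "plus_set n \<omega> = {i. i < n \<and> \<omega> i = 1}"

lemma plus_set_bij: "bij_betw (plus_set n) (spins n) (Pow {..<n})"
proof (rule bij_betwI[where g = "\<lambda>S i. if i < n then (if i \<in> S then 1 else - 1) else undefined"])
  show "(\<lambda>S i. if i < n then (if i \<in> S then 1 else - 1) else undefined) \<in> Pow {..<n} \<rightarrow> spins n"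
    by (auto simp: spins_def PiE_def extensional_def)
  show "(\<lambda>i. if i < n then if i \<in> plus_set n \<omega> then 1 else - 1 else undefined) = \<omega>" if "\<omega> \<in> spins n" for \<omega>
    using that by (auto simp: spins_def plus_set_def PiE_def extensional_def Pi_def fun_eq_iff)
qed (auto simp: plus_set_def)

lemma finite_spins: "finite (spins n)"
  unfolding spins_def by (intro finite_PiE) auto

lemma magnetization_eq:
  assumes "\<omega> \<in> spins n"
  shows "magnetization n \<omega> = 2 * real (card (plus_set n \<omega>)) - real n"
proof -
  have "\<omega> i = 2 * (if i \<in> plus_set n \<omega> then 1 else 0) - 1" if "i < n" for i
    using assms that by (auto simp: spins_def plus_set_def PiE_def Pi_def)
  then have "magnetization n \<omega> = (\<Sum>i<n. 2 * (if i \<in> plus_set n \<omega> then 1 else 0) - 1)"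
    unfolding magnetization_def by (intro sum.cong) auto
  also have "\<dots> = 2 * (\<Sum>i<n. if i \<in> plus_set n \<omega> then 1 else 0) - real n"
    by (simp add: sum_subtractf sum_distrib_left)
  also have "(\<Sum>i<n. if i \<in> plus_set n \<omega> then 1 else 0 :: real) = real (card (plus_set n \<omega>))"
    by (simp add: sum.If_cases) (rule arg_cong[where f = card], auto simp: plus_set_def)
  finally show ?thesis .
qed

lemma handshake:
  assumes E: "E \<in> regular_graphs d n"
  shows "2 * card E = d * n"
proof -
  have "(\<Sum>e\<in>E. card {v \<in> {..<n}. v \<in> e}) = d * card {..<n}"
    by (rule sum_multicount) (use E regular_graph_finite[OF E] in \<open>auto simp: regular_graphs_def\<close>)
  moreover have "card {v \<in> {..<n}. v \<in> e} = 2" if "e \<in> E" for e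
  proof -
    have "e \<in> nsets {..<n} 2" using that E by (auto simp: regular_graphs_def)
    then have "card e = 2" "{v \<in> {..<n}. v \<in> e} = e" by (auto simp: nsets_def)
    then show ?thesis by simp
  qed
  ultimately show ?thesis by simp
qed

text \<open>The product over an edge is -1 if the edge crosses and 1 otherwise, so the sum is the
  number of edges minus twice the cut.\<close>

lemma sum_edges:
  assumes E: "E \<in> regular_graphs d n" and \<omega>: "\<omega> \<in> spins n"
  shows "(\<Sum>e\<in>E. \<Prod>k\<in>e. \<omega> k) = real d * real n / 2 - 2 * real (cut_size (plus_set n \<omega>) E)"
proof -
  let ?S = "plus_set n \<omega>"
  define f where "f = (\<lambda>(x, y). {x, y :: nat})"
  define X where "X = f ` arcs ?S (- ?S) E"
  have inj: "inj_on f (arcs ?S (- ?S) E)"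
    by (auto simp: inj_on_def f_def arcs_def doubleton_eq_iff)
  have X: "X \<subseteq> E" by (auto simp: X_def f_def arcs_def)
  have "(\<Prod>k\<in>e. \<omega> k) = 1 - 2 * (if e \<in> X then 1 else 0)" if e: "e \<in> E" for e
  proof -
    have "e \<in> nsets {..<n} 2" using e E by (auto simp: regular_graphs_def)
    then obtain x y where xy: "e = {x, y}" "x \<noteq> y" "x < n" "y < n"
      by (auto simp: nsets_def card_2_iff)
    have val: "\<omega> z = (if z \<in> ?S then 1 else - 1)" if "z < n" for z
      using \<omega> that by (auto simp: spins_def plus_set_def PiE_def Pi_def)
    have "e \<in> X \<longleftrightarrow> (x \<in> ?S \<and> y \<notin> ?S) \<or> (y \<in> ?S \<and> x \<notin> ?S)"
      using e xy by (auto simp: X_def f_def arcs_def doubleton_eq_iff image_iff insert_commute)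
    then show ?thesis using xy val[of x] val[of y] by auto
  qed
  then have "(\<Sum>e\<in>E. \<Prod>k\<in>e. \<omega> k) = (\<Sum>e\<in>E. 1 - 2 * (if e \<in> X then 1 else 0))"
    by (intro sum.cong) auto
  also have "\<dots> = real (card E) - 2 * (\<Sum>e\<in>E. if e \<in> X then 1 else 0)"
    by (simp add: sum_subtractf sum_distrib_left)
  also have "(\<Sum>e\<in>E. if e \<in> X then 1 else 0 :: real) = real (card X)"
    using X regular_graph_finite[OF E] by (simp add: sum.If_cases Int_absorb1)
  also have "card X = cut_size ?S E" unfolding X_def cut_size_def by (rule card_image[OF inj])
  also have "real (card E) = real d * real n / 2"
  proof -
    have "real (2 * card E) = real (d * n)" by (simp only: handshake[OF E])
    then show ?thesis by simp
  qed
  finally show ?thesis .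
qed

text \<open>The fraction in front does not depend on the configuration and cancels in the
  normalisation.\<close>

lemma annealed_weight_eq:
  assumes R: "regular_graphs d n \<noteq> {}" and \<omega>: "\<omega> \<in> spins n"
  shows "annealed_weight d n \<beta> h \<omega> =
    exp (\<beta> * (real d * real n / 2) - h * real n) / real (card (regular_graphs d n)) *
      (exp (2 * h * real (card (plus_set n \<omega>))) * cut_sum d n (exp (- 2 * \<beta>)) (plus_set n \<omega>))"
proof -
  let ?S = "plus_set n \<omega>"
  have "annealed_weight d n \<beta> h \<omega> = (\<Sum>E\<in>regular_graphs d n.
      exp (\<beta> * (\<Sum>e\<in>E. \<Prod>k\<in>e. \<omega> k) + h * (\<Sum>i<n. \<omega> i))) / real (card (regular_graphs d n))"
    unfolding annealed_weight_def by (rule integral_pmf_of_set[OF R finite_regular_graphs])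
  also have "(\<Sum>E\<in>regular_graphs d n. exp (\<beta> * (\<Sum>e\<in>E. \<Prod>k\<in>e. \<omega> k) + h * (\<Sum>i<n. \<omega> i))) =
      (\<Sum>E\<in>regular_graphs d n. exp (\<beta> * (real d * real n / 2) - h * real n) *
        exp (2 * h * real (card ?S)) * exp (- 2 * \<beta>) ^ cut_size ?S E)"
  proof (rule sum.cong[OF refl])
    fix E assume E: "E \<in> regular_graphs d n"
    have M: "(\<Sum>i<n. \<omega> i) = 2 * real (card ?S) - real n"
      using magnetization_eq[OF \<omega>] by (simp add: magnetization_def)
    have "\<beta> * (\<Sum>e\<in>E. \<Prod>k\<in>e. \<omega> k) + h * (\<Sum>i<n. \<omega> i) =
        (\<beta> * (real d * real n / 2) - h * real n) + 2 * h * real (card ?S) + real (cut_size ?S E) * (- 2 * \<beta>)"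
      unfolding sum_edges[OF E \<omega>] M by (simp add: algebra_simps)
    then show "exp (\<beta> * (\<Sum>e\<in>E. \<Prod>k\<in>e. \<omega> k) + h * (\<Sum>i<n. \<omega> i)) =
        exp (\<beta> * (real d * real n / 2) - h * real n) *
        exp (2 * h * real (card ?S)) * exp (- 2 * \<beta>) ^ cut_size ?S E"
      by (simp only: exp_add exp_of_nat_mult)
  qed
  finally show ?thesis by (simp add: cut_sum_def sum_distrib_left sum_divide_distrib mult_ac)
qed

lemma sum_spins:
  fixes f :: "nat set \<Rightarrow> real" and g :: "nat \<Rightarrow> real"
  shows "(\<Sum>\<omega>\<in>spins n. f (plus_set n \<omega>) * g (card (plus_set n \<omega>))) =
    (\<Sum>k\<le>n. (\<Sum>S | S \<subseteq> {..<n} \<and> card S = k. f S) * g k)"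
proof -
  have "(\<Sum>\<omega>\<in>spins n. f (plus_set n \<omega>) * g (card (plus_set n \<omega>))) = (\<Sum>S\<in>Pow {..<n}. f S * g (card S))"
    by (rule sum.reindex_bij_betw[OF plus_set_bij])
  also have "\<dots> = (\<Sum>k\<le>n. \<Sum>S\<in>{S \<in> Pow {..<n}. card S = k}. f S * g (card S))"
    by (rule sum.group[symmetric]) (auto intro: order_trans[OF card_mono[of "{..<n}"]])
  also have "\<dots> = (\<Sum>k\<le>n. (\<Sum>S | S \<subseteq> {..<n} \<and> card S = k. f S) * g k)"
    unfolding sum_distrib_right by (intro sum.cong) auto
  finally show ?thesis .
qed

context
  fixes d n :: nat and \<beta> h :: real
  assumes R: "regular_graphs d n \<noteq> {}"
begin

text \<open>This reduces statements about the measure to sums over levels. \<open>f\<close> is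
  arbitrary because every subset of the finite configuration space is measurable.\<close>

lemma integral_annealed_ising:
  "(\<integral>\<omega>. f (magnetization n \<omega>) \<partial>annealed_ising d n \<beta> h) =
    (\<Sum>k\<le>n. level_weight d n \<beta> h k * f (2 * real k - real n)) / (\<Sum>k\<le>n. level_weight d n \<beta> h k)"
proof -
  define c where "c = exp (\<beta> * (real d * real n / 2) - h * real n) / real (card (regular_graphs d n))"
  have c: "c > 0" unfolding c_def using R finite_regular_graphs[of d n] by (simp add: card_gt_0_iff)
  define F where "F S = exp (2 * h * real (card S)) * cut_sum d n (exp (- 2 * \<beta>)) S" for S
  have w: "annealed_weight d n \<beta> h \<omega> = c * F (plus_set n \<omega>)" if "\<omega> \<in> spins n" for \<omega>
    using annealed_weight_eq[OF R that] by (simp add: c_def F_def)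
  have F: "F S \<ge> 0" for S using cut_sum_pos[OF R, of "exp (- 2 * \<beta>)" S] by (simp add: F_def less_imp_le)
  have L: "(\<Sum>S | S \<subseteq> {..<n} \<and> card S = k. F S) = level_weight d n \<beta> h k" for k
    unfolding F_def level_weight_def sum_distrib_left by (intro sum.cong) auto
  define Z where "Z = (\<Sum>\<eta>\<in>spins n. annealed_weight d n \<beta> h \<eta>)"
  have Z: "Z = c * (\<Sum>k\<le>n. level_weight d n \<beta> h k)"
  proof -
    have "Z = c * (\<Sum>\<omega>\<in>spins n. F (plus_set n \<omega>) * 1)" by (simp add: Z_def w sum_distrib_left)
    then show ?thesis using sum_spins[where f = F and g = "\<lambda>_. 1" and n = n] by (simp add: L)
  qed
  have Z0: "Z \<ge> 0" unfolding Z using c level_weight_nonneg by (intro mult_nonneg_nonneg sum_nonneg) auto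
  have "(\<integral>\<omega>. f (magnetization n \<omega>) \<partial>annealed_ising d n \<beta> h) =
      (\<Sum>\<omega>\<in>spins n. (annealed_weight d n \<beta> h \<omega> / Z) *\<^sub>R f (magnetization n \<omega>))"
    unfolding annealed_ising_def Z_def[symmetric]
    by (rule lebesgue_integral_point_measure_finite[OF finite_spins]) (use F c w Z0 in auto)
  also have "\<dots> = c / Z * (\<Sum>\<omega>\<in>spins n. F (plus_set n \<omega>) * f (2 * real (card (plus_set n \<omega>)) - real n))"
    unfolding sum_distrib_left by (intro sum.cong) (auto simp: w magnetization_eq)
  also have "\<dots> = c / Z * (\<Sum>k\<le>n. level_weight d n \<beta> h k * f (2 * real k - real n))"
    using sum_spins[where f = F and g = "\<lambda>k. f (2 * real k - real n)" and n = n] by (simp add: L)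
  finally show ?thesis using c by (simp add: Z)
qed

lemma measurable_annealed_ising [measurable]: "X \<in> annealed_ising d n \<beta> h \<rightarrow>\<^sub>M borel"
  by (simp add: annealed_ising_def space_borel)

lemma sets_annealed_ising: "sets (annealed_ising d n \<beta> h) = Pow (spins n)"
  by (simp add: annealed_ising_def sets_point_measure)

lemma space_annealed_ising: "space (annealed_ising d n \<beta> h) = spins n"
  by (simp add: annealed_ising_def space_point_measure)

lemma finite_measure_annealed_ising: "finite_measure (annealed_ising d n \<beta> h)"
  unfolding annealed_ising_def
  by (intro finite_measureI) (simp add: space_point_measure emeasure_point_measure_finite finite_spins)

lemma measure_annealed_ising:
  "measure (annealed_ising d n \<beta> h) {\<omega> \<in> spins n. Q (magnetization n \<omega>)} =
    (\<Sum>k | k \<le> n \<and> Q (2 * real k - real n). level_weight d n \<beta> h k) / (\<Sum>k\<le>n. level_weight d n \<beta> h k)"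
proof -
  interpret finite_measure "annealed_ising d n \<beta> h" by (rule finite_measure_annealed_ising)
  let ?A = "{\<omega> \<in> spins n. Q (magnetization n \<omega>)}"
  have "measure (annealed_ising d n \<beta> h) ?A = (\<integral>\<omega>. indicator ?A \<omega> \<partial>annealed_ising d n \<beta> h)"
    by (simp add: Bochner_Integration.integral_indicator space_annealed_ising Int_absorb2)
  also have "\<dots> = (\<integral>\<omega>. of_bool (Q (magnetization n \<omega>)) \<partial>annealed_ising d n \<beta> h)"
    by (intro Bochner_Integration.integral_cong refl) (auto simp: space_annealed_ising)
  also have "\<dots> = (\<Sum>k\<le>n. level_weight d n \<beta> h k * of_bool (Q (2 * real k - real n))) /
      (\<Sum>k\<le>n. level_weight d n \<beta> h k)"
    by (rule integral_annealed_ising)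
  also have "(\<Sum>k\<le>n. level_weight d n \<beta> h k * of_bool (Q (2 * real k - real n))) =
      (\<Sum>k | k \<le> n \<and> Q (2 * real k - real n). level_weight d n \<beta> h k)"
    by (intro sum.mono_neutral_cong_right) auto
  finally show ?thesis .
qed

lemma level_weight_sum_pos: "0 < (\<Sum>k\<le>n. level_weight d n \<beta> h k)"
  by (intro sum_pos level_weight_pos R) auto

lemma prob_space_annealed_ising: "prob_space (annealed_ising d n \<beta> h)"
proof -
  interpret finite_measure "annealed_ising d n \<beta> h" by (rule finite_measure_annealed_ising)
  have "measure (annealed_ising d n \<beta> h) (space (annealed_ising d n \<beta> h)) = 1"
    using measure_annealed_ising[of "\<lambda>_. True"] level_weight_sum_pos
    by (simp add: space_annealed_ising atMost_def)
  then show ?thesis by (intro prob_spaceI) (simp add: emeasure_eq_measure)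
qed

lemma integral_conditioned_annealed_ising:
  assumes pos: "0 < (\<Sum>k | k \<le> n \<and> Q (2 * real k - real n). level_weight d n \<beta> h k)"
  shows "(\<integral>\<omega>. f (magnetization n \<omega>) \<partial>uniform_measure (annealed_ising d n \<beta> h)
      {\<omega> \<in> spins n. Q (magnetization n \<omega>)}) =
    (\<Sum>k | k \<le> n \<and> Q (2 * real k - real n). level_weight d n \<beta> h k * f (2 * real k - real n)) /
    (\<Sum>k | k \<le> n \<and> Q (2 * real k - real n). level_weight d n \<beta> h k)"
proof -
  interpret finite_measure "annealed_ising d n \<beta> h" by (rule finite_measure_annealed_ising)
  let ?M = "annealed_ising d n \<beta> h" and ?A = "{\<omega> \<in> spins n. Q (magnetization n \<omega>)}"
  define Z where "Z = (\<Sum>k\<le>n. level_weight d n \<beta> h k)"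
  define P where "P = (\<Sum>k | k \<le> n \<and> Q (2 * real k - real n). level_weight d n \<beta> h k)"
  have mA: "measure ?M ?A = P / Z" unfolding P_def Z_def by (rule measure_annealed_ising)
  have Z: "Z > 0" unfolding Z_def by (rule level_weight_sum_pos)
  have P: "P > 0" using pos by (simp add: P_def)
  have meas: "X \<in> borel_measurable ?M" for X :: "(nat \<Rightarrow> real) \<Rightarrow> real"
    by (rule measurable_annealed_ising)
  have "measure ?M ?A > 0" using mA Z P by simp
  then have "indicator ?A \<omega> / ennreal (measure ?M ?A) = ennreal (indicator ?A \<omega> / measure ?M ?A)" for \<omega>
    using divide_ennreal[of "indicator ?A \<omega>" "measure ?M ?A"] by (simp add: ennreal_indicator)
  then have "uniform_measure ?M ?A = density ?M (\<lambda>\<omega>. ennreal (indicator ?A \<omega> / measure ?M ?A))"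
    unfolding uniform_measure_def emeasure_eq_measure by simp
  then have "(\<integral>\<omega>. f (magnetization n \<omega>) \<partial>uniform_measure ?M ?A) =
      (\<integral>\<omega>. (indicator ?A \<omega> / measure ?M ?A) *\<^sub>R f (magnetization n \<omega>) \<partial>?M)"
    using meas by (simp add: integral_density)
  also have "\<dots> = (\<integral>\<omega>. (\<lambda>x. of_bool (Q x) / (P / Z) * f x) (magnetization n \<omega>) \<partial>?M)"
    by (intro Bochner_Integration.integral_cong refl) (auto simp: space_annealed_ising mA)
  also have "\<dots> = (\<Sum>k\<le>n. level_weight d n \<beta> h k * (of_bool (Q (2 * real k - real n)) / (P / Z) * f (2 * real k - real n))) / Z"
    unfolding Z_def by (rule integral_annealed_ising)
  also have "(\<Sum>k\<le>n. level_weight d n \<beta> h k * (of_bool (Q (2 * real k - real n)) / (P / Z) * f (2 * real k - real n))) =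
      (\<Sum>k | k \<le> n \<and> Q (2 * real k - real n). level_weight d n \<beta> h k * f (2 * real k - real n) / (P / Z))"
    by (intro sum.mono_neutral_cong_right) auto
  also have "\<dots> / Z = (\<Sum>k | k \<le> n \<and> Q (2 * real k - real n). level_weight d n \<beta> h k * f (2 * real k - real n)) / P"
    unfolding sum_divide_distrib[symmetric] using Z P by simp
  finally show ?thesis by (simp add: P_def)
qed

end

section \<open>A quantitative Laplace principle\<close>

lemma abs_power_diff_le:
  fixes a b M :: real
  assumes "\<bar>a\<bar> \<le> M" "\<bar>b\<bar> \<le> M" "1 \<le> M"
  shows "\<bar>a ^ n - b ^ n\<bar> \<le> real n * M ^ n * \<bar>a - b\<bar>"
proof (induction n)
  case (Suc n)
  have "a ^ Suc n - b ^ Suc n = a * (a ^ n - b ^ n) + b ^ n * (a - b)" by (simp add: algebra_simps)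
  also have "\<bar>\<dots>\<bar> \<le> \<bar>a\<bar> * \<bar>a ^ n - b ^ n\<bar> + \<bar>b\<bar> ^ n * \<bar>a - b\<bar>"
    by (rule order_trans[OF abs_triangle_ineq]) (simp add: abs_mult power_abs)
  also have "\<dots> \<le> M * (real n * M ^ n * \<bar>a - b\<bar>) + M ^ Suc n * \<bar>a - b\<bar>"
  proof (intro add_mono mult_mono mult_right_mono Suc.IH assms)
    have "\<bar>b\<bar> ^ n \<le> M ^ n" using assms by (intro power_mono) auto
    also have "\<dots> \<le> M ^ Suc n" using assms by (intro power_increasing) auto
    finally show "\<bar>b\<bar> ^ n \<le> M ^ Suc n" .
  qed (use assms in auto)
  also have "\<dots> = real (Suc n) * M ^ Suc n * \<bar>a - b\<bar>" by (simp add: algebra_simps)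
  finally show ?case .
qed simp

lemma abs_exp_diff_le:
  fixes u v L :: real
  assumes "exp u \<le> L" "exp v \<le> L"
  shows "\<bar>exp u - exp v\<bar> \<le> L * \<bar>u - v\<bar>"
proof -
  have le: "exp s - exp t \<le> exp s * (s - t)" for s t :: real
  proof -
    have "exp s * (1 + (t - s)) \<le> exp s * exp (t - s)"
      using exp_ge_add_one_self[of "t - s"] by (intro mult_left_mono) auto
    also have "\<dots> = exp t" by (simp flip: exp_add)
    finally show ?thesis by (simp add: algebra_simps)
  qed
  have "exp s - exp t \<le> L * \<bar>s - t\<bar>" if "exp s \<le> L" for s t
  proof -
    have "exp s * (s - t) \<le> exp s * \<bar>s - t\<bar>" by (intro mult_left_mono) auto
    also have "\<dots> \<le> L * \<bar>s - t\<bar>" using that by (intro mult_right_mono) auto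
    finally show ?thesis using le[of s t] by linarith
  qed
  from this[of u v] this[of v u] show ?thesis using assms by (simp add: abs_le_iff abs_minus_commute)
qed

context
  fixes p :: nat
  assumes p: "even p" "2 \<le> p"
begin

lemma power_p_nonneg: "0 \<le> (x::real) ^ p" by (rule zero_le_even_power[OF p(1)])

lemma power_p_abs: "\<bar>x::real\<bar> ^ p = x ^ p" by (rule power_even_abs[OF p(1)])

lemma power_p_ge: "x\<^sup>2 - 1 \<le> (x::real) ^ p"
proof (cases "\<bar>x\<bar> \<le> 1")
  case True
  then have "x\<^sup>2 \<le> 1" by (simp add: abs_square_le_1)
  then show ?thesis using power_p_nonneg[of x] by linarith
next
  case False
  then have "\<bar>x\<bar>\<^sup>2 \<le> \<bar>x\<bar> ^ p" using p by (intro power_increasing) auto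
  then show ?thesis by (simp add: power_p_abs)
qed

text \<open>By \<open>power_p_ge\<close> the weight is dominated by a Gaussian, whose absolute
  moments are known; thus all even exponents \<open>p\<close> are treated at once.\<close>

lemma integrable_envelope:
  assumes c: "0 < (c::real)"
  shows "integrable lborel (\<lambda>x. (1 + \<bar>x\<bar>) ^ m * exp (- c * x ^ p))"
proof -
  define \<sigma> where "\<sigma> = 1 / sqrt (2 * c)"
  have \<sigma>: "0 < \<sigma>" "1 / (2 * \<sigma>\<^sup>2) = c" using c by (auto simp: \<sigma>_def power_divide)
  have nd: "exp (- c * x\<^sup>2) = sqrt (2 * pi * \<sigma>\<^sup>2) * normal_density 0 \<sigma> x" for x
    using \<sigma> by (simp add: normal_density_def flip: \<sigma>(2))
  have "integrable lborel (\<lambda>x. exp (- c * x\<^sup>2) * \<bar>x\<bar> ^ j)" for j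
    unfolding nd using integrable_normal_moment_abs[OF \<sigma>(1), of 0 j]
    by (simp add: mult.assoc)
  then have "integrable lborel (\<lambda>x. \<Sum>j\<le>m. real (m choose j) * (exp (- c * x\<^sup>2) * \<bar>x\<bar> ^ j))"
    by (intro Bochner_Integration.integrable_sum integrable_mult_right)
  moreover have "(\<Sum>j\<le>m. real (m choose j) * (exp (- c * x\<^sup>2) * \<bar>x\<bar> ^ j)) = (1 + \<bar>x\<bar>) ^ m * exp (- c * x\<^sup>2)" for x
    using binomial_ring[of "\<bar>x\<bar>" 1 m] by (simp add: add.commute sum_distrib_left mult_ac)
  ultimately have "integrable lborel (\<lambda>x. exp c * ((1 + \<bar>x\<bar>) ^ m * exp (- c * x\<^sup>2)))"
    by simp
  then show ?thesis
  proof (rule Bochner_Integration.integrable_bound)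
    show "AE x in lborel. norm ((1 + \<bar>x\<bar>) ^ m * exp (- c * x ^ p)) \<le> norm (exp c * ((1 + \<bar>x\<bar>) ^ m * exp (- c * x\<^sup>2)))"
    proof (rule AE_I2)
      fix x :: real
      have "c * (x\<^sup>2 - 1) \<le> c * x ^ p" using c power_p_ge by (intro mult_left_mono) auto
      then have "exp (- c * x ^ p) \<le> exp (c + (- c * x\<^sup>2))" by (simp add: algebra_simps)
      then have "(1 + \<bar>x\<bar>) ^ m * exp (- c * x ^ p) \<le> (1 + \<bar>x\<bar>) ^ m * (exp c * exp (- c * x\<^sup>2))"
        unfolding exp_add by (intro mult_left_mono) auto
      then show "norm ((1 + \<bar>x\<bar>) ^ m * exp (- c * x ^ p)) \<le> norm (exp c * ((1 + \<bar>x\<bar>) ^ m * exp (- c * x\<^sup>2)))"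
        by (simp add: abs_mult mult_ac)
    qed
  qed simp
qed

text \<open>Transfers decay from a grid point \<open>y\<close> to every point \<open>x\<close> of
  its cell, at the price of a factor 2^p in the rate. This explains the rate
  \<open>\<kappa> / 2 ^ (p + 1)\<close> below, half of \<open>\<kappa>\<close> being spent on the
  error terms.\<close>

lemma power_p_shift:
  assumes "\<bar>x - y\<bar> \<le> 1"
  shows "(x::real) ^ p / 2 ^ p - 1 \<le> y ^ p"
proof -
  define M where "M = max \<bar>y\<bar> 1"
  have "\<bar>x\<bar> \<le> 2 * M" using assms unfolding M_def by linarith
  then have "\<bar>x\<bar> ^ p \<le> (2 * M) ^ p" by (intro power_mono) auto
  also have "\<dots> = 2 ^ p * M ^ p" by (simp add: power_mult_distrib)
  also have "M ^ p \<le> \<bar>y\<bar> ^ p + 1" unfolding M_def max_def by auto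
  finally have "\<bar>x\<bar> ^ p \<le> 2 ^ p * (\<bar>y\<bar> ^ p + 1)" by simp
  then show ?thesis by (simp add: power_p_abs field_simps)
qed

section \<open>Comparison of grid sums with integrals\<close>

context
  fixes \<kappa> B \<epsilon> :: real
  assumes \<kappa>: "0 < \<kappa>" and B: "0 \<le> B" and \<epsilon>: "0 < \<epsilon>" and B\<epsilon>: "B * \<epsilon> \<le> \<kappa> / 2"
begin

lemma rate_le: "\<kappa> / 2 ^ (p + 1) * x ^ p \<le> \<kappa> * x ^ p"
proof -
  have "1 \<le> (2::real) ^ (p + 1)" by (rule one_le_power) simp
  then have "\<kappa> / 2 ^ (p + 1) \<le> \<kappa> / 1" using \<kappa> by (intro divide_left_mono) auto
  from mult_right_mono[OF this power_p_nonneg[of x]] show ?thesis by simp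
qed

text \<open>One grid weight against the limit density inside its cell. \<open>L\<close> bounds both,
  so they differ by at most \<open>L\<close> times the difference of their exponents, and the latter
  is \<open>\<eta>\<close> times a polynomial.\<close>

lemma cell_bound:
  fixes x y W \<eta> :: real
  assumes \<eta>: "0 < \<eta>" "\<eta> \<le> 1" and xy: "\<bar>x - y\<bar> \<le> \<eta>" and y: "\<bar>y\<bar> \<le> \<epsilon> / \<eta>"
    and W: "0 < W" "\<bar>ln W + \<kappa> * y ^ p\<bar> \<le> B * \<eta> * (1 + \<bar>y\<bar> ^ (p + 1))"
    and f: "\<bar>f y - f x\<bar> \<le> \<bar>y - x\<bar>" "\<bar>f x\<bar> \<le> 1 + \<bar>x\<bar>"
  shows "\<bar>W * f y - f x * exp (- \<kappa> * x ^ p)\<bar> \<le>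
    \<eta> * (exp (B + \<kappa> / 2) * (1 + 2 * B + \<kappa> * real p)) * ((1 + \<bar>x\<bar>) ^ (p + 2) * exp (- (\<kappa> / 2 ^ (p + 1)) * x ^ p))"
proof -
  define L where "L = exp (B + \<kappa> / 2) * exp (- (\<kappa> / 2 ^ (p + 1)) * x ^ p)"
  have L0: "L > 0" by (simp add: L_def)
  have yx: "\<bar>y\<bar> \<le> 1 + \<bar>x\<bar>" "\<bar>x - y\<bar> \<le> 1" using xy \<eta> by linarith+
  have \<eta>y: "\<eta> * \<bar>y\<bar> \<le> \<epsilon>" using y \<eta> by (simp add: field_simps)
  \<comment> \<open>Inside the window \<open>\<eta> * \<bar>y\<bar> \<le> \<epsilon>\<close>, so the
    error term of degree \<open>p + 1\<close> is at most \<open>B * \<epsilon> * y ^ p\<close> and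
    uses up no more than half of the decay.\<close>
  have WL: "W \<le> L"
  proof -
    have "\<eta> * \<bar>y\<bar> ^ (p + 1) = (\<eta> * \<bar>y\<bar>) * \<bar>y\<bar> ^ p" by simp
    also have "\<dots> \<le> \<epsilon> * \<bar>y\<bar> ^ p" using \<eta>y by (intro mult_right_mono) auto
    finally have "B * (\<eta> * \<bar>y\<bar> ^ (p + 1)) \<le> B * (\<epsilon> * y ^ p)" using B by (simp add: mult_left_mono power_p_abs)
    also have "\<dots> = (B * \<epsilon>) * y ^ p" by simp
    also have "\<dots> \<le> \<kappa> / 2 * y ^ p" using B\<epsilon> power_p_nonneg by (intro mult_right_mono) auto
    finally have 1: "B * (\<eta> * \<bar>y\<bar> ^ (p + 1)) \<le> \<kappa> / 2 * y ^ p" .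
    have "B * \<eta> \<le> B * 1" using \<eta> B by (intro mult_left_mono) auto
    then have "B * \<eta> * (1 + \<bar>y\<bar> ^ (p + 1)) \<le> B + \<kappa> / 2 * y ^ p"
      using 1 by (simp add: algebra_simps)
    then have "ln W \<le> B - \<kappa> / 2 * y ^ p" using W(2) by linarith
    also have "\<dots> \<le> B + \<kappa> / 2 + - (\<kappa> / 2 ^ (p + 1)) * x ^ p"
      using mult_left_mono[OF power_p_shift[OF yx(2)], of "\<kappa> / 2"] \<kappa> by (simp add: algebra_simps)
    finally have "exp (ln W) \<le> L" unfolding L_def exp_add[symmetric] by simp
    then show ?thesis using W by simp
  qed
  have \<phi>L: "exp (- \<kappa> * x ^ p) \<le> L"
  proof -
    note rate_le[of x]
    moreover have "0 \<le> B + \<kappa> / 2" using B \<kappa> by simp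
    ultimately have "- \<kappa> * x ^ p \<le> (B + \<kappa> / 2) + - (\<kappa> / 2 ^ (p + 1)) * x ^ p" by linarith
    then show ?thesis unfolding L_def exp_add[symmetric] by simp
  qed
  define M where "M = 1 + \<bar>x\<bar>"
  have M: "1 \<le> M" by (simp add: M_def)
  have diff: "\<bar>ln W + \<kappa> * x ^ p\<bar> \<le> \<eta> * (2 * B + \<kappa> * real p) * M ^ (p + 1)"
  proof -
    have "\<bar>y\<bar> ^ (p + 1) \<le> M ^ (p + 1)" "1 \<le> M ^ (p + 1)"
      using yx M by (auto intro!: power_mono one_le_power simp: M_def simp del: power_Suc)
    then have "1 + \<bar>y\<bar> ^ (p + 1) \<le> 2 * M ^ (p + 1)" by linarith
    then have 1: "B * \<eta> * (1 + \<bar>y\<bar> ^ (p + 1)) \<le> B * \<eta> * (2 * M ^ (p + 1))"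
      using B \<eta> by (intro mult_left_mono) auto
    have "\<bar>x ^ p - y ^ p\<bar> \<le> real p * M ^ p * \<bar>x - y\<bar>"
      using yx M by (intro abs_power_diff_le) (auto simp: M_def)
    also have "\<dots> \<le> real p * M ^ (p + 1) * \<eta>"
      using M xy \<eta> by (intro mult_mono power_increasing) auto
    finally have "\<kappa> * \<bar>x ^ p - y ^ p\<bar> \<le> \<kappa> * (real p * M ^ (p + 1) * \<eta>)"
      using \<kappa> by (intro mult_left_mono) auto
    moreover have "ln W + \<kappa> * x ^ p = (ln W + \<kappa> * y ^ p) + \<kappa> * (x ^ p - y ^ p)" by (simp add: algebra_simps)
    then have "\<bar>ln W + \<kappa> * x ^ p\<bar> \<le> \<bar>ln W + \<kappa> * y ^ p\<bar> + \<kappa> * \<bar>x ^ p - y ^ p\<bar>"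
      using abs_triangle_ineq[of "ln W + \<kappa> * y ^ p" "\<kappa> * (x ^ p - y ^ p)"] \<kappa> by (simp add: abs_mult)
    ultimately have "\<bar>ln W + \<kappa> * x ^ p\<bar> \<le> B * \<eta> * (2 * M ^ (p + 1)) + \<kappa> * (real p * M ^ (p + 1) * \<eta>)"
      using W(2) 1 by linarith
    then show ?thesis by (simp add: algebra_simps)
  qed
  have "\<bar>exp (ln W) - exp (- \<kappa> * x ^ p)\<bar> \<le> L * \<bar>ln W - (- \<kappa> * x ^ p)\<bar>"
    using WL \<phi>L W by (intro abs_exp_diff_le) auto
  then have W\<phi>: "\<bar>W - exp (- \<kappa> * x ^ p)\<bar> \<le> L * \<bar>ln W + \<kappa> * x ^ p\<bar>" using W by simp
  have "W * f y - f x * exp (- \<kappa> * x ^ p) = W * (f y - f x) + f x * (W - exp (- \<kappa> * x ^ p))"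
    by (simp add: algebra_simps)
  also have "\<bar>\<dots>\<bar> \<le> \<bar>W\<bar> * \<bar>f y - f x\<bar> + \<bar>f x\<bar> * \<bar>W - exp (- \<kappa> * x ^ p)\<bar>"
    by (rule order_trans[OF abs_triangle_ineq]) (simp add: abs_mult)
  also have "\<dots> \<le> L * \<eta> + M * (L * (\<eta> * (2 * B + \<kappa> * real p) * M ^ (p + 1)))"
  proof (intro add_mono mult_mono)
    show "\<bar>W - exp (- \<kappa> * x ^ p)\<bar> \<le> L * (\<eta> * (2 * B + \<kappa> * real p) * M ^ (p + 1))"
      by (rule order_trans[OF W\<phi>]) (use diff L0 in \<open>auto intro: mult_left_mono\<close>)
  qed (use WL W L0 f xy M in \<open>auto simp: M_def\<close>)
  also have "\<dots> = \<eta> * L * (1 + (2 * B + \<kappa> * real p) * M ^ (p + 2))"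
    by (simp add: algebra_simps)
  also have "\<dots> \<le> \<eta> * L * (1 * M ^ (p + 2) + (2 * B + \<kappa> * real p) * M ^ (p + 2))"
    using \<eta> L0 M one_le_power[OF M, of "p + 2"] B \<kappa> by (intro mult_left_mono add_mono) (auto simp del: power_Suc power_add)
  finally show ?thesis by (simp add: L_def M_def algebra_simps)
qed

text \<open>The first summand comes from \<open>cell_bound\<close>; \<open>1 / \<epsilon>\<close>
  accounts for the part of the integral outside the window, where
  \<open>\<eta> / \<epsilon> * (1 + \<bar>x\<bar>)\<close> is at least 1.\<close>

definition riemann_const :: real where
  "riemann_const = exp (B + \<kappa> / 2) * (1 + 2 * B + \<kappa> * real p) + 1 / \<epsilon>"

lemma riemann_const_nonneg: "0 \<le> riemann_const"
  unfolding riemann_const_def using B \<kappa> \<epsilon> by (intro add_nonneg_nonneg mult_nonneg_nonneg) auto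

lemma integrable_test:
  assumes f: "f \<in> borel_measurable borel" "\<And>x. \<bar>f x\<bar> \<le> 1 + \<bar>x\<bar>"
  shows "integrable lborel (\<lambda>x. f x * exp (- \<kappa> * x ^ p))"
proof (rule Bochner_Integration.integrable_bound[OF integrable_envelope[OF \<kappa>, of 1]])
  show "(\<lambda>x. f x * exp (- \<kappa> * x ^ p)) \<in> borel_measurable lborel" using f(1) by simp
  show "AE x in lborel. norm (f x * exp (- \<kappa> * x ^ p)) \<le> norm ((1 + \<bar>x\<bar>) ^ 1 * exp (- \<kappa> * x ^ p))"
    using f(2) by (intro AE_I2) (simp add: abs_mult mult_right_mono)
qed

text \<open>\<open>\<Delta>\<close> is the mesh of the grid, \<open>\<eta>\<close> the target
  accuracy and \<open>\<epsilon> / \<eta>\<close> the radius of the window in which the weights are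
  known; beyond it only the smallness of their sum enters. The bound is independent of
  \<open>f\<close>, as the Wasserstein distance demands.\<close>

lemma riemann_sum_approx:
  fixes \<eta> \<Delta> c :: real and K :: "nat set" and W :: "nat \<Rightarrow> real" and f :: "real \<Rightarrow> real"
  defines "X \<equiv> (\<lambda>k. \<Delta> * (real k - c))"
  assumes \<eta>: "0 < \<eta>" "\<eta> \<le> 1" and \<Delta>: "0 < \<Delta>" "\<Delta> \<le> \<eta>" and K: "finite K" and c: "\<epsilon> / \<eta> \<le> \<Delta> * c"
    and W0: "\<And>k. k \<in> K \<Longrightarrow> 0 \<le> W k"
    and W: "\<And>k. \<bar>X k\<bar> \<le> \<epsilon> / \<eta> \<Longrightarrow> k \<in> K \<and> 0 < W k \<and>
      \<bar>ln (W k) + \<kappa> * X k ^ p\<bar> \<le> B * \<eta> * (1 + \<bar>X k\<bar> ^ (p + 1))"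
    and tail: "(\<Sum>k\<in>{k \<in> K. \<not> \<bar>X k\<bar> \<le> \<epsilon> / \<eta>}. \<Delta> * W k * (1 + \<bar>X k\<bar>)) \<le> B * \<eta>"
    and f: "\<And>x y. \<bar>f y - f x\<bar> \<le> \<bar>y - x\<bar>" "\<And>x. \<bar>f x\<bar> \<le> 1 + \<bar>x\<bar>" "f \<in> borel_measurable borel"
  shows "\<bar>\<Delta> * (\<Sum>k\<in>K. W k * f (X k)) - (\<integral>x. f x * exp (- \<kappa> * x ^ p) \<partial>lborel)\<bar> \<le>
    (riemann_const * (\<integral>x. (1 + \<bar>x\<bar>) ^ (p + 2) * exp (- (\<kappa> / 2 ^ (p + 1)) * x ^ p) \<partial>lborel) + B) * \<eta>"
proof -
  define V where "V = {k \<in> K. \<bar>X k\<bar> \<le> \<epsilon> / \<eta>}"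
  define E where "E x = (1 + \<bar>x\<bar>) ^ (p + 2) * exp (- (\<kappa> / 2 ^ (p + 1)) * x ^ p)" for x
  \<comment> \<open>Half-open cells are disjoint, and membership is decided by a floor
    (\<open>cell_iff\<close>).\<close>
  define cell where "cell k = {X k ..< X k + \<Delta>}" for k
  have V: "finite V" using K by (simp add: V_def)
  have cell_iff: "x \<in> cell k \<longleftrightarrow> \<lfloor>x / \<Delta> + c\<rfloor> = int k" for x k
  proof -
    have "x \<in> cell k \<longleftrightarrow> real k \<le> x / \<Delta> + c \<and> x / \<Delta> + c < real k + 1"
      using \<Delta> by (auto simp: cell_def X_def field_simps)
    then show ?thesis by (simp add: floor_eq_iff)
  qed
  \<comment> \<open>The step function whose integral is the sum over the window.\<close>
  define g where "g x = (\<Sum>k\<in>V. indicator (cell k) x * (W k * f (X k)))" for x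
  have int_cell: "integrable lborel (\<lambda>x. indicator (cell k) x * a)" for k and a :: real
    using \<Delta> by (auto simp: cell_def intro!: integrable_mult_left integrable_real_indicator)
  have int_g: "integrable lborel g" unfolding g_def by (intro Bochner_Integration.integrable_sum int_cell)
  have g: "(\<integral>x. g x \<partial>lborel) = \<Delta> * (\<Sum>k\<in>V. W k * f (X k))"
  proof -
    have 1: "(\<integral>x. indicator (cell k) x * a \<partial>lborel) = \<Delta> * a" for k and a :: real
      using \<Delta> by (simp add: cell_def)
    have "(\<integral>x. g x \<partial>lborel) = (\<Sum>k\<in>V. \<integral>x. indicator (cell k) x * (W k * f (X k)) \<partial>lborel)"
      unfolding g_def by (rule Bochner_Integration.integral_sum) (rule int_cell)
    then show ?thesis by (simp only: 1 sum_distrib_left)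
  qed
  have int_f: "integrable lborel (\<lambda>x. f x * exp (- \<kappa> * x ^ p))"
    by (rule integrable_test[OF f(3,2)])
  have E0: "0 \<le> E x" for x by (simp add: E_def)
  have int_E: "integrable lborel E"
    unfolding E_def[abs_def] using \<kappa> by (intro integrable_envelope) auto
  have pw: "\<bar>g x - f x * exp (- \<kappa> * x ^ p)\<bar> \<le> \<eta> * riemann_const * E x" for x
  proof (cases "\<exists>k\<in>V. x \<in> cell k")
    case True
    then obtain k where k: "k \<in> V" "x \<in> cell k" by blast
    have "g x = indicator (cell k) x * (W k * f (X k)) +
        (\<Sum>j\<in>V - {k}. indicator (cell j) x * (W j * f (X j)))"
      unfolding g_def by (rule sum.remove[OF V k(1)])
    also have "(\<Sum>j\<in>V - {k}. indicator (cell j) x * (W j * f (X j))) = 0"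
      using k(2) by (intro sum.neutral) (auto simp: cell_iff)
    finally have gx: "g x = W k * f (X k)" using k(2) by simp
    have "\<bar>X k\<bar> \<le> \<epsilon> / \<eta>" using k(1) by (simp add: V_def)
    note Wk = this W[OF this]
    have "\<bar>x - X k\<bar> \<le> \<eta>" using k(2) \<Delta> by (auto simp: cell_def)
    then have "\<bar>W k * f (X k) - f x * exp (- \<kappa> * x ^ p)\<bar> \<le>
        \<eta> * (exp (B + \<kappa> / 2) * (1 + 2 * B + \<kappa> * real p)) * E x"
      unfolding E_def using Wk f by (intro cell_bound[OF \<eta>]) auto
    also have "\<dots> \<le> \<eta> * riemann_const * E x"
      using \<eta> E0 \<epsilon> by (intro mult_right_mono mult_left_mono) (auto simp: riemann_const_def)
    finally show ?thesis by (simp add: gx)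
  next
    case False
    then have "g x = 0" unfolding g_def by (intro sum.neutral) auto
    \<comment> \<open>A point in no cell lies essentially outside the window: otherwise the grid
      point to its left would be in the window, with a nonnegative index because
      \<open>\<Delta> * c\<close> is at least the radius \<open>\<epsilon> / \<eta>\<close>.\<close>
    have far: "\<epsilon> / \<eta> < 1 + \<bar>x\<bar>"
    proof (rule ccontr)
      assume near: "\<not> ?thesis"
      define k where "k = \<lfloor>x / \<Delta> + c\<rfloor>"
      define y where "y = \<Delta> * (of_int k - c)"
      have k: "of_int k \<le> x / \<Delta> + c" "x / \<Delta> + c < of_int k + 1" unfolding k_def by linarith+
      then have y: "y \<le> x" "x < y + \<Delta>" using \<Delta> by (auto simp: y_def field_simps)
      then have "\<bar>y\<bar> \<le> \<epsilon> / \<eta>" using near \<Delta> \<eta> by linarith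
      then have "- (\<Delta> * c) \<le> y" using c by linarith
      then have "0 \<le> \<Delta> * of_int k" by (simp add: y_def algebra_simps)
      then have "0 \<le> k" using \<Delta> by (simp add: zero_le_mult_iff)
      then have Xk: "X (nat k) = y" by (simp add: X_def y_def)
      then have "nat k \<in> V" using W[of "nat k"] \<open>\<bar>y\<bar> \<le> \<epsilon> / \<eta>\<close> by (simp add: V_def)
      moreover have "x \<in> cell (nat k)" using \<open>0 \<le> k\<close> by (simp add: cell_iff k_def)
      ultimately show False using False by blast
    qed
    \<comment> \<open>One factor \<open>1 + \<bar>x\<bar>\<close> of the envelope is spent to gain
      \<open>\<eta>\<close>.\<close>
    then have 1: "1 \<le> \<eta> / \<epsilon> * (1 + \<bar>x\<bar>)" using \<eta> \<epsilon> by (simp add: field_simps)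
    have "\<bar>f x * exp (- \<kappa> * x ^ p)\<bar> \<le> (1 + \<bar>x\<bar>) * exp (- (\<kappa> / 2 ^ (p + 1)) * x ^ p)"
    proof -
      show ?thesis unfolding abs_mult using f rate_le[of x] by (intro mult_mono) auto
    qed
    also have "\<dots> \<le> (\<eta> / \<epsilon> * (1 + \<bar>x\<bar>)) * ((1 + \<bar>x\<bar>) * exp (- (\<kappa> / 2 ^ (p + 1)) * x ^ p))"
      using mult_right_mono[OF 1, of "(1 + \<bar>x\<bar>) * exp (- (\<kappa> / 2 ^ (p + 1)) * x ^ p)"] by simp
    also have "\<dots> = \<eta> / \<epsilon> * ((1 + \<bar>x\<bar>) ^ 2 * exp (- (\<kappa> / 2 ^ (p + 1)) * x ^ p))"
      by (simp add: power2_eq_square)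
    also have "\<dots> \<le> \<eta> / \<epsilon> * E x"
      unfolding E_def using \<eta> \<epsilon> by (intro mult_left_mono mult_right_mono power_increasing) auto
    also have "\<dots> \<le> \<eta> * riemann_const * E x"
    proof (rule mult_right_mono[OF _ E0])
      have "1 / \<epsilon> \<le> riemann_const" using B \<kappa> by (simp add: riemann_const_def)
      then show "\<eta> / \<epsilon> \<le> \<eta> * riemann_const" using \<eta> mult_left_mono[of "1 / \<epsilon>" riemann_const \<eta>] by simp
    qed
    finally show ?thesis using \<open>g x = 0\<close> by simp
  qed
  have "\<bar>\<integral>x. g x - f x * exp (- \<kappa> * x ^ p) \<partial>lborel\<bar> \<le> (\<integral>x. \<eta> * riemann_const * E x \<partial>lborel)"
    using int_g int_f int_E pw
    by (intro order_trans[OF integral_abs_bound] integral_mono integrable_abs Bochner_Integration.integrable_diff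
        integrable_mult_right) auto
  then have 1: "\<bar>\<Delta> * (\<Sum>k\<in>V. W k * f (X k)) - (\<integral>x. f x * exp (- \<kappa> * x ^ p) \<partial>lborel)\<bar> \<le>
      \<eta> * riemann_const * (\<integral>x. E x \<partial>lborel)"
    using int_g int_f by (simp add: Bochner_Integration.integral_diff g)
  have split: "(\<Sum>k\<in>K. W k * f (X k)) = (\<Sum>k\<in>V. W k * f (X k)) +
      (\<Sum>k\<in>{k \<in> K. \<not> \<bar>X k\<bar> \<le> \<epsilon> / \<eta>}. W k * f (X k))"
    unfolding V_def by (subst sum.union_disjoint[symmetric]) (use K in \<open>auto intro!: sum.cong\<close>)
  have "\<bar>\<Delta> * (\<Sum>k\<in>{k \<in> K. \<not> \<bar>X k\<bar> \<le> \<epsilon> / \<eta>}. W k * f (X k))\<bar> \<le>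
      (\<Sum>k\<in>{k \<in> K. \<not> \<bar>X k\<bar> \<le> \<epsilon> / \<eta>}. \<Delta> * W k * (1 + \<bar>X k\<bar>))"
    unfolding sum_distrib_left
  proof (rule order_trans[OF sum_abs sum_mono])
    fix k assume "k \<in> {k \<in> K. \<not> \<bar>X k\<bar> \<le> \<epsilon> / \<eta>}"
    then have "0 \<le> \<Delta> * W k" using W0 \<Delta> by simp
    then have "\<bar>\<Delta> * W k\<bar> = \<Delta> * W k" by (rule abs_of_nonneg)
    then have "\<bar>\<Delta> * (W k * f (X k))\<bar> = \<Delta> * W k * \<bar>f (X k)\<bar>"
      using abs_mult[of "\<Delta> * W k" "f (X k)"] by (simp only: mult.assoc)
    also have "\<dots> \<le> \<Delta> * W k * (1 + \<bar>X k\<bar>)"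
      using \<open>0 \<le> \<Delta> * W k\<close> f(2) by (intro mult_left_mono)
    finally show "\<bar>\<Delta> * (W k * f (X k))\<bar> \<le> \<Delta> * W k * (1 + \<bar>X k\<bar>)" .
  qed
  then have "\<bar>\<Delta> * (\<Sum>k\<in>{k \<in> K. \<not> \<bar>X k\<bar> \<le> \<epsilon> / \<eta>}. W k * f (X k))\<bar> \<le> B * \<eta>" using tail by linarith
  then have "\<bar>\<Delta> * (\<Sum>k\<in>K. W k * f (X k)) - (\<integral>x. f x * exp (- \<kappa> * x ^ p) \<partial>lborel)\<bar> \<le>
      \<eta> * riemann_const * (\<integral>x. E x \<partial>lborel) + B * \<eta>"
    using 1 unfolding split by (simp add: distrib_left)
  then show ?thesis by (simp add: E_def algebra_simps)
qed

text \<open>The unnormalised estimate is applied to the test function and to 1; the quotient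
  inherits the rate once its denominator stays away from 0.\<close>

lemma laplace_lipschitz:
  obtains C \<eta>0 where "C \<ge> 0" "0 < \<eta>0"
    "\<And>\<eta> \<Delta> c K W f. \<lbrakk>0 < \<eta>; \<eta> < \<eta>0; 0 < \<Delta>; \<Delta> \<le> \<eta>; finite K; \<epsilon> / \<eta> \<le> \<Delta> * c;
      \<And>k. k \<in> K \<Longrightarrow> 0 \<le> W k;
      \<And>k. \<bar>\<Delta> * (real k - c)\<bar> \<le> \<epsilon> / \<eta> \<Longrightarrow> k \<in> K \<and> 0 < W k \<and>
        \<bar>ln (W k) + \<kappa> * (\<Delta> * (real k - c)) ^ p\<bar> \<le> B * \<eta> * (1 + \<bar>\<Delta> * (real k - c)\<bar> ^ (p + 1));
      (\<Sum>k\<in>{k \<in> K. \<not> \<bar>\<Delta> * (real k - c)\<bar> \<le> \<epsilon> / \<eta>}. \<Delta> * W k * (1 + \<bar>\<Delta> * (real k - c)\<bar>)) \<le> B * \<eta>;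
      1-lipschitz_on UNIV f\<rbrakk> \<Longrightarrow>
     \<bar>(\<Sum>k\<in>K. W k * f (\<Delta> * (real k - c))) / (\<Sum>k\<in>K. W k) -
       (\<integral>x. f x * exp (- \<kappa> * x ^ p) \<partial>lborel) / (\<integral>x. exp (- \<kappa> * x ^ p) \<partial>lborel)\<bar> \<le> C * \<eta>"
proof -
  define C1 where "C1 = riemann_const * (\<integral>x. (1 + \<bar>x\<bar>) ^ (p + 2) * exp (- (\<kappa> / 2 ^ (p + 1)) * x ^ p) \<partial>lborel) + B"
  have C1: "0 \<le> C1" unfolding C1_def using riemann_const_nonneg B
    by (intro add_nonneg_nonneg mult_nonneg_nonneg Bochner_Integration.integral_nonneg) auto
  define N where "N g = (\<integral>x. g x * exp (- \<kappa> * x ^ p) \<partial>lborel)" for g :: "real \<Rightarrow> real"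
  define N1 where "N1 = N (\<lambda>_. 1)"
  define N2 where "N2 = N (\<lambda>x. 1 + \<bar>x\<bar>)"
  have int1: "integrable lborel (\<lambda>x. 1 * exp (- \<kappa> * x ^ p))" by (rule integrable_test) auto
  have int2: "integrable lborel (\<lambda>x. (1 + \<bar>x\<bar>) * exp (- \<kappa> * x ^ p))" by (rule integrable_test) auto
  have N1: "N1 > 0"
  proof -
    have "N1 \<ge> 0" unfolding N1_def N_def by (intro Bochner_Integration.integral_nonneg) auto
    moreover have "N1 \<noteq> 0"
    proof
      assume "N1 = 0"
      then have "AE x in lborel. 1 * exp (- \<kappa> * x ^ p) = 0"
        unfolding N1_def N_def by (subst (asm) integral_nonneg_eq_0_iff_AE[OF int1]) auto
      then have "AE x in (lborel :: real measure). False" by simp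
      then show False by (simp add: AE_iff_measurable[of UNIV] space_lborel)
    qed
    ultimately show ?thesis by simp
  qed
  have N2: "N2 \<ge> 0" unfolding N2_def N_def by (intro Bochner_Integration.integral_nonneg) auto
  \<comment> \<open>Keeps the sum for the test function 1 above half of its limit
    \<open>N1\<close>.\<close>
  define \<eta>0 where "\<eta>0 = min 1 (N1 / (2 * C1 + 1))"
  show thesis
  proof (rule that[of "2 * C1 / N1 + 2 * C1 * N2 / N1\<^sup>2" \<eta>0])
    show "0 < \<eta>0" using N1 C1 by (simp add: \<eta>0_def)
    show "0 \<le> 2 * C1 / N1 + 2 * C1 * N2 / N1\<^sup>2" using N1 N2 C1 by simp
    fix \<eta> \<Delta> c :: real and K :: "nat set" and W :: "nat \<Rightarrow> real" and f :: "real \<Rightarrow> real"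
    let ?X = "\<lambda>k. \<Delta> * (real k - c)"
    assume \<eta>: "0 < \<eta>" "\<eta> < \<eta>0" and asm: "0 < \<Delta>" "\<Delta> \<le> \<eta>" "finite K" "\<epsilon> / \<eta> \<le> \<Delta> * c"
      "\<And>k. k \<in> K \<Longrightarrow> 0 \<le> W k"
      "\<And>k. \<bar>?X k\<bar> \<le> \<epsilon> / \<eta> \<Longrightarrow> k \<in> K \<and> 0 < W k \<and>
        \<bar>ln (W k) + \<kappa> * (?X k) ^ p\<bar> \<le> B * \<eta> * (1 + \<bar>?X k\<bar> ^ (p + 1))"
      "(\<Sum>k\<in>{k \<in> K. \<not> \<bar>?X k\<bar> \<le> \<epsilon> / \<eta>}. \<Delta> * W k * (1 + \<bar>?X k\<bar>)) \<le> B * \<eta>"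
      and lip: "1-lipschitz_on UNIV f"
    have \<eta>1: "\<eta> \<le> 1" "\<eta> < N1 / (2 * C1 + 1)" using \<eta> by (auto simp: \<eta>0_def)
    have fl: "\<bar>f y - f x\<bar> \<le> \<bar>y - x\<bar>" for x y
      using lipschitz_onD[OF lip, of y x] by (simp add: dist_real_def)
    have fm: "f \<in> borel_measurable borel"
      using lipschitz_on_continuous_on[OF lip] by (rule borel_measurable_continuous_onI)
    \<comment> \<open>A Lipschitz function is bounded by \<open>1 + \<bar>x\<bar>\<close> once its
      value at 0 has been subtracted; the constant contributes equally to both quotients
      (\<open>shift\<close>).\<close>
    define f0 where "f0 x = f x - f 0" for x
    have f0: "\<And>x y. \<bar>f0 y - f0 x\<bar> \<le> \<bar>y - x\<bar>" "\<And>x. \<bar>f0 x\<bar> \<le> 1 + \<bar>x\<bar>" "f0 \<in> borel_measurable borel"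
    proof -
      show "\<bar>f0 y - f0 x\<bar> \<le> \<bar>y - x\<bar>" for x y using fl[of y x] by (simp add: f0_def)
      show "\<bar>f0 x\<bar> \<le> 1 + \<bar>x\<bar>" for x using fl[of x 0] by (simp add: f0_def)
      show "f0 \<in> borel_measurable borel" unfolding f0_def[abs_def] using fm by simp
    qed
    define S where "S g = \<Delta> * (\<Sum>k\<in>K. W k * g (?X k))" for g :: "real \<Rightarrow> real"
    have S: "\<bar>S g - N g\<bar> \<le> C1 * \<eta>"
      if "\<And>x y. \<bar>g y - g x\<bar> \<le> \<bar>y - x\<bar>" "\<And>x. \<bar>g x\<bar> \<le> 1 + \<bar>x\<bar>" "g \<in> borel_measurable borel" for g
      unfolding S_def N_def C1_def
      by (rule riemann_sum_approx[OF \<eta>(1) \<eta>1(1) asm that])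
    have S1: "\<bar>S (\<lambda>_. 1) - N1\<bar> \<le> C1 * \<eta>" unfolding N1_def by (rule S) auto
    have S0: "\<bar>S f0 - N f0\<bar> \<le> C1 * \<eta>" by (rule S) (use f0 in auto)
    have "C1 * \<eta> \<le> N1 / 2"
    proof -
      have "\<eta> * (2 * C1 + 1) < N1" using \<eta>1(2) C1 by (simp add: pos_less_divide_eq)
      then show ?thesis using \<eta> by (simp add: algebra_simps)
    qed
    then have S1': "S (\<lambda>_. 1) \<ge> N1 / 2" using S1 by linarith
    have intf0: "integrable lborel (\<lambda>x. f0 x * exp (- \<kappa> * x ^ p))" by (rule integrable_test) (use f0 in auto)
    have Nf0: "\<bar>N f0\<bar> \<le> N2"
      unfolding N_def N2_def using f0(2) intf0 int2
      by (intro order_trans[OF integral_abs_bound] integral_mono integrable_abs)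
        (auto simp: abs_mult mult_right_mono)
    have shift: "S f / S (\<lambda>_. 1) = S f0 / S (\<lambda>_. 1) + f 0" "N f / N1 = N f0 / N1 + f 0"
    proof -
      have "S f = S f0 + f 0 * S (\<lambda>_. 1)"
        unfolding S_def f0_def by (simp add: algebra_simps sum.distrib sum_subtractf sum_distrib_left)
      then show "S f / S (\<lambda>_. 1) = S f0 / S (\<lambda>_. 1) + f 0" using S1' N1 by (simp add: field_simps)
      have "N f = (\<integral>x. f0 x * exp (- \<kappa> * x ^ p) + f 0 * (1 * exp (- \<kappa> * x ^ p)) \<partial>lborel)"
        unfolding N_def f0_def by (simp add: algebra_simps)
      also have "\<dots> = N f0 + f 0 * N1"
        unfolding N_def N1_def using intf0 int1 by (subst Bochner_Integration.integral_add) auto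
      finally show "N f / N1 = N f0 / N1 + f 0" using N1 by (simp add: field_simps)
    qed
    have "\<bar>S f0 / S (\<lambda>_. 1) - N f0 / N1\<bar> \<le> C1 * \<eta> / (N1 / 2) + N2 * (C1 * \<eta>) / (N1 / 2 * N1)"
    proof -
      have "S f0 / S (\<lambda>_. 1) - N f0 / N1 = (S f0 - N f0) / S (\<lambda>_. 1) + N f0 * (N1 - S (\<lambda>_. 1)) / (S (\<lambda>_. 1) * N1)"
        using S1' N1 by (simp add: field_simps)
      also have "\<bar>\<dots>\<bar> \<le> \<bar>S f0 - N f0\<bar> / S (\<lambda>_. 1) + \<bar>N f0\<bar> * \<bar>N1 - S (\<lambda>_. 1)\<bar> / (S (\<lambda>_. 1) * N1)"
        using S1' N1 by (intro order_trans[OF abs_triangle_ineq]) (simp add: abs_mult abs_divide)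
      also have "\<dots> \<le> C1 * \<eta> / (N1 / 2) + N2 * (C1 * \<eta>) / (N1 / 2 * N1)"
        using S0 S1 S1' N1 N2 Nf0 C1 \<eta>
        by (intro add_mono frac_le mult_mono mult_right_mono) (auto simp: abs_minus_commute)
      finally show ?thesis .
    qed
    also have "\<dots> = (2 * C1 / N1 + 2 * C1 * N2 / N1\<^sup>2) * \<eta>"
      using N1 by (simp add: field_simps power2_eq_square)
    finally have "\<bar>S f / S (\<lambda>_. 1) - N f / N1\<bar> \<le> (2 * C1 / N1 + 2 * C1 * N2 / N1\<^sup>2) * \<eta>"
      unfolding shift by simp
    then show "\<bar>(\<Sum>k\<in>K. W k * f (?X k)) / (\<Sum>k\<in>K. W k) -
       (\<integral>x. f x * exp (- \<kappa> * x ^ p) \<partial>lborel) / (\<integral>x. exp (- \<kappa> * x ^ p) \<partial>lborel)\<bar> \<le>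
       (2 * C1 / N1 + 2 * C1 * N2 / N1\<^sup>2) * \<eta>"
      using asm(1) by (simp add: S_def N_def N1_def)
  qed
qed

end

end

section \<open>Limit theorems\<close>

lemma floor_fraction:
  fixes a :: real
  assumes "0 \<le> a" "n > 0"
  shows "\<bar>real (nat \<lfloor>real n * a\<rfloor>) / real n - a\<bar> \<le> 1 / real n"
proof -
  have "0 \<le> real n * a" using assms by simp
  then have "real (nat \<lfloor>real n * a\<rfloor>) \<le> real n * a" "real n * a < real (nat \<lfloor>real n * a\<rfloor>) + 1"
    by linarith+
  then have "\<bar>real (nat \<lfloor>real n * a\<rfloor>) - real n * a\<bar> \<le> 1" by linarith
  moreover have "real (nat \<lfloor>real n * a\<rfloor>) / real n - a = (real (nat \<lfloor>real n * a\<rfloor>) - real n * a) / real n"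
    using assms by (simp add: field_simps)
  ultimately show ?thesis using assms by (simp add: abs_divide divide_right_mono)
qed

context
  fixes d :: nat and \<beta> h :: real
  assumes d: "d \<ge> 3" and \<beta>: "0 < \<beta>"
begin

lemma level_weight_asymp_sym:
  assumes \<epsilon>: "0 < \<epsilon>"
  obtains C N where "C \<ge> 0" "\<And>n k k'. n \<ge> N \<Longrightarrow> regular_graphs d n \<noteq> {} \<Longrightarrow>
    \<epsilon> \<le> real k / real n \<Longrightarrow> real k / real n \<le> 1 - \<epsilon> \<Longrightarrow>
    \<epsilon> \<le> real k' / real n \<Longrightarrow> real k' / real n \<le> 1 - \<epsilon> \<Longrightarrow>
    \<bar>ln (level_weight d n \<beta> h k') - ln (level_weight d n \<beta> h k) - real n * (A_fun d \<beta> h (real k' / real n) - A_fun d \<beta> h (real k / real n))\<bar>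
      \<le> C * \<bar>real k' / real n - real k / real n\<bar>"
proof -
  obtain C N where C: "C \<ge> 0" and asymp: "\<And>n k k'. n \<ge> N \<Longrightarrow> regular_graphs d n \<noteq> {} \<Longrightarrow>
    \<epsilon> * real n \<le> real k \<Longrightarrow> k \<le> k' \<Longrightarrow> real k' \<le> (1 - \<epsilon>) * real n \<Longrightarrow>
    \<bar>ln (level_weight d n \<beta> h k') - ln (level_weight d n \<beta> h k) - real n * (A_fun d \<beta> h (real k' / real n) - A_fun d \<beta> h (real k / real n))\<bar>
      \<le> C * (real k' - real k) / real n"
    using level_weight_asymp[OF d \<beta> \<epsilon>, where h = h] by blast
  have half: "\<bar>ln (level_weight d n \<beta> h k') - ln (level_weight d n \<beta> h k) - real n * (A_fun d \<beta> h (real k' / real n) - A_fun d \<beta> h (real k / real n))\<bar>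
      \<le> C * \<bar>real k' / real n - real k / real n\<bar>"
    if n: "n \<ge> max N 1" "regular_graphs d n \<noteq> {}" and k: "\<epsilon> \<le> real k / real n" "real k' / real n \<le> 1 - \<epsilon>" "k \<le> k'"
    for n k k'
  proof -
    have n0: "real n > 0" using n by simp
    have "\<epsilon> * real n \<le> real k" "real k' \<le> (1 - \<epsilon>) * real n"
      using k n0 by (auto simp: pos_le_divide_eq pos_divide_le_eq)
    then have "\<bar>ln (level_weight d n \<beta> h k') - ln (level_weight d n \<beta> h k) - real n * (A_fun d \<beta> h (real k' / real n) - A_fun d \<beta> h (real k / real n))\<bar>
        \<le> C * (real k' - real k) / real n"
      using n k by (intro asymp) auto
    also have "\<dots> = C * \<bar>real k' / real n - real k / real n\<bar>"
      using k n0 by (simp add: abs_of_nonneg divide_right_mono flip: diff_divide_distrib)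
    finally show ?thesis .
  qed
  show thesis
  proof (rule that[OF C, of "max N 1"])
    fix n k k' assume n: "n \<ge> max N 1" "regular_graphs d n \<noteq> {}"
      and k: "\<epsilon> \<le> real k / real n" "real k / real n \<le> 1 - \<epsilon>" "\<epsilon> \<le> real k' / real n" "real k' / real n \<le> 1 - \<epsilon>"
    show "\<bar>ln (level_weight d n \<beta> h k') - ln (level_weight d n \<beta> h k) - real n * (A_fun d \<beta> h (real k' / real n) - A_fun d \<beta> h (real k / real n))\<bar>
      \<le> C * \<bar>real k' / real n - real k / real n\<bar>"
    proof (cases "k \<le> k'")
      case True
      then show ?thesis by (intro half n k)
    next
      case False
      then have "\<bar>ln (level_weight d n \<beta> h k) - ln (level_weight d n \<beta> h k') - real n * (A_fun d \<beta> h (real k / real n) - A_fun d \<beta> h (real k' / real n))\<bar>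
          \<le> C * \<bar>real k / real n - real k' / real n\<bar>"
        by (intro half n k) auto
      moreover have "ln (level_weight d n \<beta> h k) - ln (level_weight d n \<beta> h k') - real n * (A_fun d \<beta> h (real k / real n) - A_fun d \<beta> h (real k' / real n)) =
          - (ln (level_weight d n \<beta> h k') - ln (level_weight d n \<beta> h k) - real n * (A_fun d \<beta> h (real k' / real n) - A_fun d \<beta> h (real k / real n)))"
        by (simp add: algebra_simps)
      ultimately show ?thesis by (simp only: abs_minus_cancel abs_minus_commute[of "real k / real n"])
    qed
  qed
qed

text \<open>In the interior this is compactness together with \<open>level_weight_asymp_sym\<close>;
  near the ends the level is first moved inwards by \<open>level_weight_edges\<close>. The level
  next to a maximizer \<open>a\<close> serves as the reference.\<close>

lemma off_maximizers:
  assumes F: "finite F" "F \<subseteq> {0<..<1}" and max: "\<And>f. f \<in> F \<Longrightarrow> A_fun d \<beta> h f = m"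
    and less: "\<And>b. 0 < b \<Longrightarrow> b < 1 \<Longrightarrow> b \<notin> F \<Longrightarrow> A_fun d \<beta> h b < m"
    and \<delta>: "0 < \<delta>" and a: "a \<in> F"
  obtains \<gamma> N where "0 < \<gamma>" "\<And>n k. n \<ge> N \<Longrightarrow> regular_graphs d n \<noteq> {} \<Longrightarrow> k \<le> n \<Longrightarrow>
    (\<And>f. f \<in> F \<Longrightarrow> \<bar>real k / real n - f\<bar> > \<delta>) \<Longrightarrow>
    level_weight d n \<beta> h k \<le> exp (- \<gamma> * real n) * level_weight d n \<beta> h (nat \<lfloor>real n * a\<rfloor>)"
proof -
  obtain \<epsilon>0 where \<epsilon>0: "0 < \<epsilon>0" "\<epsilon>0 < 1 / 2"
    "\<And>n k. regular_graphs d n \<noteq> {} \<Longrightarrow> real (Suc k) \<le> \<epsilon>0 * real n \<Longrightarrow> level_weight d n \<beta> h k \<le> level_weight d n \<beta> h (Suc k)"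
    "\<And>n k. regular_graphs d n \<noteq> {} \<Longrightarrow> k < n \<Longrightarrow> real k \<ge> (1 - \<epsilon>0) * real n \<Longrightarrow> level_weight d n \<beta> h (Suc k) \<le> level_weight d n \<beta> h k"
    using level_weight_edges[OF d \<beta>, where h = h] by blast
  \<comment> \<open>All maximizers keep the distance \<open>3 * \<epsilon>\<close> from 0 and 1, and
    \<open>2 * \<epsilon>\<close> is still in the range of
    \<open>level_weight_edges\<close>.\<close>
  define \<epsilon> where "\<epsilon> = Min (insert (\<epsilon>0 / 2) ((\<lambda>f. min (f / 3) ((1 - f) / 3)) ` F))"
  have \<epsilon>_le: "\<epsilon> \<le> x" if "x \<in> insert (\<epsilon>0 / 2) ((\<lambda>f. min (f / 3) ((1 - f) / 3)) ` F)" for x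
    unfolding \<epsilon>_def using F that by (intro Min_le) auto
  have \<epsilon>: "0 < \<epsilon>"
    unfolding \<epsilon>_def using F \<epsilon>0 by (subst Min_gr_iff) auto
  have \<epsilon>1: "\<epsilon> \<le> \<epsilon>0 / 2" by (rule \<epsilon>_le) simp
  have \<epsilon>F: "3 * \<epsilon> \<le> f" "3 * \<epsilon> \<le> 1 - f" if "f \<in> F" for f
  proof -
    have "\<epsilon> \<le> min (f / 3) ((1 - f) / 3)" by (rule \<epsilon>_le) (use that in auto)
    then show "3 * \<epsilon> \<le> f" "3 * \<epsilon> \<le> 1 - f" by auto
  qed
  define \<delta>' where "\<delta>' = min \<delta> \<epsilon>"
  have \<delta>': "0 < \<delta>'" "\<delta>' \<le> \<delta>" "\<delta>' \<le> \<epsilon>" using \<delta> \<epsilon> by (auto simp: \<delta>'_def)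
  define T where "T = {x \<in> {\<epsilon>..1 - \<epsilon>}. \<forall>f\<in>F. \<delta>' \<le> \<bar>x - f\<bar>}"
  \<comment> \<open>Of the gap \<open>3 * \<gamma>\<close>, one part is lost in rounding
    \<open>a\<close> to a multiple of \<open>1 / n\<close> and one in the error \<open>C\<close>;
    the third is the rate.\<close>
  obtain \<gamma> where \<gamma>: "0 < \<gamma>" "\<And>x. x \<in> T \<Longrightarrow> A_fun d \<beta> h x \<le> m - 3 * \<gamma>"
  proof (cases "T = {}")
    case True
    then show ?thesis by (intro that[of 1]) auto
  next
    case False
    have "T = {\<epsilon>..1 - \<epsilon>} \<inter> (\<Inter>f\<in>F. {x. \<delta>' \<le> \<bar>x - f\<bar>})" by (auto simp: T_def)
    moreover have "closed {x. \<delta>' \<le> \<bar>x - f\<bar>}" for f :: real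
      by (intro closed_Collect_le continuous_intros)
    ultimately have "compact T" by (auto intro!: compact_Int_closed)
    moreover have "continuous_on T (A_fun d \<beta> h)"
      using \<epsilon> by (intro cont_A[OF d \<beta>]) (auto simp: T_def)
    ultimately obtain x where x: "x \<in> T" "\<And>y. y \<in> T \<Longrightarrow> A_fun d \<beta> h y \<le> A_fun d \<beta> h x"
      using continuous_attains_sup[of T "A_fun d \<beta> h"] False by blast
    have "A_fun d \<beta> h x < m" using x(1) \<epsilon> \<delta>' by (intro less) (auto simp: T_def)
    moreover have "A_fun d \<beta> h y \<le> m - 3 * ((m - A_fun d \<beta> h x) / 3)" if "y \<in> T" for y
      using x(2)[OF that] by (simp add: field_simps)
    ultimately show ?thesis by (intro that[of "(m - A_fun d \<beta> h x) / 3"]) auto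
  qed
  obtain C N where C: "C \<ge> 0" and asymp: "\<And>n k k'. n \<ge> N \<Longrightarrow> regular_graphs d n \<noteq> {} \<Longrightarrow>
    \<epsilon> \<le> real k / real n \<Longrightarrow> real k / real n \<le> 1 - \<epsilon> \<Longrightarrow>
    \<epsilon> \<le> real k' / real n \<Longrightarrow> real k' / real n \<le> 1 - \<epsilon> \<Longrightarrow>
    \<bar>ln (level_weight d n \<beta> h k') - ln (level_weight d n \<beta> h k) - real n * (A_fun d \<beta> h (real k' / real n) - A_fun d \<beta> h (real k / real n))\<bar>
      \<le> C * \<bar>real k' / real n - real k / real n\<bar>"
    using level_weight_asymp_sym[OF \<epsilon>] by blast
  have a01: "0 < a" "a < 1" using a F by auto
  have "isCont (A_fun d \<beta> h) a" by (rule DERIV_isCont[OF A_fun_deriv[OF d \<beta> a01]])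
  then have "eventually (\<lambda>x. dist (A_fun d \<beta> h x) (A_fun d \<beta> h a) < \<gamma>) (nhds a)"
    using \<gamma> by (intro tendstoD) (auto simp: isCont_def tendsto_at_iff_tendsto_nhds)
  then obtain e where e: "0 < e" "\<And>x. dist x a < e \<Longrightarrow> dist (A_fun d \<beta> h x) (A_fun d \<beta> h a) < \<gamma>"
    unfolding eventually_nhds_metric by auto
  define N' where "N' = N + nat \<lceil>1 / e\<rceil> + nat \<lceil>1 / \<epsilon>\<rceil> + nat \<lceil>C / \<gamma>\<rceil> + 2"
  show thesis
  proof (rule that[OF \<gamma>(1), of N'])
    fix n k assume n: "n \<ge> N'" and R: "regular_graphs d n \<noteq> {}" and k: "k \<le> n"
      and far: "\<And>f. f \<in> F \<Longrightarrow> \<bar>real k / real n - f\<bar> > \<delta>"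
    have n0: "real n > 0" "n > 0" using n by (auto simp: N'_def)
    have "1 / e < real n" "1 / \<epsilon> < real n" and Cn: "C / \<gamma> \<le> real n" using n unfolding N'_def by linarith+
    then have ne: "1 / real n < e" "1 / real n < \<epsilon>" using e \<epsilon> n0 by (auto simp: field_simps)
    define ka where "ka = nat \<lfloor>real n * a\<rfloor>"
    have ka: "\<bar>real ka / real n - a\<bar> \<le> 1 / real n"
      unfolding ka_def using a01 n0 by (intro floor_fraction) auto
    have kab: "\<epsilon> \<le> real ka / real n" "real ka / real n \<le> 1 - \<epsilon>" using ka ne \<epsilon>F[OF a] by linarith+
    have "dist (A_fun d \<beta> h (real ka / real n)) (A_fun d \<beta> h a) < \<gamma>" using ka ne by (intro e) (simp add: dist_real_def)
    then have Aka: "A_fun d \<beta> h (real ka / real n) \<ge> m - \<gamma>" using max[OF a] by (simp add: dist_real_def)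
    have key: "level_weight d n \<beta> h j \<le> exp (- \<gamma> * real n) * level_weight d n \<beta> h ka" if j: "real j / real n \<in> T" "j \<le> n" for j
    proof -
      have jb: "\<epsilon> \<le> real j / real n" "real j / real n \<le> 1 - \<epsilon>" using j by (auto simp: T_def)
      have "\<bar>ln (level_weight d n \<beta> h j) - ln (level_weight d n \<beta> h ka) - real n * (A_fun d \<beta> h (real j / real n) - A_fun d \<beta> h (real ka / real n))\<bar>
        \<le> C * \<bar>real j / real n - real ka / real n\<bar>"
        using n by (intro asymp R kab jb) (simp add: N'_def)
      moreover have "C * \<bar>real j / real n - real ka / real n\<bar> \<le> C * 1"
        using C kab jb \<epsilon> by (intro mult_left_mono) auto
      moreover have "real n * (A_fun d \<beta> h (real j / real n) - A_fun d \<beta> h (real ka / real n)) \<le> real n * (- 2 * \<gamma>)"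
        using \<gamma>(2)[OF j(1)] Aka by (intro mult_left_mono) auto
      moreover have "C \<le> \<gamma> * real n" using Cn \<gamma> by (simp add: field_simps)
      moreover have "real n * (- 2 * \<gamma>) = - (\<gamma> * real n) - \<gamma> * real n" by simp
      ultimately have "ln (level_weight d n \<beta> h j) \<le> - (\<gamma> * real n) + ln (level_weight d n \<beta> h ka)" by argo
      then have "exp (ln (level_weight d n \<beta> h j)) \<le> exp (- \<gamma> * real n + ln (level_weight d n \<beta> h ka))" by simp
      moreover have "ka \<le> n"
      proof -
        have "real ka / real n \<le> 1" using kab \<epsilon> by linarith
        then show ?thesis using n0 by (simp add: pos_divide_le_eq)
      qed
      ultimately show ?thesis using level_weight_pos[OF R, of j] level_weight_pos[OF R, of ka] j
        unfolding exp_add by simp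
    qed
    consider "real k < \<epsilon> * real n" | "real k > (1 - \<epsilon>) * real n" | "\<epsilon> * real n \<le> real k" "real k \<le> (1 - \<epsilon>) * real n"
      by linarith
    then have "level_weight d n \<beta> h k \<le> exp (- \<gamma> * real n) * level_weight d n \<beta> h ka"
    proof cases
      case 3
      then have "real k / real n \<in> T"
        using far \<delta>' n0 by (auto simp: T_def pos_le_divide_eq pos_divide_le_eq intro!: less_imp_le intro: le_less_trans)
      then show ?thesis using key k by simp
    next
      case 1
      \<comment> \<open>The first level above \<open>\<epsilon> * n\<close>. It lies below
        \<open>2 * \<epsilon> * n\<close>, hence in the monotone range and at distance at least
        \<open>\<epsilon>\<close> from every maximizer, in terms of \<open>k / n\<close>.\<close>
      define k1 where "k1 = nat \<lceil>\<epsilon> * real n\<rceil>"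
      have en: "0 \<le> \<epsilon> * real n" using \<epsilon> n0 by simp
      then have k1: "\<epsilon> * real n \<le> real k1" "real k1 < \<epsilon> * real n + 1" unfolding k1_def by linarith+
      have ne': "1 < \<epsilon> * real n" using ne n0 by (simp add: field_simps)
      have k1': "real k1 \<le> \<epsilon>0 * real n"
      proof -
        have "\<epsilon> * real n + \<epsilon> * real n \<le> \<epsilon>0 * real n" using \<epsilon>1 mult_right_mono[of "2 * \<epsilon>" \<epsilon>0 "real n"] by simp
        then show ?thesis using k1 ne' by linarith
      qed
      have "k \<le> k1" using 1 k1 by linarith
      then have "level_weight d n \<beta> h k \<le> level_weight d n \<beta> h k1"
      proof (induction k rule: inc_induct)
        case (step j)
        have "real (Suc j) \<le> \<epsilon>0 * real n" using step k1' by linarith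
        then show ?case using \<epsilon>0(3)[OF R, of j] step.IH by linarith
      qed simp
      also have "level_weight d n \<beta> h k1 \<le> exp (- \<gamma> * real n) * level_weight d n \<beta> h ka"
      proof (rule key)
        have x: "\<epsilon> \<le> real k1 / real n" "real k1 / real n < \<epsilon> + 1 / real n"
          using k1 n0 by (auto simp: field_simps)
        then have "real k1 / real n < 2 * \<epsilon>" using ne by linarith
        then have "\<delta>' \<le> \<bar>real k1 / real n - f\<bar>" if "f \<in> F" for f
          using \<epsilon>F[OF that] \<delta>' by linarith
        moreover have "real k1 / real n \<le> 1 - \<epsilon>"
          using \<open>real k1 / real n < 2 * \<epsilon>\<close> \<epsilon>1 \<epsilon>0 by linarith
        ultimately show "real k1 / real n \<in> T" using x by (auto simp: T_def)
        have "real k1 \<le> 1 * real n" using k1' \<epsilon>0 mult_right_mono[of \<epsilon>0 1 "real n"] by linarith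
        then show "k1 \<le> n" by simp
      qed
      finally show ?thesis .
    next
      case 2
      define k2 where "k2 = nat \<lfloor>(1 - \<epsilon>) * real n\<rfloor>"
      have e1: "\<epsilon> < 1 / 4" using \<epsilon>1 \<epsilon>0 by linarith
      have en: "0 \<le> (1 - \<epsilon>) * real n" using e1 n0 by simp
      then have k2: "real k2 \<le> (1 - \<epsilon>) * real n" "(1 - \<epsilon>) * real n < real k2 + 1" unfolding k2_def by linarith+
      have ne': "1 < \<epsilon> * real n" using ne n0 by (simp add: field_simps)
      have k2': "(1 - \<epsilon>0) * real n \<le> real k2"
      proof -
        have "\<epsilon> * real n + \<epsilon> * real n \<le> \<epsilon>0 * real n" using \<epsilon>1 mult_right_mono[of "2 * \<epsilon>" \<epsilon>0 "real n"] by simp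
        then show ?thesis using k2 ne' unfolding left_diff_distrib mult_1 by linarith
      qed
      have "k2 \<le> k" using 2 k2 by linarith
      then have "level_weight d n \<beta> h k \<le> level_weight d n \<beta> h k2" using k
      proof (induction k rule: dec_induct)
        case (step j)
        have "(1 - \<epsilon>0) * real n \<le> real j" using step k2' by linarith
        then show ?case using \<epsilon>0(4)[OF R, of j] step by simp
      qed simp
      also have "level_weight d n \<beta> h k2 \<le> exp (- \<gamma> * real n) * level_weight d n \<beta> h ka"
      proof (rule key)
        have x: "real k2 / real n \<le> 1 - \<epsilon>" "1 - \<epsilon> < real k2 / real n + 1 / real n"
          using k2 n0 by (auto simp: field_simps)
        then have "1 - 2 * \<epsilon> < real k2 / real n" using ne by linarith
        then have "\<delta>' \<le> \<bar>real k2 / real n - f\<bar>" if "f \<in> F" for f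
          using \<epsilon>F[OF that] \<delta>' by linarith
        moreover have "\<epsilon> \<le> real k2 / real n"
          using \<open>1 - 2 * \<epsilon> < real k2 / real n\<close> e1 by linarith
        ultimately show "real k2 / real n \<in> T" using x by (auto simp: T_def)
        have "real k2 \<le> real n" using k2 \<open>k2 \<le> k\<close> k by linarith
        then show "k2 \<le> n" by simp
      qed
      finally show ?thesis .
    qed
    then show "level_weight d n \<beta> h k \<le> exp (- \<gamma> * real n) * level_weight d n \<beta> h (nat \<lfloor>real n * a\<rfloor>)" by (simp add: ka_def)
  qed
qed

end

lemma exp_beats_square:
  assumes "0 < (\<gamma>::real)"
  obtains N where "\<And>n. n \<ge> N \<Longrightarrow> (real n + 1) * (2 * exp (- \<gamma> * real n) * (1 + 2 * real n)) \<le> 2 / real n"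
proof -
  have "(\<lambda>n. real n * ((real n + 1) * (2 * exp (- \<gamma> * real n) * (1 + 2 * real n)))) \<longlonglongrightarrow> 0"
    using assms by real_asymp
  then have "eventually (\<lambda>n. real n * ((real n + 1) * (2 * exp (- \<gamma> * real n) * (1 + 2 * real n))) < 2) sequentially"
    by (rule order_tendstoD) simp
  then obtain N where N: "\<And>n. n \<ge> N \<Longrightarrow> real n * ((real n + 1) * (2 * exp (- \<gamma> * real n) * (1 + 2 * real n))) < 2"
    unfolding eventually_sequentially by blast
  show thesis
  proof (rule that[of "max N 1"])
    fix n assume "n \<ge> max N 1"
    then show "(real n + 1) * (2 * exp (- \<gamma> * real n) * (1 + 2 * real n)) \<le> 2 / real n"
      using N[of n] by (simp add: field_simps)
  qed
qed

section \<open>The local limit at one maximizer\<close>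

context
  fixes d :: nat and \<beta> h :: real
  assumes d: "d \<ge> 3" and \<beta>: "0 < \<beta>"
begin

text \<open>The Laplace principle with mesh \<open>2 * n powr (1 / p) / n\<close> and accuracy
  \<open>2 / n powr (1 / p)\<close>; the factor 2 reflects that the magnetization is 2k - n. The
  sets \<open>K n\<close> allow for conditioning: they contain a neighbourhood of \<open>a\<close>,
  and their levels away from \<open>a\<close> are exponentially light.\<close>

lemma local_wasserstein:
  fixes K :: "nat \<Rightarrow> nat set"
  assumes p: "even p" "2 \<le> p" and a: "0 < a" "a < 1" and \<kappa>': "0 < \<kappa>'"
    and M: "0 \<le> M" and \<delta>0: "0 < \<delta>0"
    and exp: "\<And>x. \<bar>x - a\<bar> \<le> \<delta>0 \<Longrightarrow> \<bar>A_fun d \<beta> h x - A_fun d \<beta> h a + \<kappa>' * (x - a) ^ p\<bar> \<le> M * \<bar>x - a\<bar> ^ (p + 1)"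
    and K: "\<And>n. K n \<subseteq> {..n}" and \<delta>1: "0 < \<delta>1"
      "\<And>n k. 0 < n \<Longrightarrow> k \<le> n \<Longrightarrow> \<bar>real k / real n - a\<bar> \<le> \<delta>1 \<Longrightarrow> k \<in> K n"
    and tail: "\<And>\<epsilon>. 0 < \<epsilon> \<Longrightarrow> \<exists>\<gamma>>0. \<exists>N. \<forall>n\<ge>N. regular_graphs d n \<noteq> {} \<longrightarrow> (\<forall>k\<in>K n.
      \<bar>real k / real n - a\<bar> > \<epsilon> \<longrightarrow> level_weight d n \<beta> h k \<le> exp (- \<gamma> * real n) * level_weight d n \<beta> h (nat \<lfloor>real n * a\<rfloor>))"
  obtains C N where "0 \<le> C" "\<And>n f. n \<ge> N \<Longrightarrow> regular_graphs d n \<noteq> {} \<Longrightarrow> 1-lipschitz_on UNIV f \<Longrightarrow>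
    \<bar>(\<Sum>k\<in>K n. level_weight d n \<beta> h k * f (2 * real n powr (1 / real p) * (real k / real n - a))) / (\<Sum>k\<in>K n. level_weight d n \<beta> h k) -
      (\<integral>x. f x * exp (- (\<kappa>' / 2 ^ p) * x ^ p) \<partial>lborel) / (\<integral>x. exp (- (\<kappa>' / 2 ^ p) * x ^ p) \<partial>lborel)\<bar>
    \<le> C / real n powr (1 / real p)"
proof -
  define b where "b = min (a / 2) ((1 - a) / 2)"
  have b: "0 < b" "b \<le> a / 2" "b \<le> (1 - a) / 2" using a by (auto simp: b_def min_def)
  obtain C0 N0 where C0: "C0 \<ge> 0" and asymp: "\<And>n k k'. n \<ge> N0 \<Longrightarrow> regular_graphs d n \<noteq> {} \<Longrightarrow>
    b \<le> real k / real n \<Longrightarrow> real k / real n \<le> 1 - b \<Longrightarrow>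
    b \<le> real k' / real n \<Longrightarrow> real k' / real n \<le> 1 - b \<Longrightarrow>
    \<bar>ln (level_weight d n \<beta> h k') - ln (level_weight d n \<beta> h k) - real n * (A_fun d \<beta> h (real k' / real n) - A_fun d \<beta> h (real k / real n))\<bar>
      \<le> C0 * \<bar>real k' / real n - real k / real n\<bar>"
    using level_weight_asymp_sym[OF d \<beta> b(1), where h = h] by blast
  \<comment> \<open>\<open>\<kappa>' + 2 * M\<close> covers the expansions at \<open>k / n\<close>
    and at the rounded maximizer, \<open>2 * C0\<close> the error in the level weights, and 1 makes
    \<open>B \<ge> 1\<close>, as used for the tail.\<close>
  define B where "B = \<kappa>' + 2 * M + 2 * C0 + 1"
  have B: "B \<ge> 1" using \<kappa>' M C0 by (simp add: B_def)
  define \<kappa> where "\<kappa> = \<kappa>' / 2 ^ p"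
  have \<kappa>: "0 < \<kappa>" using \<kappa>' by (simp add: \<kappa>_def)
  \<comment> \<open>In terms of \<open>k / n\<close> the window has radius
    \<open>\<epsilon> / 4\<close>, which must stay within the ranges of the expansion, of
    \<open>K n\<close> and of the asymptotics; the second bound yields
    \<open>B * \<epsilon> \<le> \<kappa> / 2\<close>.\<close>
  define \<epsilon> where "\<epsilon> = min (4 * min \<delta>0 (min \<delta>1 b)) (\<kappa> / (2 * B))"
  have \<epsilon>: "0 < \<epsilon>" using \<delta>0 \<delta>1 b \<kappa> B by (simp add: \<epsilon>_def)
  have \<epsilon>4: "\<epsilon> / 4 \<le> \<delta>0" "\<epsilon> / 4 \<le> \<delta>1" "\<epsilon> / 4 \<le> b"
  proof -
    have "\<epsilon> \<le> 4 * min \<delta>0 (min \<delta>1 b)" by (simp add: \<epsilon>_def)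
    then show "\<epsilon> / 4 \<le> \<delta>0" "\<epsilon> / 4 \<le> \<delta>1" "\<epsilon> / 4 \<le> b" by auto
  qed
  have "\<epsilon> \<le> \<kappa> / (2 * B)" by (simp add: \<epsilon>_def)
  then have B\<epsilon>: "B * \<epsilon> \<le> \<kappa> / 2" using B by (simp add: field_simps)
  have B0: "0 \<le> B" using B by simp
  obtain C \<eta>0 where C: "C \<ge> 0" "0 < \<eta>0" and laplace:
    "\<And>\<eta> \<Delta> c K W f. \<lbrakk>0 < \<eta>; \<eta> < \<eta>0; 0 < \<Delta>; \<Delta> \<le> \<eta>; finite K; \<epsilon> / \<eta> \<le> \<Delta> * c;
      \<And>k. k \<in> K \<Longrightarrow> 0 \<le> W k;
      \<And>k. \<bar>\<Delta> * (real k - c)\<bar> \<le> \<epsilon> / \<eta> \<Longrightarrow> k \<in> K \<and> 0 < W k \<and>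
        \<bar>ln (W k) + \<kappa> * (\<Delta> * (real k - c)) ^ p\<bar> \<le> B * \<eta> * (1 + \<bar>\<Delta> * (real k - c)\<bar> ^ (p + 1));
      (\<Sum>k\<in>{k \<in> K. \<not> \<bar>\<Delta> * (real k - c)\<bar> \<le> \<epsilon> / \<eta>}. \<Delta> * W k * (1 + \<bar>\<Delta> * (real k - c)\<bar>)) \<le> B * \<eta>;
      1-lipschitz_on UNIV f\<rbrakk> \<Longrightarrow>
     \<bar>(\<Sum>k\<in>K. W k * f (\<Delta> * (real k - c))) / (\<Sum>k\<in>K. W k) -
       (\<integral>x. f x * exp (- \<kappa> * x ^ p) \<partial>lborel) / (\<integral>x. exp (- \<kappa> * x ^ p) \<partial>lborel)\<bar> \<le> C * \<eta>"
  proof (rule laplace_lipschitz[OF p \<kappa> B0 \<epsilon> B\<epsilon>], goal_cases)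
    case (1 C \<eta>0)
    show thesis by (rule 1(1)[OF 1(2,3)]) (rule 1(4); assumption)
  qed
  obtain \<gamma> N1 where \<gamma>: "0 < \<gamma>" and tail': "\<And>n k. n \<ge> N1 \<Longrightarrow> regular_graphs d n \<noteq> {} \<Longrightarrow> k \<in> K n \<Longrightarrow>
      \<bar>real k / real n - a\<bar> > \<epsilon> / 4 \<Longrightarrow> level_weight d n \<beta> h k \<le> exp (- \<gamma> * real n) * level_weight d n \<beta> h (nat \<lfloor>real n * a\<rfloor>)"
    using tail[of "\<epsilon> / 4"] \<epsilon> by auto
  obtain N2 where N2: "\<And>n. n \<ge> N2 \<Longrightarrow> (real n + 1) * (2 * exp (- \<gamma> * real n) * (1 + 2 * real n)) \<le> 2 / real n"
    using exp_beats_square[OF \<gamma>] by blast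
  have "filterlim (\<lambda>n. real n powr (1 / real p)) at_top sequentially" using p by real_asymp
  then have "eventually (\<lambda>n. real n powr (1 / real p) > 2 / \<eta>0) sequentially"
    by (simp add: filterlim_at_top_dense)
  then obtain N3 where N3: "\<And>n. n \<ge> N3 \<Longrightarrow> real n powr (1 / real p) > 2 / \<eta>0"
    unfolding eventually_sequentially by blast
  define N where "N = N0 + N1 + N2 + N3 + nat \<lceil>1 / b\<rceil> + nat \<lceil>1 / \<delta>0\<rceil> + 1"
  show thesis
  proof (rule that[of "C * 2" N])
    show "0 \<le> C * 2" using C by simp
    fix n and f :: "real \<Rightarrow> real"
    assume n: "n \<ge> N" and R: "regular_graphs d n \<noteq> {}" and f: "1-lipschitz_on UNIV f"
    have nN: "n \<ge> N0" "n \<ge> N1" "n \<ge> N2" "n \<ge> N3" and n0: "n > 0" using n by (auto simp: N_def)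
    have n1: "real n \<ge> 1" using n0 by simp
    have "1 / b \<le> real n" "1 / \<delta>0 \<le> real n" using n unfolding N_def by linarith+
    then have nb: "1 / real n \<le> b" "1 / real n \<le> \<delta>0" using b \<delta>0 n1 by (auto simp: field_simps)
    define r where "r = real n powr (1 / real p)"
    have r1: "r \<ge> 1" unfolding r_def using n1 by (intro ge_one_powr_ge_zero) auto
    have rp: "r ^ p = real n"
    proof -
      have "r ^ p = r powr real p" using r1 by (simp add: powr_realpow)
      also have "\<dots> = real n" unfolding r_def powr_powr using p n1 by simp
      finally show ?thesis .
    qed
    have r2: "r\<^sup>2 \<le> real n" "r \<le> real n"
      unfolding rp[symmetric] using power_increasing[of 2 p r] power_increasing[of 1 p r] r1 p by auto
    define \<eta> where "\<eta> = 2 / r"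
    define \<Delta> where "\<Delta> = 2 * r / real n"
    define c where "c = real n * a"
    have \<eta>: "0 < \<eta>" "\<eta> < \<eta>0"
    proof -
      show "0 < \<eta>" using r1 by (simp add: \<eta>_def)
      have "r > 2 / \<eta>0" unfolding r_def by (rule N3[OF nN(4)])
      then show "\<eta> < \<eta>0" using C r1 by (simp add: \<eta>_def field_simps)
    qed
    have \<Delta>: "0 < \<Delta>" "\<Delta> \<le> \<eta>" "\<Delta> \<le> 2"
      using r1 r2 n1 by (auto simp: \<Delta>_def \<eta>_def field_simps power2_eq_square)
    have X: "\<Delta> * (real k - c) = 2 * r * (real k / real n - a)" for k
      using n1 by (simp add: \<Delta>_def c_def field_simps)
    have window: "\<bar>\<Delta> * (real k - c)\<bar> \<le> \<epsilon> / \<eta> \<longleftrightarrow> \<bar>real k / real n - a\<bar> \<le> \<epsilon> / 4" for k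
    proof -
      have "\<bar>\<Delta> * (real k - c)\<bar> = r * (2 * \<bar>real k / real n - a\<bar>)"
        unfolding X using r1 by (simp add: abs_mult)
      moreover have "\<epsilon> / \<eta> = r * (\<epsilon> / 2)" using r1 by (simp add: \<eta>_def)
      moreover have "r * (2 * u) \<le> r * (\<epsilon> / 2) \<longleftrightarrow> u \<le> \<epsilon> / 4" for u
        using r1 by (subst mult_le_cancel_left_pos) auto
      ultimately show ?thesis by (simp only:)
    qed
    define k0 where "k0 = nat \<lfloor>real n * a\<rfloor>"
    have k0: "\<bar>real k0 / real n - a\<bar> \<le> 1 / real n"
      unfolding k0_def using a n0 by (intro floor_fraction) auto
    have k0': "\<bar>real k0 / real n - a\<bar> \<le> b" using k0 nb by linarith
    have bb: "2 * b \<le> a" "2 * b \<le> 1 - a" using b by auto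
    have k0b: "b \<le> real k0 / real n" "real k0 / real n \<le> 1 - b"
      using abs_le_D1[OF k0'] abs_le_D2[OF k0'] bb by auto
    have k0n: "k0 \<le> n"
    proof -
      have "real k0 / real n \<le> 1" using k0b b by linarith
      then show ?thesis using n0 by (simp add: pos_divide_le_eq)
    qed
    have Lk0: "0 < level_weight d n \<beta> h k0" by (rule level_weight_pos[OF R k0n])
    \<comment> \<open>Normalised by the level next to \<open>a\<close>, so that
      \<open>ln (W k)\<close> approximates n (A(k/n) - A(a)).\<close>
    define W where "W k = level_weight d n \<beta> h k / level_weight d n \<beta> h k0" for k
    have finK: "finite (K n)" using K finite_subset by blast
    have W0: "0 \<le> W k" for k unfolding W_def using Lk0 level_weight_nonneg by simp
    have Wk: "k \<in> K n \<and> 0 < W k \<and>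
        \<bar>ln (W k) + \<kappa> * (\<Delta> * (real k - c)) ^ p\<bar> \<le> B * \<eta> * (1 + \<bar>\<Delta> * (real k - c)\<bar> ^ (p + 1))"
      if k: "\<bar>\<Delta> * (real k - c)\<bar> \<le> \<epsilon> / \<eta>" for k
    proof -
      define t where "t = real k / real n - a"
      define x where "x = \<Delta> * (real k - c)"
      define t0 where "t0 = real k0 / real n - a"
      have t: "\<bar>t\<bar> \<le> \<epsilon> / 4" using k unfolding window t_def .
      have tb: "\<bar>t\<bar> \<le> b" "\<bar>t\<bar> \<le> \<delta>0" "\<bar>t\<bar> \<le> \<delta>1" using t \<epsilon>4 by linarith+
      have kb: "b \<le> real k / real n" "real k / real n \<le> 1 - b"
        using abs_le_D1[OF tb(1)] abs_le_D2[OF tb(1)] bb unfolding t_def by auto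
      have kn: "k \<le> n"
      proof -
        have "real k / real n \<le> 1" using kb b by linarith
        then show ?thesis using n0 by (simp add: pos_divide_le_eq)
      qed
      have Lk: "0 < level_weight d n \<beta> h k" by (rule level_weight_pos[OF R kn])
      have xt: "x = 2 * r * t" by (simp add: x_def t_def X)
      have tx: "t = x / (2 * r)" using r1 by (simp add: xt)
      \<comment> \<open>The scaling n^(1/p) is the one for which n times the leading term of A is of
        order one.\<close>
      have ntp: "real n * t ^ p = x ^ p / 2 ^ p"
        using r1 by (simp add: tx power_divide power_mult_distrib flip: rp)
      define Y where "Y = 1 + \<bar>x\<bar> ^ (p + 1)"
      have Y1: "Y \<ge> 1" by (simp add: Y_def)
      have xY: "\<bar>x\<bar> \<le> Y"
      proof (cases "\<bar>x\<bar> \<le> 1")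
        case False
        then have "\<bar>x\<bar> ^ 1 \<le> \<bar>x\<bar> ^ (p + 1)" by (intro power_increasing) auto
        then show ?thesis by (simp add: Y_def)
      qed (use Y1 in linarith)
      have e1: "real n * (M * \<bar>t\<bar> ^ (p + 1)) \<le> M * \<eta> * Y"
      proof -
        have "real n * \<bar>t\<bar> ^ (p + 1) = \<bar>x\<bar> ^ (p + 1) / (2 ^ (p + 1) * r)"
          using r1 by (simp add: tx abs_divide abs_mult power_divide power_mult_distrib flip: rp)
        also have "\<dots> \<le> \<bar>x\<bar> ^ (p + 1) / (1 * r)"
          using r1 by (intro divide_left_mono mult_right_mono one_le_power mult_pos_pos) auto
        also have "\<dots> \<le> \<eta> * Y"
        proof -
          have "0 \<le> \<bar>x\<bar> ^ (p + 1)" by simp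
          then show ?thesis using r1 unfolding \<eta>_def Y_def by (simp add: field_simps del: power_Suc)
        qed
        finally have "M * (real n * \<bar>t\<bar> ^ (p + 1)) \<le> M * (\<eta> * Y)" using M by (rule mult_left_mono)
        then show ?thesis by (simp add: mult_ac)
      qed
      have inv: "1 / real n \<le> \<eta> * Y"
      proof -
        have "1 / real n \<le> 1 / r" using r1 r2 by (intro divide_left_mono) auto
        also have "\<dots> \<le> \<eta> * 1" using r1 by (simp add: \<eta>_def divide_right_mono)
        also have "\<dots> \<le> \<eta> * Y" using \<eta> Y1 by (intro mult_left_mono) auto
        finally show ?thesis .
      qed
      \<comment> \<open>The rounding error is at most 1/n, and since \<open>p \<ge> 2\<close> it
        enters at least squared; multiplication by \<open>n\<close> leaves O(1/n).\<close>
      have e2: "\<bar>real n * (A_fun d \<beta> h (real k0 / real n) - A_fun d \<beta> h a)\<bar> \<le> (\<kappa>' + M) * (\<eta> * Y)"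
      proof -
        have t0: "\<bar>t0\<bar> \<le> 1 / real n" "\<bar>t0\<bar> \<le> 1" using k0 n1 unfolding t0_def
          by (auto intro: order_trans)
        have pw: "\<bar>t0\<bar> ^ j \<le> (1 / real n)\<^sup>2" if "2 \<le> j" for j
        proof -
          have "\<bar>t0\<bar> ^ j \<le> \<bar>t0\<bar> ^ 2" using t0 that by (intro power_decreasing) auto
          also have "\<dots> \<le> (1 / real n)\<^sup>2" using t0 by (intro power_mono) auto
          finally show ?thesis .
        qed
        have "\<bar>A_fun d \<beta> h (real k0 / real n) - A_fun d \<beta> h a + \<kappa>' * t0 ^ p\<bar> \<le> M * \<bar>t0\<bar> ^ (p + 1)"
          unfolding t0_def using k0 nb by (intro exp) linarith
        moreover have "\<bar>\<kappa>' * t0 ^ p\<bar> = \<kappa>' * \<bar>t0\<bar> ^ p" using \<kappa>' by (simp add: abs_mult power_abs)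
        ultimately have "\<bar>A_fun d \<beta> h (real k0 / real n) - A_fun d \<beta> h a\<bar> \<le> M * \<bar>t0\<bar> ^ (p + 1) + \<kappa>' * \<bar>t0\<bar> ^ p" by linarith
        also have "\<dots> \<le> M * (1 / real n)\<^sup>2 + \<kappa>' * (1 / real n)\<^sup>2"
          using M \<kappa>' p by (intro add_mono mult_left_mono pw) auto
        finally have "real n * \<bar>A_fun d \<beta> h (real k0 / real n) - A_fun d \<beta> h a\<bar> \<le> real n * (M * (1 / real n)\<^sup>2 + \<kappa>' * (1 / real n)\<^sup>2)"
          by (intro mult_left_mono) auto
        also have "\<dots> = (\<kappa>' + M) * (1 / real n)" using n1 by (simp add: field_simps power2_eq_square)
        also have "\<dots> \<le> (\<kappa>' + M) * (\<eta> * Y)" using inv \<kappa>' M by (intro mult_left_mono) auto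
        finally show ?thesis by (simp add: abs_mult)
      qed
      have e3: "C0 * \<bar>real k / real n - real k0 / real n\<bar> \<le> 2 * C0 * (\<eta> * Y)"
      proof -
        have "\<bar>real k / real n - real k0 / real n\<bar> \<le> \<bar>t\<bar> + 1 / real n"
          using k0 unfolding t_def by linarith
        also have "\<bar>t\<bar> \<le> \<eta> * Y"
        proof -
          have "\<bar>t\<bar> = \<bar>x\<bar> / (2 * r)" using r1 by (simp add: tx abs_divide abs_mult)
          also have "\<dots> \<le> Y / (2 * r)" using xY r1 by (intro divide_right_mono) auto
          also have "\<dots> \<le> \<eta> * Y" using Y1 r1 by (simp add: \<eta>_def field_simps)
          finally show ?thesis .
        qed
        finally have "\<bar>real k / real n - real k0 / real n\<bar> \<le> 2 * (\<eta> * Y)" using inv by linarith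
        then have "C0 * \<bar>real k / real n - real k0 / real n\<bar> \<le> C0 * (2 * (\<eta> * Y))"
          using C0 by (rule mult_left_mono)
        then show ?thesis by (simp add: mult_ac)
      qed
      have lnW: "ln (W k) = ln (level_weight d n \<beta> h k) - ln (level_weight d n \<beta> h k0)"
        unfolding W_def using Lk Lk0 by (simp add: ln_div)
      have as: "\<bar>ln (W k) - real n * (A_fun d \<beta> h (real k / real n) - A_fun d \<beta> h (real k0 / real n))\<bar> \<le> 2 * C0 * (\<eta> * Y)"
        unfolding lnW by (rule order_trans[OF asymp[OF nN(1) R k0b kb] e3])
      have "\<bar>real n * (A_fun d \<beta> h (real k / real n) - A_fun d \<beta> h a + \<kappa>' * t ^ p)\<bar> \<le> M * \<eta> * Y"
      proof -
        have "\<bar>A_fun d \<beta> h (real k / real n) - A_fun d \<beta> h a + \<kappa>' * t ^ p\<bar> \<le> M * \<bar>t\<bar> ^ (p + 1)"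
          unfolding t_def by (rule exp) (use tb in \<open>simp add: t_def\<close>)
        then have "real n * \<bar>A_fun d \<beta> h (real k / real n) - A_fun d \<beta> h a + \<kappa>' * t ^ p\<bar> \<le> real n * (M * \<bar>t\<bar> ^ (p + 1))"
          by (intro mult_left_mono) auto
        then show ?thesis using e1 by (simp add: abs_mult)
      qed
      moreover have "real n * (A_fun d \<beta> h (real k / real n) - A_fun d \<beta> h a + \<kappa>' * t ^ p) =
          real n * (A_fun d \<beta> h (real k / real n) - A_fun d \<beta> h (real k0 / real n)) + real n * (A_fun d \<beta> h (real k0 / real n) - A_fun d \<beta> h a) + \<kappa> * x ^ p"
      proof -
        have "real n * (\<kappa>' * t ^ p) = \<kappa> * x ^ p"
          using arg_cong[OF ntp, of "\<lambda>z. \<kappa>' * z"] by (simp add: \<kappa>_def mult_ac)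
        then show ?thesis by (simp add: algebra_simps)
      qed
      ultimately have "\<bar>ln (W k) + \<kappa> * x ^ p\<bar> \<le> M * \<eta> * Y + (\<kappa>' + M) * (\<eta> * Y) + 2 * C0 * (\<eta> * Y)"
        using e2 as by linarith
      also have "\<dots> = (B - 1) * (\<eta> * Y)" by (simp add: B_def algebra_simps)
      also have "\<dots> \<le> B * (\<eta> * Y)" using \<eta> Y1 by (intro mult_right_mono) auto
      finally have main: "\<bar>ln (W k) + \<kappa> * x ^ p\<bar> \<le> B * \<eta> * Y" by (simp add: mult_ac)
      have "k \<in> K n" using tb(3) by (intro \<delta>1(2) n0 kn) (simp add: t_def)
      moreover have "0 < W k" using Lk Lk0 by (simp add: W_def)
      ultimately show ?thesis using main unfolding Y_def x_def by blast
    qed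
    \<comment> \<open>There are at most \<open>n + 1\<close> levels outside the window, each
      exponentially small by \<open>tail'\<close>.\<close>
    have tl: "(\<Sum>k\<in>{k \<in> K n. \<not> \<bar>\<Delta> * (real k - c)\<bar> \<le> \<epsilon> / \<eta>}. \<Delta> * W k * (1 + \<bar>\<Delta> * (real k - c)\<bar>)) \<le> B * \<eta>"
    proof -
      define q where "q = 2 * exp (- \<gamma> * real n) * (1 + 2 * real n)"
      have "(\<Sum>k\<in>{k \<in> K n. \<not> \<bar>\<Delta> * (real k - c)\<bar> \<le> \<epsilon> / \<eta>}. \<Delta> * W k * (1 + \<bar>\<Delta> * (real k - c)\<bar>)) \<le>
          (\<Sum>k\<in>{k \<in> K n. \<not> \<bar>\<Delta> * (real k - c)\<bar> \<le> \<epsilon> / \<eta>}. q)"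
      proof (rule sum_mono)
        fix k assume "k \<in> {k \<in> K n. \<not> \<bar>\<Delta> * (real k - c)\<bar> \<le> \<epsilon> / \<eta>}"
        then have k: "k \<in> K n" "\<bar>real k / real n - a\<bar> > \<epsilon> / 4" unfolding window by auto
        have "level_weight d n \<beta> h k \<le> exp (- \<gamma> * real n) * level_weight d n \<beta> h k0"
          unfolding k0_def by (rule tail'[OF nN(2) R k])
        then have Wk: "W k \<le> exp (- \<gamma> * real n)" using Lk0 by (simp add: W_def pos_divide_le_eq)
        have "k \<le> n" using k K by blast
        then have "0 \<le> real k / real n" "real k / real n \<le> 1" using n0 by auto
        then have "\<bar>real k / real n - a\<bar> \<le> 1" using a by linarith
        then have "2 * r * \<bar>real k / real n - a\<bar> \<le> 2 * real n * 1" using r1 r2 by (intro mult_mono) auto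
        then have "\<bar>\<Delta> * (real k - c)\<bar> \<le> 2 * real n" unfolding X using r1 by (simp add: abs_mult)
        then show "\<Delta> * W k * (1 + \<bar>\<Delta> * (real k - c)\<bar>) \<le> q"
          unfolding q_def using Wk \<Delta> W0[of k] by (intro mult_mono) auto
      qed
      also have "\<dots> = real (card {k \<in> K n. \<not> \<bar>\<Delta> * (real k - c)\<bar> \<le> \<epsilon> / \<eta>}) * q" by simp
      also have "\<dots> \<le> (real n + 1) * q"
      proof (rule mult_right_mono)
        have "card {k \<in> K n. \<not> \<bar>\<Delta> * (real k - c)\<bar> \<le> \<epsilon> / \<eta>} \<le> card {..n}"
          using K by (intro card_mono) auto
        then show "real (card {k \<in> K n. \<not> \<bar>\<Delta> * (real k - c)\<bar> \<le> \<epsilon> / \<eta>}) \<le> real n + 1" by simp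
      qed (simp add: q_def)
      also have "\<dots> \<le> 2 / real n" unfolding q_def by (rule N2[OF nN(3)])
      also have "\<dots> \<le> \<eta>" unfolding \<eta>_def using r1 r2 by (intro divide_left_mono) auto
      also have "\<dots> \<le> B * \<eta>" using B \<eta> by simp
      finally show ?thesis .
    qed
    have "\<epsilon> / \<eta> \<le> \<Delta> * c"
    proof -
      have "\<epsilon> / \<eta> = \<epsilon> / 2 * r" using r1 by (simp add: \<eta>_def)
      also have "\<dots> \<le> 2 * a * r" using \<epsilon>4(3) b r1 by (intro mult_right_mono) auto
      also have "\<dots> = \<Delta> * c" using n1 by (simp add: \<Delta>_def c_def)
      finally show ?thesis .
    qed
    from laplace[OF \<eta> \<Delta>(1,2) finK this W0 Wk tl f]
    have "\<bar>(\<Sum>k\<in>K n. W k * f (\<Delta> * (real k - c))) / (\<Sum>k\<in>K n. W k) -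
       (\<integral>x. f x * exp (- \<kappa> * x ^ p) \<partial>lborel) / (\<integral>x. exp (- \<kappa> * x ^ p) \<partial>lborel)\<bar> \<le> C * \<eta>" .
    moreover have "(\<Sum>k\<in>K n. W k * f (\<Delta> * (real k - c))) / (\<Sum>k\<in>K n. W k) =
        (\<Sum>k\<in>K n. level_weight d n \<beta> h k * f (2 * r * (real k / real n - a))) / (\<Sum>k\<in>K n. level_weight d n \<beta> h k)"
    proof -
      have "(\<Sum>k\<in>K n. W k * f (\<Delta> * (real k - c))) = (\<Sum>k\<in>K n. level_weight d n \<beta> h k * f (2 * r * (real k / real n - a))) / level_weight d n \<beta> h k0"
        unfolding W_def X by (simp add: sum_divide_distrib)
      moreover have "(\<Sum>k\<in>K n. W k) = (\<Sum>k\<in>K n. level_weight d n \<beta> h k) / level_weight d n \<beta> h k0"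
        unfolding W_def by (simp add: sum_divide_distrib)
      ultimately show ?thesis using Lk0 by simp
    qed
    ultimately show "\<bar>(\<Sum>k\<in>K n. level_weight d n \<beta> h k * f (2 * real n powr (1 / real p) * (real k / real n - a))) / (\<Sum>k\<in>K n. level_weight d n \<beta> h k) -
      (\<integral>x. f x * exp (- (\<kappa>' / 2 ^ p) * x ^ p) \<partial>lborel) / (\<integral>x. exp (- (\<kappa>' / 2 ^ p) * x ^ p) \<partial>lborel)\<bar>
    \<le> C * 2 / real n powr (1 / real p)"
      unfolding r_def[symmetric] \<kappa>_def[symmetric] by (simp add: \<eta>_def)
  qed
qed

end

section \<open>Transfer from level weights to the measures of the theorem\<close>

lemma eventually_graph_sizes:
  assumes "\<And>n. n \<ge> N \<Longrightarrow> regular_graphs d n \<noteq> {} \<Longrightarrow> P n"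
  shows "\<forall>\<^sub>F n in graph_sizes d. P n"
  unfolding graph_sizes_def eventually_inf_principal
  using eventually_ge_at_top[of "max N (Suc d)"]
proof eventually_elim
  case (elim n)
  then show ?case using assms[of n] regular_graphs_nonempty[of d n] by auto
qed

lemma tendsto_exp_graph_sizes:
  assumes "0 < c"
  shows "((\<lambda>n. exp (- c * real n)) \<longlongrightarrow> 0) (graph_sizes d)"
proof (rule tendsto_mono)
  show "graph_sizes d \<le> sequentially" by (simp add: graph_sizes_def)
  show "((\<lambda>n. exp (- c * real n)) \<longlongrightarrow> 0) sequentially" using assms by real_asymp
qed

lemma wasserstein_leI:
  assumes "\<And>f. 1-lipschitz_on UNIV f \<Longrightarrow> \<bar>(\<integral>x. f x \<partial>P) - (\<integral>x. f x \<partial>Q)\<bar> \<le> c"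
  shows "wasserstein P Q \<le> ennreal c"
  unfolding wasserstein_def using assms by (intro SUP_least ennreal_leI) auto

lemma lipschitz_measurable: "1-lipschitz_on UNIV f \<Longrightarrow> (f :: real \<Rightarrow> real) \<in> borel_measurable borel"
  by (rule borel_measurable_continuous_onI) (rule lipschitz_on_continuous_on)

lemma integral_density_proportional_to:
  fixes f \<phi> :: "real \<Rightarrow> real"
  assumes f: "f \<in> borel_measurable borel" and \<phi>: "\<phi> \<in> borel_measurable borel" "\<And>x. 0 \<le> \<phi> x"
  shows "(\<integral>x. f x \<partial>density_proportional_to \<phi>) = (\<integral>x. f x * \<phi> x \<partial>lborel) / (\<integral>x. \<phi> x \<partial>lborel)"
proof -
  have "0 \<le> (\<integral>x. \<phi> x \<partial>lborel)" using \<phi> by (intro Bochner_Integration.integral_nonneg) auto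
  then have "(\<integral>x. f x \<partial>density_proportional_to \<phi>) = (\<integral>x. (\<phi> x / (\<integral>x. \<phi> x \<partial>lborel)) *\<^sub>R f x \<partial>lborel)"
    unfolding density_proportional_to_def using f \<phi> by (intro integral_density) auto
  also have "\<dots> = (\<integral>x. f x * \<phi> x / (\<integral>x. \<phi> x \<partial>lborel) \<partial>lborel)" by (simp add: mult.commute)
  finally show ?thesis by simp
qed

lemma centered_normal_eq:
  assumes v: "0 < v"
  shows "centered_normal v = density_proportional_to (\<lambda>x. exp (- (1 / (2 * v)) * x\<^sup>2))"
proof -
  define c where "c = sqrt (2 * pi * v)"
  have c: "c > 0" using v by (simp add: c_def)
  have nd: "normal_density 0 (sqrt v) x = exp (- (1 / (2 * v)) * x\<^sup>2) / c" for x
    using v by (simp add: normal_density_def c_def)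
  have "(\<integral>x. normal_density 0 (sqrt v) x \<partial>lborel) = 1" using v by (intro integral_normal_density) auto
  then have "(\<integral>x. exp (- (1 / (2 * v)) * x\<^sup>2) \<partial>lborel) = c" unfolding nd using c by simp
  then show ?thesis unfolding centered_normal_def density_proportional_to_def nd by simp
qed

lemma maximizers_less:
  assumes "a \<in> maximizers d \<beta> h" "0 \<le> b" "b \<le> 1" "b \<notin> maximizers d \<beta> h"
  shows "A_fun d \<beta> h b < A_fun d \<beta> h a"
proof (rule ccontr)
  assume "\<not> ?thesis"
  then have "b \<in> maximizers d \<beta> h" using assms by (auto simp: maximizers_def intro: order_trans)
  then show False using assms by simp
qed

lemma maximizers_eq: "a \<in> maximizers d \<beta> h \<Longrightarrow> b \<in> maximizers d \<beta> h \<Longrightarrow> A_fun d \<beta> h a = A_fun d \<beta> h b"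
  by (force simp: maximizers_def intro: antisym)

text \<open>Convergence in law thus has to be tested only away from the atoms of the limit.\<close>

lemma not_isCont_atom:
  assumes "prob_space M" "sets M = sets borel" "0 < measure M {x}"
  shows "\<not> isCont (cdf M) x"
proof -
  interpret prob_space M by fact
  interpret finite_borel_measure M
    by standard (use assms sets_eq_imp_space_eq[OF assms(2)] in auto)
  show ?thesis using assms(3) isCont_cdf by simp
qed

lemma cdf_half_half:
  "cdf (half_half y z) x = (of_bool (y \<le> x) + of_bool (z \<le> x)) / 2"
proof -
  have "cdf (half_half y z) x = measure (measure_pmf (bernoulli_pmf (1/2))) {b. (if b then y else z) \<le> x}"
    unfolding cdf_def half_half_def by (subst measure_distr) (auto simp: vimage_def)
  also have "\<dots> = (\<Sum>b\<in>{b. (if b then y else z) \<le> x}. pmf (bernoulli_pmf (1/2)) b)"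
    by (rule measure_measure_pmf_finite) simp
  also have "{b. (if b then y else z) \<le> x} = (if y \<le> x then {True} else {}) \<union> (if z \<le> x then {False} else {})"
    by (auto split: if_splits)
  finally show ?thesis by auto
qed

lemma half_half_atom:
  shows "0 < measure (half_half y z) {y}" "0 < measure (half_half y z) {z}"
proof -
  have eq: "measure (half_half y z) {w} = (\<Sum>b\<in>{b. (if b then y else z) = w}. pmf (bernoulli_pmf (1/2)) b)" for w
    unfolding half_half_def by (subst measure_distr) (auto simp: vimage_def measure_measure_pmf_finite)
  show "0 < measure (half_half y z) {y}"
    unfolding eq by (rule sum_pos2[of _ True]) auto
  show "0 < measure (half_half y z) {z}"
    unfolding eq by (rule sum_pos2[of _ False]) auto
qed

lemma half_half_prob: "prob_space (half_half y z)" "sets (half_half y z) = sets borel"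
  unfolding half_half_def by (auto intro!: prob_space.prob_space_distr prob_space_measure_pmf)

lemma cdf_return: "cdf (return borel y) x = of_bool (y \<le> x)"
  by (simp add: cdf_def measure_return)

lemma magnetization_deviation: "0 < n \<Longrightarrow> (2 * real k - real n) / real n - (2 * a - 1) = 2 * (real k / real n - a)"
  by (simp add: field_simps)

lemma cdf_magnetization:
  "cdf (distr (annealed_ising d n \<beta> h) borel (\<lambda>\<omega>. magnetization n \<omega> / real n)) x =
    measure (annealed_ising d n \<beta> h) {\<omega> \<in> spins n. magnetization n \<omega> / real n \<le> x}"
  unfolding cdf_def
  by (subst measure_distr)
    (auto simp: annealed_ising_def space_point_measure space_borel intro!: arg_cong[where f = "measure _"])

lemma measure_mono_ising:
  assumes "regular_graphs d n \<noteq> {}" "\<And>\<omega>. \<omega> \<in> spins n \<Longrightarrow> P \<omega> \<Longrightarrow> Q \<omega>"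
  shows "measure (annealed_ising d n \<beta> h) {\<omega> \<in> spins n. P \<omega>} \<le> measure (annealed_ising d n \<beta> h) {\<omega> \<in> spins n. Q \<omega>}"
proof -
  interpret prob_space "annealed_ising d n \<beta> h" by (rule prob_space_annealed_ising[OF assms(1)])
  show ?thesis using assms by (intro finite_measure_mono) (auto simp: sets_annealed_ising)
qed

lemma measure_compl_ising:
  assumes "regular_graphs d n \<noteq> {}"
  shows "measure (annealed_ising d n \<beta> h) {\<omega> \<in> spins n. \<not> P \<omega>} = 1 - measure (annealed_ising d n \<beta> h) {\<omega> \<in> spins n. P \<omega>}"
proof -
  interpret prob_space "annealed_ising d n \<beta> h" by (rule prob_space_annealed_ising[OF assms(1)])
  have "{\<omega> \<in> spins n. \<not> P \<omega>} = space (annealed_ising d n \<beta> h) - {\<omega> \<in> spins n. P \<omega>}" by (auto simp: space_annealed_ising[OF assms])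
  then show ?thesis by (simp add: prob_compl sets_annealed_ising[OF assms])
qed

lemma measure_diff_ising:
  assumes R: "regular_graphs d n \<noteq> {}"
    and "\<And>\<omega>. \<omega> \<in> spins n \<Longrightarrow> P \<omega> \<Longrightarrow> Q \<omega> \<or> D \<omega>"
  shows "measure (annealed_ising d n \<beta> h) {\<omega> \<in> spins n. P \<omega>} \<le> measure (annealed_ising d n \<beta> h) {\<omega> \<in> spins n. Q \<omega>} + measure (annealed_ising d n \<beta> h) {\<omega> \<in> spins n. D \<omega>}"
proof -
  interpret prob_space "annealed_ising d n \<beta> h" by (rule prob_space_annealed_ising[OF R])
  have "measure (annealed_ising d n \<beta> h) {\<omega> \<in> spins n. P \<omega>} \<le> measure (annealed_ising d n \<beta> h) ({\<omega> \<in> spins n. Q \<omega>} \<union> {\<omega> \<in> spins n. D \<omega>})"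
    using assms by (intro finite_measure_mono) (auto simp: sets_annealed_ising[OF R])
  also have "\<dots> \<le> measure (annealed_ising d n \<beta> h) {\<omega> \<in> spins n. Q \<omega>} + measure (annealed_ising d n \<beta> h) {\<omega> \<in> spins n. D \<omega>}"
    by (intro measure_subadditive) (auto simp: sets_annealed_ising[OF R])
  finally show ?thesis .
qed

context
  fixes d :: nat and \<beta> h :: real
  assumes d: "d \<ge> 3" and \<beta>: "0 < \<beta>"
begin

lemma concentration:
  assumes F: "maximizers d \<beta> h = F" "finite F" "F \<noteq> {}" and \<delta>: "0 < \<delta>"
  shows "\<exists>c>0. \<forall>\<^sub>F n in graph_sizes d.
    measure (annealed_ising d n \<beta> h) {\<omega> \<in> spins n. \<forall>f\<in>F. \<bar>magnetization n \<omega> / real n - (2 * f - 1)\<bar> > \<delta>} \<le> exp (- c * real n)"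
proof -
  obtain a where a: "a \<in> F" using F by blast
  have F01: "F \<subseteq> {0<..<1}" using F(1) maximizer_interior[OF d \<beta>] by auto
  obtain \<gamma> N where \<gamma>: "0 < \<gamma>" and far: "\<And>n k. n \<ge> N \<Longrightarrow> regular_graphs d n \<noteq> {} \<Longrightarrow> k \<le> n \<Longrightarrow>
    (\<And>f. f \<in> F \<Longrightarrow> \<bar>real k / real n - f\<bar> > \<delta> / 2) \<Longrightarrow>
    level_weight d n \<beta> h k \<le> exp (- \<gamma> * real n) * level_weight d n \<beta> h (nat \<lfloor>real n * a\<rfloor>)"
  proof (rule off_maximizers[OF d \<beta> F(2) F01, where h = h and m = "A_fun d \<beta> h a" and \<delta> = "\<delta> / 2" and a = a])
    show "A_fun d \<beta> h f = A_fun d \<beta> h a" if "f \<in> F" for f using that a F(1) by (intro maximizers_eq) auto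
    show "A_fun d \<beta> h b < A_fun d \<beta> h a" if "0 < b" "b < 1" "b \<notin> F" for b using that a F(1) by (intro maximizers_less) auto
  qed (use \<delta> a in auto)
  have "(\<lambda>n. (real n + 1) * exp (- (\<gamma> / 2) * real n)) \<longlonglongrightarrow> 0" using \<gamma> by real_asymp
  then have "eventually (\<lambda>n. (real n + 1) * exp (- (\<gamma> / 2) * real n) < 1) sequentially"
    by (rule order_tendstoD) simp
  then obtain N' where N': "\<And>n. n \<ge> N' \<Longrightarrow> (real n + 1) * exp (- (\<gamma> / 2) * real n) < 1"
    unfolding eventually_sequentially by blast
  have "\<forall>\<^sub>F n in graph_sizes d. measure (annealed_ising d n \<beta> h)
      {\<omega> \<in> spins n. \<forall>f\<in>F. \<bar>magnetization n \<omega> / real n - (2 * f - 1)\<bar> > \<delta>} \<le> exp (- (\<gamma> / 2) * real n)"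
  proof (rule eventually_graph_sizes[where N = "max (max N N') 1"])
    fix n assume n: "n \<ge> max (max N N') 1" and R: "regular_graphs d n \<noteq> {}"
    define Z where "Z = (\<Sum>k\<le>n. level_weight d n \<beta> h k)"
    define K where "K = {k. k \<le> n \<and> (\<forall>f\<in>F. \<bar>(2 * real k - real n) / real n - (2 * f - 1)\<bar> > \<delta>)}"
    have Z: "Z > 0" unfolding Z_def by (rule level_weight_sum_pos[OF R])
    have a01: "0 < a" "a < 1" using F01 a by auto
    have "nat \<lfloor>real n * a\<rfloor> \<le> n"
    proof -
      have "real n * a \<le> real n * 1" using a01 by (intro mult_left_mono) auto
      then show ?thesis by (simp add: nat_le_iff floor_le_iff)
    qed
    then have Lka: "level_weight d n \<beta> h (nat \<lfloor>real n * a\<rfloor>) \<le> Z"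
      unfolding Z_def using level_weight_nonneg by (intro member_le_sum) auto
    have "level_weight d n \<beta> h k \<le> exp (- \<gamma> * real n) * Z" if "k \<in> K" for k
    proof -
      have "\<bar>real k / real n - f\<bar> > \<delta> / 2" if "f \<in> F" for f
      proof -
        have "\<bar>2 * (real k / real n - f)\<bar> > \<delta>"
          using \<open>k \<in> K\<close> that n magnetization_deviation[of n k f] by (auto simp: K_def)
        moreover have "\<bar>2 * u\<bar> = 2 * \<bar>u\<bar>" for u :: real by (simp add: abs_mult)
        ultimately have "\<delta> < 2 * \<bar>real k / real n - f\<bar>" by (simp only:)
        then show ?thesis by argo
      qed
      then have "level_weight d n \<beta> h k \<le> exp (- \<gamma> * real n) * level_weight d n \<beta> h (nat \<lfloor>real n * a\<rfloor>)"
        using \<open>k \<in> K\<close> n by (intro far R) (auto simp: K_def)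
      also have "\<dots> \<le> exp (- \<gamma> * real n) * Z" using Lka by (intro mult_left_mono) auto
      finally show ?thesis .
    qed
    then have "(\<Sum>k\<in>K. level_weight d n \<beta> h k) \<le> real (card K) * (exp (- \<gamma> * real n) * Z)"
      by (rule sum_bounded_above)
    also have "\<dots> \<le> (real n + 1) * (exp (- \<gamma> * real n) * Z)"
    proof (rule mult_right_mono)
      have "card K \<le> card {..n}" by (intro card_mono) (auto simp: K_def)
      then show "real (card K) \<le> real n + 1" by simp
    qed (use Z in auto)
    \<comment> \<open>Half of the exponential rate absorbs the number of levels.\<close>
    also have "\<dots> = ((real n + 1) * exp (- (\<gamma> / 2) * real n)) * (exp (- (\<gamma> / 2) * real n) * Z)"
      by (simp add: mult_ac flip: exp_add)
    also have "\<dots> \<le> 1 * (exp (- (\<gamma> / 2) * real n) * Z)"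
      using N'[of n] n Z by (intro mult_right_mono) auto
    finally have "(\<Sum>k\<in>K. level_weight d n \<beta> h k) / Z \<le> exp (- (\<gamma> / 2) * real n)" using Z by (simp add: pos_divide_le_eq)
    moreover have "measure (annealed_ising d n \<beta> h) {\<omega> \<in> spins n. \<forall>f\<in>F. \<bar>magnetization n \<omega> / real n - (2 * f - 1)\<bar> > \<delta>} =
        (\<Sum>k\<in>K. level_weight d n \<beta> h k) / Z"
      unfolding K_def Z_def
      using measure_annealed_ising[OF R, where Q = "\<lambda>m. \<forall>f\<in>F. \<bar>m / real n - (2 * f - 1)\<bar> > \<delta>"] .
    ultimately show "measure (annealed_ising d n \<beta> h) {\<omega> \<in> spins n. \<forall>f\<in>F. \<bar>magnetization n \<omega> / real n - (2 * f - 1)\<bar> > \<delta>}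
        \<le> exp (- (\<gamma> / 2) * real n)" by simp
  qed
  then show ?thesis using \<gamma> by (intro exI[of _ "\<gamma> / 2"]) auto
qed

text \<open>A point to one side of all limit values has positive distance from them, so the event in
  question or its complement lies in the rare event of \<open>concentration\<close>.\<close>

lemma cdf_tendsto_outside:
  assumes F: "maximizers d \<beta> h = F" "finite F" "F \<noteq> {}"
  shows "(\<And>f. f \<in> F \<Longrightarrow> x < 2 * f - 1) \<Longrightarrow>
      ((\<lambda>n. cdf (distr (annealed_ising d n \<beta> h) borel (\<lambda>\<omega>. magnetization n \<omega> / real n)) x) \<longlongrightarrow> 0) (graph_sizes d)"
    and "(\<And>f. f \<in> F \<Longrightarrow> 2 * f - 1 < x) \<Longrightarrow>
      ((\<lambda>n. cdf (distr (annealed_ising d n \<beta> h) borel (\<lambda>\<omega>. magnetization n \<omega> / real n)) x) \<longlongrightarrow> 1) (graph_sizes d)"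
proof -
  define \<delta> where "\<delta> = Min ((\<lambda>f. \<bar>2 * f - 1 - x\<bar>) ` F) / 2"
  have \<delta>_le: "2 * \<delta> \<le> \<bar>2 * f - 1 - x\<bar>" if "f \<in> F" for f
    using that F by (simp add: \<delta>_def)
  have \<delta>_pos: "0 < \<delta>" if "\<And>f. f \<in> F \<Longrightarrow> 2 * f - 1 \<noteq> x"
    using that F unfolding \<delta>_def by (simp add: Min_gr_iff)
  {
    assume x: "\<And>f. f \<in> F \<Longrightarrow> x < 2 * f - 1"
    have \<delta>: "0 < \<delta>" by (rule \<delta>_pos) (use x in force)
    obtain c where c: "0 < c" and conc: "\<forall>\<^sub>F n in graph_sizes d.
        measure (annealed_ising d n \<beta> h) {\<omega> \<in> spins n. \<forall>f\<in>F. \<bar>magnetization n \<omega> / real n - (2 * f - 1)\<bar> > \<delta>} \<le> exp (- c * real n)"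
      using concentration[OF F \<delta>] by blast
    have R: "\<forall>\<^sub>F n in graph_sizes d. regular_graphs d n \<noteq> {}"
      by (rule eventually_graph_sizes[of 0]) simp
    show "((\<lambda>n. cdf (distr (annealed_ising d n \<beta> h) borel (\<lambda>\<omega>. magnetization n \<omega> / real n)) x) \<longlongrightarrow> 0) (graph_sizes d)"
    proof (rule tendsto_sandwich[OF _ _ tendsto_const tendsto_exp_graph_sizes[OF c]])
      show "\<forall>\<^sub>F n in graph_sizes d. 0 \<le> cdf (distr (annealed_ising d n \<beta> h) borel (\<lambda>\<omega>. magnetization n \<omega> / real n)) x"
        by (simp add: cdf_def)
      show "\<forall>\<^sub>F n in graph_sizes d. cdf (distr (annealed_ising d n \<beta> h) borel (\<lambda>\<omega>. magnetization n \<omega> / real n)) x \<le> exp (- c * real n)"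
        using conc R
      proof eventually_elim
        case (elim n)
        have "measure (annealed_ising d n \<beta> h) {\<omega> \<in> spins n. magnetization n \<omega> / real n \<le> x} \<le>
            measure (annealed_ising d n \<beta> h) {\<omega> \<in> spins n. \<forall>f\<in>F. \<bar>magnetization n \<omega> / real n - (2 * f - 1)\<bar> > \<delta>}"
        proof (rule measure_mono_ising[OF elim(2)], intro ballI)
          fix \<omega> f assume "magnetization n \<omega> / real n \<le> x" "f \<in> F"
          then show "\<delta> < \<bar>magnetization n \<omega> / real n - (2 * f - 1)\<bar>"
            using \<delta>_le[of f] x[of f] \<delta> by linarith
        qed
        then show ?case using elim(1) unfolding cdf_magnetization by linarith
      qed
    qed
  }
  {
    assume x: "\<And>f. f \<in> F \<Longrightarrow> 2 * f - 1 < x"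
    have \<delta>: "0 < \<delta>" by (rule \<delta>_pos) (use x in force)
    obtain c where c: "0 < c" and conc: "\<forall>\<^sub>F n in graph_sizes d.
        measure (annealed_ising d n \<beta> h) {\<omega> \<in> spins n. \<forall>f\<in>F. \<bar>magnetization n \<omega> / real n - (2 * f - 1)\<bar> > \<delta>} \<le> exp (- c * real n)"
      using concentration[OF F \<delta>] by blast
    have R: "\<forall>\<^sub>F n in graph_sizes d. regular_graphs d n \<noteq> {}"
      by (rule eventually_graph_sizes[of 0]) simp
    have lim: "((\<lambda>n. 1 - exp (- c * real n)) \<longlongrightarrow> 1) (graph_sizes d)"
      using tendsto_diff[OF tendsto_const tendsto_exp_graph_sizes[OF c], of 1 d] by simp
    show "((\<lambda>n. cdf (distr (annealed_ising d n \<beta> h) borel (\<lambda>\<omega>. magnetization n \<omega> / real n)) x) \<longlongrightarrow> 1) (graph_sizes d)"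
    proof (rule tendsto_sandwich[OF _ _ lim tendsto_const])
      show "\<forall>\<^sub>F n in graph_sizes d. 1 - exp (- c * real n) \<le> cdf (distr (annealed_ising d n \<beta> h) borel (\<lambda>\<omega>. magnetization n \<omega> / real n)) x"
        using conc R
      proof eventually_elim
        case (elim n)
        have "measure (annealed_ising d n \<beta> h) {\<omega> \<in> spins n. \<not> magnetization n \<omega> / real n \<le> x} \<le>
            measure (annealed_ising d n \<beta> h) {\<omega> \<in> spins n. \<forall>f\<in>F. \<bar>magnetization n \<omega> / real n - (2 * f - 1)\<bar> > \<delta>}"
        proof (rule measure_mono_ising[OF elim(2)], intro ballI)
          fix \<omega> f assume "\<not> magnetization n \<omega> / real n \<le> x" "f \<in> F"
          then show "\<delta> < \<bar>magnetization n \<omega> / real n - (2 * f - 1)\<bar>"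
            using \<delta>_le[of f] x[of f] \<delta> by linarith
        qed
        then show ?case using elim(1) unfolding cdf_magnetization measure_compl_ising[OF elim(2)] by linarith
      qed
      show "\<forall>\<^sub>F n in graph_sizes d. cdf (distr (annealed_ising d n \<beta> h) borel (\<lambda>\<omega>. magnetization n \<omega> / real n)) x \<le> 1"
        using R
      proof eventually_elim
        case (elim n)
        interpret prob_space "annealed_ising d n \<beta> h" by (rule prob_space_annealed_ising[OF elim])
        show ?case unfolding cdf_magnetization by simp
      qed
    qed
  }
qed

lemma wasserstein_bound:
  assumes p: "even p" "2 \<le> p" and a: "a \<in> maximizers d \<beta> h" "finite (maximizers d \<beta> h)" and \<kappa>': "0 < \<kappa>'"
    and M: "0 \<le> M" and \<delta>0: "0 < \<delta>0"
    and exp: "\<And>x. \<bar>x - a\<bar> \<le> \<delta>0 \<Longrightarrow> \<bar>A_fun d \<beta> h x - A_fun d \<beta> h a + \<kappa>' * (x - a) ^ p\<bar> \<le> M * \<bar>x - a\<bar> ^ (p + 1)"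
    and K: "\<And>n. K n = {k. k \<le> n \<and> Q n (2 * real k - real n)}" and \<delta>1: "0 < \<delta>1"
      "\<And>n k. 0 < n \<Longrightarrow> k \<le> n \<Longrightarrow> \<bar>real k / real n - a\<bar> \<le> \<delta>1 \<Longrightarrow> k \<in> K n"
    and sep: "0 < \<delta>2" "\<And>n k f. 0 < n \<Longrightarrow> k \<in> K n \<Longrightarrow> f \<in> maximizers d \<beta> h \<Longrightarrow> f \<noteq> a \<Longrightarrow>
      \<bar>real k / real n - f\<bar> > \<delta>2"
    and Pn: "\<And>n f. regular_graphs d n \<noteq> {} \<Longrightarrow> f \<in> borel_measurable borel \<Longrightarrow>
      0 < (\<Sum>k\<in>K n. level_weight d n \<beta> h k) \<Longrightarrow>
      (\<integral>x. f x \<partial>P n) = (\<Sum>k\<in>K n. level_weight d n \<beta> h k * f (2 * real n powr (1 / real p) * (real k / real n - a))) / (\<Sum>k\<in>K n. level_weight d n \<beta> h k)"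
  shows "\<exists>C. \<forall>\<^sub>F n in graph_sizes d. wasserstein (P n)
    (density_proportional_to (\<lambda>x. exp (- (\<kappa>' / 2 ^ p) * x ^ p))) \<le> ennreal (C * real n powr (- 1 / real p))"
proof -
  note I = maximizer_interior[OF d \<beta> a(1)]
  have sub: "maximizers d \<beta> h \<subseteq> {0<..<1}" using maximizer_interior[OF d \<beta>] by auto
  have tail: "\<exists>\<gamma>>0. \<exists>N. \<forall>n\<ge>N. regular_graphs d n \<noteq> {} \<longrightarrow> (\<forall>k\<in>K n.
      \<bar>real k / real n - a\<bar> > \<epsilon> \<longrightarrow> level_weight d n \<beta> h k \<le> exp (- \<gamma> * real n) * level_weight d n \<beta> h (nat \<lfloor>real n * a\<rfloor>))" if \<epsilon>: "0 < \<epsilon>" for \<epsilon>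
  proof -
    obtain \<gamma> N where \<gamma>: "0 < \<gamma>" and far: "\<And>n k. n \<ge> N \<Longrightarrow> regular_graphs d n \<noteq> {} \<Longrightarrow> k \<le> n \<Longrightarrow>
      (\<And>f. f \<in> maximizers d \<beta> h \<Longrightarrow> \<bar>real k / real n - f\<bar> > min \<epsilon> \<delta>2) \<Longrightarrow>
      level_weight d n \<beta> h k \<le> exp (- \<gamma> * real n) * level_weight d n \<beta> h (nat \<lfloor>real n * a\<rfloor>)"
    proof (rule off_maximizers[OF d \<beta> a(2) sub, where h = h and m = "A_fun d \<beta> h a" and \<delta> = "min \<epsilon> \<delta>2" and a = a])
      show "A_fun d \<beta> h f = A_fun d \<beta> h a" if "f \<in> maximizers d \<beta> h" for f using that a by (intro maximizers_eq) auto
      show "A_fun d \<beta> h b < A_fun d \<beta> h a" if "0 < b" "b < 1" "b \<notin> maximizers d \<beta> h" for b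
        using that a by (intro maximizers_less) auto
    qed (use \<epsilon> sep a in auto)
    have "level_weight d n \<beta> h k \<le> exp (- \<gamma> * real n) * level_weight d n \<beta> h (nat \<lfloor>real n * a\<rfloor>)"
      if n: "n \<ge> max N 1" "regular_graphs d n \<noteq> {}" and k: "k \<in> K n" "\<bar>real k / real n - a\<bar> > \<epsilon>" for n k
    proof (rule far)
      fix f assume f: "f \<in> maximizers d \<beta> h"
      show "\<bar>real k / real n - f\<bar> > min \<epsilon> \<delta>2"
      proof (cases "f = a")
        case False
        then have "\<bar>real k / real n - f\<bar> > \<delta>2" using n by (intro sep(2) k f) auto
        then show ?thesis by simp
      qed (use k in auto)
    qed (use n k K in auto)
    then show ?thesis using \<gamma> by blast
  qed
  have Kn: "K n \<subseteq> {..n}" for n using K by auto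
  obtain C N where C: "0 \<le> C" and main: "\<And>n f. n \<ge> N \<Longrightarrow> regular_graphs d n \<noteq> {} \<Longrightarrow> 1-lipschitz_on UNIV f \<Longrightarrow>
    \<bar>(\<Sum>k\<in>K n. level_weight d n \<beta> h k * f (2 * real n powr (1 / real p) * (real k / real n - a))) / (\<Sum>k\<in>K n. level_weight d n \<beta> h k) -
      (\<integral>x. f x * exp (- (\<kappa>' / 2 ^ p) * x ^ p) \<partial>lborel) / (\<integral>x. exp (- (\<kappa>' / 2 ^ p) * x ^ p) \<partial>lborel)\<bar>
    \<le> C / real n powr (1 / real p)"
  proof (rule local_wasserstein[OF d \<beta> p I \<kappa>' M \<delta>0 exp Kn \<delta>1 tail], goal_cases)
    case (6 C N)
    show thesis by (rule 6(1)[OF 6(2)]) (rule 6(3); assumption)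
  qed
  have "\<forall>\<^sub>F n in graph_sizes d. wasserstein (P n)
    (density_proportional_to (\<lambda>x. exp (- (\<kappa>' / 2 ^ p) * x ^ p))) \<le> ennreal (C * real n powr (- 1 / real p))"
  proof (rule eventually_graph_sizes[where N = "max N (nat \<lceil>1 / \<delta>1\<rceil> + 1)"], rule wasserstein_leI)
    fix n and f :: "real \<Rightarrow> real"
    assume n: "n \<ge> max N (nat \<lceil>1 / \<delta>1\<rceil> + 1)" and R: "regular_graphs d n \<noteq> {}" and f: "1-lipschitz_on UNIV f"
    have n0: "n > 0" using n by simp
    have fm: "f \<in> borel_measurable borel" by (rule lipschitz_measurable[OF f])
    have pos: "0 < (\<Sum>k\<in>K n. level_weight d n \<beta> h k)"
    proof (rule sum_pos)
      show "finite (K n)" using Kn finite_subset by blast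
      define k0 where "k0 = nat \<lfloor>real n * a\<rfloor>"
      have "1 / \<delta>1 \<le> real n" using n by linarith
      then have "1 / real n \<le> \<delta>1" using \<delta>1 n0 by (simp add: field_simps)
      moreover have "\<bar>real k0 / real n - a\<bar> \<le> 1 / real n"
        unfolding k0_def using I n0 by (intro floor_fraction) auto
      moreover have "k0 \<le> n"
      proof -
        have "real n * a \<le> real n * 1" using I by (intro mult_left_mono) auto
        then show ?thesis unfolding k0_def by (simp add: nat_le_iff floor_le_iff)
      qed
      ultimately have "k0 \<in> K n" using n0 by (intro \<delta>1(2)) auto
      then show "K n \<noteq> {}" by blast
      show "0 < level_weight d n \<beta> h k" if "k \<in> K n" for k using that Kn by (intro level_weight_pos R) auto
    qed
    have "(\<integral>x. f x \<partial>density_proportional_to (\<lambda>x. exp (- (\<kappa>' / 2 ^ p) * x ^ p))) =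
        (\<integral>x. f x * exp (- (\<kappa>' / 2 ^ p) * x ^ p) \<partial>lborel) / (\<integral>x. exp (- (\<kappa>' / 2 ^ p) * x ^ p) \<partial>lborel)"
      by (rule integral_density_proportional_to[OF fm]) auto
    moreover have "C / real n powr (1 / real p) = C * real n powr (- 1 / real p)"
      by (simp add: powr_minus divide_inverse)
    ultimately show "\<bar>(\<integral>x. f x \<partial>P n) - (\<integral>x. f x \<partial>density_proportional_to (\<lambda>x. exp (- (\<kappa>' / 2 ^ p) * x ^ p)))\<bar>
        \<le> C * real n powr (- 1 / real p)"
      using main[of n f] n R f Pn[OF R fm pos] by simp
  qed
  then show ?thesis by blast
qed

end

lemma integral_distr_ising:
  assumes R: "regular_graphs d n \<noteq> {}" and f: "f \<in> borel_measurable borel"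
    and T: "\<And>k. T (2 * real k - real n) = t k"
  shows "(\<integral>x. f x \<partial>distr (annealed_ising d n \<beta> h) borel (\<lambda>\<omega>. T (magnetization n \<omega>))) =
    (\<Sum>k\<in>{k. k \<le> n \<and> True}. level_weight d n \<beta> h k * f (t k)) / (\<Sum>k\<in>{k. k \<le> n \<and> True}. level_weight d n \<beta> h k)"
proof -
  have "(\<integral>x. f x \<partial>distr (annealed_ising d n \<beta> h) borel (\<lambda>\<omega>. T (magnetization n \<omega>))) =
      (\<integral>\<omega>. f (T (magnetization n \<omega>)) \<partial>annealed_ising d n \<beta> h)"
    using f measurable_annealed_ising[OF R] by (intro integral_distr) auto
  also have "\<dots> = (\<Sum>k\<le>n. level_weight d n \<beta> h k * f (T (2 * real k - real n))) / (\<Sum>k\<le>n. level_weight d n \<beta> h k)"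
    by (rule integral_annealed_ising[OF R, where f = "\<lambda>m. f (T m)"])
  finally show ?thesis by (simp add: T atMost_def)
qed

lemma integral_distr_conditioned_ising:
  assumes R: "regular_graphs d n \<noteq> {}" and f: "f \<in> borel_measurable borel"
    and T: "\<And>k. T (2 * real k - real n) = t k"
    and pos: "0 < (\<Sum>k | k \<le> n \<and> Q (2 * real k - real n). level_weight d n \<beta> h k)"
  shows "(\<integral>x. f x \<partial>distr (uniform_measure (annealed_ising d n \<beta> h) {\<omega> \<in> spins n. Q (magnetization n \<omega>)}) borel
      (\<lambda>\<omega>. T (magnetization n \<omega>))) =
    (\<Sum>k | k \<le> n \<and> Q (2 * real k - real n). level_weight d n \<beta> h k * f (t k)) / (\<Sum>k | k \<le> n \<and> Q (2 * real k - real n). level_weight d n \<beta> h k)"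
proof -
  have "(\<integral>x. f x \<partial>distr (uniform_measure (annealed_ising d n \<beta> h) {\<omega> \<in> spins n. Q (magnetization n \<omega>)}) borel
      (\<lambda>\<omega>. T (magnetization n \<omega>))) =
      (\<integral>\<omega>. f (T (magnetization n \<omega>)) \<partial>uniform_measure (annealed_ising d n \<beta> h) {\<omega> \<in> spins n. Q (magnetization n \<omega>)})"
  proof (rule integral_distr)
    show "(\<lambda>\<omega>. T (magnetization n \<omega>)) \<in>
        uniform_measure (annealed_ising d n \<beta> h) {\<omega> \<in> spins n. Q (magnetization n \<omega>)} \<rightarrow>\<^sub>M borel"
      using measurable_annealed_ising[OF R] by (simp add: uniform_measure_def)
  qed (use f in auto)
  also have "\<dots> = (\<Sum>k | k \<le> n \<and> Q (2 * real k - real n). level_weight d n \<beta> h k * f (T (2 * real k - real n))) /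
      (\<Sum>k | k \<le> n \<and> Q (2 * real k - real n). level_weight d n \<beta> h k)"
    by (rule integral_conditioned_annealed_ising[OF R pos, where f = "\<lambda>m. f (T m)"])
  finally show ?thesis by (simp add: T)
qed

lemma sqrt_scaling: "((2 * real k - real n) - real n * (2 * a - 1)) / sqrt (real n) =
    2 * real n powr (1 / 2) * (real k / real n - a)"
proof (cases "n = 0")
  case False
  then have "2 * real k - real n - real n * (2 * a - 1) = real n * (2 * (real k / real n - a))"
    by (simp add: field_simps)
  moreover have "real n / sqrt (real n) = sqrt (real n)" by (rule real_div_sqrt) simp
  then have "real n * u / sqrt (real n) = sqrt (real n) * u" for u
    by (simp only: times_divide_eq_left[symmetric])
  moreover have "real n powr (1 / 2) = sqrt (real n)" by (simp add: powr_half_sqrt)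
  ultimately show ?thesis by (simp only: mult.assoc mult.left_commute)
qed simp

lemma critical_scaling: "real n powr (- 3 / 4) * (2 * real k - real n) = 2 * real n powr (1 / real 4) * (real k / real n - 1 / 2)"
proof (cases "n = 0")
  case False
  have "real n powr (1 / 4) = real n powr (- 3 / 4 + 1)" by simp
  also have "\<dots> = real n powr (- 3 / 4) * real n" using False by (subst powr_add) simp
  finally show ?thesis using False by (simp add: field_simps)
qed simp

text \<open>The spin flip exchanges the levels \<open>k\<close> and \<open>n - k\<close>, whose
  weights agree at zero field.\<close>

lemma measure_flip:
  assumes R: "regular_graphs d n \<noteq> {}"
  shows "measure (annealed_ising d n \<beta> 0) {\<omega> \<in> spins n. Q (- magnetization n \<omega>)} = measure (annealed_ising d n \<beta> 0) {\<omega> \<in> spins n. Q (magnetization n \<omega>)}"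
proof -
  have "(\<Sum>k | k \<le> n \<and> Q (- (2 * real k - real n)). level_weight d n \<beta> 0 k) = (\<Sum>k | k \<le> n \<and> Q (2 * real k - real n). level_weight d n \<beta> 0 k)"
  proof (rule sum.reindex_bij_witness[of _ "\<lambda>k. n - k" "\<lambda>k. n - k"])
    have flip: "2 * real (n - k) - real n = - (2 * real k - real n)" if "k \<le> n" for k
      using that by (simp add: of_nat_diff)
    show "n - k \<in> {k. k \<le> n \<and> Q (2 * real k - real n)}" if "k \<in> {k. k \<le> n \<and> Q (- (2 * real k - real n))}" for k
      using that flip[of k] by simp
    show "n - k \<in> {k. k \<le> n \<and> Q (- (2 * real k - real n))}" if "k \<in> {k. k \<le> n \<and> Q (2 * real k - real n)}" for k
      using that flip[of k] by simp
  qed (auto simp: level_weight_compl)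
  then show ?thesis
    using measure_annealed_ising[OF R, where Q = "\<lambda>m. Q (- m)"] measure_annealed_ising[OF R, where Q = Q] by simp
qed

context
  fixes d :: nat and \<beta> h :: real
  assumes d: "d \<ge> 3" and \<beta>: "0 < \<beta>"
begin

lemma wasserstein_normal_bound:
  assumes a: "a \<in> maximizers d \<beta> h" "finite (maximizers d \<beta> h)" and neg: "ddA d \<beta> a < 0"
    and K: "\<And>n. K n = {k. k \<le> n \<and> Q n (2 * real k - real n)}" and \<delta>1: "0 < \<delta>1"
      "\<And>n k. 0 < n \<Longrightarrow> k \<le> n \<Longrightarrow> \<bar>real k / real n - a\<bar> \<le> \<delta>1 \<Longrightarrow> k \<in> K n"
    and sep: "0 < \<delta>2" "\<And>n k f. 0 < n \<Longrightarrow> k \<in> K n \<Longrightarrow> f \<in> maximizers d \<beta> h \<Longrightarrow> f \<noteq> a \<Longrightarrow>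
      \<bar>real k / real n - f\<bar> > \<delta>2"
    and Pn: "\<And>n f. regular_graphs d n \<noteq> {} \<Longrightarrow> f \<in> borel_measurable borel \<Longrightarrow>
      0 < (\<Sum>k\<in>K n. level_weight d n \<beta> h k) \<Longrightarrow>
      (\<integral>x. f x \<partial>P n) = (\<Sum>k\<in>K n. level_weight d n \<beta> h k * f (2 * real n powr (1 / 2) * (real k / real n - a))) / (\<Sum>k\<in>K n. level_weight d n \<beta> h k)"
  shows "\<exists>C. \<forall>\<^sub>F n in graph_sizes d. wasserstein (P n)
    (centered_normal (4 / \<bar>(deriv ^^ 2) (A_fun d \<beta> h) a\<bar>)) \<le> ennreal (C * real n powr (- 1 / 2))"
proof -
  note I = maximizer_interior[OF d \<beta> a(1)]
  obtain M \<delta>0 where M: "0 \<le> M" "0 < \<delta>0" and E: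
    "\<And>x. \<bar>x - a\<bar> \<le> \<delta>0 \<Longrightarrow> \<bar>A_fun d \<beta> h x - A_fun d \<beta> h a - ddA d \<beta> a / 2 * (x - a) ^ 2\<bar> \<le> M * \<bar>x - a\<bar> ^ 3"
    using A_fun_expansion_2[OF d \<beta> I maximizer_critical[OF d \<beta> a(1)]] by blast
  define \<kappa>' where "\<kappa>' = - ddA d \<beta> a / 2"
  have \<kappa>': "0 < \<kappa>'" using neg by (simp add: \<kappa>'_def)
  have p: "even (2 :: nat)" "(2 :: nat) \<le> 2" by auto
  have E': "\<bar>A_fun d \<beta> h x - A_fun d \<beta> h a + \<kappa>' * (x - a) ^ 2\<bar> \<le> M * \<bar>x - a\<bar> ^ (2 + 1)" if "\<bar>x - a\<bar> \<le> \<delta>0" for x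
    using E[OF that] by (simp add: \<kappa>'_def)
  have Pn': "(\<integral>x. f x \<partial>P n) = (\<Sum>k\<in>K n. level_weight d n \<beta> h k * f (2 * real n powr (1 / real 2) * (real k / real n - a))) / (\<Sum>k\<in>K n. level_weight d n \<beta> h k)"
    if "regular_graphs d n \<noteq> {}" "f \<in> borel_measurable borel" "0 < (\<Sum>k\<in>K n. level_weight d n \<beta> h k)" for n f
    using Pn[OF that] by simp
  have v: "0 < 4 / \<bar>ddA d \<beta> a\<bar>" using neg by simp
  \<comment> \<open>Half of |A''| from the expansion and the factor 2^2 from the magnetization give
    the exponent |A''| / 8, hence the variance 4 / |A''|.\<close>
  have "1 / (2 * (4 / \<bar>ddA d \<beta> a\<bar>)) = \<kappa>' / 2 ^ 2" using neg by (simp add: \<kappa>'_def)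
  then have "centered_normal (4 / \<bar>(deriv ^^ 2) (A_fun d \<beta> h) a\<bar>) =
      density_proportional_to (\<lambda>x. exp (- (\<kappa>' / 2 ^ 2) * x ^ 2))"
    using centered_normal_eq[OF v] by (simp only: deriv2_A_fun[OF d \<beta> I])
  moreover have "\<exists>C. \<forall>\<^sub>F n in graph_sizes d. wasserstein (P n)
      (density_proportional_to (\<lambda>x. exp (- (\<kappa>' / 2 ^ 2) * x ^ 2))) \<le> ennreal (C * real n powr (- 1 / real 2))"
    by (rule wasserstein_bound[OF d \<beta> p a \<kappa>' M E' K \<delta>1 sep Pn'])
  ultimately show ?thesis by (simp only: of_nat_numeral)
qed

lemma unique_maximizer:
  assumes U: "(\<beta>, h) \<in> uniqueness_region d" and max: "maximizers d \<beta> h = {a}"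
  shows "conv_in_law (graph_sizes d) (\<lambda>n. distr (annealed_ising d n \<beta> h) borel (\<lambda>\<omega>. magnetization n \<omega> / real n))
      (return borel (2 * a - 1))"
    and "\<forall>\<^sub>F \<delta> in at_right 0. \<exists>c>0. \<forall>\<^sub>F n in graph_sizes d.
      measure (annealed_ising d n \<beta> h) {\<omega> \<in> spins n. \<bar>magnetization n \<omega> / real n - (2 * a - 1)\<bar> > \<delta>} \<le> exp (- c * real n)"
    and "\<exists>C. \<forall>\<^sub>F n in graph_sizes d. wasserstein
      (distr (annealed_ising d n \<beta> h) borel (\<lambda>\<omega>. (magnetization n \<omega> - real n * (2 * a - 1)) / sqrt (real n)))
      (centered_normal (4 / \<bar>(deriv ^^ 2) (A_fun d \<beta> h) a\<bar>)) \<le> ennreal (C * real n powr (- 1 / 2))"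
proof -
  have am: "a \<in> maximizers d \<beta> h" using max by simp
  have fin: "finite (maximizers d \<beta> h)" using max by simp
  have neg: "ddA d \<beta> a < 0" by (rule maximizer_ddA_neg_uniqueness[OF d \<beta> am U])
  show "conv_in_law (graph_sizes d) (\<lambda>n. distr (annealed_ising d n \<beta> h) borel (\<lambda>\<omega>. magnetization n \<omega> / real n))
      (return borel (2 * a - 1))"
    unfolding conv_in_law_def
  proof (intro allI impI)
    fix x assume cont: "isCont (cdf (return borel (2 * a - 1))) x"
    have "x \<noteq> 2 * a - 1"
    proof
      assume "x = 2 * a - 1"
      then have "0 < measure (return borel (2 * a - 1)) {x}" by (simp add: measure_return)
      then show False using not_isCont_atom[of "return borel (2 * a - 1)" x] cont
        by (simp add: prob_space_return)
    qed
    then consider "x < 2 * a - 1" | "2 * a - 1 < x" by linarith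
    then show "((\<lambda>n. cdf (distr (annealed_ising d n \<beta> h) borel (\<lambda>\<omega>. magnetization n \<omega> / real n)) x) \<longlongrightarrow>
        cdf (return borel (2 * a - 1)) x) (graph_sizes d)"
    proof cases
      case 1
      then show ?thesis using cdf_tendsto_outside(1)[OF d \<beta> max, of x] by (simp add: cdf_return)
    next
      case 2
      then show ?thesis using cdf_tendsto_outside(2)[OF d \<beta> max, of x] by (simp add: cdf_return)
    qed
  qed
  show "\<forall>\<^sub>F \<delta> in at_right 0. \<exists>c>0. \<forall>\<^sub>F n in graph_sizes d.
      measure (annealed_ising d n \<beta> h) {\<omega> \<in> spins n. \<bar>magnetization n \<omega> / real n - (2 * a - 1)\<bar> > \<delta>} \<le> exp (- c * real n)"
    using eventually_at_right_less[of "0::real"]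
  proof eventually_elim
    case (elim \<delta>)
    then show ?case using concentration[OF d \<beta> max _ _ elim] by simp
  qed
  show "\<exists>C. \<forall>\<^sub>F n in graph_sizes d. wasserstein
      (distr (annealed_ising d n \<beta> h) borel (\<lambda>\<omega>. (magnetization n \<omega> - real n * (2 * a - 1)) / sqrt (real n)))
      (centered_normal (4 / \<bar>(deriv ^^ 2) (A_fun d \<beta> h) a\<bar>)) \<le> ennreal (C * real n powr (- 1 / 2))"
  proof (rule wasserstein_normal_bound[OF am fin neg, where K = "\<lambda>n. {k. k \<le> n \<and> True}" and Q = "\<lambda>_ _. True"
        and ?\<delta>1.0 = 1 and ?\<delta>2.0 = 1])
    show "(\<integral>x. f x \<partial>distr (annealed_ising d n \<beta> h) borel (\<lambda>\<omega>. (magnetization n \<omega> - real n * (2 * a - 1)) / sqrt (real n))) =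
        (\<Sum>k\<in>{k. k \<le> n \<and> True}. level_weight d n \<beta> h k * f (2 * real n powr (1 / 2) * (real k / real n - a))) /
        (\<Sum>k\<in>{k. k \<le> n \<and> True}. level_weight d n \<beta> h k)"
      if "regular_graphs d n \<noteq> {}" "f \<in> borel_measurable borel" for n and f :: "real \<Rightarrow> real"
      by (rule integral_distr_ising[OF that, where T = "\<lambda>m. (m - real n * (2 * a - 1)) / sqrt (real n)"])
        (rule sqrt_scaling)
  qed (use max in auto)
qed

end

context
  fixes d :: nat and \<beta> :: real
  assumes d: "d \<ge> 3" and \<beta>: "0 < \<beta>"
begin

text \<open>Reflection maps the pair of maximizers to itself and reverses the order.\<close>

lemma maximizers_symmetric:
  assumes max: "maximizers d \<beta> 0 = {am, ap}" and less: "am < ap"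
  shows "am = 1 - ap"
proof -
  have flip: "1 - a \<in> maximizers d \<beta> 0" if "a \<in> maximizers d \<beta> 0" for a
    using that A_fun_sym[OF d \<beta>, of a] by (auto simp: maximizers_def)
  have "1 - am \<in> {am, ap}" "1 - ap \<in> {am, ap}"
    using flip[of am] flip[of ap] unfolding max by blast+
  then show ?thesis using less by auto
qed

lemma two_maximizers:
  assumes sup: "\<beta> > beta_c d" and less: "am < ap" and max: "maximizers d \<beta> 0 = {am, ap}"
  shows "\<forall>\<^sub>F \<delta> in at_right 0. \<exists>c>0. \<forall>\<^sub>F n in graph_sizes d.
      measure (annealed_ising d n \<beta> 0) {\<omega> \<in> spins n. \<forall>a\<in>{am, ap}. \<bar>magnetization n \<omega> / real n - (2 * a - 1)\<bar> > \<delta>} \<le> exp (- c * real n)"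
    and "conv_in_law (graph_sizes d) (\<lambda>n. distr (annealed_ising d n \<beta> 0) borel (\<lambda>\<omega>. magnetization n \<omega> / real n))
      (half_half (2 * am - 1) (2 * ap - 1))"
    and "\<forall>a\<in>{am, ap}. \<forall>\<^sub>F \<delta> in at_right 0. \<exists>C. \<forall>\<^sub>F n in graph_sizes d. wasserstein
      (distr (uniform_measure (annealed_ising d n \<beta> 0) {\<omega> \<in> spins n. \<bar>magnetization n \<omega> / real n - (2 * a - 1)\<bar> \<le> \<delta>}) borel
        (\<lambda>\<omega>. (magnetization n \<omega> - real n * (2 * a - 1)) / sqrt (real n)))
      (centered_normal (4 / \<bar>(deriv ^^ 2) (A_fun d \<beta> 0) a\<bar>)) \<le> ennreal (C * real n powr (- 1 / 2))"
proof -
  have fin: "finite {am, ap}" "{am, ap} \<noteq> {}" by auto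
  have sym: "am = 1 - ap" by (rule maximizers_symmetric[OF max less])
  note conc = concentration[OF d \<beta> max fin]
  show "\<forall>\<^sub>F \<delta> in at_right 0. \<exists>c>0. \<forall>\<^sub>F n in graph_sizes d.
      measure (annealed_ising d n \<beta> 0) {\<omega> \<in> spins n. \<forall>a\<in>{am, ap}. \<bar>magnetization n \<omega> / real n - (2 * a - 1)\<bar> > \<delta>} \<le> exp (- c * real n)"
    using eventually_at_right_less[of "0::real"] by eventually_elim (rule conc)
  show "conv_in_law (graph_sizes d) (\<lambda>n. distr (annealed_ising d n \<beta> 0) borel (\<lambda>\<omega>. magnetization n \<omega> / real n))
      (half_half (2 * am - 1) (2 * ap - 1))"
    unfolding conv_in_law_def
  proof (intro allI impI)
    fix x assume cont: "isCont (cdf (half_half (2 * am - 1) (2 * ap - 1))) x"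
    define z where "z = 2 * ap - 1"
    have z: "2 * am - 1 = - z" "2 * ap - 1 = z" "0 < z" using sym less by (auto simp: z_def)
    have "x \<noteq> 2 * am - 1" "x \<noteq> 2 * ap - 1"
      using not_isCont_atom[OF half_half_prob] half_half_atom cont by blast+
    then consider "x < - z" | "z < x" | "- z < x" "x < z" using z by linarith
    then show "((\<lambda>n. cdf (distr (annealed_ising d n \<beta> 0) borel (\<lambda>\<omega>. magnetization n \<omega> / real n)) x) \<longlongrightarrow>
        cdf (half_half (2 * am - 1) (2 * ap - 1)) x) (graph_sizes d)"
    proof cases
      case 1
      then have "x < 2 * f - 1" if "f \<in> {am, ap}" for f using that z by auto
      from cdf_tendsto_outside(1)[OF d \<beta> max fin this] show ?thesis
        using 1 z by (simp add: cdf_half_half)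
    next
      case 2
      then have "2 * f - 1 < x" if "f \<in> {am, ap}" for f using that z by auto
      from cdf_tendsto_outside(2)[OF d \<beta> max fin this] show ?thesis
        using 2 z by (simp add: cdf_half_half)
    next
      \<comment> \<open>Between the two limit values the spin flip shows that the probabilities of
        M/n \<le> x and of M/n > x differ by at most that of |M/n| \<le> |x|. This event keeps away
        from both limit values and is exponentially rare, so both probabilities tend to 1/2.\<close>
      case 3
      define \<delta> where "\<delta> = (z - \<bar>x\<bar>) / 2"
      have \<delta>: "0 < \<delta>" using 3 by (auto simp: \<delta>_def abs_if)
      obtain c where c: "0 < c" and ev: "\<forall>\<^sub>F n in graph_sizes d.
          measure (annealed_ising d n \<beta> 0) {\<omega> \<in> spins n. \<forall>a\<in>{am, ap}. \<bar>magnetization n \<omega> / real n - (2 * a - 1)\<bar> > \<delta>} \<le> exp (- c * real n)"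
        using conc[OF \<delta>] by blast
      have R: "\<forall>\<^sub>F n in graph_sizes d. regular_graphs d n \<noteq> {}"
        by (rule eventually_graph_sizes[of 0]) simp
      have "\<forall>\<^sub>F n in graph_sizes d. norm (cdf (distr (annealed_ising d n \<beta> 0) borel (\<lambda>\<omega>. magnetization n \<omega> / real n)) x - 1 / 2) \<le> exp (- c * real n)"
        using ev R
      proof eventually_elim
        case (elim n)
        define far where "far \<omega> \<longleftrightarrow> (\<forall>a\<in>{am, ap}. \<bar>magnetization n \<omega> / real n - (2 * a - 1)\<bar> > \<delta>)" for \<omega>
        have far: "far \<omega>" if "\<bar>magnetization n \<omega> / real n\<bar> \<le> \<bar>x\<bar>" for \<omega>
        proof -
          have "\<bar>m - - z\<bar> > \<delta> \<and> \<bar>m - z\<bar> > \<delta>" if "\<bar>m\<bar> \<le> \<bar>x\<bar>" for m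
          proof -
            have "2 * \<delta> = z - \<bar>x\<bar>" by (simp add: \<delta>_def field_simps)
            then have "\<bar>m\<bar> + 2 * \<delta> \<le> z" using that by argo
            then show ?thesis using \<delta> by (intro conjI) (simp_all add: abs_if split: if_splits)
          qed
          note dev = this[OF that]
          show ?thesis
            unfolding far_def
          proof
            fix f assume "f \<in> {am, ap}"
            then have "2 * f - 1 = - z \<or> 2 * f - 1 = z" using z by blast
            then show "\<delta> < \<bar>magnetization n \<omega> / real n - (2 * f - 1)\<bar>"
              using dev by (elim disjE) (simp_all only:)
          qed
        qed
        define u where "u = measure (annealed_ising d n \<beta> 0) {\<omega> \<in> spins n. magnetization n \<omega> / real n \<le> x}"
        have "measure (annealed_ising d n \<beta> 0) {\<omega> \<in> spins n. - magnetization n \<omega> / real n \<le> x} = u"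
          unfolding u_def by (rule measure_flip[OF elim(2), where Q = "\<lambda>m. m / real n \<le> x"])
        then have flip: "measure (annealed_ising d n \<beta> 0) {\<omega> \<in> spins n. \<not> - magnetization n \<omega> / real n \<le> x} = 1 - u"
          using measure_compl_ising[OF elim(2), where P = "\<lambda>\<omega>. - magnetization n \<omega> / real n \<le> x"] by simp
        have "u \<le> (1 - u) + measure (annealed_ising d n \<beta> 0) {\<omega> \<in> spins n. far \<omega>}"
          unfolding flip[symmetric] unfolding u_def
        proof (rule measure_diff_ising[OF elim(2)])
          fix \<omega> assume "magnetization n \<omega> / real n \<le> x"
          then have "\<not> - (magnetization n \<omega> / real n) \<le> x \<or> \<bar>magnetization n \<omega> / real n\<bar> \<le> \<bar>x\<bar>" by linarith
          then show "\<not> - magnetization n \<omega> / real n \<le> x \<or> far \<omega>" using far[of \<omega>] by auto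
        qed
        moreover have "1 - u \<le> u + measure (annealed_ising d n \<beta> 0) {\<omega> \<in> spins n. far \<omega>}"
          unfolding flip[symmetric] unfolding u_def
        proof (rule measure_diff_ising[OF elim(2)])
          fix \<omega> assume "\<not> - magnetization n \<omega> / real n \<le> x"
          then have "magnetization n \<omega> / real n \<le> x \<or> \<bar>magnetization n \<omega> / real n\<bar> \<le> \<bar>x\<bar>"
            unfolding minus_divide_left[symmetric] by linarith
          then show "magnetization n \<omega> / real n \<le> x \<or> far \<omega>" using far[of \<omega>] by auto
        qed
        moreover have "measure (annealed_ising d n \<beta> 0) {\<omega> \<in> spins n. far \<omega>} \<le> exp (- c * real n)"
          using elim(1) by (simp only: far_def)
        moreover have "0 < exp (- c * real n)" by simp
        ultimately show ?case unfolding cdf_magnetization u_def[symmetric] real_norm_def by linarith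
      qed
      from Lim_null_comparison[OF this tendsto_exp_graph_sizes[OF c]]
      have "((\<lambda>n. cdf (distr (annealed_ising d n \<beta> 0) borel (\<lambda>\<omega>. magnetization n \<omega> / real n)) x) \<longlongrightarrow> 1 / 2) (graph_sizes d)"
        by (simp add: LIM_zero_iff)
      moreover have "cdf (half_half (2 * am - 1) (2 * ap - 1)) x = 1 / 2" using 3 z by (simp add: cdf_half_half)
      ultimately show ?thesis by (simp only:)
    qed
  qed
  show "\<forall>a\<in>{am, ap}. \<forall>\<^sub>F \<delta> in at_right 0. \<exists>C. \<forall>\<^sub>F n in graph_sizes d. wasserstein
      (distr (uniform_measure (annealed_ising d n \<beta> 0) {\<omega> \<in> spins n. \<bar>magnetization n \<omega> / real n - (2 * a - 1)\<bar> \<le> \<delta>}) borel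
        (\<lambda>\<omega>. (magnetization n \<omega> - real n * (2 * a - 1)) / sqrt (real n)))
      (centered_normal (4 / \<bar>(deriv ^^ 2) (A_fun d \<beta> 0) a\<bar>)) \<le> ennreal (C * real n powr (- 1 / 2))"
  proof
    fix a assume "a \<in> {am, ap}"
    then have a: "a \<in> maximizers d \<beta> 0" using max by simp
    have finm: "finite (maximizers d \<beta> 0)" using max by simp
    have neg: "ddA d \<beta> a < 0" by (rule maximizer_ddA_neg_supercritical[OF d \<beta> a sup])
    have gap: "f \<in> maximizers d \<beta> 0 \<Longrightarrow> f \<noteq> a \<Longrightarrow> \<bar>f - a\<bar> = ap - am" for f
      using a less unfolding max by auto
    \<comment> \<open>In terms of \<open>k / n\<close> the conditioning has radius
      \<open>\<delta> / 2\<close>, less than half the gap, which keeps the other maximizer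
      out.\<close>
    have "\<forall>\<^sub>F \<delta> in at_right 0. \<delta> \<in> {0<..<ap - am}"
      using less by (intro eventually_at_right_real) auto
    then show "\<forall>\<^sub>F \<delta> in at_right 0. \<exists>C. \<forall>\<^sub>F n in graph_sizes d. wasserstein
      (distr (uniform_measure (annealed_ising d n \<beta> 0) {\<omega> \<in> spins n. \<bar>magnetization n \<omega> / real n - (2 * a - 1)\<bar> \<le> \<delta>}) borel
        (\<lambda>\<omega>. (magnetization n \<omega> - real n * (2 * a - 1)) / sqrt (real n)))
      (centered_normal (4 / \<bar>(deriv ^^ 2) (A_fun d \<beta> 0) a\<bar>)) \<le> ennreal (C * real n powr (- 1 / 2))"
    proof eventually_elim
      case (elim \<delta>)
      define Q where "Q n m \<longleftrightarrow> \<bar>m / real n - (2 * a - 1)\<bar> \<le> \<delta>" for n :: nat and m :: real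
      have Q: "Q n (2 * real k - real n) \<longleftrightarrow> \<bar>real k / real n - a\<bar> \<le> \<delta> / 2" if "0 < n" for n k
      proof -
        have "\<bar>2 * u\<bar> \<le> \<delta> \<longleftrightarrow> \<bar>u\<bar> \<le> \<delta> / 2" for u by (auto simp: abs_mult)
        then show ?thesis unfolding Q_def magnetization_deviation[OF that] .
      qed
      show ?case
        unfolding Q_def[symmetric]
      proof (rule wasserstein_normal_bound[OF d \<beta> a finm neg, where Q = Q
            and K = "\<lambda>n. {k. k \<le> n \<and> Q n (2 * real k - real n)}" and ?\<delta>1.0 = "\<delta> / 2" and ?\<delta>2.0 = "(ap - am) / 4"])
        fix n k f assume "0 < n" "k \<in> {k. k \<le> n \<and> Q n (2 * real k - real n)}" "f \<in> maximizers d \<beta> 0" "f \<noteq> a"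
        then have "\<bar>real k / real n - a\<bar> \<le> \<delta> / 2" "\<bar>f - a\<bar> = ap - am" using Q gap by auto
        moreover have "\<delta> < ap - am" using elim by simp
        moreover have "\<bar>f - a\<bar> \<le> \<bar>real k / real n - a\<bar> + \<bar>real k / real n - f\<bar>" by simp
        ultimately have "(ap - am) / 2 < \<bar>real k / real n - f\<bar>" by argo
        then show "(ap - am) / 4 < \<bar>real k / real n - f\<bar>" using less by linarith
      next
        fix n and f :: "real \<Rightarrow> real"
        assume asm: "regular_graphs d n \<noteq> {}" "f \<in> borel_measurable borel"
          "0 < (\<Sum>k | k \<le> n \<and> Q n (2 * real k - real n). level_weight d n \<beta> 0 k)"
        show "(\<integral>x. f x \<partial>distr (uniform_measure (annealed_ising d n \<beta> 0) {\<omega> \<in> spins n. Q n (magnetization n \<omega>)}) borel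
            (\<lambda>\<omega>. (magnetization n \<omega> - real n * (2 * a - 1)) / sqrt (real n))) =
          (\<Sum>k | k \<le> n \<and> Q n (2 * real k - real n). level_weight d n \<beta> 0 k * f (2 * real n powr (1 / 2) * (real k / real n - a))) /
          (\<Sum>k | k \<le> n \<and> Q n (2 * real k - real n). level_weight d n \<beta> 0 k)"
          by (rule integral_distr_conditioned_ising[OF asm(1,2) _ asm(3),
                where T = "\<lambda>m. (m - real n * (2 * a - 1)) / sqrt (real n)"]) (rule sqrt_scaling)
      qed (use elim less Q in auto)
    qed
  qed
qed

lemma critical_wasserstein:
  assumes crit: "\<beta> = beta_c d"
  shows "\<exists>C. \<forall>\<^sub>F n in graph_sizes d. wasserstein
    (distr (annealed_ising d n \<beta> 0) borel (\<lambda>\<omega>. real n powr (- 3 / 4) * magnetization n \<omega>))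
    (density_proportional_to (\<lambda>x. exp ((deriv ^^ 4) (A_fun d \<beta> 0) (1 / 2) * x ^ 4 / (2 ^ 4 * fact 4))))
    \<le> ennreal (C * real n powr (- 1 / 4))"
proof -
  define \<phi>0 where "\<phi>0 = critical_factor d \<beta> 0"
  have neg: "\<phi>0 < 0" unfolding \<phi>0_def by (rule critical_factor_neg[OF d \<beta> crit])
  \<comment> \<open>The comparison includes the endpoints, which \<open>critical_unique_max\<close>
    leaves out; A is 0 there and positive somewhere inside.\<close>
  have less: "A_fun d \<beta> 0 b < A_fun d \<beta> 0 (1 / 2)" if "0 \<le> b" "b \<le> 1" "b \<noteq> 1 / 2" for b
  proof (cases "b = 0 \<or> b = 1")
    case True
    obtain c where c: "0 < c" "c < 1" "A_fun d \<beta> 0 c > 0"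
      using A_fun_pos_near_0[OF d \<beta>, of 0] by (auto simp: A_fun_def)
    have "A_fun d \<beta> 0 c \<le> A_fun d \<beta> 0 (1 / 2)"
    proof (cases "c = 1 / 2")
      case True
      show ?thesis unfolding True by (rule order_refl)
    qed (use critical_unique_max[OF d \<beta> crit c(1,2)] in simp)
    then show ?thesis using True c A_fun_endpoints[of d \<beta> 0] by auto
  next
    case False
    then show ?thesis using that by (intro critical_unique_max[OF d \<beta> crit]) auto
  qed
  have max: "maximizers d \<beta> 0 = {1 / 2}"
  proof (intro equalityI subsetI)
    fix a assume "a \<in> maximizers d \<beta> 0"
    then have "0 \<le> a" "a \<le> 1" "A_fun d \<beta> 0 (1 / 2) \<le> A_fun d \<beta> 0 a" by (auto simp: maximizers_def)
    then show "a \<in> {1 / 2}" using less[of a] by force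
  next
    fix a :: real assume "a \<in> {1 / 2}"
    then have a: "a = 1 / 2" by simp
    show "a \<in> maximizers d \<beta> 0"
      unfolding maximizers_def a
    proof (intro CollectI conjI ballI)
      fix b :: real assume b: "b \<in> {0..1}"
      show "A_fun d \<beta> 0 b \<le> A_fun d \<beta> 0 (1 / 2)"
      proof (cases "b = 1 / 2")
        case True
        show ?thesis unfolding True by (rule order_refl)
      qed (use less[of b] b in auto)
    qed simp
  qed
  obtain M \<delta>0 where M: "0 \<le> M" "0 < \<delta>0" and E:
    "\<And>x. \<bar>x - 1 / 2\<bar> \<le> \<delta>0 \<Longrightarrow> \<bar>A_fun d \<beta> 0 x - A_fun d \<beta> 0 (1 / 2) -
       \<phi>0 / 3 * (x - 1 / 2) ^ 4\<bar> \<le> M * \<bar>x - 1 / 2\<bar> ^ 5"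
    unfolding \<phi>0_def using A_fun_expansion_4[OF d \<beta> crit] by blast
  define \<kappa>' where "\<kappa>' = - \<phi>0 / 3"
  have \<kappa>': "0 < \<kappa>'" using neg by (simp add: \<kappa>'_def)
  have E': "\<bar>A_fun d \<beta> 0 x - A_fun d \<beta> 0 (1 / 2) + \<kappa>' * (x - 1 / 2) ^ 4\<bar> \<le> M * \<bar>x - 1 / 2\<bar> ^ (4 + 1)"
    if "\<bar>x - 1 / 2\<bar> \<le> \<delta>0" for x
    using E[OF that] by (simp add: \<kappa>'_def)
  have p: "even (4 :: nat)" "(2 :: nat) \<le> 4" by auto
  have half: "1 / 2 \<in> maximizers d \<beta> 0" "finite (maximizers d \<beta> 0)" using max by auto
  have "\<exists>C. \<forall>\<^sub>F n in graph_sizes d. wasserstein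
    (distr (annealed_ising d n \<beta> 0) borel (\<lambda>\<omega>. real n powr (- 3 / 4) * magnetization n \<omega>))
    (density_proportional_to (\<lambda>x. exp (- (\<kappa>' / 2 ^ 4) * x ^ 4))) \<le> ennreal (C * real n powr (- 1 / real 4))"
  proof (rule wasserstein_bound[OF d \<beta> p half \<kappa>' M E', where K = "\<lambda>n. {k. k \<le> n \<and> True}" and Q = "\<lambda>_ _. True"
        and ?\<delta>1.0 = 1 and ?\<delta>2.0 = 1])
    show "(\<integral>x. f x \<partial>distr (annealed_ising d n \<beta> 0) borel (\<lambda>\<omega>. real n powr (- 3 / 4) * magnetization n \<omega>)) =
        (\<Sum>k\<in>{k. k \<le> n \<and> True}. level_weight d n \<beta> 0 k * f (2 * real n powr (1 / real 4) * (real k / real n - 1 / 2))) /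
        (\<Sum>k\<in>{k. k \<le> n \<and> True}. level_weight d n \<beta> 0 k)"
      if "regular_graphs d n \<noteq> {}" "f \<in> borel_measurable borel" for n and f :: "real \<Rightarrow> real"
      by (rule integral_distr_ising[OF that, where T = "\<lambda>m. real n powr (- 3 / 4) * m"])
        (rule critical_scaling)
  qed (use max in auto)
  \<comment> \<open>Both sides equal \<open>\<phi>0 / 48 * x ^ 4\<close>.\<close>
  moreover have "(deriv ^^ 4) (A_fun d \<beta> 0) (1 / 2) * x ^ 4 / (2 ^ 4 * fact 4) = - (\<kappa>' / 2 ^ 4) * x ^ 4" for x
    unfolding deriv4_A_fun[OF d \<beta> crit] \<phi>0_def[symmetric] by (simp add: \<kappa>'_def fact_numeral)
  ultimately show ?thesis by simp
qed

end

theorem theorem5p9: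
  fixes d :: nat and \<beta> h :: real
  assumes "d \<ge> 3" and "\<beta> > 0"
  shows
    "\<comment> \<open>(i)\<close>
     ((\<beta>, h) \<in> uniqueness_region d \<longrightarrow> (\<forall>a. maximizers d \<beta> h = {a} \<longrightarrow>
        conv_in_law (graph_sizes d)
          (\<lambda>n. distr (annealed_ising d n \<beta> h) borel (\<lambda>\<omega>. magnetization n \<omega> / real n))
          (return borel (2 * a - 1))
      \<and> (\<forall>\<^sub>F \<delta> in at_right 0. \<exists>c>0. \<forall>\<^sub>F n in graph_sizes d.
          measure (annealed_ising d n \<beta> h)
            {\<omega> \<in> spins n. \<bar>magnetization n \<omega> / real n - (2 * a - 1)\<bar> > \<delta>}
          \<le> exp (- c * real n))
      \<and> (\<exists>C. \<forall>\<^sub>F n in graph_sizes d.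
          wasserstein
            (distr (annealed_ising d n \<beta> h) borel
              (\<lambda>\<omega>. (magnetization n \<omega> - real n * (2 * a - 1)) / sqrt (real n)))
            (centered_normal (4 / \<bar>(deriv ^^ 2) (A_fun d \<beta> h) a\<bar>))
          \<le> ennreal (C * real n powr (- 1 / 2)))))
     \<and>
     \<comment> \<open>(ii)\<close>
     (\<beta> > beta_c d \<and> h = 0 \<longrightarrow> (\<forall>am ap. am < ap \<and> maximizers d \<beta> h = {am, ap} \<longrightarrow>
        (\<forall>\<^sub>F \<delta> in at_right 0. \<exists>c>0. \<forall>\<^sub>F n in graph_sizes d.
          measure (annealed_ising d n \<beta> h)
            {\<omega> \<in> spins n. \<forall>a\<in>{am, ap}. \<bar>magnetization n \<omega> / real n - (2 * a - 1)\<bar> > \<delta>}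
          \<le> exp (- c * real n))
      \<and> conv_in_law (graph_sizes d)
          (\<lambda>n. distr (annealed_ising d n \<beta> h) borel (\<lambda>\<omega>. magnetization n \<omega> / real n))
          (half_half (2 * am - 1) (2 * ap - 1))
      \<and> (\<forall>a\<in>{am, ap}. \<forall>\<^sub>F \<delta> in at_right 0. \<exists>C. \<forall>\<^sub>F n in graph_sizes d.
          wasserstein
            (distr
              (uniform_measure (annealed_ising d n \<beta> h)
                {\<omega> \<in> spins n. \<bar>magnetization n \<omega> / real n - (2 * a - 1)\<bar> \<le> \<delta>})
              borel
              (\<lambda>\<omega>. (magnetization n \<omega> - real n * (2 * a - 1)) / sqrt (real n)))
            (centered_normal (4 / \<bar>(deriv ^^ 2) (A_fun d \<beta> h) a\<bar>))
          \<le> ennreal (C * real n powr (- 1 / 2)))))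
     \<and>
     \<comment> \<open>(iii)\<close>
     (\<beta> = beta_c d \<and> h = 0 \<longrightarrow>
        (\<exists>C. \<forall>\<^sub>F n in graph_sizes d.
          wasserstein
            (distr (annealed_ising d n \<beta> h) borel
              (\<lambda>\<omega>. real n powr (- 3 / 4) * magnetization n \<omega>))
            (density_proportional_to
              (\<lambda>x. exp ((deriv ^^ 4) (A_fun d \<beta> h) (1 / 2) * x ^ 4 / (2 ^ 4 * fact 4))))
          \<le> ennreal (C * real n powr (- 1 / 4))))"
proof (intro conjI impI allI, goal_cases)
  case (1 a)
  then show ?case by (rule unique_maximizer(1)[OF assms])
next
  case (2 a)
  then show ?case by (rule unique_maximizer(2)[OF assms])
next
  case (3 a)
  then show ?case by (rule unique_maximizer(3)[OF assms])
next
  case (4 am ap)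
  then have h: "h = 0" by simp
  show ?case unfolding h by (rule two_maximizers(1)[OF assms]) (use 4 h in auto)
next
  case (5 am ap)
  then have h: "h = 0" by simp
  show ?case unfolding h by (rule two_maximizers(2)[OF assms]) (use 5 h in auto)
next
  case (6 am ap)
  then have h: "h = 0" by simp
  show ?case unfolding h by (rule two_maximizers(3)[OF assms]) (use 6 h in auto)
next
  case 7
  then have h: "h = 0" by simp
  show ?case unfolding h by (rule critical_wasserstein[OF assms]) (use 7 in simp)
qed

end
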